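(* Let $H$ be a $d$-regular graph for some fixed $d \ge 2$ and fix $\beta_1\in\mathbb{R}$ and $\beta_2, \alpha > 0$. Let $G_n$ be an exponential random graph on $n$ labeled vertices with law $$p_{\alpha,\beta}(G_n) = \frac{1}{Z_n}\exp\left(\binom n2\left(\beta_1 t(K_2,G_n) + \beta_2 t(H,G_n)^\alpha\right)\right),$$ where $Z_n$ is the normalizing constant. (a) Suppose $\alpha \ge d/e(H)$. There exists a subset $\Gamma = \left\{(\beta_1,\varphi(\beta_1)) : \beta_1 < \log(e(H)\alpha - 1) - \frac{e(H)\alpha}{e(H)\alpha-1}\right\}$ of $\mathbb{R}^2$, for some function $\varphi:\mathbb{R}\to\mathbb{R}$, such that for every $(\beta_1,\beta_2)\in (\mathbb{R}\times(0,\infty))\setminus\Gamma$ there exists $0<u^*<1$ so that $\delta_\square(G_n,u^* )\to 0$ almost surely as $n\to\infty$, and for every $(\beta_1,\beta_2)\in\Gamma$ there exist $0<u_1^*<u_2^*<1$ such that $\min\{\delta_\square(G_n,u_1^* ),\delta_\square(G_n,u_2^* )\}\to 0$ almost surely as $n\to\infty$. (b) Suppose $0<\alpha<d/e(H)$ and $\beta_1 \ge \log(d-1) - d/(d-1)$. Then there exists $0<u^*<1$ such that $\delta_\square(G_n,u^* )\to 0$ almost surely as $n\to\infty$. (c) Suppose $0<\alpha<d/e(H)$ and $\beta_1 < \log(d-1) - d/(d-1)$. Then there exists an open interval of values $\beta_2>0$ with the property that there exist $\varepsilon, C>0$ such that for all $n$, $$\mathbb{P}\left(\inf\{\delta_\square(G_n,s)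 : 0\le s\le 1\} > \varepsilon\right) \ge 1 - e^{-Cn^2}.$$
   Context: Graphs are finite and simple, with vertex set $V(\cdot)$ and edge set $E(\cdot)$; $e(H) = |E(H)|$. For each $n$, $G_n$ is a random element of the set of all $2^{\binom n2}$ simple graphs on $n$ labeled vertices with the stated law ($Z_n$ is the sum of the exponentials over all such graphs); the $G_n$ are defined on a common probability space. $K_2$ is the single-edge graph. For graphs $H, G$, $t(H,G) := \hom(H,G)/|V(G)|^{|V(H)|}$, where $\hom(H,G)$ is the number of maps $V(H)\to V(G)$ carrying edges to edges. For a graph $G$ and $s \in [0,1]$, $\delta_\square(G,s) := \sup_{A,B \subset V(G)} \frac{1}{|V(G)|^2}\big|e_G(A,B) - s|A||B|\big|$, where $e_G(A,B)$ is the number of pairs $(a,b)\in A\times B$ with $ab \in E(G)$.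
   Formalization: In (c), "for all n" is proved for all n ≥ 2: for n = 1 the only graph has no edges, so the infimum is 0 and the stated probability bound fails for every C > 0. *)

theory Defs
  imports "HOL-Probability.Probability"
begin

type_synonym 'v graph = "'v set \<times> 'v set set"

abbreviation verts :: "'v graph \<Rightarrow> 'v set" where "verts \<equiv> fst"

abbreviation edges :: "'v graph \<Rightarrow> 'v set set" where "edges \<equiv> snd"

definition simple_graph :: "'v graph \<Rightarrow> bool" where
  "simple_graph G \<longleftrightarrow> finite (verts G) \<and> edges G \<subseteq> {e. e \<subseteq> verts G \<and> card e = 2}"

definition regular_graph :: "nat \<Rightarrow> 'v graph \<Rightarrow> bool" where
  "regular_graph d G \<longleftrightarrow> (\<forall>v\<in>verts G. card {e \<in> edges G. v \<in> e} = d)"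

definition K2 :: "nat graph" where
  "K2 = ({0, 1}, {{0, 1}})"

(* If G is simple, f ` e can only be an edge of G when f is injective on e. *)
definition homs :: "'v graph \<Rightarrow> 'w graph \<Rightarrow> ('v \<Rightarrow> 'w) set" where
  "homs H G = {f \<in> verts H \<rightarrow>\<^sub>E verts G. \<forall>e\<in>edges H. f ` e \<in> edges G}"

definition hom_density :: "'v graph \<Rightarrow> 'w graph \<Rightarrow> real" where
  "hom_density H G = real (card (homs H G)) / real (card (verts G)) ^ card (verts H)"

(* Ordered pairs: an edge inside the intersection of A and B is counted twice. *)
definition edge_count :: "'v graph \<Rightarrow> 'v set \<Rightarrow> 'v set \<Rightarrow> nat" where
  "edge_count G A B = card {(a, b). a \<in> A \<and> b \<in> B \<and> {a, b} \<in> edges G}"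

definition cut_dist :: "'v graph \<Rightarrow> real \<Rightarrow> real" where
  "cut_dist G s = (SUP (A, B) \<in> Pow (verts G) \<times> Pow (verts G).
     \<bar>real (edge_count G A B) - s * real (card A) * real (card B)\<bar> / (real (card (verts G)))\<^sup>2)"

definition labeled_graphs :: "nat \<Rightarrow> nat graph set" where
  "labeled_graphs n = {G. simple_graph G \<and> verts G = {1..n}}"

definition ergm_weight :: "'v graph \<Rightarrow> real \<Rightarrow> real \<Rightarrow> real \<Rightarrow> nat \<Rightarrow> nat graph \<Rightarrow> real" where
  "ergm_weight H \<alpha> \<beta>1 \<beta>2 n G =
     exp (real (n choose 2) * (\<beta>1 * hom_density K2 G + \<beta>2 * hom_density H G powr \<alpha>))"

definition ergm_Z :: "'v graph \<Rightarrow> real \<Rightarrow> real \<Rightarrow> real \<Rightarrow> nat \<Rightarrow> real" where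
  "ergm_Z H \<alpha> \<beta>1 \<beta>2 n = (\<Sum>G\<in>labeled_graphs n. ergm_weight H \<alpha> \<beta>1 \<beta>2 n G)"

definition ergm_prob :: "'v graph \<Rightarrow> real \<Rightarrow> real \<Rightarrow> real \<Rightarrow> nat \<Rightarrow> nat graph \<Rightarrow> real" where
  "ergm_prob H \<alpha> \<beta>1 \<beta>2 n G = ergm_weight H \<alpha> \<beta>1 \<beta>2 n G / ergm_Z H \<alpha> \<beta>1 \<beta>2 n"

(* The random graphs live on one common probability space; nothing is assumed about
   their joint law.  The empty vertex set (n = 0) is left out. *)
definition is_ergm ::
    "'v graph \<Rightarrow> real \<Rightarrow> real \<Rightarrow> real \<Rightarrow> 'w measure \<Rightarrow> (nat \<Rightarrow> 'w \<Rightarrow> nat graph) \<Rightarrow> bool" where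
  "is_ergm H \<alpha> \<beta>1 \<beta>2 M G \<longleftrightarrow> prob_space M \<and>
     (\<forall>n\<ge>1. distributed M (count_space (labeled_graphs n)) (G n)
              (\<lambda>g. ennreal (ergm_prob H \<alpha> \<beta>1 \<beta>2 n g)))"

end

theory Submission
  imports Defs "HOL-Real_Asymp.Real_Asymp"
begin

text \<open>Splitting the graphs by their block densities along a weak regularity partition reduces the
  Gibbs measure to the free energy of weighted graphs \<open>w\<close>: a union bound over partitions and edge
  counts gives the upper bound, inhomogeneous Bernoulli graphs the lower bound for the partition
  function. Finner's inequality \<open>t(H, w) \<le> (avg w\<^sup>d) powr (e(H) / d)\<close> bounds the free energy by
  the average of a one-variable function \<open>ell\<close>, directly if \<open>\<gamma> = e(H) \<alpha> \<ge> d\<close>, and after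
  linearising the power \<open>\<gamma> / d < 1\<close> otherwise. If \<open>ell\<close> has one maximizer \<open>u\<close>, near-optimal \<open>w\<close> are
  close to the constant \<open>u\<close>. If it has two, near-optimal \<open>w\<close> are almost two-valued and almost
  extremal in Finner's inequality, which makes \<open>w\<^sup>d\<close> almost of rank one and so \<open>w\<close> almost constant.
  In (c), the best constant maximizes \<open>ell\<close> but not the linearised function, and a constant
  perturbed on all edges at a small vertex set is better; so graphs near a constant are exponentially
  rare. Borel-Cantelli turns exponential bounds into almost sure convergence.\<close>

subsection \<open>Averages and Finner's inequality\<close>

text \<open>No limit objects enter: all estimates concern weights on the n vertices themselves and
  are uniform in n. This works because the classes of the union bound number only
  \<open>exp (O (n ln n))\<close>, against weights of order \<open>exp (n\<^sup>2)\<close>, and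
  because the density of H is continuous in the cut norm. The thresholds have one source. A critical
  point x of \<open>ell\<close> determines its coefficient, and as a function of x this coefficient
  has positive derivative exactly where \<beta>1 exceeds \<open>crit_threshold\<close>, whose
  maximum, at (\<gamma> - 1) / \<gamma>, is ln (\<gamma> - 1) - \<gamma> / (\<gamma> - 1). For
  \<gamma> < d the tangent makes d the effective exponent, hence d in place of \<gamma> in (b) and
  (c). With two maximizers the bound by \<open>ell\<close> cannot exclude weights that mix both
  values; only the loss in Finner's inequality does, so this loss is kept and quantified. In (c) one
  pair \<epsilon>, C must serve every n \<ge> 2; the small n, beyond the reach of asymptotics, need
  a graph far from every constant: the complete graph, kept away by its missing loops.\<close>

definition avg :: "'a set \<Rightarrow> ('a \<Rightarrow> real) \<Rightarrow> real" where
  "avg A f = (\<Sum>x\<in>A. f x) / real (card A)"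

lemma avg_cong: "(\<And>x. x \<in> A \<Longrightarrow> f x = g x) \<Longrightarrow> avg A f = avg A g"
  by (simp add: avg_def cong: sum.cong)

lemma avg_mono: "(\<And>x. x \<in> A \<Longrightarrow> f x \<le> g x) \<Longrightarrow> avg A f \<le> avg A g"
  unfolding avg_def by (intro divide_right_mono sum_mono) auto

lemma avg_add: "avg A (\<lambda>x. f x + g x) = avg A f + avg A g"
  by (simp add: avg_def sum.distrib add_divide_distrib)

lemma avg_diff: "avg A (\<lambda>x. f x - g x) = avg A f - avg A g"
  by (simp add: avg_def sum_subtractf diff_divide_distrib)

lemma avg_cmult: "avg A (\<lambda>x. c * f x) = c * avg A f"
  by (simp add: avg_def sum_distrib_left)

lemma avg_cmult_right: "avg A (\<lambda>x. f x * c) = avg A f * c"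
  by (simp add: avg_def sum_distrib_right)

lemma avg_const: "finite A \<Longrightarrow> A \<noteq> {} \<Longrightarrow> avg A (\<lambda>x. c) = c"
  by (simp add: avg_def)

lemma avg_nonneg: "(\<And>x. x \<in> A \<Longrightarrow> 0 \<le> f x) \<Longrightarrow> 0 \<le> avg A f"
  unfolding avg_def by (intro divide_nonneg_nonneg sum_nonneg) auto

lemma avg_le_1: "(\<And>x. x \<in> A \<Longrightarrow> f x \<le> 1) \<Longrightarrow> avg A f \<le> 1"
proof -
  assume "\<And>x. x \<in> A \<Longrightarrow> f x \<le> 1"
  then have "(\<Sum>x\<in>A. f x) \<le> real (card A)" using sum_bounded_above[of A f 1] by auto
  then show ?thesis unfolding avg_def by (simp add: divide_le_eq)
qed

lemma avg_abs: "\<bar>avg A f\<bar> \<le> avg A (\<lambda>x. \<bar>f x\<bar>)"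
  unfolding avg_def by (simp add: divide_right_mono)

lemma avg_swap: "avg A (\<lambda>x. avg B (\<lambda>y. f x y)) = avg B (\<lambda>y. avg A (\<lambda>x. f x y))"
proof -
  have "(\<Sum>x\<in>A. \<Sum>y\<in>B. f x y) = (\<Sum>y\<in>B. \<Sum>x\<in>A. f x y)" by (rule sum.swap)
  then show ?thesis unfolding avg_def by (simp add: sum_divide_distrib[symmetric] mult.commute)
qed

lemma avg_prod: "avg (A \<times> B) f = avg A (\<lambda>x. avg B (\<lambda>y. f (x, y)))"
  unfolding avg_def sum.cartesian_product'
  by (simp add: sum_divide_distrib[symmetric] card_cartesian_product mult.commute)

text \<open>Fubini for one coordinate: \<open>g(v := a)\<close> is a bijection between the pairs (a,
  g) and the maps on \<open>insert v J\<close>. Averages over maps from \<open>verts H\<close> are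
  evaluated below by splitting off vertices in this way.\<close>

lemma avg_PiE_insert:
  assumes "finite J" "v \<notin> J" "finite V"
  shows "avg (insert v J \<rightarrow>\<^sub>E V) F = avg (J \<rightarrow>\<^sub>E V) (\<lambda>g. avg V (\<lambda>a. F (g(v := a))))"
proof -
  have inj: "inj_on (\<lambda>(y, g). g(v := y)) (V \<times> (J \<rightarrow>\<^sub>E V))"
  proof (rule inj_onI, clarify)
    fix y g y' g' assume *: "g \<in> J \<rightarrow>\<^sub>E V" "g' \<in> J \<rightarrow>\<^sub>E V" "g(v := y) = g'(v := y')"
    have "y = y'" using fun_cong[OF *(3), of v] by simp
    moreover have "g x = g' x" for x
    proof (cases "x = v")
      case True
      then show ?thesis using PiE_arb[OF *(1) assms(2)] PiE_arb[OF *(2) assms(2)] by simp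
    next
      case False
      then show ?thesis using fun_cong[OF *(3), of x] by simp
    qed
    ultimately show "y = y' \<and> g = g'" by auto
  qed
  have "(\<Sum>f\<in>insert v J \<rightarrow>\<^sub>E V. F f) = (\<Sum>(y, g)\<in>V \<times> (J \<rightarrow>\<^sub>E V). F (g(v := y)))"
    unfolding PiE_insert_eq by (subst sum.reindex[OF inj]) (simp add: case_prod_unfold)
  also have "\<dots> = (\<Sum>g\<in>J \<rightarrow>\<^sub>E V. \<Sum>y\<in>V. F (g(v := y)))"
    by (simp add: sum.cartesian_product[symmetric]) (rule sum.swap)
  finally show ?thesis
    using assms by (simp add: avg_def card_PiE sum_divide_distrib[symmetric])
qed

lemma avg_singleton: "avg {x} f = f x"
  by (simp add: avg_def)

text \<open>Integrating out a coordinate that F ignores changes nothing. Dependence is phrased as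
  agreement on S, since the extensional maps on I and on S are different functions and F is
  evaluated at both.\<close>

lemma avg_PiE_local:
  assumes "finite I" "finite V" "V \<noteq> {}" "S \<subseteq> I"
    and dep: "\<And>f g. (\<And>i. i \<in> S \<Longrightarrow> f i = g i) \<Longrightarrow> F f = F g"
  shows "avg (I \<rightarrow>\<^sub>E V) F = avg (S \<rightarrow>\<^sub>E V) F"
proof -
  have "finite (I - S)" using assms by auto
  then have "avg (S \<union> (I - S) \<rightarrow>\<^sub>E V) F = avg (S \<rightarrow>\<^sub>E V) F"
  proof (induction "I - S" arbitrary: I rule: finite_induct)
    case empty
    then show ?case by (metis Un_empty_right)
  next
    case (insert v J)
    have v: "v \<notin> S" "S \<inter> J = {}" using insert.hyps by auto
    have "J = (S \<union> J) - S" using v by auto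
    from insert.hyps(3)[OF this] have IH: "avg (S \<union> J \<rightarrow>\<^sub>E V) F = avg (S \<rightarrow>\<^sub>E V) F"
      using v by (simp add: Diff_triv Int_commute Un_Diff)
    have "avg (insert v (S \<union> J) \<rightarrow>\<^sub>E V) F = avg (S \<union> J \<rightarrow>\<^sub>E V) (\<lambda>g. avg V (\<lambda>a. F (g(v := a))))"
      by (rule avg_PiE_insert) (use insert.hyps(1,2) assms(2) v finite_subset[OF assms(4,1)] in auto)
    also have "\<dots> = avg (S \<union> J \<rightarrow>\<^sub>E V) (\<lambda>g. avg V (\<lambda>a. F g))"
      by (intro avg_cong dep) (use v in auto)
    also have "\<dots> = avg (S \<union> J \<rightarrow>\<^sub>E V) F" using assms(2,3) by (simp add: avg_const)
    finally have "avg (insert v (S \<union> J) \<rightarrow>\<^sub>E V) F = avg (S \<union> J \<rightarrow>\<^sub>E V) F" .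
    moreover have "S \<union> I = insert v (S \<union> J)" using insert.hyps(4) by blast
    ultimately show ?case using IH by simp
  qed
  moreover have "S \<union> (I - S) = I" using assms by auto
  ultimately show ?thesis by simp
qed

lemma avg_PiE_pair:
  assumes "finite I" "finite V" "V \<noteq> {}" "a \<in> I" "b \<in> I" "a \<noteq> b"
  shows "avg (I \<rightarrow>\<^sub>E V) (\<lambda>f. \<phi> (f a) (f b)) = avg V (\<lambda>x. avg V (\<lambda>y. \<phi> x y))"
proof -
  have "avg (I \<rightarrow>\<^sub>E V) (\<lambda>f. \<phi> (f a) (f b)) = avg ({a, b} \<rightarrow>\<^sub>E V) (\<lambda>f. \<phi> (f a) (f b))"
    by (rule avg_PiE_local) (use assms in \<open>simp_all\<close>)
  also have "\<dots> = avg V (\<lambda>y. avg V (\<lambda>x. \<phi> x y))"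
    using assms by (simp add: avg_PiE_insert avg_singleton)
  also have "\<dots> = avg V (\<lambda>x. avg V (\<lambda>y. \<phi> x y))" by (rule avg_swap)
  finally show ?thesis .
qed

text \<open>Divide each factor by its d-norm and apply the arithmetic-geometric mean inequality
  pointwise to the d-th powers, with d equal weights 1 / d. A factor of norm zero cannot be
  normalised; it vanishes on V and is treated first.\<close>

lemma generalized_Hoelder:
  assumes V: "finite V" "V \<noteq> {}" and T: "finite T" "card T = d" "d > 0"
    and nonneg: "\<And>i x. i \<in> T \<Longrightarrow> x \<in> V \<Longrightarrow> 0 \<le> f i x"
  shows "avg V (\<lambda>x. \<Prod>i\<in>T. f i x) \<le> (\<Prod>i\<in>T. root d (avg V (\<lambda>x. f i x ^ d)))"
proof (cases "\<exists>i\<in>T. avg V (\<lambda>x. f i x ^ d) = 0")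
  case True
  then obtain i where i: "i \<in> T" "avg V (\<lambda>x. f i x ^ d) = 0" by auto
  then have "(\<Sum>x\<in>V. f i x ^ d) = 0" using V by (simp add: avg_def)
  then have "\<And>x. x \<in> V \<Longrightarrow> f i x = 0"
    using V nonneg i(1) T by (subst (asm) sum_nonneg_eq_0_iff) auto
  then have "\<And>x. x \<in> V \<Longrightarrow> (\<Prod>i\<in>T. f i x) = 0" using i(1) T by (meson prod_zero)
  then have "avg V (\<lambda>x. \<Prod>i\<in>T. f i x) = 0" by (simp add: avg_def)
  moreover have "0 \<le> (\<Prod>i\<in>T. root d (avg V (\<lambda>x. f i x ^ d)))"
    using nonneg T by (intro prod_nonneg real_root_ge_zero avg_nonneg zero_le_power) auto
  ultimately show ?thesis by simp
next
  case False
  define N where "N i = root d (avg V (\<lambda>x. f i x ^ d))" for i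
  have pos: "avg V (\<lambda>x. f i x ^ d) > 0" if "i \<in> T" for i
    using False that nonneg by (metis avg_nonneg less_eq_real_def zero_le_power)
  then have N: "N i > 0" "N i ^ d = avg V (\<lambda>x. f i x ^ d)" if "i \<in> T" for i
    using that T by (auto simp: N_def less_imp_le)
  have pt: "(\<Prod>i\<in>T. f i x) \<le> (\<Prod>i\<in>T. N i) * (\<Sum>i\<in>T. (f i x / N i) ^ d / d)" if "x \<in> V" for x
  proof -
    have "(\<Prod>i\<in>T. f i x / N i) = (\<Prod>i\<in>T. (f i x / N i) ^ d) powr (1 / d)"
    proof -
      have "0 \<le> (\<Prod>i\<in>T. f i x / N i)"
        using N nonneg that by (intro prod_nonneg) (auto simp: less_imp_le)
      then show ?thesis
        using real_root_power_cancel[of d "\<Prod>i\<in>T. f i x / N i"] T(3)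
          root_powr_inverse[of d "(\<Prod>i\<in>T. f i x / N i) ^ d"]
        by (simp add: prod_power_distrib[symmetric])
    qed
    also have "\<dots> \<le> (\<Sum>i\<in>T. (f i x / N i) ^ d / d)"
      using arith_geom_mean[of T "\<lambda>i. (f i x / N i) ^ d"] T N nonneg that
      by (fastforce simp: less_imp_le)
    finally have "(\<Prod>i\<in>T. f i x) / (\<Prod>i\<in>T. N i) \<le> (\<Sum>i\<in>T. (f i x / N i) ^ d / d)"
      by (simp add: prod_dividef)
    moreover have "(\<Prod>i\<in>T. N i) > 0" using N by (intro prod_pos) auto
    ultimately show ?thesis by (simp add: divide_le_eq mult.commute)
  qed
  have "avg V (\<lambda>x. \<Prod>i\<in>T. f i x) \<le> avg V (\<lambda>x. (\<Prod>i\<in>T. N i) * (\<Sum>i\<in>T. (f i x / N i) ^ d / d))"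
    by (rule avg_mono) (rule pt)
  also have "\<dots> = (\<Prod>i\<in>T. N i) * (\<Sum>i\<in>T. avg V (\<lambda>x. (f i x / N i) ^ d) / d)"
    by (simp add: avg_cmult) (simp add: avg_def sum.swap[of _ V] sum_divide_distrib sum_distrib_right mult.commute)
  also have "(\<Sum>i\<in>T. avg V (\<lambda>x. (f i x / N i) ^ d) / d) = (\<Sum>i\<in>T. 1 / d)"
  proof (rule sum.cong[OF refl])
    fix i assume i: "i \<in> T"
    have "avg V (\<lambda>x. (f i x / N i) ^ d) = avg V (\<lambda>x. f i x ^ d) / N i ^ d"
      by (simp add: avg_def power_divide sum_divide_distrib[symmetric])
    then show "avg V (\<lambda>x. (f i x / N i) ^ d) / d = 1 / d" using N[OF i] pos[OF i] by simp
  qed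
  finally show ?thesis using T by (simp add: N_def)
qed

text \<open>Finner's inequality on a finite power, integrating out one coordinate at a time: each step
  is a Hoelder inequality for the \<open>d\<close> factors that depend on that coordinate.\<close>
lemma finner_inequality:
  fixes F :: "'e \<Rightarrow> ('v \<Rightarrow> 'w) \<Rightarrow> real"
  assumes "finite I" and V: "finite V" "V \<noteq> {}" and "finite E" "d > 0"
    and "\<And>e f. e \<in> E \<Longrightarrow> 0 \<le> F e f"
    and "\<And>e f g. e \<in> E \<Longrightarrow> (\<And>i. i \<in> S e \<Longrightarrow> f i = g i) \<Longrightarrow> F e f = F e g"
    and "\<And>v. v \<in> I \<Longrightarrow> card {e \<in> E. v \<in> S e} = d"
  shows "avg (I \<rightarrow>\<^sub>E V) (\<lambda>f. \<Prod>e\<in>E. F e f) \<le> (\<Prod>e\<in>E. root d (avg (I \<rightarrow>\<^sub>E V) (\<lambda>f. F e f ^ d)))"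
  using assms(1,6,7,8)
proof (induction I arbitrary: F rule: finite_induct)
  case empty
  show ?case using \<open>d > 0\<close> empty.prems(1) by (simp add: avg_singleton real_root_power_cancel)
next
  case (insert v J)
  \<comment> \<open>The d-norm of the factor in coordinate v. A factor that ignores v is left
    unchanged, and no dependence set grows, so the induction hypothesis applies to the remaining
    coordinates.\<close>
  define F' where "F' e g = root d (avg V (\<lambda>a. F e (g(v := a)) ^ d))" for e g
  have F'_nonneg: "0 \<le> F' e g" if "e \<in> E" for e g
    unfolding F'_def using insert.prems(1)[OF that] \<open>d > 0\<close> by (intro real_root_ge_zero avg_nonneg zero_le_power)
  have step: "avg V (\<lambda>a. \<Prod>e\<in>E. F e (g(v := a))) \<le> (\<Prod>e\<in>E. F' e g)" for g
  proof -
    let ?T = "{e \<in> E. v \<in> S e}"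
    have fin: "finite ?T" using \<open>finite E\<close> by auto
    obtain a0 where "a0 \<in> V" using V by auto
    have const: "F e (g(v := a)) = F e g" if "e \<in> E - ?T" for e a
      using that by (intro insert.prems(2)) auto
    have split: "(\<Prod>e\<in>E. h e) = (\<Prod>e\<in>E - ?T. h e) * (\<Prod>e\<in>?T. h e)" for h :: "'e \<Rightarrow> real"
      using prod.subset_diff[of ?T E h] \<open>finite E\<close> by auto
    have "avg V (\<lambda>a. \<Prod>e\<in>E. F e (g(v := a)))
        = avg V (\<lambda>a. (\<Prod>e\<in>E - ?T. F e g) * (\<Prod>e\<in>?T. F e (g(v := a))))"
      by (intro avg_cong) (simp only: split[of "\<lambda>e. F e (g(v := _))"] const cong: prod.cong)
    also have "\<dots> \<le> (\<Prod>e\<in>E - ?T. F e g) * (\<Prod>e\<in>?T. F' e g)"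
      unfolding avg_cmult F'_def
      by (intro mult_left_mono generalized_Hoelder prod_nonneg V fin \<open>d > 0\<close> insert.prems(1)) (use insert.prems(3) in auto)
    also have "(\<Prod>e\<in>E - ?T. F e g) = (\<Prod>e\<in>E - ?T. F' e g)"
    proof (intro prod.cong refl)
      fix e assume e: "e \<in> E - ?T"
      show "F e g = F' e g"
        unfolding F'_def const[OF e] using V e insert.prems(1)[of e g] \<open>d > 0\<close>
        by (simp add: avg_const real_root_power_cancel)
    qed
    finally show ?thesis by (subst split)
  qed
  have "avg (insert v J \<rightarrow>\<^sub>E V) (\<lambda>f. \<Prod>e\<in>E. F e f) \<le> avg (J \<rightarrow>\<^sub>E V) (\<lambda>g. \<Prod>e\<in>E. F' e g)"
    unfolding avg_PiE_insert[OF insert.hyps V(1)] by (intro avg_mono step)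
  also have "\<dots> \<le> (\<Prod>e\<in>E. root d (avg (J \<rightarrow>\<^sub>E V) (\<lambda>f. F' e f ^ d)))"
  proof (rule insert.IH)
    show "F' e f = F' e g" if "e \<in> E" "\<And>i. i \<in> S e \<Longrightarrow> f i = g i" for e f g
    proof -
      have "F e (f(v := a)) = F e (g(v := a))" for a
        using that by (intro insert.prems(2)) auto
      then show ?thesis by (simp add: F'_def)
    qed
  qed (use F'_nonneg insert.prems(3) in auto)
  also have "\<dots> = (\<Prod>e\<in>E. root d (avg (insert v J \<rightarrow>\<^sub>E V) (\<lambda>f. F e f ^ d)))"
  proof (intro prod.cong refl)
    fix e assume e: "e \<in> E"
    have "F' e f ^ d = avg V (\<lambda>a. F e (f(v := a)) ^ d)" for f
      unfolding F'_def using insert.prems(1)[OF e] \<open>d > 0\<close> by (simp add: avg_nonneg)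
    then show "root d (avg (J \<rightarrow>\<^sub>E V) (\<lambda>f. F' e f ^ d)) = root d (avg (insert v J \<rightarrow>\<^sub>E V) (\<lambda>f. F e f ^ d))"
      by (simp add: avg_PiE_insert[OF insert.hyps V(1)])
  qed
  finally show ?case .
qed

text \<open>A symmetric function on \<open>V \<times> V\<close> is encoded as a function of the set \<open>{x, y}\<close>; singletons
  are the diagonal.\<close>
definition avg2 :: "'w set \<Rightarrow> ('w set \<Rightarrow> real) \<Rightarrow> real" where
  "avg2 V w = avg V (\<lambda>x. avg V (\<lambda>y. w {x, y}))"

definition wdens :: "'v graph \<Rightarrow> 'w set \<Rightarrow> ('w set \<Rightarrow> real) \<Rightarrow> real" where
  "wdens H V w = avg (verts H \<rightarrow>\<^sub>E V) (\<lambda>f. \<Prod>e\<in>edges H. w (f ` e))"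

lemma avg2_cong: "(\<And>x y. x \<in> V \<Longrightarrow> y \<in> V \<Longrightarrow> f {x, y} = g {x, y}) \<Longrightarrow> avg2 V f = avg2 V g"
  unfolding avg2_def by (intro avg_cong) auto

lemma avg2_mono: "(\<And>x y. x \<in> V \<Longrightarrow> y \<in> V \<Longrightarrow> f {x, y} \<le> g {x, y}) \<Longrightarrow> avg2 V f \<le> avg2 V g"
  unfolding avg2_def by (intro avg_mono) auto

lemma avg2_add: "avg2 V (\<lambda>e. f e + g e) = avg2 V f + avg2 V g"
  by (simp add: avg2_def avg_add)

lemma avg2_diff: "avg2 V (\<lambda>e. f e - g e) = avg2 V f - avg2 V g"
  by (simp add: avg2_def avg_diff)

lemma avg2_cmult: "avg2 V (\<lambda>e. c * f e) = c * avg2 V f"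
  by (simp add: avg2_def avg_cmult)

lemma avg2_const: "finite V \<Longrightarrow> V \<noteq> {} \<Longrightarrow> avg2 V (\<lambda>e. c) = c"
  by (simp add: avg2_def avg_const)

lemma avg2_nonneg: "(\<And>x y. x \<in> V \<Longrightarrow> y \<in> V \<Longrightarrow> 0 \<le> f {x, y}) \<Longrightarrow> 0 \<le> avg2 V f"
  unfolding avg2_def by (intro avg_nonneg) auto

lemma avg2_le_1: "(\<And>x y. x \<in> V \<Longrightarrow> y \<in> V \<Longrightarrow> f {x, y} \<le> 1) \<Longrightarrow> avg2 V f \<le> 1"
  unfolding avg2_def by (intro avg_le_1) auto

lemma avg2_abs: "\<bar>avg2 V f\<bar> \<le> avg2 V (\<lambda>e. \<bar>f e\<bar>)"
  unfolding avg2_def by (rule order_trans[OF avg_abs]) (intro avg_mono avg_abs)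

lemma simple_graph_edgeE:
  assumes "simple_graph H" "e \<in> edges H"
  obtains a b where "e = {a, b}" "a \<noteq> b" "a \<in> verts H" "b \<in> verts H"
proof -
  have "e \<subseteq> verts H" "card e = 2" using assms by (auto simp: simple_graph_def)
  then show ?thesis using that by (auto simp: card_2_iff)
qed

lemma simple_graph_finite:
  assumes "simple_graph H" shows "finite (verts H)" "finite (edges H)"
  using assms finite_subset[of "edges H" "Pow (verts H)"] by (auto simp: simple_graph_def)

lemma avg_edge:
  assumes "simple_graph H" "e \<in> edges H" "finite V" "V \<noteq> {}"
  shows "avg (verts H \<rightarrow>\<^sub>E V) (\<lambda>f. w (f ` e)) = avg2 V w"
proof -
  obtain a b where ab: "e = {a, b}" "a \<noteq> b" "a \<in> verts H" "b \<in> verts H"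
    using simple_graph_edgeE[OF assms(1,2)] .
  then show ?thesis
    using avg_PiE_pair[of "verts H" V a b "\<lambda>x y. w {x, y}"] assms simple_graph_finite[OF assms(1)]
    by (simp add: avg2_def)
qed

lemma image_edge_in:
  assumes "simple_graph H" "e \<in> edges H" "f \<in> verts H \<rightarrow>\<^sub>E V"
  obtains x y where "x \<in> V" "y \<in> V" "f ` e = {x, y}"
proof -
  obtain a b where "e = {a, b}" "a \<in> verts H" "b \<in> verts H"
    using simple_graph_edgeE[OF assms(1,2)] .
  then show ?thesis using assms(3) by (intro that[of "f a" "f b"]) auto
qed

lemma wdens_cong:
  assumes "simple_graph H" "\<And>x y. x \<in> V \<Longrightarrow> y \<in> V \<Longrightarrow> w {x, y} = w' {x, y}"
  shows "wdens H V w = wdens H V w'"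
  unfolding wdens_def
proof (intro avg_cong prod.cong refl)
  fix f e assume f: "f \<in> verts H \<rightarrow>\<^sub>E V" and e: "e \<in> edges H"
  obtain x y where "x \<in> V" "y \<in> V" "f ` e = {x, y}" using image_edge_in[OF assms(1) e f] .
  then show "w (f ` e) = w' (f ` e)" using assms(2) by simp
qed

lemma wdens_bounds:
  assumes "simple_graph H" "\<And>x y. x \<in> V \<Longrightarrow> y \<in> V \<Longrightarrow> 0 \<le> w {x, y} \<and> w {x, y} \<le> 1"
  shows "0 \<le> wdens H V w" "wdens H V w \<le> 1"
proof -
  have "0 \<le> w (f ` e) \<and> w (f ` e) \<le> 1" if f: "f \<in> verts H \<rightarrow>\<^sub>E V" and e: "e \<in> edges H" for f e
  proof -
    obtain x y where "x \<in> V" "y \<in> V" "f ` e = {x, y}" using image_edge_in[OF assms(1) e f] .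
    then show ?thesis using assms(2) by simp
  qed
  then show "0 \<le> wdens H V w" "wdens H V w \<le> 1"
    unfolding wdens_def by (auto intro!: avg_nonneg avg_le_1 prod_nonneg prod_le_1)
qed

text \<open>Finner's inequality with the edges of H as factors: each vertex lies in d of them, and
  each factor depends on two coordinates, so its norm is an average over
  \<open>V \<times> V\<close>.\<close>

lemma wdens_le_norm:
  fixes H :: "'v graph" and w :: "'w set \<Rightarrow> real"
  assumes H: "simple_graph H" "regular_graph d H" "d > 0" and V: "finite V" "V \<noteq> {}"
    and w: "\<And>x y. x \<in> V \<Longrightarrow> y \<in> V \<Longrightarrow> 0 \<le> w {x, y}"
  shows "wdens H V w \<le> root d (avg2 V (\<lambda>e. w e ^ d)) ^ card (edges H)"
proof -
  \<comment> \<open>Finner's inequality wants factors that are nonnegative at all maps, while w is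
    controlled only on pairs from V. The extension by zero leaves the averages unchanged.\<close>
  define w' where "w' e = (if \<exists>x\<in>V. \<exists>y\<in>V. e = {x, y} then w e else 0)" for e
  have w'_eq: "w' {x, y} = w {x, y}" if "x \<in> V" "y \<in> V" for x y using that unfolding w'_def by auto
  have w'_nonneg: "0 \<le> w' e" for e using w unfolding w'_def by auto
  have "wdens H V w = avg (verts H \<rightarrow>\<^sub>E V) (\<lambda>f. \<Prod>e\<in>edges H. w' (f ` e))"
    using wdens_cong[OF H(1), of V w w'] w'_eq unfolding wdens_def by simp
  also have "\<dots> \<le> (\<Prod>e\<in>edges H. root d (avg (verts H \<rightarrow>\<^sub>E V) (\<lambda>f. w' (f ` e) ^ d)))"
  proof (rule finner_inequality[where S = "\<lambda>e. e"])
    show "w' (f ` e) = w' (g ` e)" if "\<And>i. i \<in> e \<Longrightarrow> f i = g i" for e and f g :: "'v \<Rightarrow> 'w"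
      using that by (intro arg_cong[of _ _ w'] image_cong) auto
  qed (use H V w'_nonneg simple_graph_finite[OF H(1)] in \<open>auto simp: regular_graph_def\<close>)
  also have "\<dots> = (\<Prod>e\<in>edges H. root d (avg2 V (\<lambda>e. w e ^ d)))"
  proof (intro prod.cong refl)
    fix e assume e: "e \<in> edges H"
    have "avg (verts H \<rightarrow>\<^sub>E V) (\<lambda>f. w' (f ` e) ^ d) = avg2 V (\<lambda>e. w' e ^ d)"
      using avg_edge[OF H(1) e V, of "\<lambda>e. w' e ^ d"] by simp
    also have "\<dots> = avg2 V (\<lambda>e. w e ^ d)" by (intro avg2_cong) (simp add: w'_eq)
    finally show "root d (avg (verts H \<rightarrow>\<^sub>E V) (\<lambda>f. w' (f ` e) ^ d)) = root d (avg2 V (\<lambda>e. w e ^ d))" by simp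
  qed
  finally show ?thesis by simp
qed

subsection \<open>Cut norm and counting lemma\<close>

text \<open>The cut norm as a bound rather than a supremum, which makes sums and comparisons
  immediate. Rectangles may meet the diagonal, so the values \<open>D {x}\<close> count as
  well.\<close>

definition cut_le :: "'w set \<Rightarrow> ('w set \<Rightarrow> real) \<Rightarrow> real \<Rightarrow> bool" where
  "cut_le V D c \<longleftrightarrow> (\<forall>A\<subseteq>V. \<forall>B\<subseteq>V. \<bar>\<Sum>x\<in>A. \<Sum>y\<in>B. D {x, y}\<bar> \<le> c * (real (card V))\<^sup>2)"

lemma cut_leD: "cut_le V D c \<Longrightarrow> A \<subseteq> V \<Longrightarrow> B \<subseteq> V \<Longrightarrow> \<bar>\<Sum>x\<in>A. \<Sum>y\<in>B. D {x, y}\<bar> \<le> c * (real (card V))\<^sup>2"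
  by (simp add: cut_le_def)

lemma avg2_sum: "avg2 V w = (\<Sum>x\<in>V. \<Sum>y\<in>V. w {x, y}) / (real (card V))\<^sup>2"
  by (simp add: avg2_def avg_def sum_divide_distrib[symmetric] power2_eq_square)

lemma cut_le_mono: "cut_le V D c \<Longrightarrow> c \<le> c' \<Longrightarrow> cut_le V D c'"
  unfolding cut_le_def by (meson mult_right_mono order_trans zero_le_power2)

lemma cut_le_cong:
  assumes "\<And>x y. x \<in> V \<Longrightarrow> y \<in> V \<Longrightarrow> D {x, y} = D' {x, y}"
  shows "cut_le V D c \<longleftrightarrow> cut_le V D' c"
proof -
  have "(\<Sum>x\<in>A. \<Sum>y\<in>B. D {x, y}) = (\<Sum>x\<in>A. \<Sum>y\<in>B. D' {x, y})" if "A \<subseteq> V" "B \<subseteq> V" for A B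
    using that assms by (intro sum.cong refl) auto
  then show ?thesis by (simp add: cut_le_def)
qed

lemma cut_le_uminus: "cut_le V D c \<Longrightarrow> cut_le V (\<lambda>e. - D e) c"
  by (simp add: cut_le_def sum_negf)

lemma cut_le_add: "cut_le V D c \<Longrightarrow> cut_le V D' c' \<Longrightarrow> cut_le V (\<lambda>e. D e + D' e) (c + c')"
  unfolding cut_le_def sum.distrib distrib_right
  by (meson abs_triangle_ineq add_mono order_trans)

lemma cut_le_nonneg: "cut_le V D c \<Longrightarrow> finite V \<Longrightarrow> V \<noteq> {} \<Longrightarrow> 0 \<le> c"
  using cut_leD[of V D c "{}" "{}"] by (auto simp: zero_le_mult_iff)

lemma cut_le_L1:
  assumes "finite V" "V \<noteq> {}"
  shows "cut_le V D (avg2 V (\<lambda>e. \<bar>D e\<bar>))"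
  unfolding cut_le_def
proof (intro allI impI)
  fix A B assume AB: "A \<subseteq> V" "B \<subseteq> V"
  have "\<bar>\<Sum>x\<in>A. \<Sum>y\<in>B. D {x, y}\<bar> \<le> (\<Sum>x\<in>A. \<Sum>y\<in>B. \<bar>D {x, y}\<bar>)"
    by (rule order_trans[OF sum_abs]) (intro sum_mono sum_abs)
  also have "\<dots> \<le> (\<Sum>x\<in>V. \<Sum>y\<in>V. \<bar>D {x, y}\<bar>)"
    using AB assms by (intro order_trans[OF sum_mono[OF sum_mono2] sum_mono2] sum_nonneg) auto
  also have "\<dots> = avg2 V (\<lambda>e. \<bar>D e\<bar>) * (real (card V))\<^sup>2"
    using assms by (simp add: avg2_sum)
  finally show "\<bar>\<Sum>x\<in>A. \<Sum>y\<in>B. D {x, y}\<bar> \<le> avg2 V (\<lambda>e. \<bar>D e\<bar>) * (real (card V))\<^sup>2" .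
qed

text \<open>A linear form on a cube is largest at a vertex: keep the points whose coefficient is
  positive.\<close>

lemma sum_weight_le_subset_sum:
  fixes f S :: "'a \<Rightarrow> real"
  assumes "finite V" "\<And>x. x \<in> V \<Longrightarrow> 0 \<le> f x \<and> f x \<le> 1"
  shows "\<exists>A\<subseteq>V. (\<Sum>x\<in>V. f x * S x) \<le> (\<Sum>x\<in>A. S x)"
proof (intro exI conjI)
  show "{x\<in>V. S x > 0} \<subseteq> V" by auto
  have "(\<Sum>x\<in>V. f x * S x) \<le> (\<Sum>x\<in>V. if S x > 0 then S x else 0)"
  proof (rule sum_mono)
    fix x assume x: "x \<in> V"
    show "f x * S x \<le> (if S x > 0 then S x else 0)"
      using assms(2)[OF x] by (auto simp: mult_left_le_one_le mult_nonneg_nonpos)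
  qed
  also have "\<dots> = (\<Sum>x\<in>{x\<in>V. S x > 0}. S x)" using assms(1) by (simp add: sum.inter_filter)
  finally show "(\<Sum>x\<in>V. f x * S x) \<le> (\<Sum>x\<in>{x\<in>V. S x > 0}. S x)" .
qed

text \<open>The vertex argument, used in f with g fixed and then in g, extends the cut bound from
  rectangles to fractional weights.\<close>

lemma cut_le_bilinear_upper:
  assumes "finite V" "cut_le V D c"
    and f: "\<And>x. x \<in> V \<Longrightarrow> 0 \<le> f x \<and> f x \<le> 1" and g: "\<And>x. x \<in> V \<Longrightarrow> 0 \<le> g x \<and> g x \<le> 1"
  shows "(\<Sum>x\<in>V. \<Sum>y\<in>V. f x * g y * D {x, y}) \<le> c * (real (card V))\<^sup>2"
proof -
  obtain A where A: "A \<subseteq> V"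
    "(\<Sum>x\<in>V. f x * (\<Sum>y\<in>V. g y * D {x, y})) \<le> (\<Sum>x\<in>A. \<Sum>y\<in>V. g y * D {x, y})"
    using sum_weight_le_subset_sum[where f = f and S = "\<lambda>x. \<Sum>y\<in>V. g y * D {x, y}", OF assms(1) f] by auto
  obtain B where B: "B \<subseteq> V"
    "(\<Sum>y\<in>V. g y * (\<Sum>x\<in>A. D {x, y})) \<le> (\<Sum>y\<in>B. \<Sum>x\<in>A. D {x, y})"
    using sum_weight_le_subset_sum[where f = g and S = "\<lambda>y. \<Sum>x\<in>A. D {x, y}", OF assms(1) g] by auto
  have "(\<Sum>x\<in>V. \<Sum>y\<in>V. f x * g y * D {x, y}) = (\<Sum>x\<in>V. f x * (\<Sum>y\<in>V. g y * D {x, y}))"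
    by (simp add: sum_distrib_left mult.assoc)
  also note A(2)
  also have "(\<Sum>x\<in>A. \<Sum>y\<in>V. g y * D {x, y}) = (\<Sum>y\<in>V. g y * (\<Sum>x\<in>A. D {x, y}))"
    by (subst sum.swap) (simp add: sum_distrib_left)
  also note B(2)
  also have "(\<Sum>y\<in>B. \<Sum>x\<in>A. D {x, y}) = (\<Sum>x\<in>A. \<Sum>y\<in>B. D {x, y})" by (rule sum.swap)
  also have "\<dots> \<le> c * (real (card V))\<^sup>2" using cut_leD[OF assms(2) A(1) B(1)] by simp
  finally show ?thesis .
qed

lemma cut_le_bilinear:
  assumes "finite V" "cut_le V D c"
    and f: "\<And>x. x \<in> V \<Longrightarrow> 0 \<le> f x \<and> f x \<le> 1" and g: "\<And>x. x \<in> V \<Longrightarrow> 0 \<le> g x \<and> g x \<le> 1"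
  shows "\<bar>\<Sum>x\<in>V. \<Sum>y\<in>V. f x * g y * D {x, y}\<bar> \<le> c * (real (card V))\<^sup>2"
  using cut_le_bilinear_upper[where f = f and g = g, OF assms]
    cut_le_bilinear_upper[where f = f and g = g, OF assms(1) cut_le_uminus[OF assms(2)] f g]
  by (simp add: sum_negf)

text \<open>Fix the images of all vertices other than the ends a, b of e0. No other edge contains
  both ends, so each remaining factor depends on at most one of the two free images, and the inner
  average is a bilinear form with weights in [0, 1].\<close>

lemma swap_edge_bound:
  fixes H :: "'v graph" and Y :: "'v set \<Rightarrow> 'w set \<Rightarrow> real"
  assumes H: "simple_graph H" "e0 \<in> edges H" and V: "finite V" "V \<noteq> {}"
    and cut: "cut_le V D c" and Y: "\<And>e s. 0 \<le> Y e s \<and> Y e s \<le> 1"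
  shows "\<bar>avg (verts H \<rightarrow>\<^sub>E V) (\<lambda>f. D (f ` e0) * (\<Prod>e\<in>edges H - {e0}. Y e (f ` e)))\<bar> \<le> c"
proof -
  obtain a b where ab: "e0 = {a, b}" "a \<noteq> b" "a \<in> verts H" "b \<in> verts H"
    using simple_graph_edgeE[OF H] .
  define R where "R = verts H - {a, b}"
  have vH: "verts H = insert a (insert b R)" using ab by (auto simp: R_def)
  have fin: "finite R" "finite (insert b R)" "a \<notin> insert b R" "b \<notin> R" "finite (edges H)"
    using simple_graph_finite[OF H(1)] ab by (auto simp: R_def)
  define E1 where "E1 = {e \<in> edges H - {e0}. a \<in> e}"
  \<comment> \<open>Edges that avoid both ends are put here too; they are constant in both free
    images.\<close>
  define E2 where "E2 = {e \<in> edges H - {e0}. a \<notin> e}"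
  have split: "(\<Prod>e\<in>edges H - {e0}. h e) = (\<Prod>e\<in>E1. h e) * (\<Prod>e\<in>E2. h e)" for h :: "'v set \<Rightarrow> real"
  proof -
    have "edges H - {e0} = E1 \<union> E2" "E1 \<inter> E2 = {}" by (auto simp: E1_def E2_def)
    moreover have "finite E1" "finite E2" using fin by (auto simp: E1_def E2_def)
    ultimately show ?thesis by (simp add: prod.union_disjoint)
  qed
  have bE1: "b \<notin> e" if "e \<in> E1" for e
  proof
    assume "b \<in> e"
    have "e \<in> edges H" using that by (auto simp: E1_def)
    then obtain a' b' where "e = {a', b'}" "a' \<noteq> b'"
      using simple_graph_edgeE[OF H(1)] by metis
    then have "e = e0" using \<open>b \<in> e\<close> that ab by (auto simp: E1_def)
    then show False using that by (simp add: E1_def)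
  qed
  define F where "F f = D (f ` e0) * (\<Prod>e\<in>edges H - {e0}. Y e (f ` e))" for f :: "'v \<Rightarrow> 'w"
  define \<phi> where "\<phi> g x = (\<Prod>e\<in>E1. Y e ((g(a := x)) ` e))" for g :: "'v \<Rightarrow> 'w" and x
  define \<psi> where "\<psi> g y = (\<Prod>e\<in>E2. Y e ((g(b := y)) ` e))" for g :: "'v \<Rightarrow> 'w" and y
  have F_eq: "F (g(b := y, a := x)) = \<phi> g x * \<psi> g y * D {x, y}" for g x y
  proof -
    have "(g(b := y, a := x)) ` e0 = {x, y}" using ab by auto
    moreover have "(g(b := y, a := x)) ` e = (g(a := x)) ` e" if "e \<in> E1" for e
      using bE1[OF that] by (intro image_cong) auto
    moreover have "(g(b := y, a := x)) ` e = (g(b := y)) ` e" if "e \<in> E2" for e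
      using that by (intro image_cong) (auto simp: E2_def)
    ultimately show ?thesis by (simp add: F_def split \<phi>_def \<psi>_def)
  qed
  have in01: "0 \<le> \<phi> g x \<and> \<phi> g x \<le> 1" "0 \<le> \<psi> g x \<and> \<psi> g x \<le> 1" for g x
    using Y by (auto simp: \<phi>_def \<psi>_def intro!: prod_nonneg prod_le_1)
  have inner: "\<bar>avg V (\<lambda>y. avg V (\<lambda>x. F (g(b := y, a := x))))\<bar> \<le> c" for g
  proof -
    have n: "(real (card V))\<^sup>2 > 0" using V by (simp add: card_gt_0_iff)
    have "avg V (\<lambda>y. avg V (\<lambda>x. F (g(b := y, a := x)))) = avg V (\<lambda>x. avg V (\<lambda>y. F (g(b := y, a := x))))"
      by (rule avg_swap)
    also have "\<dots> = (\<Sum>x\<in>V. \<Sum>y\<in>V. \<phi> g x * \<psi> g y * D {x, y}) / (real (card V))\<^sup>2"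
      unfolding F_eq by (simp add: avg_def sum_divide_distrib[symmetric] power2_eq_square)
    finally show ?thesis
      using cut_le_bilinear[where f = "\<phi> g" and g = "\<psi> g", OF V(1) cut in01] n by (simp add: divide_le_eq)
  qed
  have "avg (verts H \<rightarrow>\<^sub>E V) F = avg (R \<rightarrow>\<^sub>E V) (\<lambda>g. avg V (\<lambda>y. avg V (\<lambda>x. F (g(b := y, a := x)))))"
    unfolding vH avg_PiE_insert[OF fin(2,3) V(1)] avg_PiE_insert[OF fin(1,4) V(1)] ..
  also have "\<bar>\<dots>\<bar> \<le> avg (R \<rightarrow>\<^sub>E V) (\<lambda>g. c)"
    by (rule order_trans[OF avg_abs]) (intro avg_mono inner)
  also have "\<dots> = c" using fin V by (intro avg_const finite_PiE) (auto simp: PiE_eq_empty_iff)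
  finally show ?thesis by (simp add: F_def[abs_def])
qed

text \<open>Telescoping over the edges of H: turning w into u at a single edge costs at most c by
  \<open>swap_edge_bound\<close>, whatever mixture of u and w stands at the other edges.\<close>

lemma counting_lemma_aux:
  fixes H :: "'v graph" and u w :: "'w set \<Rightarrow> real"
  assumes H: "simple_graph H" and V: "finite V" "V \<noteq> {}"
    and cut: "cut_le V (\<lambda>e. u e - w e) c"
    and u: "\<And>s. 0 \<le> u s \<and> u s \<le> 1" and w: "\<And>s. 0 \<le> w s \<and> w s \<le> 1"
  shows "\<bar>wdens H V u - wdens H V w\<bar> \<le> real (card (edges H)) * c"
proof -
  define h where "h E1 = avg (verts H \<rightarrow>\<^sub>E V) (\<lambda>f. \<Prod>e\<in>edges H. (if e \<in> E1 then u else w) (f ` e))" for E1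
  have finE: "finite (edges H)" using simple_graph_finite[OF H] by simp
  have "E1 \<subseteq> edges H \<Longrightarrow> \<bar>h E1 - h {}\<bar> \<le> real (card E1) * c" if "finite E1" for E1
    using that
  proof (induction E1 rule: finite_induct)
    case empty
    then show ?case by simp
  next
    case (insert e0 E1)
    define Y where "Y e = (if e \<in> E1 then u else w)" for e
    have e0: "e0 \<in> edges H" using insert by auto
    have rest: "(\<Prod>e\<in>edges H. (if e \<in> E' then u else w) (f ` e))
        = (if e0 \<in> E' then u else w) (f ` e0) * (\<Prod>e\<in>edges H - {e0}. Y e (f ` e))"
      if "E' - {e0} = E1" for E' and f :: "'v \<Rightarrow> 'w"
    proof -
      have "e \<in> E' \<longleftrightarrow> e \<in> E1" if "e \<noteq> e0" for e using \<open>E' - {e0} = E1\<close> that by blast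
      then have "(\<Prod>e\<in>edges H - {e0}. (if e \<in> E' then u else w) (f ` e))
          = (\<Prod>e\<in>edges H - {e0}. Y e (f ` e))"
        by (intro prod.cong refl) (simp add: Y_def)
      then show ?thesis
        using prod.remove[OF finE e0, of "\<lambda>e. (if e \<in> E' then u else w) (f ` e)"] by simp
    qed
    have "h (insert e0 E1) - h E1
      = avg (verts H \<rightarrow>\<^sub>E V) (\<lambda>f. (\<lambda>s. u s - w s) (f ` e0) * (\<Prod>e\<in>edges H - {e0}. Y e (f ` e)))"
      unfolding h_def avg_diff[symmetric]
    proof (intro avg_cong)
      fix f :: "'v \<Rightarrow> 'w"
      have "insert e0 E1 - {e0} = E1" "E1 - {e0} = E1" using insert.hyps by auto
      from rest[OF this(1), of f] rest[OF this(2), of f] insert.hyps(2)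
      show "(\<Prod>e\<in>edges H. (if e \<in> insert e0 E1 then u else w) (f ` e))
        - (\<Prod>e\<in>edges H. (if e \<in> E1 then u else w) (f ` e))
        = (u (f ` e0) - w (f ` e0)) * (\<Prod>e\<in>edges H - {e0}. Y e (f ` e))"
        by (simp only: insertI1 if_True if_False left_diff_distrib)
    qed
    also have "\<bar>\<dots>\<bar> \<le> c"
      using u w by (intro swap_edge_bound[OF H e0 V cut]) (auto simp: Y_def)
    finally have "\<bar>h (insert e0 E1) - h E1\<bar> \<le> c" .
    moreover have "\<bar>h E1 - h {}\<bar> \<le> real (card E1) * c" using insert by auto
    ultimately have "\<bar>h (insert e0 E1) - h {}\<bar> \<le> c + real (card E1) * c" by linarith
    then show ?case using insert.hyps by (simp add: algebra_simps)
  qed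
  from this[OF finE] have "\<bar>h (edges H) - h {}\<bar> \<le> real (card (edges H)) * c" by simp
  moreover have "h (edges H) = wdens H V u" by (simp add: h_def wdens_def cong: prod.cong)
  moreover have "h {} = wdens H V w" by (simp add: h_def wdens_def)
  ultimately show ?thesis by simp
qed

lemma counting_lemma:
  fixes H :: "'v graph" and u w :: "'w set \<Rightarrow> real"
  assumes H: "simple_graph H" and V: "finite V" "V \<noteq> {}"
    and cut: "cut_le V (\<lambda>e. u e - w e) c"
    and u: "\<And>x y. x \<in> V \<Longrightarrow> y \<in> V \<Longrightarrow> 0 \<le> u {x, y} \<and> u {x, y} \<le> 1"
    and w: "\<And>x y. x \<in> V \<Longrightarrow> y \<in> V \<Longrightarrow> 0 \<le> w {x, y} \<and> w {x, y} \<le> 1"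
  shows "\<bar>wdens H V u - wdens H V w\<bar> \<le> real (card (edges H)) * c"
proof -
  define tr where "tr h e = (if \<exists>x\<in>V. \<exists>y\<in>V. e = {x, y} then h e else 0)" for h :: "'w set \<Rightarrow> real" and e
  have tr: "tr h {x, y} = h {x, y}" if "x \<in> V" "y \<in> V" for h x y using that unfolding tr_def by auto
  have 1: "wdens H V (tr h) = wdens H V h" for h by (intro wdens_cong[OF H] tr)
  have 2: "0 \<le> tr h s \<and> tr h s \<le> 1" if "\<And>x y. x \<in> V \<Longrightarrow> y \<in> V \<Longrightarrow> 0 \<le> h {x, y} \<and> h {x, y} \<le> 1" for h s
    using that unfolding tr_def by auto
  have 3: "cut_le V (\<lambda>e. tr u e - tr w e) c"
    using cut by (subst cut_le_cong[where D' = "\<lambda>e. u e - w e"]) (auto simp: tr)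
  show ?thesis
    using counting_lemma_aux[OF H V 3 2[of u] 2[of w]] u w by (simp add: 1)
qed

text \<open>The defining property of a conditional expectation: a test function that is constant on
  the fibres of T cannot distinguish g from its fibre averages.\<close>

lemma sum_fibre_avg:
  fixes g k :: "'a \<Rightarrow> real"
  assumes "finite S" and k: "\<And>s s'. s \<in> S \<Longrightarrow> s' \<in> S \<Longrightarrow> T s = T s' \<Longrightarrow> k s = k s'"
  shows "(\<Sum>s\<in>S. avg {s'\<in>S. T s' = T s} g * k s) = (\<Sum>s\<in>S. g s * k s)"
proof -
  have grp: "(\<Sum>s\<in>S. h s) = (\<Sum>t\<in>T ` S. \<Sum>s\<in>{s\<in>S. T s = t}. h s)" for h :: "'a \<Rightarrow> real"
    using sum.group[of S "T ` S" T h] assms(1) by simp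
  show ?thesis
    unfolding grp[of "\<lambda>s. avg {s'\<in>S. T s' = T s} g * k s"] grp[of "\<lambda>s. g s * k s"]
  proof (rule sum.cong[OF refl])
    fix t assume "t \<in> T ` S"
    then obtain s0 where s0: "s0 \<in> S" "t = T s0" by auto
    let ?F = "{s\<in>S. T s = t}"
    have ne: "card ?F \<noteq> 0" using s0 assms(1) by auto
    have kk: "k s = k s0" if "s \<in> ?F" for s
      using k[of s s0] that s0 by simp
    have "(\<Sum>s\<in>?F. avg {s'\<in>S. T s' = T s} g * k s) = (\<Sum>s\<in>?F. avg ?F g * k s0)"
    proof (rule sum.cong[OF refl])
      fix s assume s: "s \<in> ?F"
      then have "{s'\<in>S. T s' = T s} = ?F" by simp
      then show "avg {s'\<in>S. T s' = T s} g * k s = avg ?F g * k s0" using kk[OF s] by simp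
    qed
    also have "\<dots> = (\<Sum>s\<in>?F. g s) * k s0" using ne by (simp add: avg_def)
    also have "\<dots> = (\<Sum>s\<in>?F. g s * k s)"
      unfolding sum_distrib_right by (intro sum.cong refl) (simp only: kk)
    finally show "(\<Sum>s\<in>?F. avg {s'\<in>S. T s' = T s} g * k s) = (\<Sum>s\<in>?F. g s * k s)" .
  qed
qed

subsection \<open>Weak regularity\<close>

text \<open>A block is indexed by the set of the labels of both ends, so it joins the rectangles of
  (i, j) and (j, i). Thus the average is again a function of unordered pairs; singletons fall into
  the blocks with a single label.\<close>

definition block_avg :: "'w set \<Rightarrow> ('w \<Rightarrow> nat) \<Rightarrow> ('w set \<Rightarrow> real) \<Rightarrow> 'w set \<Rightarrow> real" where
  "block_avg V c g e = avg {p \<in> V \<times> V. c ` {fst p, snd p} = c ` e} (\<lambda>p. g {fst p, snd p})"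

lemma block_avg_sum:
  assumes "finite V"
    and k: "\<And>x y x' y'. \<lbrakk>x \<in> V; y \<in> V; x' \<in> V; y' \<in> V; c ` {x, y} = c ` {x', y'}\<rbrakk> \<Longrightarrow> k x y = k x' y'"
  shows "(\<Sum>x\<in>V. \<Sum>y\<in>V. block_avg V c g {x, y} * k x y) = (\<Sum>x\<in>V. \<Sum>y\<in>V. g {x, y} * k x y)"
proof -
  have "(\<Sum>p\<in>V\<times>V. avg {p'\<in>V\<times>V. c ` {fst p', snd p'} = c ` {fst p, snd p}} (\<lambda>p. g {fst p, snd p}) * k (fst p) (snd p))
     = (\<Sum>p\<in>V\<times>V. g {fst p, snd p} * k (fst p) (snd p))"
  proof (rule sum_fibre_avg[where T = "\<lambda>p. c ` {fst p, snd p}"])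
    fix p p' assume "p \<in> V \<times> V" "p' \<in> V \<times> V" "c ` {fst p, snd p} = c ` {fst p', snd p'}"
    then show "k (fst p) (snd p) = k (fst p') (snd p')" by (intro k) auto
  qed (use assms(1) in simp)
  then show ?thesis by (simp only: sum.cartesian_product' block_avg_def fst_conv snd_conv)
qed

lemma block_avg_bounds:
  assumes "\<And>x y. x \<in> V \<Longrightarrow> y \<in> V \<Longrightarrow> 0 \<le> g {x, y} \<and> g {x, y} \<le> 1"
  shows "0 \<le> block_avg V c g e" "block_avg V c g e \<le> 1"
  using assms unfolding block_avg_def by (auto intro!: avg_nonneg avg_le_1)

lemma block_avg_cong:
  assumes "\<And>x. x \<in> V \<Longrightarrow> c x = c' x" "x \<in> V" "y \<in> V"
  shows "block_avg V c g {x, y} = block_avg V c' g {x, y}"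
proof -
  have "{p \<in> V \<times> V. c ` {fst p, snd p} = c ` {x, y}} = {p \<in> V \<times> V. c' ` {fst p, snd p} = c' ` {x, y}}"
    using assms by auto
  then show ?thesis by (simp only: block_avg_def)
qed

lemma block_avg_fibre: "c ` e = c ` e' \<Longrightarrow> block_avg V c g e = block_avg V c g e'"
  by (simp only: block_avg_def)

definition energy :: "'w set \<Rightarrow> ('w set \<Rightarrow> real) \<Rightarrow> ('w \<Rightarrow> nat) \<Rightarrow> real" where
  "energy V g c = (\<Sum>x\<in>V. \<Sum>y\<in>V. (block_avg V c g {x, y})\<^sup>2)"

text \<open>The old label in base 4 with one extra bit for each side of the rectangle, so the number
  of labels grows by a factor of four.\<close>

definition refine :: "('w \<Rightarrow> nat) \<Rightarrow> 'w set \<Rightarrow> 'w set \<Rightarrow> 'w \<Rightarrow> nat" where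
  "refine c A B x = 4 * c x + (if x \<in> A then 2 else 0) + (if x \<in> B then 1 else 0)"

lemma refine_eqD:
  assumes "refine c A B x = refine c A B y"
  shows "c x = c y \<and> (x \<in> A \<longleftrightarrow> y \<in> A) \<and> (x \<in> B \<longleftrightarrow> y \<in> B)"
  using assms unfolding refine_def by (auto split: if_splits; presburger)

lemma refine_image_eqD:
  assumes "refine c A B ` {x, y} = refine c A B ` {x', y'}"
  shows "c ` {x, y} = c ` {x', y'}"
    "(of_bool (x \<in> A \<and> y \<in> B) + of_bool (y \<in> A \<and> x \<in> B) :: real)
      = of_bool (x' \<in> A \<and> y' \<in> B) + of_bool (y' \<in> A \<and> x' \<in> B)"
proof -
  let ?r = "refine c A B"
  have "?r x = ?r x' \<and> ?r y = ?r y' \<or> ?r x = ?r y' \<and> ?r y = ?r x'"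
    using assms by (auto simp: doubleton_eq_iff)
  then show "c ` {x, y} = c ` {x', y'}"
    "(of_bool (x \<in> A \<and> y \<in> B) + of_bool (y \<in> A \<and> x \<in> B) :: real)
      = of_bool (x' \<in> A \<and> y' \<in> B) + of_bool (y' \<in> A \<and> x' \<in> B)"
    by (auto dest!: refine_eqD)
qed

lemma sum2_Cauchy_Schwarz:
  fixes f h :: "'a \<Rightarrow> 'b \<Rightarrow> real"
  shows "(\<Sum>x\<in>A. \<Sum>y\<in>B. f x y * h x y)\<^sup>2 \<le> (\<Sum>x\<in>A. \<Sum>y\<in>B. (f x y)\<^sup>2) * (\<Sum>x\<in>A. \<Sum>y\<in>B. (h x y)\<^sup>2)"
  using Cauchy_Schwarz_ineq_sum[of "\<lambda>p. f (fst p) (snd p)" "\<lambda>p. h (fst p) (snd p)" "A \<times> B"]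
  by (simp only: sum.cartesian_product' fst_conv snd_conv)

text \<open>Block averages are orthogonal projections, so by Pythagoras the gain in energy is the
  squared distance between the two block averages. The finer one sees the rectangle exactly; hence
  the discrepancy on \<open>A \<times> B\<close> is an inner product with the difference of the two,
  and Cauchy-Schwarz applies.\<close>

lemma energy_increment:
  fixes g :: "'w set \<Rightarrow> real"
  assumes V: "finite V" and AB: "A \<subseteq> V" "B \<subseteq> V"
  shows "(\<Sum>x\<in>A. \<Sum>y\<in>B. g {x, y} - block_avg V c g {x, y})\<^sup>2
    \<le> (energy V g (refine c A B) - energy V g c) * (real (card V))\<^sup>2"
proof -
  let ?r = "refine c A B"
  define w where "w = block_avg V c g"
  define w' where "w' = block_avg V ?r g"
  \<comment> \<open>Block functions are symmetric, so the indicator of \<open>A \<times> B\<close>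
    has to be symmetrised. The factor 2 that this brings into the sum cancels, after squaring,
    against the bound 4 for \<open>(k x y)\<^sup>2\<close>.\<close>
  define k :: "'w \<Rightarrow> 'w \<Rightarrow> real" where "k x y = of_bool (x \<in> A \<and> y \<in> B) + of_bool (y \<in> A \<and> x \<in> B)" for x y
  have 1: "(\<Sum>x\<in>V. \<Sum>y\<in>V. w' {x, y} * w {x, y}) = (\<Sum>x\<in>V. \<Sum>y\<in>V. g {x, y} * w {x, y})"
    unfolding w'_def w_def
    by (rule block_avg_sum[OF V, where k = "\<lambda>x y. block_avg V c g {x, y}"])
      (metis refine_image_eqD(1) block_avg_fibre)
  have 2: "(\<Sum>x\<in>V. \<Sum>y\<in>V. w {x, y} * w {x, y}) = (\<Sum>x\<in>V. \<Sum>y\<in>V. g {x, y} * w {x, y})"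
    unfolding w_def
    by (rule block_avg_sum[OF V, where k = "\<lambda>x y. block_avg V c g {x, y}"]) (metis block_avg_fibre)
  have 3: "(\<Sum>x\<in>V. \<Sum>y\<in>V. w' {x, y} * k x y) = (\<Sum>x\<in>V. \<Sum>y\<in>V. g {x, y} * k x y)"
    unfolding w'_def by (rule block_avg_sum[OF V]) (auto simp only: k_def dest: refine_image_eqD(2))
  have sq: "(\<Sum>x\<in>V. \<Sum>y\<in>V. (w' {x, y} - w {x, y})\<^sup>2) = energy V g ?r - energy V g c"
  proof -
    have "(\<Sum>x\<in>V. \<Sum>y\<in>V. (w' {x, y} - w {x, y})\<^sup>2) = (\<Sum>x\<in>V. \<Sum>y\<in>V. (w' {x, y})\<^sup>2)
      + (\<Sum>x\<in>V. \<Sum>y\<in>V. w {x, y} * w {x, y}) - 2 * (\<Sum>x\<in>V. \<Sum>y\<in>V. w' {x, y} * w {x, y})"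
      by (simp add: power2_diff sum.distrib sum_subtractf sum_distrib_left power2_eq_square algebra_simps)
    also have "\<dots> = (\<Sum>x\<in>V. \<Sum>y\<in>V. (w' {x, y})\<^sup>2) - (\<Sum>x\<in>V. \<Sum>y\<in>V. (w {x, y})\<^sup>2)"
      using 1 2 by (simp add: power2_eq_square)
    finally show ?thesis by (simp add: energy_def w_def w'_def)
  qed
  have ind: "(\<Sum>x\<in>V. \<Sum>y\<in>V. h x y * of_bool (x \<in> A \<and> y \<in> B)) = (\<Sum>x\<in>A. \<Sum>y\<in>B. h x y)" for h :: "'w \<Rightarrow> 'w \<Rightarrow> real"
  proof -
    have "(\<Sum>y\<in>V. h x y * of_bool (x \<in> A \<and> y \<in> B)) = (if x \<in> A then (\<Sum>y\<in>B. h x y) else 0)" for x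
      using V AB by (simp add: Int_absorb1)
    then have "(\<Sum>x\<in>V. \<Sum>y\<in>V. h x y * of_bool (x \<in> A \<and> y \<in> B)) = (\<Sum>x\<in>V. if x \<in> A then (\<Sum>y\<in>B. h x y) else 0)"
      by (simp only:)
    also have "\<dots> = (\<Sum>x\<in>A. \<Sum>y\<in>B. h x y)"
      using V AB by (simp add: sum.inter_restrict[symmetric] Int_absorb1)
    finally show ?thesis .
  qed
  have kk: "(\<Sum>x\<in>V. \<Sum>y\<in>V. (g {x, y} - w {x, y}) * k x y) = 2 * (\<Sum>x\<in>A. \<Sum>y\<in>B. g {x, y} - w {x, y})"
  proof -
    have "(\<Sum>x\<in>V. \<Sum>y\<in>V. (g {x, y} - w {x, y}) * of_bool (y \<in> A \<and> x \<in> B))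
      = (\<Sum>y\<in>V. \<Sum>x\<in>V. (g {y, x} - w {y, x}) * of_bool (y \<in> A \<and> x \<in> B))"
      by (subst sum.swap) (simp add: insert_commute)
    then show ?thesis using ind[of "\<lambda>x y. g {x, y} - w {x, y}"]
      by (simp add: k_def distrib_left sum.distrib)
  qed
  have "(\<Sum>x\<in>V. \<Sum>y\<in>V. (g {x, y} - w {x, y}) * k x y) = (\<Sum>x\<in>V. \<Sum>y\<in>V. (w' {x, y} - w {x, y}) * k x y)"
    using 3 by (simp add: left_diff_distrib sum_subtractf)
  then have "(2 * (\<Sum>x\<in>A. \<Sum>y\<in>B. g {x, y} - w {x, y}))\<^sup>2 = (\<Sum>x\<in>V. \<Sum>y\<in>V. (w' {x, y} - w {x, y}) * k x y)\<^sup>2"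
    by (simp add: kk)
  also have "\<dots> \<le> (energy V g ?r - energy V g c) * (\<Sum>x\<in>V. \<Sum>y\<in>V. (k x y)\<^sup>2)"
    unfolding sq[symmetric] by (rule sum2_Cauchy_Schwarz)
  also have "\<dots> \<le> (energy V g ?r - energy V g c) * (4 * (real (card V))\<^sup>2)"
  proof (rule mult_left_mono)
    have "(\<Sum>x\<in>V. \<Sum>y\<in>V. (k x y)\<^sup>2) \<le> (\<Sum>x\<in>V. \<Sum>y\<in>V. 4)" by (intro sum_mono) (auto simp: k_def)
    then show "(\<Sum>x\<in>V. \<Sum>y\<in>V. (k x y)\<^sup>2) \<le> 4 * (real (card V))\<^sup>2" by (simp add: power2_eq_square)
    show "0 \<le> energy V g ?r - energy V g c" unfolding sq[symmetric] by (intro sum_nonneg) auto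
  qed
  finally show ?thesis by (simp add: w_def power2_eq_square)
qed

text \<open>Weak regularity: maximise the energy over labellings with \<open>4 ^ m\<close> labels. For some
  \<open>m < M\<close> the maximum grows by at most a fraction \<open>1 / M\<close>, so no rectangle can witness a large
  cut norm.\<close>
lemma weak_regularity:
  fixes g :: "'w set \<Rightarrow> real"
  assumes V: "finite V" "V \<noteq> {}" and M: "M > 0"
    and g: "\<And>x y. x \<in> V \<Longrightarrow> y \<in> V \<Longrightarrow> 0 \<le> g {x, y} \<and> g {x, y} \<le> 1"
  shows "\<exists>c \<in> V \<rightarrow>\<^sub>E {..<4 ^ M}. cut_le V (\<lambda>e. g e - block_avg V c g e) (1 / sqrt (real M))"
proof -
  define n2 where "n2 = (real (card V))\<^sup>2"
  define L where "L m = (V \<rightarrow>\<^sub>E {..<4 ^ m :: nat})" for m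
  define q where "q m = Max (energy V g ` L m)" for m
  have L: "finite (L m)" "L m \<noteq> {}" for m
  proof -
    show "finite (L m)" using V by (auto simp: L_def intro!: finite_PiE)
    have "0 \<in> {..<4 ^ m :: nat}" by simp
    then show "L m \<noteq> {}" unfolding L_def PiE_eq_empty_iff by blast
  qed
  have en_bounds: "0 \<le> energy V g c" "energy V g c \<le> n2" for c
  proof -
    show "0 \<le> energy V g c" by (simp add: energy_def sum_nonneg)
    have "energy V g c \<le> (\<Sum>x\<in>V. \<Sum>y\<in>V. 1)"
      unfolding energy_def using block_avg_bounds[of V g c] g
      by (intro sum_mono) (simp add: power_le_one)
    then show "energy V g c \<le> n2" by (simp add: n2_def power2_eq_square)
  qed
  have q: "0 \<le> q m" "q m \<le> n2" for m
    using L[of m] en_bounds by (auto simp: q_def Max_ge_iff)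
  have "\<exists>m<M. q (Suc m) - q m \<le> n2 / M"
  proof (rule ccontr)
    assume "\<not> ?thesis"
    then have "(\<Sum>m<M. n2 / M) < (\<Sum>m<M. q (Suc m) - q m)"
      using M by (intro sum_strict_mono) auto
    also have "\<dots> = q M - q 0" by (simp add: sum_lessThan_telescope)
    finally show False using M q[of M] q[of 0] by simp
  qed
  then obtain m where m: "m < M" "q (Suc m) - q m \<le> n2 / M" by auto
  have "q m \<in> energy V g ` L m" unfolding q_def using L[of m] by (intro Max_in) auto
  then obtain c where c: "c \<in> L m" "q m = energy V g c" by blast
  have "cut_le V (\<lambda>e. g e - block_avg V c g e) (1 / sqrt (real M))"
    unfolding cut_le_def
  proof (intro allI impI)
    fix A B assume AB: "A \<subseteq> V" "B \<subseteq> V"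
    \<comment> \<open>The competing labellings are extensional, hence the restriction; it does not
      affect the energy.\<close>
    let ?r = "restrict (refine c A B) V"
    have "?r \<in> L (Suc m)"
    proof -
      have "refine c A B x < 4 ^ Suc m" if "x \<in> V" for x
      proof -
        have "c x < 4 ^ m" using c(1) that by (auto simp: L_def)
        then show ?thesis by (auto simp: refine_def)
      qed
      then show ?thesis by (auto simp: L_def)
    qed
    then have "energy V g ?r \<le> q (Suc m)" using L[of "Suc m"] by (simp add: q_def)
    moreover have "energy V g ?r = energy V g (refine c A B)"
      unfolding energy_def by (intro sum.cong refl arg_cong[of _ _ "\<lambda>z. z\<^sup>2"] block_avg_cong) auto
    ultimately have "energy V g (refine c A B) - energy V g c \<le> n2 / M" using m c by simp
    then have "(\<Sum>x\<in>A. \<Sum>y\<in>B. g {x, y} - block_avg V c g {x, y})\<^sup>2 \<le> n2 / M * n2"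
      using energy_increment[OF V(1) AB, of g c] mult_right_mono[of _ _ n2]
      unfolding n2_def by (smt (verit, ccfv_SIG) zero_le_power2)
    also have "\<dots> = (1 / sqrt (real M) * n2)\<^sup>2"
      by (simp add: power_mult_distrib power_divide power2_eq_square)
    finally have "\<bar>\<Sum>x\<in>A. \<Sum>y\<in>B. g {x, y} - block_avg V c g {x, y}\<bar> \<le> \<bar>1 / sqrt (real M) * n2\<bar>"
      by (simp only: abs_le_square_iff)
    then show "\<bar>\<Sum>x\<in>A. \<Sum>y\<in>B. g {x, y} - block_avg V c g {x, y}\<bar> \<le> 1 / sqrt (real M) * (real (card V))\<^sup>2"
      by (simp add: n2_def)
  qed
  moreover have "c \<in> V \<rightarrow>\<^sub>E {..<4 ^ M}"
  proof -
    have "(4::nat) ^ m \<le> 4 ^ M" using m by (intro power_increasing) auto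
    then have sub: "{..<4 ^ m :: nat} \<subseteq> {..<4 ^ M}" by simp
    have "L m \<subseteq> L M" unfolding L_def by (rule PiE_mono) (rule sub)
    then show ?thesis using c(1) unfolding L_def[of M, symmetric] by (rule subsetD)
  qed
  ultimately show ?thesis by blast
qed

subsection \<open>Labelled graphs and block densities\<close>

definition pairs :: "nat \<Rightarrow> nat set set" where
  "pairs n = {e. e \<subseteq> {1..n} \<and> card e = 2}"

definition adj :: "'w graph \<Rightarrow> 'w set \<Rightarrow> real" where
  "adj G e = of_bool (e \<in> edges G)"

lemma adj_bounds: "0 \<le> adj G e \<and> adj G e \<le> 1"
  by (simp add: adj_def)

lemma pairsE:
  assumes "e \<in> pairs n"
  obtains x y where "e = {x, y}" "x \<noteq> y" "x \<in> {1..n}" "y \<in> {1..n}"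
proof -
  from assms have *: "e \<subseteq> {1..n}" "card e = 2" by (auto simp: pairs_def)
  then obtain x y where "e = {x, y}" "x \<noteq> y" by (meson card_2_iff)
  then show ?thesis using that *(1) by blast
qed

lemma singleton_notin_pairs: "{x} \<notin> pairs n"
  by (simp add: pairs_def)

lemma finite_pairs: "finite (pairs n)"
  by (rule finite_subset[of _ "Pow {1..n}"]) (auto simp: pairs_def)

lemma labeled_graphs_eq: "labeled_graphs n = (\<lambda>E. ({1..n}, E)) ` Pow (pairs n)"
  by (force simp: labeled_graphs_def simple_graph_def pairs_def)

lemma finite_labeled_graphs: "finite (labeled_graphs n)"
  by (simp add: labeled_graphs_eq finite_pairs)

lemma labeled_graphsD:
  assumes "G \<in> labeled_graphs n"
  shows "simple_graph G" "verts G = {1..n}" "edges G \<subseteq> pairs n"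
  using assms by (auto simp: labeled_graphs_def simple_graph_def pairs_def)

lemma sum_labeled_graphs: "(\<Sum>G\<in>labeled_graphs n. h G) = (\<Sum>E\<in>Pow (pairs n). h ({1..n}, E))"
  unfolding labeled_graphs_eq by (subst sum.reindex) (auto simp: inj_on_def)

lemma hom_density_eq_wdens:
  assumes "simple_graph H" "finite (verts G)"
  shows "hom_density H G = wdens H (verts G) (adj G)"
proof -
  have fin: "finite (verts H)" "finite (edges H)" using simple_graph_finite[OF assms(1)] by auto
  have "(\<Prod>e\<in>edges H. adj G (f ` e)) = of_bool (\<forall>e\<in>edges H. f ` e \<in> edges G)" for f
  proof (cases "\<forall>e\<in>edges H. f ` e \<in> edges G")
    case True
    then show ?thesis by (simp add: adj_def)
  next
    case False
    then have "\<exists>e\<in>edges H. adj G (f ` e) = 0" by (auto simp: adj_def)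
    then show ?thesis using False fin(2) by (simp add: prod_zero)
  qed
  then have "(\<Sum>f\<in>verts H \<rightarrow>\<^sub>E verts G. \<Prod>e\<in>edges H. adj G (f ` e)) = real (card (homs H G))"
    using fin assms(2) by (simp add: homs_def finite_PiE Int_def)
  then show ?thesis
    using fin by (simp add: hom_density_def wdens_def avg_def card_PiE)
qed

lemma simple_K2: "simple_graph K2"
  by (auto simp: simple_graph_def K2_def)

lemma hom_density_K2:
  assumes "finite (verts G)" "verts G \<noteq> {}"
  shows "hom_density K2 G = avg2 (verts G) (adj G)"
  using avg_edge[OF simple_K2, of "{0, 1}" "verts G" "adj G"] assms
    hom_density_eq_wdens[OF simple_K2 assms(1)]
  by (simp add: wdens_def K2_def del: One_nat_def)

lemma edge_count_sum:
  assumes "finite A" "finite B"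
  shows "real (edge_count G A B) = (\<Sum>a\<in>A. \<Sum>b\<in>B. adj G {a, b})"
proof -
  have "{(a, b). a \<in> A \<and> b \<in> B \<and> {a, b} \<in> edges G} = (SIGMA a:A. {b\<in>B. {a, b} \<in> edges G})" by auto
  then show ?thesis
    using assms by (simp add: edge_count_def adj_def Int_def)
qed

lemma cut_dist_le_iff:
  assumes "finite (verts G)" "verts G \<noteq> {}"
  shows "cut_dist G s \<le> c \<longleftrightarrow> cut_le (verts G) (\<lambda>e. adj G e - s) c"
proof -
  let ?V = "verts G"
  let ?h = "\<lambda>(A, B). \<bar>real (edge_count G A B) - s * real (card A) * real (card B)\<bar> / (real (card ?V))\<^sup>2"
  have n: "(real (card ?V))\<^sup>2 > 0" using assms by (simp add: card_gt_0_iff)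
  have "cut_dist G s \<le> c \<longleftrightarrow> (\<forall>p\<in>Pow ?V \<times> Pow ?V. ?h p \<le> c)"
    unfolding cut_dist_def using assms(1)
    by (intro cSUP_le_iff bdd_above_finite) auto
  also have "\<dots> \<longleftrightarrow> (\<forall>A\<subseteq>?V. \<forall>B\<subseteq>?V. ?h (A, B) \<le> c)" by auto
  also have "\<dots> \<longleftrightarrow> cut_le ?V (\<lambda>e. adj G e - s) c"
  proof -
    have "?h (A, B) \<le> c \<longleftrightarrow> \<bar>\<Sum>x\<in>A. \<Sum>y\<in>B. adj G {x, y} - s\<bar> \<le> c * (real (card ?V))\<^sup>2"
      if "A \<subseteq> ?V" "B \<subseteq> ?V" for A B
    proof -
      have "finite A" "finite B" using that assms finite_subset by auto
      then show ?thesis using n by (simp add: edge_count_sum sum_subtractf divide_le_eq mult_ac)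
    qed
    then show ?thesis unfolding cut_le_def by blast
  qed
  finally show ?thesis .
qed

lemma cut_dist_nonneg:
  assumes "finite (verts G)" "verts G \<noteq> {}"
  shows "0 \<le> cut_dist G s"
  using cut_dist_le_iff[OF assms, of s "cut_dist G s"] cut_le_nonneg assms by blast

section \<open>Binary entropy, Bernoulli graphs and the size of a block class\<close>

definition ent :: "real \<Rightarrow> real" where
  "ent x = - x * ln x - (1 - x) * ln (1 - x)"

text \<open>The tangent bound \<open>- y * ln y \<le> 1 - y\<close>, taken at x and at 1 - x, adds
  up to 1; this weaker form of ln 2 suffices.\<close>

lemma ent_bounds:
  assumes "0 \<le> x" "x \<le> 1" shows "0 \<le> ent x" "ent x \<le> 1"
proof -
  have *: "0 \<le> - y * ln y \<and> - y * ln y \<le> 1 - y" if "0 \<le> y" "y \<le> 1" for y :: real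
  proof (cases "y = 0")
    case False
    then have "ln y \<le> 0" "ln (1 / y) \<le> 1 / y - 1" using that ln_le_minus_one[of "1 / y"] by auto
    then have "y * - ln y \<le> y * (1 / y - 1)" "0 \<le> y * - ln y"
      using that False by (intro mult_left_mono mult_nonneg_nonneg; simp add: ln_div)+
    then show ?thesis using False by (simp add: right_diff_distrib)
  qed simp
  show "0 \<le> ent x" "ent x \<le> 1"
    using *[of x] *[of "1 - x"] assms unfolding ent_def minus_mult_left by linarith+
qed

lemma sum_pairs:
  fixes \<phi> :: "nat set \<Rightarrow> real"
  shows "(\<Sum>x\<in>{1..n}. \<Sum>y\<in>{1..n}. if x \<noteq> y then \<phi> {x, y} else 0) = 2 * (\<Sum>e\<in>pairs n. \<phi> e)"
proof -
  let ?S = "{p \<in> {1..n} \<times> {1..n}. fst p \<noteq> snd p}"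
  have "(\<Sum>x\<in>{1..n}. \<Sum>y\<in>{1..n}. if x \<noteq> y then \<phi> {x, y} else 0)
    = (\<Sum>p\<in>{1..n} \<times> {1..n}. if fst p \<noteq> snd p then \<phi> {fst p, snd p} else 0)"
    by (simp only: sum.cartesian_product' fst_conv snd_conv)
  also have "\<dots> = (\<Sum>p\<in>?S. \<phi> {fst p, snd p})" by (simp add: sum.inter_filter)
  also have "\<dots> = (\<Sum>e\<in>pairs n. \<Sum>p\<in>{p \<in> ?S. {fst p, snd p} = e}. \<phi> {fst p, snd p})"
    by (rule sum.group[symmetric]) (auto simp: finite_pairs pairs_def)
  also have "\<dots> = (\<Sum>e\<in>pairs n. 2 * \<phi> e)"
  proof (rule sum.cong[OF refl])
    fix e assume "e \<in> pairs n"
    then obtain a b where ab: "e = {a, b}" "a \<noteq> b" "a \<in> {1..n}" "b \<in> {1..n}" by (rule pairsE)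
    have "{p \<in> ?S. {fst p, snd p} = e} = {(a, b), (b, a)}"
      using ab by (auto simp: doubleton_eq_iff)
    then show "(\<Sum>p\<in>{p \<in> ?S. {fst p, snd p} = e}. \<phi> {fst p, snd p}) = 2 * \<phi> e"
      using ab by (simp add: insert_commute)
  qed
  finally show ?thesis by (simp add: sum_distrib_left)
qed

text \<open>The law of the inhomogeneous random graph with independent edges.\<close>

definition bernoulli_weight :: "nat \<Rightarrow> (nat set \<Rightarrow> real) \<Rightarrow> nat graph \<Rightarrow> real" where
  "bernoulli_weight n p G = (\<Prod>e\<in>pairs n. if e \<in> edges G then p e else 1 - p e)"

lemma bernoulli_weight_sum: "(\<Sum>G\<in>labeled_graphs n. bernoulli_weight n p G) = 1"
proof -
  have "(\<Sum>G\<in>labeled_graphs n. bernoulli_weight n p G)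
    = (\<Sum>E\<in>Pow (pairs n). (\<Prod>e\<in>E. p e) * (\<Prod>e\<in>pairs n - E. 1 - p e))"
    unfolding sum_labeled_graphs
  proof (rule sum.cong[OF refl])
    fix E assume "E \<in> Pow (pairs n)"
    then show "bernoulli_weight n p ({1..n}, E) = (\<Prod>e\<in>E. p e) * (\<Prod>e\<in>pairs n - E. 1 - p e)"
      by (simp add: bernoulli_weight_def prod.If_cases finite_pairs Int_absorb1 Diff_eq)
  qed
  also have "\<dots> = (\<Prod>e\<in>pairs n. p e + (1 - p e))" by (rule prod_add[OF finite_pairs, symmetric])
  finally show ?thesis by simp
qed

lemma bernoulli_weight_nonneg:
  assumes "\<And>e. e \<in> pairs n \<Longrightarrow> 0 \<le> p e \<and> p e \<le> 1"
  shows "0 \<le> bernoulli_weight n p G"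
  unfolding bernoulli_weight_def using assms by (intro prod_nonneg) auto

text \<open>The hypotheses exclude precisely the vanishing factors, where the convention
  \<open>ln 0 = 0\<close> would turn a zero into a one.\<close>

lemma bernoulli_weight_exp:
  assumes "\<And>e. e \<in> pairs n \<Longrightarrow> e \<in> edges G \<Longrightarrow> 0 < p e"
    and "\<And>e. e \<in> pairs n \<Longrightarrow> e \<notin> edges G \<Longrightarrow> p e < 1"
  shows "bernoulli_weight n p G = exp (\<Sum>e\<in>pairs n. adj G e * ln (p e) + (1 - adj G e) * ln (1 - p e))"
  unfolding bernoulli_weight_def exp_sum[OF finite_pairs]
  using assms by (intro prod.cong refl) (auto simp: adj_def)

lemma block_avg_pos:
  assumes "finite V" "x \<in> V" "y \<in> V" "\<And>e. 0 \<le> g e" "0 < g {x, y}"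
  shows "0 < block_avg V c g {x, y}"
proof -
  let ?S = "{p \<in> V \<times> V. c ` {fst p, snd p} = c ` {x, y}}"
  have S: "finite ?S" "(x, y) \<in> ?S" using assms by auto
  have "0 < (\<Sum>p\<in>?S. g {fst p, snd p})"
    by (rule sum_pos2[OF S]) (use assms in auto)
  moreover have "card ?S > 0" using S by (subst card_gt_0_iff) (intro conjI notI; simp only: empty_iff)
  ultimately show ?thesis unfolding block_avg_def avg_def by simp
qed

lemma block_avg_compl:
  assumes "finite V" "x \<in> V" "y \<in> V"
  shows "block_avg V c (\<lambda>e. 1 - g e) {x, y} = 1 - block_avg V c g {x, y}"
proof -
  let ?S = "{p \<in> V \<times> V. c ` {fst p, snd p} = c ` {x, y}}"
  have fin: "finite ?S" by (rule finite_subset[OF _ finite_cartesian_product[OF assms(1) assms(1)]]) auto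
  have mem: "(x, y) \<in> ?S" using assms(2,3) by simp
  have "?S \<noteq> {}"
  proof
    assume "?S = {}"
    from equals0D[OF this] mem show False by (rule notE)
  qed
  then have "avg ?S (\<lambda>p. 1) = 1" by (rule avg_const[OF fin])
  then show ?thesis unfolding block_avg_def avg_diff by simp
qed

text \<open>The Bernoulli measure with edge probabilities \<open>w\<close> gives every graph with block densities
  \<open>w\<close> a mass of at least \<open>exp (- \<Sum> ent w / 2)\<close>.\<close>
lemma card_block_class_le:
  assumes sub: "C \<subseteq> labeled_graphs n"
    and w: "\<And>G x y. G \<in> C \<Longrightarrow> x \<in> {1..n} \<Longrightarrow> y \<in> {1..n} \<Longrightarrow> block_avg {1..n} c (adj G) {x, y} = w {x, y}"
  shows "real (card C) \<le> exp ((real n)\<^sup>2 / 2 * avg2 {1..n} (\<lambda>e. ent (w e)))"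
proof (cases "C = {}")
  case False
  let ?V = "{1..n}"
  have w01: "0 \<le> w {x, y} \<and> w {x, y} \<le> 1" if "x \<in> ?V" "y \<in> ?V" for x y
    using False w[OF _ that] block_avg_bounds[of ?V "adj _" c "{x, y}"] adj_bounds
    by (metis ex_in_conv)
  have pw: "0 \<le> w e \<and> w e \<le> 1" if "e \<in> pairs n" for e
    using that by (rule pairsE) (use w01 in blast)
  have low: "exp (- (\<Sum>x\<in>?V. \<Sum>y\<in>?V. ent (w {x, y})) / 2) \<le> bernoulli_weight n w G" if G: "G \<in> C" for G
  proof -
    have nosing: "adj G {x} = 0" for x
      using labeled_graphsD(3)[of G n] G sub singleton_notin_pairs[of x n] by (auto simp: adj_def)
    have pos: "0 < w e" if e: "e \<in> pairs n" "e \<in> edges G" for e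
    proof -
      obtain x y where "e = {x, y}" "x \<in> ?V" "y \<in> ?V" using e(1) by (rule pairsE)
      then show ?thesis
        using w[OF G, of x y] block_avg_pos[of ?V x y "adj G" c] e by (simp add: adj_def)
    qed
    have lt1: "w e < 1" if e: "e \<in> pairs n" "e \<notin> edges G" for e
    proof -
      obtain x y where "e = {x, y}" "x \<in> ?V" "y \<in> ?V" using e(1) by (rule pairsE)
      then show ?thesis
        using w[OF G, of x y] block_avg_pos[of ?V x y "\<lambda>e. 1 - adj G e" c] block_avg_compl[of ?V x y c "adj G"] e
        by (simp add: adj_def)
    qed
    define \<phi> where "\<phi> e = adj G e * ln (w e) + (1 - adj G e) * ln (1 - w e)" for e
    \<comment> \<open>The log-odds of w are constant on blocks, so the edges of G may be replaced by
      their block densities.\<close>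
    have "(\<Sum>x\<in>?V. \<Sum>y\<in>?V. adj G {x, y} * (ln (w {x, y}) - ln (1 - w {x, y})))
      = (\<Sum>x\<in>?V. \<Sum>y\<in>?V. block_avg ?V c (adj G) {x, y} * (ln (w {x, y}) - ln (1 - w {x, y})))"
    proof (rule block_avg_sum[symmetric])
      fix x y x' y' assume *: "x \<in> ?V" "y \<in> ?V" "x' \<in> ?V" "y' \<in> ?V" "c ` {x, y} = c ` {x', y'}"
      have "w {x, y} = w {x', y'}"
        unfolding w[OF G *(1,2), symmetric] w[OF G *(3,4), symmetric] by (rule block_avg_fibre[OF *(5)])
      then show "ln (w {x, y}) - ln (1 - w {x, y}) = ln (w {x', y'}) - ln (1 - w {x', y'})" by simp
    qed simp
    also have "\<dots> = (\<Sum>x\<in>?V. \<Sum>y\<in>?V. w {x, y} * (ln (w {x, y}) - ln (1 - w {x, y})))"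
      by (intro sum.cong refl) (simp only: w[OF G])
    finally have main: "(\<Sum>x\<in>?V. \<Sum>y\<in>?V. \<phi> {x, y}) = - (\<Sum>x\<in>?V. \<Sum>y\<in>?V. ent (w {x, y}))"
      by (simp add: \<phi>_def ent_def algebra_simps sum.distrib sum_subtractf sum_negf)
    \<comment> \<open>G has no loops, so the diagonal terms are
      \<open>ln (1 - w {x}) \<le> 0\<close>; dropping them raises the sum and leaves the proper
      pairs.\<close>
    have "(\<Sum>x\<in>?V. \<Sum>y\<in>?V. \<phi> {x, y}) \<le> (\<Sum>x\<in>?V. \<Sum>y\<in>?V. if x \<noteq> y then \<phi> {x, y} else 0)"
    proof (intro sum_mono)
      fix x y assume xy: "x \<in> ?V" "y \<in> ?V"
      have "ln (1 - w {x}) \<le> 0"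
        using w01[OF xy(1) xy(1)] by (cases "w {x} = 1") (auto simp: ln_le_zero_iff)
      then show "\<phi> {x, y} \<le> (if x \<noteq> y then \<phi> {x, y} else 0)"
        by (cases "x = y") (simp_all add: \<phi>_def nosing)
    qed
    also have "\<dots> = 2 * (\<Sum>e\<in>pairs n. \<phi> e)" by (rule sum_pairs)
    finally have "- (\<Sum>x\<in>?V. \<Sum>y\<in>?V. ent (w {x, y})) / 2 \<le> (\<Sum>e\<in>pairs n. \<phi> e)" using main by simp
    moreover have "bernoulli_weight n w G = exp (\<Sum>e\<in>pairs n. \<phi> e)"
      unfolding \<phi>_def by (rule bernoulli_weight_exp) (rule pos lt1; assumption)+
    ultimately show ?thesis by simp
  qed
  have "real (card C) * exp (- (\<Sum>x\<in>?V. \<Sum>y\<in>?V. ent (w {x, y})) / 2) = (\<Sum>G\<in>C. exp (- (\<Sum>x\<in>?V. \<Sum>y\<in>?V. ent (w {x, y})) / 2))"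
    by simp
  also have "\<dots> \<le> (\<Sum>G\<in>C. bernoulli_weight n w G)" by (intro sum_mono low)
  also have "\<dots> \<le> (\<Sum>G\<in>labeled_graphs n. bernoulli_weight n w G)"
    using sub finite_labeled_graphs pw by (intro sum_mono2 bernoulli_weight_nonneg) auto
  also have "\<dots> = 1" by (rule bernoulli_weight_sum)
  finally have "real (card C) \<le> exp ((\<Sum>x\<in>?V. \<Sum>y\<in>?V. ent (w {x, y})) / 2)"
    by (simp add: exp_minus field_simps)
  moreover have "(\<Sum>x\<in>?V. \<Sum>y\<in>?V. ent (w {x, y})) / 2 = (real n)\<^sup>2 / 2 * avg2 ?V (\<lambda>e. ent (w e))"
    by (cases "n = 0") (simp_all add: avg2_sum)
  ultimately show ?thesis by simp
qed simp

section \<open>Free energy and the union bound over block classes\<close>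

text \<open>The exponential rate per pair of vertices: times \<open>n choose 2\<close>, and up to
  lower order, it is the logarithm of the total weight of the graphs that look like w. The entropy
  term counts these graphs, the other two form the exponent of the weight.\<close>

definition free_energy :: "'v graph \<Rightarrow> real \<Rightarrow> real \<Rightarrow> real \<Rightarrow> 'w set \<Rightarrow> ('w set \<Rightarrow> real) \<Rightarrow> real" where
  "free_energy H \<alpha> \<beta>1 \<beta>2 V w = \<beta>1 * avg2 V w + avg2 V (\<lambda>e. ent (w e)) + \<beta>2 * wdens H V w powr \<alpha>"

lemma real_choose_2: "real (n choose 2) = (real n)\<^sup>2 / 2 - real n / 2"
proof -
  have "real (n choose 2) = real (n * (n - 1)) / 2"
    unfolding choose_two by (subst real_of_nat_div) auto
  then show ?thesis by (cases n) (auto simp: power2_eq_square algebra_simps)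
qed

lemma ergm_weight_eq:
  assumes "simple_graph H" "G \<in> labeled_graphs n" "n \<ge> 1"
  shows "ergm_weight H \<alpha> \<beta>1 \<beta>2 n G
    = exp (real (n choose 2) * (\<beta>1 * avg2 {1..n} (adj G) + \<beta>2 * wdens H {1..n} (adj G) powr \<alpha>))"
  using labeled_graphsD[OF assms(2)] assms hom_density_eq_wdens[OF assms(1), of G] hom_density_K2[of G]
  by (simp add: ergm_weight_def)

text \<open>Counts instead of densities, since they are integers of size at most
  \<open>n\<^sup>2\<close>; this bounds the number of classes in the union bound.\<close>

definition block_count :: "'w set \<Rightarrow> ('w \<Rightarrow> nat) \<Rightarrow> 'w graph \<Rightarrow> nat set \<Rightarrow> nat" where
  "block_count V c G L = card {p \<in> V \<times> V. c ` {fst p, snd p} = L \<and> {fst p, snd p} \<in> edges G}"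

lemma block_avg_count:
  assumes "finite V"
  shows "block_avg V c (adj G) e = real (block_count V c G (c ` e)) / real (card {p \<in> V \<times> V. c ` {fst p, snd p} = c ` e})"
proof -
  let ?S = "{p \<in> V \<times> V. c ` {fst p, snd p} = c ` e}"
  have fin: "finite ?S" by (rule finite_subset[OF _ finite_cartesian_product[OF assms assms]]) auto
  have "(\<Sum>p\<in>?S. adj G {fst p, snd p}) = real (card {p \<in> ?S. {fst p, snd p} \<in> edges G})"
    using fin by (simp add: adj_def Int_def)
  also have "{p \<in> ?S. {fst p, snd p} \<in> edges G} = {p \<in> V \<times> V. c ` {fst p, snd p} = c ` e \<and> {fst p, snd p} \<in> edges G}"
    by auto
  finally show ?thesis unfolding block_avg_def avg_def block_count_def by simp
qed

lemma avg2_block_avg: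
  assumes "finite V"
  shows "avg2 V (block_avg V c g) = avg2 V g"
  using block_avg_sum[OF assms, where k = "\<lambda>x y. 1" and c = c and g = g] by (simp add: avg2_sum)

text \<open>Graphs are sorted by their labelling and by their edge counts for every set of labels;
  \<open>K ^ n * (n\<^sup>2 + 1) ^ (2 ^ K)\<close> bounds the number of classes. In one class the
  block densities agree, so the entropy bounds its size, and the counting lemma the weight of its
  members. The summand n pays for passing from \<open>n\<^sup>2 / 2\<close> to
  \<open>n choose 2\<close> in the entropy.\<close>

lemma ergm_weight_sum_upper:
  fixes H :: "'v graph"
  assumes H: "simple_graph H" and n: "n \<ge> 1" and \<beta>2: "\<beta>2 \<ge> 0" and sub: "B \<subseteq> labeled_graphs n"
    and B: "\<And>G. G \<in> B \<Longrightarrow> \<exists>c \<in> {1..n} \<rightarrow>\<^sub>E {..<K}. 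
        cut_le {1..n} (\<lambda>e. adj G e - block_avg {1..n} c (adj G) e) \<eta>
        \<and> free_energy H \<alpha> \<beta>1 \<beta>2 {1..n} (block_avg {1..n} c (adj G)) \<le> \<Lambda>"
    and modulus: "\<And>s t. \<lbrakk>0 \<le> s; s \<le> 1; 0 \<le> t; t \<le> 1; \<bar>s - t\<bar> \<le> real (card (edges H)) * \<eta>\<rbrakk> \<Longrightarrow> s powr \<alpha> \<le> t powr \<alpha> + \<omega>"
  shows "(\<Sum>G\<in>B. ergm_weight H \<alpha> \<beta>1 \<beta>2 n G)
    \<le> real (K ^ n * (n\<^sup>2 + 1) ^ (2 ^ K)) * exp (real (n choose 2) * (\<Lambda> + \<beta>2 * \<omega>) + n)"
proof -
  let ?V = "{1..n}" and ?N = "real (n choose 2)"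
  let ?bound = "exp (?N * (\<Lambda> + \<beta>2 * \<omega>) + n)"
  have V: "finite ?V" "?V \<noteq> {}" using n by auto
  define P where "P G c \<longleftrightarrow> c \<in> ?V \<rightarrow>\<^sub>E {..<K}
     \<and> cut_le ?V (\<lambda>e. adj G e - block_avg ?V c (adj G) e) \<eta>
     \<and> free_energy H \<alpha> \<beta>1 \<beta>2 ?V (block_avg ?V c (adj G)) \<le> \<Lambda>" for G c
  have "\<exists>c. P G c" if "G \<in> B" for G
    using B[OF that] by (elim bexE) (rule exI, simp only: P_def simp_thms)
  then have "\<forall>G\<in>B. \<exists>c. P G c" by (rule ballI)
  then obtain cc where "\<forall>G\<in>B. P G (cc G)" by (rule bchoice[THEN exE])
  then have cc: "cc G \<in> ?V \<rightarrow>\<^sub>E {..<K}"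
     "cut_le ?V (\<lambda>e. adj G e - block_avg ?V (cc G) (adj G) e) \<eta>"
     "free_energy H \<alpha> \<beta>1 \<beta>2 ?V (block_avg ?V (cc G) (adj G)) \<le> \<Lambda>" if "G \<in> B" for G
    using that by (simp_all only: P_def simp_thms)
  define \<tau> where "\<tau> G = (cc G, restrict (block_count ?V (cc G) G) (Pow {..<K}))" for G
  define T where "T = (?V \<rightarrow>\<^sub>E {..<K}) \<times> (Pow {..<K} \<rightarrow>\<^sub>E {..n\<^sup>2})"
  have finT: "finite T" by (auto simp: T_def intro!: finite_PiE)
  have cardT: "card T = K ^ n * (n\<^sup>2 + 1) ^ (2 ^ K)"
    by (simp add: T_def card_cartesian_product card_PiE card_Pow)
  have finB: "finite B" using sub finite_labeled_graphs finite_subset by blast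
  have \<tau>T: "\<tau> ` B \<subseteq> T"
  proof
    fix t assume "t \<in> \<tau> ` B"
    then obtain G where G: "G \<in> B" "t = \<tau> G" by auto
    have "block_count ?V (cc G) G L \<le> n\<^sup>2" for L
    proof -
      have "block_count ?V (cc G) G L \<le> card (?V \<times> ?V)"
        unfolding block_count_def by (rule card_mono) auto
      then show ?thesis by (simp add: power2_eq_square card_cartesian_product)
    qed
    then show "t \<in> T" using G cc(1) by (auto simp: T_def \<tau>_def)
  qed
  have fibre: "(\<Sum>G\<in>{G\<in>B. \<tau> G = t}. ergm_weight H \<alpha> \<beta>1 \<beta>2 n G) \<le> ?bound" for t
  proof (cases "{G\<in>B. \<tau> G = t} = {}")
    case True
    then show ?thesis by (simp only: sum.empty exp_ge_zero)
  next
    case False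
    define C where "C = {G\<in>B. \<tau> G = t}"
    obtain G0 where G0: "G0 \<in> C" using False C_def by auto
    define c where "c = cc G0"
    define w where "w = block_avg ?V c (adj G0)"
    have C: "G \<in> B" "G \<in> labeled_graphs n" "cc G = c" if "G \<in> C" for G
      using that G0 sub by (auto simp: C_def \<tau>_def c_def)
    have wC: "block_avg ?V c (adj G) {x, y} = w {x, y}" if G: "G \<in> C" and xy: "x \<in> ?V" "y \<in> ?V" for G x y
    proof -
      have L: "c ` {x, y} \<in> Pow {..<K}" using cc(1)[OF C(1)[OF G0]] xy unfolding c_def by auto
      have "snd (\<tau> G) (c ` {x, y}) = snd (\<tau> G0) (c ` {x, y})" using G G0 by (simp add: C_def)
      then have "block_count ?V c G (c ` {x, y}) = block_count ?V c G0 (c ` {x, y})"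
        using L C(3)[OF G] C(3)[OF G0] unfolding \<tau>_def by (simp only: snd_conv restrict_apply if_True)
      then show ?thesis unfolding w_def block_avg_count[OF V(1)] by simp
    qed
    have w01: "0 \<le> w e \<and> w e \<le> 1" for e
      unfolding w_def using block_avg_bounds[of ?V "adj G0"] adj_bounds by blast
    have fe: "free_energy H \<alpha> \<beta>1 \<beta>2 ?V w \<le> \<Lambda>" using cc(3)[OF C(1)[OF G0]] by (simp add: w_def c_def)
    let ?a = "\<beta>1 * avg2 ?V w + \<beta>2 * (wdens H ?V w powr \<alpha> + \<omega>)"
    have wt: "ergm_weight H \<alpha> \<beta>1 \<beta>2 n G \<le> exp (?N * ?a)" if G: "G \<in> C" for G
    proof -
      have 1: "avg2 ?V (adj G) = avg2 ?V w"
        using avg2_block_avg[OF V(1), of c "adj G"] avg2_cong[of ?V "block_avg ?V c (adj G)" w] wC[OF G] by simp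
      have "cut_le ?V (\<lambda>e. adj G e - w e) \<eta>"
        using cc(2)[OF C(1)[OF G]] C(3)[OF G] wC[OF G]
        by (subst cut_le_cong[where D' = "\<lambda>e. adj G e - block_avg ?V c (adj G) e"]) auto
      then have "\<bar>wdens H ?V (adj G) - wdens H ?V w\<bar> \<le> real (card (edges H)) * \<eta>"
        using adj_bounds[of G] w01 by (intro counting_lemma[OF H V]) auto
      moreover have "0 \<le> wdens H ?V (adj G)" "wdens H ?V (adj G) \<le> 1" "0 \<le> wdens H ?V w" "wdens H ?V w \<le> 1"
        using wdens_bounds[OF H, of ?V "adj G"] wdens_bounds[OF H, of ?V w] adj_bounds[of G] w01 by auto
      ultimately have "wdens H ?V (adj G) powr \<alpha> \<le> wdens H ?V w powr \<alpha> + \<omega>" by (intro modulus) auto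
      then show ?thesis
        unfolding ergm_weight_eq[OF H C(2)[OF G] n] 1 using \<beta>2
        by (intro iffD2[OF exp_le_cancel_iff] mult_left_mono add_left_mono) auto
    qed
    let ?h = "avg2 ?V (\<lambda>e. ent (w e))"
    have h: "0 \<le> ?h" "?h \<le> 1" using ent_bounds w01 by (auto intro!: avg2_nonneg avg2_le_1)
    have "(\<Sum>G\<in>C. ergm_weight H \<alpha> \<beta>1 \<beta>2 n G) \<le> (\<Sum>G\<in>C. exp (?N * ?a))" by (intro sum_mono wt)
    also have "\<dots> = real (card C) * exp (?N * ?a)" by simp
    also have "\<dots> \<le> exp ((real n)\<^sup>2 / 2 * ?h) * exp (?N * ?a)"
      using C(2) wC by (intro mult_right_mono card_block_class_le[where c = c]) auto
    also have "\<dots> = exp (?N * (?a + ?h) + real n / 2 * ?h)"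
      by (simp add: exp_add[symmetric] real_choose_2 algebra_simps)
    also have "\<dots> \<le> ?bound"
    proof -
      have "?N * (?a + ?h) \<le> ?N * (\<Lambda> + \<beta>2 * \<omega>)"
        using fe by (intro mult_left_mono) (auto simp: free_energy_def algebra_simps)
      moreover have "real n / 2 * ?h \<le> real n / 2 * 1" using h by (intro mult_left_mono) auto
      moreover have "real n / 2 * 1 \<le> real n" by simp
      ultimately show ?thesis by simp
    qed
    finally show ?thesis by (simp only: C_def)
  qed
  have "(\<Sum>G\<in>B. ergm_weight H \<alpha> \<beta>1 \<beta>2 n G) = (\<Sum>t\<in>T. \<Sum>G\<in>{G\<in>B. \<tau> G = t}. ergm_weight H \<alpha> \<beta>1 \<beta>2 n G)"
    by (rule sum.group[OF finB finT \<tau>T, symmetric])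
  also have "\<dots> \<le> (\<Sum>t\<in>T. ?bound)" by (intro sum_mono fibre)
  finally show ?thesis by (simp add: cardT)
qed

subsection \<open>Lower bound for the partition function\<close>

text \<open>The diagonal is set to zero, so that on the vertices 1, ..., n every value is either
  zero or, under the Bernoulli measure, a centred variable belonging to one pair.\<close>

definition centred :: "(nat set \<Rightarrow> real) \<Rightarrow> nat graph \<Rightarrow> nat set \<Rightarrow> real" where
  "centred p G e = (if card e = 2 then adj G e - p e else 0)"

lemma abs_centred_le:
  assumes "0 \<le> p e" "p e \<le> 1" shows "\<bar>centred p G e\<bar> \<le> 1"
  using assms by (simp add: centred_def adj_def)

text \<open>Pair each graph without e0 with the same graph plus e0. With q = \<open>p e0\<close> the
  two contributions carry (1 - q) (- q) and q (1 - q) and cancel, as R is blind to e0.\<close>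

lemma bernoulli_zero_mean:
  assumes e0: "e0 \<in> pairs n"
    and R: "\<And>E. E \<subseteq> pairs n - {e0} \<Longrightarrow> R ({1..n}, insert e0 E) = R ({1..n}, E)"
  shows "(\<Sum>G\<in>labeled_graphs n. bernoulli_weight n p G * ((adj G e0 - p e0) * R G)) = 0"
proof -
  define E' where "E' = pairs n - {e0}"
  have E': "pairs n = insert e0 E'" "e0 \<notin> E'" "finite E'" using e0 finite_pairs by (auto simp: E'_def)
  define f where "f E = bernoulli_weight n p ({1..n}, E) * ((adj ({1..n}, E) e0 - p e0) * R ({1..n}, E))" for E
  define b where "b E = (\<Prod>e\<in>E'. if e \<in> E then p e else 1 - p e)" for E
  have "(\<Sum>E\<in>Pow (pairs n). f E) = (\<Sum>E\<in>Pow E'. f E) + (\<Sum>E\<in>insert e0 ` Pow E'. f E)"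
    unfolding E'(1) Pow_insert by (rule sum.union_disjoint) (use E' in auto)
  also have "(\<Sum>E\<in>insert e0 ` Pow E'. f E) = (\<Sum>E\<in>Pow E'. f (insert e0 E))"
    by (subst sum.reindex) (use E'(2) in \<open>auto simp: inj_on_def\<close>)
  also have "(\<Sum>E\<in>Pow E'. f E) + (\<Sum>E\<in>Pow E'. f (insert e0 E)) = (\<Sum>E\<in>Pow E'. f E + f (insert e0 E))"
    by (rule sum.distrib[symmetric])
  also have "\<dots> = (\<Sum>E\<in>Pow E'. 0)"
  proof (rule sum.cong[OF refl])
    fix E assume E: "E \<in> Pow E'"
    have n0: "e0 \<notin> E" using E E'(2) by auto
    have b1: "bernoulli_weight n p ({1..n}, E) = (1 - p e0) * b E"
      unfolding bernoulli_weight_def b_def E'(1) using E' n0 by simp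
    have "(\<Prod>e\<in>E'. if e \<in> insert e0 E then p e else 1 - p e) = b E"
      unfolding b_def by (intro prod.cong refl) (use E'(2) in auto)
    then have b2: "bernoulli_weight n p ({1..n}, insert e0 E) = p e0 * b E"
      unfolding bernoulli_weight_def E'(1) using E' by simp
    have b3: "R ({1..n}, insert e0 E) = R ({1..n}, E)" using E by (intro R) (auto simp: E'_def)
    have a0: "adj ({1..n}, E) e0 = 0" "adj ({1..n}, insert e0 E) e0 = 1" using n0 by (simp_all add: adj_def)
    show "f E + f (insert e0 E) = 0" unfolding f_def b1 b2 b3 a0 by algebra
  qed
  finally show ?thesis unfolding sum_labeled_graphs f_def by simp
qed

text \<open>The trace of the fourth power of the symmetric matrix \<open>centred p G\<close>, a sum
  over closed walks of length four. It controls all rectangle sums at once, and its mean is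
  accessible through independence.\<close>

definition codegree_energy :: "nat \<Rightarrow> (nat set \<Rightarrow> real) \<Rightarrow> nat graph \<Rightarrow> real" where
  "codegree_energy n p G = (\<Sum>y\<in>{1..n}. \<Sum>y'\<in>{1..n}. (\<Sum>x\<in>{1..n}. centred p G {x, y} * centred p G {x, y'})\<^sup>2)"

text \<open>A closed walk through x, y, x', y' with \<open>y \<noteq> y'\<close>,
  \<open>x \<noteq> x'\<close> and \<open>x \<noteq> y'\<close> uses the pair {x, y} only once, so
  its mean vanishes. Each of the three coincidences leaves \<open>n ^ 3\<close> walks, and each walk
  contributes at most 1.\<close>

lemma bernoulli_codegree_energy:
  assumes p: "\<And>e. 0 \<le> p e \<and> p e \<le> 1"
  shows "(\<Sum>G\<in>labeled_graphs n. bernoulli_weight n p G * codegree_energy n p G) \<le> 3 * real n ^ 3"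
proof -
  let ?V = "{1..n}"
  let ?b = "bernoulli_weight n p"
  define t where "t G x x' y y' = centred p G {x, y} * (centred p G {x, y'} * centred p G {x', y} * centred p G {x', y'})"
    for G x x' y y'
  have b0: "0 \<le> ?b G" for G by (intro bernoulli_weight_nonneg p)
  have term_bd: "(\<Sum>G\<in>labeled_graphs n. ?b G * t G x x' y y') \<le> of_bool (y = y') + of_bool (x = x') + of_bool (x = y')"
    if xy: "x \<in> ?V" "y \<in> ?V" for x x' y y'
  proof (cases "y = y' \<or> x = x' \<or> x = y'")
    case True
    have "(\<Sum>G\<in>labeled_graphs n. ?b G * t G x x' y y') \<le> (\<Sum>G\<in>labeled_graphs n. ?b G * 1)"
    proof (intro sum_mono mult_left_mono b0)
      fix G
      have c1: "\<bar>centred p G e\<bar> \<le> 1" for e using abs_centred_le p by blast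
      have "\<bar>t G x x' y y'\<bar> \<le> 1 * (1 * 1 * 1)"
        unfolding t_def abs_mult by (intro mult_mono c1 mult_nonneg_nonneg) auto
      then show "t G x x' y y' \<le> 1" by simp
    qed
    also have "\<dots> = 1" using bernoulli_weight_sum by simp
    also have "(1::real) \<le> of_bool (y = y') + of_bool (x = x') + of_bool (x = y')" using True by auto
    finally show ?thesis .
  next
    case False
    have "(\<Sum>G\<in>labeled_graphs n. ?b G * t G x x' y y') = 0"
    proof (cases "x = y")
      case True
      then show ?thesis by (simp add: t_def centred_def)
    next
      case neq: False
      have e0: "{x, y} \<in> pairs n" using xy neq by (auto simp: pairs_def)
      have c2: "card {x, y} = 2" using neq by simp
      have "(\<Sum>G\<in>labeled_graphs n. ?b G * ((adj G {x, y} - p {x, y}) * (centred p G {x, y'} * centred p G {x', y} * centred p G {x', y'}))) = 0"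
      proof (rule bernoulli_zero_mean[OF e0])
        fix E assume "E \<subseteq> pairs n - {{x, y}}"
        have "{x, y'} \<noteq> {x, y}" "{x', y} \<noteq> {x, y}" "{x', y'} \<noteq> {x, y}"
          using False by (auto simp: doubleton_eq_iff)
        then show "centred p (?V, insert {x, y} E) {x, y'} * centred p (?V, insert {x, y} E) {x', y} * centred p (?V, insert {x, y} E) {x', y'}
          = centred p (?V, E) {x, y'} * centred p (?V, E) {x', y} * centred p (?V, E) {x', y'}"
          by (simp add: centred_def adj_def)
      qed
      then show ?thesis unfolding t_def by (simp add: centred_def[of p _ "{x, y}"] c2)
    qed
    then show ?thesis by simp
  qed
  have ce: "codegree_energy n p G = (\<Sum>y\<in>?V. \<Sum>y'\<in>?V. \<Sum>x\<in>?V. \<Sum>x'\<in>?V. t G x x' y y')" for G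
    unfolding codegree_energy_def power2_eq_square sum_product t_def by (simp only: mult.assoc)
  have "(\<Sum>G\<in>labeled_graphs n. ?b G * codegree_energy n p G)
    = (\<Sum>y\<in>?V. \<Sum>y'\<in>?V. \<Sum>x\<in>?V. \<Sum>x'\<in>?V. \<Sum>G\<in>labeled_graphs n. ?b G * t G x x' y y')"
    unfolding ce sum_distrib_left by (simp only: sum.swap[of _ ?V "labeled_graphs n"])
  also have "\<dots> \<le> (\<Sum>y\<in>?V. \<Sum>y'\<in>?V. \<Sum>x\<in>?V. \<Sum>x'\<in>?V. of_bool (y = y') + of_bool (x = x') + of_bool (x = y'))"
    by (intro sum_mono term_bd)
  also have "\<dots> = 3 * real n ^ 3"
    by (simp add: sum.distrib sum_distrib_left[symmetric] sum_distrib_right[symmetric] power3_eq_cube of_bool_def)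
  finally show ?thesis .
qed

text \<open>Cauchy-Schwarz twice: over x, after which S is enlarged to all vertices, and then over
  the pairs (y, y').\<close>

lemma rectangle_sum_le_codegree_energy:
  assumes S: "S \<subseteq> {1..n}" "T \<subseteq> {1..n}"
  shows "(\<Sum>x\<in>S. \<Sum>y\<in>T. centred p G {x, y}) ^ 4 \<le> real n ^ 4 * codegree_energy n p G"
proof -
  let ?V = "{1..n}"
  let ?a = "\<lambda>x y. centred p G {x, y}"
  have cS: "real (card S) \<le> n" "real (card T) \<le> n" using card_mono[OF _ S(1)] card_mono[OF _ S(2)] by auto
  define C where "C y y' = (\<Sum>x\<in>?V. ?a x y * ?a x y')" for y y'
  have "(\<Sum>x\<in>S. \<Sum>y\<in>T. ?a x y)\<^sup>2 \<le> (\<Sum>x\<in>S. (\<Sum>y\<in>T. ?a x y)\<^sup>2) * card S"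
    by (rule sum_squared_le_sum_of_squares)
  also have "\<dots> \<le> (\<Sum>x\<in>?V. (\<Sum>y\<in>T. ?a x y)\<^sup>2) * n"
    using S cS by (intro mult_mono sum_mono2) (auto simp: sum_nonneg)
  also have "(\<Sum>x\<in>?V. (\<Sum>y\<in>T. ?a x y)\<^sup>2) = (\<Sum>y\<in>T. \<Sum>y'\<in>T. C y y')"
    unfolding power2_eq_square sum_product C_def by (simp only: sum.swap[of _ ?V T])
  finally have 1: "(\<Sum>x\<in>S. \<Sum>y\<in>T. ?a x y)\<^sup>2 \<le> (\<Sum>y\<in>T. \<Sum>y'\<in>T. C y y') * n" .
  have "(\<Sum>y\<in>T. \<Sum>y'\<in>T. C y y')\<^sup>2 \<le> (\<Sum>y\<in>T. \<Sum>y'\<in>T. 1\<^sup>2) * (\<Sum>y\<in>T. \<Sum>y'\<in>T. (C y y')\<^sup>2)"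
    using sum2_Cauchy_Schwarz[of "\<lambda>y y'. 1" C T T] by simp
  also have "\<dots> \<le> (real n)\<^sup>2 * (\<Sum>y\<in>?V. \<Sum>y'\<in>?V. (C y y')\<^sup>2)"
  proof (rule mult_mono)
    show "(\<Sum>y\<in>T. \<Sum>y'\<in>T. 1\<^sup>2) \<le> (real n)\<^sup>2" using cS by (simp add: power2_eq_square mult_mono)
    show "(\<Sum>y\<in>T. \<Sum>y'\<in>T. (C y y')\<^sup>2) \<le> (\<Sum>y\<in>?V. \<Sum>y'\<in>?V. (C y y')\<^sup>2)"
      using S by (intro order_trans[OF sum_mono[OF sum_mono2] sum_mono2] sum_nonneg) auto
  qed (auto simp: sum_nonneg)
  finally have 2: "(\<Sum>y\<in>T. \<Sum>y'\<in>T. C y y')\<^sup>2 \<le> (real n)\<^sup>2 * codegree_energy n p G"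
    by (simp add: codegree_energy_def C_def)
  have "((\<Sum>x\<in>S. \<Sum>y\<in>T. ?a x y)\<^sup>2)\<^sup>2 \<le> ((\<Sum>y\<in>T. \<Sum>y'\<in>T. C y y') * n)\<^sup>2"
    by (rule power_mono[OF 1]) simp
  also have "\<dots> = (\<Sum>y\<in>T. \<Sum>y'\<in>T. C y y')\<^sup>2 * (real n)\<^sup>2" by (simp add: power_mult_distrib)
  also have "\<dots> \<le> (real n)\<^sup>2 * codegree_energy n p G * (real n)\<^sup>2" by (rule mult_right_mono[OF 2]) simp
  finally show ?thesis by (simp add: power2_eq_square power4_eq_xxxx mult_ac)
qed

text \<open>The fourth root of \<open>n ^ 4 * (6 * n ^ 3)\<close>, divided by
  \<open>n\<^sup>2\<close>. The 6 is twice the 3 that bounds the mean, so by Markov's inequality the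
  hypothesis holds with Bernoulli probability at least 1 / 2.\<close>

lemma cut_le_centred:
  assumes n: "n \<ge> 1" and "codegree_energy n p G \<le> 6 * real n ^ 3"
  shows "cut_le {1..n} (centred p G) (root 4 (6 / n))"
  unfolding cut_le_def
proof (intro allI impI)
  fix S T assume ST: "S \<subseteq> {1..n}" "T \<subseteq> {1..n}"
  let ?s = "\<Sum>x\<in>S. \<Sum>y\<in>T. centred p G {x, y}"
  have "\<bar>?s\<bar> ^ 4 = ?s ^ 4" by simp
  also have "\<dots> \<le> real n ^ 4 * (6 * real n ^ 3)"
    using rectangle_sum_le_codegree_energy[OF ST] assms(2) by (meson mult_left_mono order_trans zero_le_power of_nat_0_le_iff)
  also have "\<dots> = 6 / n * (real n)\<^sup>2 ^ 4" using n by (simp add: field_simps flip: power_mult power_add power_Suc)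
  also have "\<dots> = (root 4 (6 / n) * (real n)\<^sup>2) ^ 4" using n by (simp add: power_mult_distrib)
  finally have "\<bar>?s\<bar> \<le> root 4 (6 / n) * (real n)\<^sup>2"
    by (rule power_mono_iff[THEN iffD1, rotated 3]) auto
  then show "\<bar>?s\<bar> \<le> root 4 (6 / n) * (real (card {1..n}))\<^sup>2" by simp
qed

text \<open>A coefficient that depends on labels only splits the sum into \<open>k\<^sup>2\<close>
  rectangles, each controlled by the cut norm. The log-odds of a block-constant Bernoulli measure
  are such coefficients.\<close>

lemma block_sum_bound:
  fixes D \<mu> :: "nat set \<Rightarrow> real"
  assumes V: "finite V" and cut: "cut_le V D \<tau>" and c: "\<And>x. x \<in> V \<Longrightarrow> c x < k"
    and \<Lambda>: "\<And>L. \<bar>\<mu> L\<bar> \<le> \<Lambda>0"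
  shows "\<bar>\<Sum>x\<in>V. \<Sum>y\<in>V. D {x, y} * \<mu> (c ` {x, y})\<bar> \<le> (real k)\<^sup>2 * (\<Lambda>0 * (\<tau> * (real (card V))\<^sup>2))"
proof -
  let ?B = "\<lambda>i. {x \<in> V. c x = i}"
  have "0 \<le> \<Lambda>0" using \<Lambda>[of "{}"] by linarith
  have grp: "(\<Sum>x\<in>V. h x) = (\<Sum>i\<in>{..<k}. \<Sum>x\<in>?B i. h x)" for h :: "nat \<Rightarrow> real"
    by (rule sum.group[symmetric]) (use V c in auto)
  have "(\<Sum>x\<in>V. \<Sum>y\<in>V. D {x, y} * \<mu> (c ` {x, y}))
    = (\<Sum>i\<in>{..<k}. \<Sum>x\<in>?B i. \<Sum>j\<in>{..<k}. \<Sum>y\<in>?B j. D {x, y} * \<mu> (c ` {x, y}))"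
    by (simp only: grp)
  also have "\<dots> = (\<Sum>i\<in>{..<k}. \<Sum>j\<in>{..<k}. \<mu> {i, j} * (\<Sum>x\<in>?B i. \<Sum>y\<in>?B j. D {x, y}))"
  proof (rule sum.cong[OF refl])
    fix i
    have "(\<Sum>x\<in>?B i. \<Sum>j\<in>{..<k}. \<Sum>y\<in>?B j. D {x, y} * \<mu> (c ` {x, y}))
      = (\<Sum>j\<in>{..<k}. \<Sum>x\<in>?B i. \<Sum>y\<in>?B j. D {x, y} * \<mu> (c ` {x, y}))" by (rule sum.swap)
    also have "\<dots> = (\<Sum>j\<in>{..<k}. \<mu> {i, j} * (\<Sum>x\<in>?B i. \<Sum>y\<in>?B j. D {x, y}))"
      unfolding sum_distrib_left by (intro sum.cong refl) auto
    finally show "(\<Sum>x\<in>?B i. \<Sum>j\<in>{..<k}. \<Sum>y\<in>?B j. D {x, y} * \<mu> (c ` {x, y}))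
      = (\<Sum>j\<in>{..<k}. \<mu> {i, j} * (\<Sum>x\<in>?B i. \<Sum>y\<in>?B j. D {x, y}))" .
  qed
  also have "\<bar>\<dots>\<bar> \<le> (\<Sum>i\<in>{..<k}. \<Sum>j\<in>{..<k}. \<Lambda>0 * (\<tau> * (real (card V))\<^sup>2))"
  proof (rule order_trans[OF sum_abs], intro sum_mono, rule order_trans[OF sum_abs], intro sum_mono)
    fix i j
    show "\<bar>\<mu> {i, j} * (\<Sum>x\<in>?B i. \<Sum>y\<in>?B j. D {x, y})\<bar> \<le> \<Lambda>0 * (\<tau> * (real (card V))\<^sup>2)"
      unfolding abs_mult by (intro mult_mono \<Lambda> cut_leD[OF cut] \<open>0 \<le> \<Lambda>0\<close>) auto
  qed
  also have "\<dots> = (real k)\<^sup>2 * (\<Lambda>0 * (\<tau> * (real (card V))\<^sup>2))" by (simp add: power2_eq_square)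
  finally show ?thesis .
qed

section \<open>Moduli of continuity and the asymptotic bounds\<close>

text \<open>Uniform continuity on [0, 1] stands in for a Lipschitz bound, which fails at 0 when
  \<alpha> < 1.\<close>

lemma powr_modulus:
  fixes \<alpha> :: real
  assumes "\<alpha> > 0" "\<omega> > 0"
  obtains \<kappa> where "\<kappa> > 0"
    "\<And>s t. \<lbrakk>0 \<le> s; s \<le> 1; 0 \<le> t; t \<le> 1; \<bar>s - t\<bar> \<le> \<kappa>\<rbrakk> \<Longrightarrow> \<bar>s powr \<alpha> - t powr \<alpha>\<bar> \<le> \<omega>"
proof -
  have "continuous_on {0..1::real} (\<lambda>x. x powr \<alpha>)"
    using assms(1) by (intro continuous_on_powr' continuous_intros) auto
  then have "uniformly_continuous_on {0..1::real} (\<lambda>x. x powr \<alpha>)"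
    by (intro compact_uniformly_continuous) auto
  then obtain \<delta> where \<delta>: "\<delta> > 0"
    "\<And>s t. \<lbrakk>s \<in> {0..1}; t \<in> {0..1}; dist t s < \<delta>\<rbrakk> \<Longrightarrow> dist (t powr \<alpha>) (s powr \<alpha>) < \<omega>"
    unfolding uniformly_continuous_on_def using assms(2) by metis
  show ?thesis
  proof (rule that[of "\<delta> / 2"])
    fix s t :: real assume "0 \<le> s" "s \<le> 1" "0 \<le> t" "t \<le> 1" "\<bar>s - t\<bar> \<le> \<delta> / 2"
    then have "dist (s powr \<alpha>) (t powr \<alpha>) < \<omega>" using \<delta>(1) by (intro \<delta>(2)) (auto simp: dist_real_def)
    then show "\<bar>s powr \<alpha> - t powr \<alpha>\<bar> \<le> \<omega>" by (simp add: dist_real_def)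
  qed (use \<delta> in simp)
qed

lemma eventually_le_choose_2:
  fixes f :: "nat \<Rightarrow> real"
  assumes "(\<lambda>n. f n / ((real n)\<^sup>2 / 2 - real n / 2)) \<longlonglongrightarrow> 0" "\<zeta> > 0"
  shows "\<forall>\<^sub>F n in sequentially. f n \<le> real (n choose 2) * \<zeta>"
proof -
  have "\<forall>\<^sub>F n in sequentially. f n / ((real n)\<^sup>2 / 2 - real n / 2) < \<zeta>"
    by (rule order_tendstoD(2)[OF assms])
  moreover have "\<forall>\<^sub>F n in sequentially. 0 < (real n)\<^sup>2 / 2 - real n / 2" by real_asymp
  ultimately show ?thesis
  proof eventually_elim
    case (elim n)
    then show ?case by (simp add: real_choose_2 divide_less_eq mult.commute)
  qed
qed

text \<open>For fixed K the number of classes is \<open>exp (O (n ln n))\<close>. The order of the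
  quantifiers matters: the precision \<eta>0 is known before K, which weak regularity determines
  from the precision, and n0 serves all B and \<Lambda>.\<close>

lemma ergm_weight_sum_upper_asymptotic:
  fixes H :: "'v graph"
  assumes H: "simple_graph H" and \<beta>2: "\<beta>2 \<ge> 0" and \<alpha>: "\<alpha> > 0" and \<zeta>: "\<zeta> > 0"
  shows "\<exists>\<eta>0>0. \<forall>\<eta>\<ge>0. \<eta> \<le> \<eta>0 \<longrightarrow> (\<forall>K. \<exists>n0. \<forall>n\<ge>n0. \<forall>B\<subseteq>labeled_graphs n. \<forall>\<Lambda>.
      (\<forall>G\<in>B. \<exists>c \<in> {1..n} \<rightarrow>\<^sub>E {..<K}. 
        cut_le {1..n} (\<lambda>e. adj G e - block_avg {1..n} c (adj G) e) \<eta>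
        \<and> free_energy H \<alpha> \<beta>1 \<beta>2 {1..n} (block_avg {1..n} c (adj G)) \<le> \<Lambda>)
      \<longrightarrow> (\<Sum>G\<in>B. ergm_weight H \<alpha> \<beta>1 \<beta>2 n G) \<le> exp (real (n choose 2) * (\<Lambda> + \<zeta>)))"
proof -
  \<comment> \<open>One half of \<zeta> is for the modulus of continuity, the other for the number
    of classes; the \<open>+ 1\<close> covers \<beta>2 = 0.\<close>
  define \<omega> where "\<omega> = \<zeta> / (2 * (\<beta>2 + 1))"
  have \<omega>: "\<omega> > 0" "\<beta>2 * \<omega> \<le> \<zeta> / 2" using \<beta>2 \<zeta> by (auto simp: \<omega>_def field_simps)
  obtain \<kappa> where \<kappa>: "\<kappa> > 0"
    "\<And>s t. \<lbrakk>0 \<le> s; s \<le> 1; 0 \<le> t; t \<le> 1; \<bar>s - t\<bar> \<le> \<kappa>\<rbrakk> \<Longrightarrow> \<bar>s powr \<alpha> - t powr \<alpha>\<bar> \<le> \<omega>"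
    using powr_modulus[OF \<alpha> \<omega>(1)] by blast
  define \<eta>0 where "\<eta>0 = \<kappa> / (real (card (edges H)) + 1)"
  have \<eta>0: "\<eta>0 > 0" using \<kappa> by (simp add: \<eta>0_def add_nonneg_pos)
  have e\<eta>: "real (card (edges H)) * \<eta> \<le> \<kappa>" if "\<eta> \<le> \<eta>0" for \<eta>
  proof -
    have "real (card (edges H)) * \<eta> \<le> real (card (edges H)) * \<eta>0" using that by (intro mult_left_mono) auto
    also have "\<dots> \<le> (real (card (edges H)) + 1) * \<eta>0" using \<eta>0 by (intro mult_right_mono) auto
    also have "\<dots> = \<kappa>" by (simp add: \<eta>0_def add_nonneg_pos)
    finally show ?thesis .
  qed
  show ?thesis
  proof (rule exI[of _ \<eta>0], intro conjI allI impI \<eta>0)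
    fix \<eta> :: real and K :: nat
    assume \<eta>: "0 \<le> \<eta>" "\<eta> \<le> \<eta>0"
    define a where "a = ln (real K + 1)"
    define b where "b = real (2 ^ K)"
    have "(\<lambda>n. (real n * a + b * ln ((real n)\<^sup>2 + 1) + real n) / ((real n)\<^sup>2 / 2 - real n / 2)) \<longlonglongrightarrow> 0"
      by real_asymp
    then have "\<forall>\<^sub>F n in sequentially. real n * a + b * ln ((real n)\<^sup>2 + 1) + real n \<le> real (n choose 2) * (\<zeta> / 2)"
      by (rule eventually_le_choose_2) (use \<zeta> in simp)
    then obtain n0 where n0: "\<And>n. n \<ge> n0 \<Longrightarrow> real n * a + b * ln ((real n)\<^sup>2 + 1) + real n \<le> real (n choose 2) * (\<zeta> / 2)"
      unfolding eventually_sequentially by blast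
    show "\<exists>n0. \<forall>n\<ge>n0. \<forall>B\<subseteq>labeled_graphs n. \<forall>\<Lambda>.
      (\<forall>G\<in>B. \<exists>c \<in> {1..n} \<rightarrow>\<^sub>E {..<K}. 
        cut_le {1..n} (\<lambda>e. adj G e - block_avg {1..n} c (adj G) e) \<eta>
        \<and> free_energy H \<alpha> \<beta>1 \<beta>2 {1..n} (block_avg {1..n} c (adj G)) \<le> \<Lambda>)
      \<longrightarrow> (\<Sum>G\<in>B. ergm_weight H \<alpha> \<beta>1 \<beta>2 n G) \<le> exp (real (n choose 2) * (\<Lambda> + \<zeta>))"
    proof (rule exI[of _ "max n0 1"], intro allI impI)
      fix n B \<Lambda>
      let ?N = "real (n choose 2)"
      assume n: "max n0 1 \<le> n" and sub: "B \<subseteq> labeled_graphs n"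
        and B: "\<forall>G\<in>B. \<exists>c \<in> {1..n} \<rightarrow>\<^sub>E {..<K}. 
          cut_le {1..n} (\<lambda>e. adj G e - block_avg {1..n} c (adj G) e) \<eta>
          \<and> free_energy H \<alpha> \<beta>1 \<beta>2 {1..n} (block_avg {1..n} c (adj G)) \<le> \<Lambda>"
      have n1: "n \<ge> 1" using n by simp
      have "(\<Sum>G\<in>B. ergm_weight H \<alpha> \<beta>1 \<beta>2 n G)
        \<le> real (K ^ n * (n\<^sup>2 + 1) ^ (2 ^ K)) * exp (?N * (\<Lambda> + \<beta>2 * \<omega>) + n)"
      proof (rule ergm_weight_sum_upper[OF H n1 \<beta>2 sub])
        fix s t :: real assume "0 \<le> s" "s \<le> 1" "0 \<le> t" "t \<le> 1" "\<bar>s - t\<bar> \<le> real (card (edges H)) * \<eta>"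
        then have "\<bar>s powr \<alpha> - t powr \<alpha>\<bar> \<le> \<omega>" using e\<eta>[OF \<eta>(2)] by (intro \<kappa>(2)) auto
        then show "s powr \<alpha> \<le> t powr \<alpha> + \<omega>" by linarith
      qed (rule bspec[OF B])
      also have "\<dots> \<le> exp (real n * a + b * ln ((real n)\<^sup>2 + 1)) * exp (?N * (\<Lambda> + \<beta>2 * \<omega>) + n)"
      proof (rule mult_right_mono)
        have "real (K ^ n * (n\<^sup>2 + 1) ^ (2 ^ K)) \<le> (real K + 1) ^ n * ((real n)\<^sup>2 + 1) ^ (2 ^ K)"
          by (auto intro!: mult_mono power_mono simp: add.commute)
        also have "\<dots> = exp a ^ n * exp (ln ((real n)\<^sup>2 + 1)) ^ (2 ^ K)"
          unfolding a_def by (subst (1 2) exp_ln) (auto simp: add_nonneg_pos)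
        also have "\<dots> = exp (real n * a + b * ln ((real n)\<^sup>2 + 1))"
          unfolding exp_add exp_of_nat_mult[symmetric] b_def by simp
        finally show "real (K ^ n * (n\<^sup>2 + 1) ^ (2 ^ K)) \<le> exp (real n * a + b * ln ((real n)\<^sup>2 + 1))" .
      qed simp
      also have "\<dots> \<le> exp (?N * (\<Lambda> + \<zeta>))"
      proof -
        have "?N * (\<beta>2 * \<omega>) \<le> ?N * (\<zeta> / 2)" using \<omega> by (intro mult_left_mono) auto
        then show ?thesis using n0[of n] n unfolding exp_add[symmetric] by (simp add: algebra_simps)
      qed
      finally show "(\<Sum>G\<in>B. ergm_weight H \<alpha> \<beta>1 \<beta>2 n G) \<le> exp (?N * (\<Lambda> + \<zeta>))" .
    qed
  qed
qed

lemma exp_regroup: "exp (a + h - r - e) = exp (h - r - e) * exp (a::real)"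
  by (simp add: exp_add exp_diff)

text \<open>Change of measure: under a Bernoulli measure with block-constant edge probabilities, the
  graphs of small \<open>codegree_energy\<close> have mass at least 1 / 2. On them the weight of the
  model exceeds the Bernoulli weight by the exponential of \<open>n choose 2\<close> times the free
  energy, up to the stated errors. The margin \<rho> keeps the log-odds bounded.\<close>

lemma ergm_Z_lower:
  fixes H :: "'v graph" and P :: "nat set \<Rightarrow> real"
  assumes H: "simple_graph H" and n: "n \<ge> 1" and \<beta>2: "\<beta>2 \<ge> 0"
    and c: "\<And>x. x \<in> {1..n} \<Longrightarrow> c x < k"
    and \<rho>: "0 < \<rho>" and P: "\<And>L. \<rho> \<le> P L \<and> P L \<le> 1 - \<rho>"
    and \<tau>: "\<tau> = root 4 (6 / n) + 1 / n"
    and modulus: "\<And>s t. \<lbrakk>0 \<le> s; s \<le> 1; 0 \<le> t; t \<le> 1; \<bar>s - t\<bar> \<le> real (card (edges H)) * \<tau>\<rbrakk> \<Longrightarrow> s powr \<alpha> \<le> t powr \<alpha> + \<omega>"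
  shows "exp (real (n choose 2) * (free_energy H \<alpha> \<beta>1 \<beta>2 {1..n} (\<lambda>e. P (c ` e)) - \<bar>\<beta>1\<bar> * \<tau> - \<beta>2 * \<omega>)
      - ln 2 - n - (real k)\<^sup>2 * (- ln \<rho>) * \<tau> * (real n)\<^sup>2) \<le> ergm_Z H \<alpha> \<beta>1 \<beta>2 n"
proof -
  let ?V = "{1..n}" and ?N = "real (n choose 2)"
  have V: "finite ?V" "?V \<noteq> {}" using n by auto
  define p where "p e = P (c ` e)" for e
  have p: "\<rho> \<le> p e" "p e \<le> 1 - \<rho>" for e using P by (auto simp: p_def)
  have p01: "0 \<le> p e \<and> p e \<le> 1" for e using p[of e] \<rho> by linarith
  have p01': "0 < p e" "p e < 1" for e using p[of e] \<rho> by linarith+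
  have \<tau>0: "0 \<le> root 4 (6 / n)" "0 \<le> \<tau>" by (auto simp: \<tau>)
  define S where "S = {G \<in> labeled_graphs n. codegree_energy n p G \<le> 6 * real n ^ 3}"
  let ?b = "bernoulli_weight n p"
  have b0: "0 \<le> ?b G" for G by (intro bernoulli_weight_nonneg p01)
  have mass: "1 / 2 \<le> (\<Sum>G\<in>S. ?b G)"
  proof -
    let ?S' = "labeled_graphs n - S"
    have ce0: "0 \<le> codegree_energy n p G" for G by (simp add: codegree_energy_def sum_nonneg)
    have "6 * real n ^ 3 * (\<Sum>G\<in>?S'. ?b G) = (\<Sum>G\<in>?S'. ?b G * (6 * real n ^ 3))"
      by (subst mult.commute) (rule sum_distrib_right)
    also have "\<dots> \<le> (\<Sum>G\<in>?S'. ?b G * codegree_energy n p G)"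
      by (intro sum_mono mult_left_mono b0) (auto simp: S_def)
    also have "\<dots> \<le> (\<Sum>G\<in>labeled_graphs n. ?b G * codegree_energy n p G)"
      by (intro sum_mono2 finite_labeled_graphs mult_nonneg_nonneg b0 ce0) auto
    also have "\<dots> \<le> 3 * real n ^ 3" by (rule bernoulli_codegree_energy[OF p01])
    finally have "(\<Sum>G\<in>?S'. ?b G) \<le> 1 / 2" using n by (simp add: field_simps)
    moreover have "(\<Sum>G\<in>?S'. ?b G) + (\<Sum>G\<in>S. ?b G) = 1"
      using sum.subset_diff[of S "labeled_graphs n" ?b] bernoulli_weight_sum finite_labeled_graphs
      by (simp add: S_def)
    ultimately show ?thesis by linarith
  qed
  let ?h = "avg2 ?V (\<lambda>e. ent (p e))"
  let ?f = "\<beta>1 * avg2 ?V p + \<beta>2 * wdens H ?V p powr \<alpha>"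
  let ?A = "?N * (?f - \<bar>\<beta>1\<bar> * \<tau> - \<beta>2 * \<omega>)"
  let ?err = "(real k)\<^sup>2 * (- ln \<rho>) * \<tau> * (real n)\<^sup>2"
  have err0: "0 \<le> ?err"
  proof -
    have "ln \<rho> \<le> 0" using p[of "{}"] \<rho> by (intro ln_le_zero_iff[THEN iffD2]) auto
    then show ?thesis using \<tau>0 by (intro mult_nonneg_nonneg) auto
  qed
  have ent01: "0 \<le> ent (p e)" "ent (p e) \<le> 1" for e using ent_bounds p01 by auto
  have main: "?b G * exp (?A + (real n)\<^sup>2 / 2 * ?h - real n / 2 - ?err) \<le> ergm_weight H \<alpha> \<beta>1 \<beta>2 n G" if G: "G \<in> S" for G
  proof -
    have Gl: "G \<in> labeled_graphs n" using G by (simp add: S_def)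
    have nosing: "adj G {x} = 0" for x
      using labeled_graphsD(3)[OF Gl] singleton_notin_pairs[of x n] by (auto simp: adj_def)
    have cutc: "cut_le ?V (centred p G) (root 4 (6 / n))"
      using G by (intro cut_le_centred n) (simp add: S_def)
    have cut: "cut_le ?V (\<lambda>e. adj G e - p e) \<tau>"
    proof -
      \<comment> \<open>The diagonal values \<open>- p {x}\<close> are absent from
        \<open>centred\<close>. They concern n of the \<open>n\<^sup>2\<close> ordered pairs, hence
        the term 1 / n in \<tau>.\<close>
      define D where "D e = (if card e = 2 then 0 else - p e)" for e :: "nat set"
      have "cut_le ?V D (1 / n)"
      proof (rule cut_le_mono[OF cut_le_L1[OF V]])
        have "(\<Sum>x\<in>?V. \<Sum>y\<in>?V. \<bar>D {x, y}\<bar>) \<le> (\<Sum>x\<in>?V. \<Sum>y\<in>?V. of_bool (x = y))"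
          using p01 by (intro sum_mono) (auto simp: D_def)
        also have "\<dots> = real n" by (simp add: of_bool_def)
        finally show "avg2 ?V (\<lambda>e. \<bar>D e\<bar>) \<le> 1 / n"
          using n by (simp add: avg2_sum field_simps power2_eq_square)
      qed
      from cut_le_add[OF cutc this] show ?thesis
        unfolding \<tau> by (subst cut_le_cong) (auto simp: centred_def D_def nosing insert_absorb card_insert_if)
    qed
    have edges: "avg2 ?V p - \<tau> \<le> avg2 ?V (adj G)" "avg2 ?V (adj G) \<le> avg2 ?V p + \<tau>"
    proof -
      have "\<bar>avg2 ?V (\<lambda>e. adj G e - p e)\<bar> \<le> \<tau>"
        using cut_leD[OF cut order_refl order_refl] n by (simp add: avg2_sum divide_le_eq)
      then show "avg2 ?V p - \<tau> \<le> avg2 ?V (adj G)" "avg2 ?V (adj G) \<le> avg2 ?V p + \<tau>"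
        unfolding avg2_diff by linarith+
    qed
    have dens: "wdens H ?V p powr \<alpha> \<le> wdens H ?V (adj G) powr \<alpha> + \<omega>"
    proof -
      have "\<bar>wdens H ?V (adj G) - wdens H ?V p\<bar> \<le> real (card (edges H)) * \<tau>"
        using adj_bounds[of G] p01 by (intro counting_lemma[OF H V cut]) auto
      moreover have "0 \<le> wdens H ?V (adj G)" "wdens H ?V (adj G) \<le> 1" "0 \<le> wdens H ?V p" "wdens H ?V p \<le> 1"
        using wdens_bounds[OF H, of ?V "adj G"] wdens_bounds[OF H, of ?V p] adj_bounds[of G] p01 by auto
      ultimately show ?thesis by (intro modulus) auto
    qed
    have "exp ?A \<le> ergm_weight H \<alpha> \<beta>1 \<beta>2 n G"
      unfolding ergm_weight_eq[OF H Gl n]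
    proof (intro iffD2[OF exp_le_cancel_iff] mult_left_mono)
      have "\<beta>1 * avg2 ?V p - \<bar>\<beta>1\<bar> * \<tau> \<le> \<beta>1 * avg2 ?V (adj G)"
      proof -
        have "\<bar>\<beta>1 * (avg2 ?V p - avg2 ?V (adj G))\<bar> \<le> \<bar>\<beta>1\<bar> * \<tau>"
          unfolding abs_mult using edges by (intro mult_left_mono) auto
        then show ?thesis by (simp add: right_diff_distrib)
      qed
      moreover have "\<beta>2 * wdens H ?V p powr \<alpha> \<le> \<beta>2 * (wdens H ?V (adj G) powr \<alpha> + \<omega>)"
        using \<beta>2 dens by (intro mult_left_mono) auto
      ultimately show "?f - \<bar>\<beta>1\<bar> * \<tau> - \<beta>2 * \<omega> \<le> \<beta>1 * avg2 ?V (adj G) + \<beta>2 * wdens H ?V (adj G) powr \<alpha>"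
        by (simp add: distrib_left)
    qed simp
    moreover have "?b G * exp ((real n)\<^sup>2 / 2 * ?h - real n / 2 - ?err) \<le> 1"
    proof -
      \<comment> \<open>The log-odds: the log-likelihood of G is minus the total entropy plus the
        linear form in \<open>adj G - p\<close> with coefficients \<mu>. They depend on labels only,
        so \<open>block_sum_bound\<close> controls this form.\<close>
      define \<mu> where "\<mu> L = ln (P L) - ln (1 - P L)" for L
      have \<mu>: "\<bar>\<mu> L\<bar> \<le> - ln \<rho>" for L
      proof -
        have "ln \<rho> \<le> ln (P L)" "ln (P L) \<le> 0" "ln \<rho> \<le> ln (1 - P L)" "ln (1 - P L) \<le> 0"
          using P[of L] \<rho> by (auto intro!: ln_mono)
        then show ?thesis by (auto simp: \<mu>_def)
      qed
      have ps: "(\<Sum>e\<in>pairs n. \<phi> e) = (\<Sum>x\<in>?V. \<Sum>y\<in>?V. if x \<noteq> y then \<phi> {x, y} else 0) / 2" for \<phi> :: "nat set \<Rightarrow> real"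
        using sum_pairs[where n = n and \<phi> = \<phi>] by simp
      have e1: "(\<Sum>e\<in>pairs n. (adj G e - p e) * \<mu> (c ` e)) \<le> ?err"
      proof -
        have "(\<Sum>e\<in>pairs n. (adj G e - p e) * \<mu> (c ` e)) = (\<Sum>x\<in>?V. \<Sum>y\<in>?V. centred p G {x, y} * \<mu> (c ` {x, y})) / 2"
          unfolding ps by (intro arg_cong[of _ _ "\<lambda>z. z / 2"] sum.cong refl) (auto simp: centred_def)
        moreover have "\<bar>\<Sum>x\<in>?V. \<Sum>y\<in>?V. centred p G {x, y} * \<mu> (c ` {x, y})\<bar>
           \<le> (real k)\<^sup>2 * (- ln \<rho> * (\<tau> * (real (card ?V))\<^sup>2))"
          using cutc by (intro block_sum_bound[OF V(1) _ c \<mu>] cut_le_mono[OF cutc]) (auto simp: \<tau>)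
        ultimately show ?thesis using err0 by (simp add: mult.assoc)
      qed
      have e2: "(\<Sum>e\<in>pairs n. ent (p e)) \<ge> (real n)\<^sup>2 / 2 * ?h - real n / 2"
      proof -
        have "(\<Sum>x\<in>?V. \<Sum>y\<in>?V. ent (p {x, y})) \<le> (\<Sum>x\<in>?V. \<Sum>y\<in>?V. (if x \<noteq> y then ent (p {x, y}) else 0) + of_bool (x = y))"
          using ent01 by (intro sum_mono) auto
        also have "\<dots> = 2 * (\<Sum>e\<in>pairs n. ent (p e)) + n"
          using sum_pairs[where n = n and \<phi> = "\<lambda>e. ent (p e)"] by (simp add: sum.distrib of_bool_def)
        finally show ?thesis using n by (simp add: avg2_sum)
      qed
      have "?b G = exp (\<Sum>e\<in>pairs n. adj G e * ln (p e) + (1 - adj G e) * ln (1 - p e))"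
        using p01' by (intro bernoulli_weight_exp) auto
      also have "(\<Sum>e\<in>pairs n. adj G e * ln (p e) + (1 - adj G e) * ln (1 - p e))
        = (\<Sum>e\<in>pairs n. (adj G e - p e) * \<mu> (c ` e) - ent (p e))"
        by (intro sum.cong refl) (simp add: \<mu>_def p_def ent_def algebra_simps)
      finally have "?b G = exp ((\<Sum>e\<in>pairs n. (adj G e - p e) * \<mu> (c ` e)) - (\<Sum>e\<in>pairs n. ent (p e)))"
        by (simp add: sum_subtractf)
      then show ?thesis using e1 e2 by (simp add: exp_add[symmetric])
    qed
    ultimately have "?b G * exp ((real n)\<^sup>2 / 2 * ?h - real n / 2 - ?err) * exp ?A \<le> 1 * ergm_weight H \<alpha> \<beta>1 \<beta>2 n G"
      by (intro mult_mono) auto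
    moreover have "?b G * exp (?A + (real n)\<^sup>2 / 2 * ?h - real n / 2 - ?err)
      = ?b G * exp ((real n)\<^sup>2 / 2 * ?h - real n / 2 - ?err) * exp ?A"
      by (simp only: exp_regroup mult.assoc)
    ultimately show ?thesis by (simp only: mult_1)
  qed
  have h0: "0 \<le> ?h" using ent01 by (intro avg2_nonneg) auto
  have "exp (?N * (free_energy H \<alpha> \<beta>1 \<beta>2 ?V p - \<bar>\<beta>1\<bar> * \<tau> - \<beta>2 * \<omega>) - ln 2 - n - ?err)
    \<le> 1 / 2 * exp (?A + (real n)\<^sup>2 / 2 * ?h - real n / 2 - ?err)"
  proof -
    have "?N * (free_energy H \<alpha> \<beta>1 \<beta>2 ?V p - \<bar>\<beta>1\<bar> * \<tau> - \<beta>2 * \<omega>) = ?A + ?N * ?h"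
      by (simp add: free_energy_def algebra_simps)
    also have "?N * ?h \<le> (real n)\<^sup>2 / 2 * ?h" using h0 by (intro mult_right_mono) (simp add: real_choose_2)
    finally have "exp (?N * (free_energy H \<alpha> \<beta>1 \<beta>2 ?V p - \<bar>\<beta>1\<bar> * \<tau> - \<beta>2 * \<omega>) - ln 2 - n - ?err)
      \<le> exp (- ln 2 + (?A + (real n)\<^sup>2 / 2 * ?h - real n / 2 - ?err))" by simp
    also have "\<dots> = 1 / 2 * exp (?A + (real n)\<^sup>2 / 2 * ?h - real n / 2 - ?err)"
      unfolding exp_add[of "- ln 2"] by (simp add: exp_minus)
    finally show ?thesis .
  qed
  also have "\<dots> \<le> (\<Sum>G\<in>S. ?b G) * exp (?A + (real n)\<^sup>2 / 2 * ?h - real n / 2 - ?err)"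
    using mass by (intro mult_right_mono) auto
  also have "\<dots> = (\<Sum>G\<in>S. ?b G * exp (?A + (real n)\<^sup>2 / 2 * ?h - real n / 2 - ?err))"
    by (rule sum_distrib_right)
  also have "\<dots> \<le> (\<Sum>G\<in>S. ergm_weight H \<alpha> \<beta>1 \<beta>2 n G)" by (intro sum_mono main)
  also have "\<dots> \<le> ergm_Z H \<alpha> \<beta>1 \<beta>2 n"
    unfolding ergm_Z_def by (intro sum_mono2 finite_labeled_graphs) (auto simp: S_def ergm_weight_def)
  finally show ?thesis unfolding p_def .
qed

text \<open>Here n0 is uniform in the labelling and in the probabilities, because the vertex set
  planted for the symmetry breaking changes with n.\<close>

lemma ergm_Z_lower_asymptotic:
  fixes H :: "'v graph"
  assumes H: "simple_graph H" and \<beta>2: "\<beta>2 \<ge> 0" and \<alpha>: "\<alpha> > 0" and \<zeta>: "\<zeta> > 0" and \<rho>: "\<rho> > 0"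
  shows "\<exists>n0. \<forall>n\<ge>n0. \<forall>(c :: nat \<Rightarrow> nat) P. (\<forall>x\<in>{1..n}. c x < k) \<longrightarrow> (\<forall>L. \<rho> \<le> P L \<and> P L \<le> 1 - \<rho>)
     \<longrightarrow> exp (real (n choose 2) * (free_energy H \<alpha> \<beta>1 \<beta>2 {1..n} (\<lambda>e. P (c ` e)) - \<zeta>)) \<le> ergm_Z H \<alpha> \<beta>1 \<beta>2 n"
proof -
  define \<omega> where "\<omega> = \<zeta> / (2 * (\<beta>2 + 1))"
  have \<omega>: "\<omega> > 0" "\<beta>2 * \<omega> \<le> \<zeta> / 2" using \<beta>2 \<zeta> by (auto simp: \<omega>_def field_simps)
  obtain \<kappa> where \<kappa>: "\<kappa> > 0"
    "\<And>s t. \<lbrakk>0 \<le> s; s \<le> 1; 0 \<le> t; t \<le> 1; \<bar>s - t\<bar> \<le> \<kappa>\<rbrakk> \<Longrightarrow> \<bar>s powr \<alpha> - t powr \<alpha>\<bar> \<le> \<omega>"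
    using powr_modulus[OF \<alpha> \<omega>(1)] by blast
  define \<tau> where "\<tau> n = root 4 (6 / real n) + 1 / real n" for n
  define Q where "Q = (real k)\<^sup>2 * (- ln \<rho>)"
  have lim\<tau>: "\<tau> \<longlonglongrightarrow> 0" unfolding \<tau>_def by real_asymp
  have "(\<lambda>n. real (card (edges H)) * \<tau> n) \<longlonglongrightarrow> 0" using tendsto_mult_right_zero[OF lim\<tau>] by simp
  then have ev1: "\<forall>\<^sub>F n in sequentially. real (card (edges H)) * \<tau> n < \<kappa>"
    by (rule order_tendstoD) (rule \<kappa>(1))
  have "(\<lambda>n. (((real n)\<^sup>2 / 2 - real n / 2) * (\<bar>\<beta>1\<bar> * \<tau> n) + ln 2 + real n + Q * \<tau> n * (real n)\<^sup>2)
      / ((real n)\<^sup>2 / 2 - real n / 2)) \<longlonglongrightarrow> 0"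
    unfolding \<tau>_def by real_asymp
  from eventually_le_choose_2[OF this, of "\<zeta> / 2"]
  have ev2: "\<forall>\<^sub>F n in sequentially. real (n choose 2) * (\<bar>\<beta>1\<bar> * \<tau> n) + ln 2 + real n + Q * \<tau> n * (real n)\<^sup>2
      \<le> real (n choose 2) * (\<zeta> / 2)"
    using \<zeta> by (simp add: real_choose_2)
  obtain n0 where n0: "\<And>n. n \<ge> n0 \<Longrightarrow> n \<ge> 1 \<and> real (card (edges H)) * \<tau> n < \<kappa> \<and>
     real (n choose 2) * (\<bar>\<beta>1\<bar> * \<tau> n) + ln 2 + real n + Q * \<tau> n * (real n)\<^sup>2 \<le> real (n choose 2) * (\<zeta> / 2)"
    using eventually_conj[OF eventually_ge_at_top[of 1] eventually_conj[OF ev1 ev2]]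
    unfolding eventually_sequentially by blast
  show ?thesis
  proof (rule exI[of _ n0], intro allI impI)
    fix n and c :: "nat \<Rightarrow> nat" and P :: "nat set \<Rightarrow> real" assume n: "n0 \<le> n" and c: "\<forall>x\<in>{1..n}. c x < k" and P: "\<forall>L. \<rho> \<le> P L \<and> P L \<le> 1 - \<rho>"
    let ?N = "real (n choose 2)" and ?F = "free_energy H \<alpha> \<beta>1 \<beta>2 {1..n} (\<lambda>e. P (c ` e))"
    have "exp (?N * (?F - \<bar>\<beta>1\<bar> * \<tau> n - \<beta>2 * \<omega>) - ln 2 - n - (real k)\<^sup>2 * (- ln \<rho>) * \<tau> n * (real n)\<^sup>2) \<le> ergm_Z H \<alpha> \<beta>1 \<beta>2 n"
    proof (rule ergm_Z_lower[OF H _ \<beta>2 _ \<rho>])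
      show "n \<ge> 1" using n0[OF n] by simp
      show "c x < k" if "x \<in> {1..n}" for x using c that by blast
      show "\<rho> \<le> P L \<and> P L \<le> 1 - \<rho>" for L using P by blast
      show "\<tau> n = root 4 (6 / n) + 1 / n" by (simp add: \<tau>_def)
      fix s t :: real assume "0 \<le> s" "s \<le> 1" "0 \<le> t" "t \<le> 1" "\<bar>s - t\<bar> \<le> real (card (edges H)) * \<tau> n"
      then have "\<bar>s powr \<alpha> - t powr \<alpha>\<bar> \<le> \<omega>" using n0[OF n] by (intro \<kappa>(2)) auto
      then show "s powr \<alpha> \<le> t powr \<alpha> + \<omega>" by linarith
    qed
    moreover have "?N * (?F - \<zeta>) \<le> ?N * (?F - \<bar>\<beta>1\<bar> * \<tau> n - \<beta>2 * \<omega>) - ln 2 - n - (real k)\<^sup>2 * (- ln \<rho>) * \<tau> n * (real n)\<^sup>2"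
    proof -
      have "?N * (\<beta>2 * \<omega>) \<le> ?N * (\<zeta> / 2)" using \<omega> by (intro mult_left_mono) auto
      then show ?thesis using n0[OF n] unfolding Q_def[symmetric] by (simp add: algebra_simps)
    qed
    ultimately show "exp (?N * (?F - \<zeta>)) \<le> ergm_Z H \<alpha> \<beta>1 \<beta>2 n"
      by (meson exp_le_cancel_iff order_trans)
  qed
qed

subsection \<open>The one-variable problem\<close>

text \<open>For \<kappa> = \<beta>2 and \<gamma> = e(H) \<alpha> this is the free energy of the
  constant weight x. Coefficient and exponent are parameters because the linearised problem has
  exponent d and another coefficient.\<close>

definition ell :: "real \<Rightarrow> real \<Rightarrow> real \<Rightarrow> real \<Rightarrow> real" where
  "ell \<beta>1 \<kappa> \<gamma> x = \<beta>1 * x + ent x + \<kappa> * x powr \<gamma>"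

definition ell' :: "real \<Rightarrow> real \<Rightarrow> real \<Rightarrow> real \<Rightarrow> real" where
  "ell' \<beta>1 \<kappa> \<gamma> x = \<beta>1 + ln (1 - x) - ln x + \<kappa> * \<gamma> * x powr (\<gamma> - 1)"

definition is_maximizer :: "(real \<Rightarrow> real) \<Rightarrow> real \<Rightarrow> bool" where
  "is_maximizer f u \<longleftrightarrow> 0 < u \<and> u < 1 \<and> (\<forall>x\<in>{0..1}. f x \<le> f u)"

lemma is_maximizerD: "is_maximizer f u \<Longrightarrow> 0 \<le> x \<Longrightarrow> x \<le> 1 \<Longrightarrow> f x \<le> f u"
  by (simp add: is_maximizer_def)

lemma continuous_on_ent: "continuous_on {0..1} ent"
proof -
  have "continuous_on {0..} (\<lambda>x::real. x * ln x)"
    unfolding continuous_on_def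
  proof
    fix x :: real assume "x \<in> {0..}"
    show "((\<lambda>x. x * ln x) \<longlongrightarrow> x * ln x) (at x within {0..})"
    proof (cases "x = 0")
      case True
      have "((\<lambda>x::real. x * ln x) \<longlongrightarrow> 0) (at_right 0)" by real_asymp
      then show ?thesis using True by (simp add: at_within_Ici_at_right)
    next
      case False
      then show ?thesis by (intro tendsto_intros) auto
    qed
  qed
  then have 1: "continuous_on {0..1} (\<lambda>x::real. x * ln x)" by (rule continuous_on_subset) auto
  have 2: "continuous_on {0..1} (\<lambda>x::real. (1 - x) * ln (1 - x))"
    by (rule continuous_on_compose2[OF 1]) (auto intro!: continuous_intros)
  have "continuous_on {0..1} (\<lambda>x::real. - (x * ln x) - (1 - x) * ln (1 - x))"
    by (intro continuous_intros 1 2)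
  then show ?thesis by (simp add: ent_def[abs_def])
qed

lemma continuous_on_ell: "\<gamma> > 0 \<Longrightarrow> continuous_on {0..1} (ell \<beta>1 \<kappa> \<gamma>)"
  unfolding ell_def[abs_def]
  by (intro continuous_intros continuous_on_ent continuous_on_powr') auto

lemma DERIV_ell:
  assumes "0 < x" "x < 1"
  shows "(ell \<beta>1 \<kappa> \<gamma> has_real_derivative ell' \<beta>1 \<kappa> \<gamma> x) (at x)"
proof -
  have "((\<lambda>x. \<beta>1 * x + (- x * ln x - (1 - x) * ln (1 - x)) + \<kappa> * x powr \<gamma>) has_real_derivative ell' \<beta>1 \<kappa> \<gamma> x) (at x)"
    unfolding ell'_def using assms
    by (auto intro!: derivative_eq_intros)
  then show ?thesis by (simp add: ell_def[abs_def] ent_def)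
qed

text \<open>The entropy has slope plus infinity at 0 and minus infinity at 1, while the power term
  is increasing and has bounded slope near 1.\<close>

lemma ell_max_interior:
  assumes "\<gamma> > 0" "\<kappa> > 0" and u: "u \<in> {0..1}" "\<forall>x\<in>{0..1}. ell \<beta>1 \<kappa> \<gamma> x \<le> ell \<beta>1 \<kappa> \<gamma> u"
  shows "is_maximizer (ell \<beta>1 \<kappa> \<gamma>) u"
proof -
  let ?f = "ell \<beta>1 \<kappa> \<gamma>"
  have cont: "continuous_on {a..b} ?f" if "0 \<le> a" "b \<le> 1" for a b
    using continuous_on_ell[OF assms(1)] by (rule continuous_on_subset) (use that in auto)
  have "u \<noteq> 0"
  proof
    assume u0: "u = 0"
    have "filterlim (\<lambda>x. \<beta>1 + ln (1 - x) - ln x) at_top (at_right (0::real))" by real_asymp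
    then have "\<forall>\<^sub>F x in at_right 0. 0 < \<beta>1 + ln (1 - x) - ln x" unfolding filterlim_at_top_dense by (rule spec)
    then obtain b where b: "b > 0" "\<And>x. 0 < x \<Longrightarrow> x < b \<Longrightarrow> 0 < \<beta>1 + ln (1 - x) - ln x"
      unfolding eventually_at_right_field by blast
    define m where "m = min b 1"
    have m: "0 < m" "m \<le> 1" using b by (auto simp: m_def)
    have "?f 0 < ?f m"
    proof (rule DERIV_pos_imp_increasing_open[OF m(1)])
      fix x assume x: "0 < x" "x < m"
      have "ell' \<beta>1 \<kappa> \<gamma> x > 0"
        unfolding ell'_def using b(2)[of x] x assms by (intro add_pos_nonneg) (auto simp: m_def)
      then show "\<exists>y. (?f has_real_derivative y) (at x) \<and> 0 < y" using DERIV_ell[of x] x m by (intro exI[of _ "ell' \<beta>1 \<kappa> \<gamma> x"]) simp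
    qed (use cont m in auto)
    then show False using bspec[OF u(2), of m] u0 m by simp
  qed
  moreover have "u \<noteq> 1"
  proof
    assume u1: "u = 1"
    have "filterlim (\<lambda>x. \<beta>1 + ln (1 - x) - ln x + \<kappa> * \<gamma> * 2) at_bot (at_left (1::real))" by real_asymp
    then have "\<forall>\<^sub>F x in at_left 1. \<beta>1 + ln (1 - x) - ln x + \<kappa> * \<gamma> * 2 < 0" unfolding filterlim_at_bot_dense by (rule spec)
    then obtain b where b: "b < 1" "\<And>x. b < x \<Longrightarrow> x < 1 \<Longrightarrow> \<beta>1 + ln (1 - x) - ln x + \<kappa> * \<gamma> * 2 < 0"
      unfolding eventually_at_left_field by blast
    define m where "m = max b (1/2)"
    have m: "1/2 \<le> m" "m < 1" using b by (auto simp: m_def)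
    have "?f 1 < ?f m"
    proof (rule DERIV_neg_imp_decreasing_open[OF m(2)])
      fix x assume x: "m < x" "x < 1"
      \<comment> \<open>For \<gamma> < 1 this power exceeds 1; on [1 / 2, 1) it stays below 2,
        whatever \<gamma> is.\<close>
      have "x powr (\<gamma> - 1) = x powr \<gamma> / x" using x m by (simp add: powr_diff)
      also have "\<dots> \<le> 1 / x" using x m assms powr_mono2[of \<gamma> x 1] by (intro divide_right_mono) auto
      also have "\<dots> \<le> 2" using x m by (simp add: field_simps)
      finally have "\<kappa> * \<gamma> * x powr (\<gamma> - 1) \<le> \<kappa> * \<gamma> * 2" using assms by (intro mult_left_mono) auto
      then have "ell' \<beta>1 \<kappa> \<gamma> x < 0" unfolding ell'_def using b(2)[of x] x by (auto simp: m_def)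
      then show "\<exists>y. (?f has_real_derivative y) (at x) \<and> y < 0" using DERIV_ell[of x] x m by (intro exI[of _ "ell' \<beta>1 \<kappa> \<gamma> x"]) simp
    qed (use cont m in auto)
    then show False using bspec[OF u(2), of m] u1 m by simp
  qed
  ultimately show ?thesis using u unfolding is_maximizer_def by auto
qed

lemma ell_maximizer_exists:
  assumes "\<gamma> > 0" "\<kappa> > 0"
  shows "\<exists>u. is_maximizer (ell \<beta>1 \<kappa> \<gamma>) u"
proof -
  obtain u where u: "u \<in> {0..1}" "\<forall>x\<in>{0..1}. ell \<beta>1 \<kappa> \<gamma> x \<le> ell \<beta>1 \<kappa> \<gamma> u"
    using continuous_attains_sup[OF _ _ continuous_on_ell[OF assms(1)], of \<beta>1 \<kappa>] by auto
  then show ?thesis using ell_max_interior[OF assms] by blast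
qed

lemma maximizer_critical:
  assumes "is_maximizer (ell \<beta>1 \<kappa> \<gamma>) u"
  shows "ell' \<beta>1 \<kappa> \<gamma> u = 0"
proof -
  have u: "0 < u" "u < 1" "\<forall>x\<in>{0..1}. ell \<beta>1 \<kappa> \<gamma> x \<le> ell \<beta>1 \<kappa> \<gamma> u" using assms by (auto simp: is_maximizer_def)
  show ?thesis
    by (rule DERIV_local_max[OF DERIV_ell[OF u(1,2)], of "min u (1 - u)"]) (use u in \<open>auto simp: abs_if split: if_splits\<close>)
qed

text \<open>At a critical point \<open>x\<close> of \<open>ell \<beta>1 \<kappa> \<gamma>\<close> the coefficient is determined by \<open>x\<close>:
  \<open>\<kappa> * \<gamma> = crit_coeff \<beta>1 \<gamma> x\<close>. The monotonicity of this function is governed by the sign of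
  \<open>\<beta>1 - crit_threshold \<gamma> x\<close>.\<close>
definition crit_coeff :: "real \<Rightarrow> real \<Rightarrow> real \<Rightarrow> real" where
  "crit_coeff \<beta>1 \<gamma> x = (ln x - ln (1 - x) - \<beta>1) * x powr (1 - \<gamma>)"

definition crit_threshold :: "real \<Rightarrow> real \<Rightarrow> real" where
  "crit_threshold \<gamma> x = ln x - ln (1 - x) - 1 / ((\<gamma> - 1) * (1 - x))"

text \<open>The maximum point of \<open>crit_threshold \<gamma>\<close>; the value there is the
  bound on \<beta>1 in the theorem.\<close>

definition crit_point :: "real \<Rightarrow> real" where
  "crit_point \<gamma> = (\<gamma> - 1) / \<gamma>"

text \<open>The sign of the derivative is that of
  \<open>\<kappa> * \<gamma> - crit_coeff \<beta>1 \<gamma> x\<close>, so the shape of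
  \<open>ell\<close> can be read off from a function that does not involve \<kappa>.\<close>

lemma ell'_eq:
  assumes "0 < x"
  shows "ell' \<beta>1 \<kappa> \<gamma> x = x powr (\<gamma> - 1) * (\<kappa> * \<gamma> - crit_coeff \<beta>1 \<gamma> x)"
proof -
  have "x powr (\<gamma> - 1) * x powr (1 - \<gamma>) = 1" using assms by (simp add: powr_add[symmetric])
  then have "x powr (\<gamma> - 1) * crit_coeff \<beta>1 \<gamma> x = ln x - ln (1 - x) - \<beta>1"
    by (simp add: crit_coeff_def mult.left_commute)
  then show ?thesis by (simp add: ell'_def right_diff_distrib algebra_simps)
qed

lemma critical_iff:
  assumes "0 < x"
  shows "ell' \<beta>1 \<kappa> \<gamma> x = 0 \<longleftrightarrow> crit_coeff \<beta>1 \<gamma> x = \<kappa> * \<gamma>"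
  using assms by (auto simp: ell'_eq)

lemma DERIV_crit_coeff:
  assumes "0 < x" "x < 1" "\<gamma> > 1"
  shows "(crit_coeff \<beta>1 \<gamma> has_real_derivative ((\<gamma> - 1) * x powr (- \<gamma>) * (\<beta>1 - crit_threshold \<gamma> x))) (at x)"
proof -
  have 1: "(crit_coeff \<beta>1 \<gamma> has_real_derivative
     ((1 / x + 1 / (1 - x)) * x powr (1 - \<gamma>) + (ln x - ln (1 - x) - \<beta>1) * ((1 - \<gamma>) * x powr (1 - \<gamma> - 1)))) (at x)"
    unfolding crit_coeff_def[abs_def] using assms by (auto intro!: derivative_eq_intros simp: divide_simps)
  have 2: "x powr (1 - \<gamma>) = x * x powr (- \<gamma>)" using assms by (simp add: powr_diff powr_minus field_simps)
  have 3: "1 / x + 1 / (1 - x) = 1 / (x * (1 - x))" using assms by (simp add: field_simps)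
  have "(1 / x + 1 / (1 - x)) * x powr (1 - \<gamma>) + (ln x - ln (1 - x) - \<beta>1) * ((1 - \<gamma>) * x powr (1 - \<gamma> - 1))
     = x powr (- \<gamma>) * (1 / (1 - x) - (\<gamma> - 1) * (ln x - ln (1 - x) - \<beta>1))"
  proof -
    have 4: "1 / (x * (1 - x)) * (x * Y) = Y * (1 / (1 - x))" for Y using assms by simp
    have 5: "x powr (1 - \<gamma> - 1) = x powr (- \<gamma>)" by simp
    show ?thesis unfolding 2 3 4 5 by (simp only: right_diff_distrib left_diff_distrib mult_ac)
  qed
  also have "\<dots> = (\<gamma> - 1) * x powr (- \<gamma>) * (\<beta>1 - crit_threshold \<gamma> x)"
  proof -
    have 6: "1 / (1 - x) = (\<gamma> - 1) * (1 / ((\<gamma> - 1) * (1 - x)))" using assms by simp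
    show ?thesis unfolding crit_threshold_def by (subst 6) algebra
  qed
  finally show ?thesis using 1 by simp
qed

lemma crit_point_bounds: "\<gamma> > 1 \<Longrightarrow> 0 < crit_point \<gamma> \<and> crit_point \<gamma> < 1"
  by (simp add: crit_point_def)

lemma crit_threshold_crit_point:
  assumes "\<gamma> > 1"
  shows "crit_threshold \<gamma> (crit_point \<gamma>) = ln (\<gamma> - 1) - \<gamma> / (\<gamma> - 1)"
proof -
  have "1 - crit_point \<gamma> = 1 / \<gamma>" using assms by (simp add: crit_point_def field_simps)
  then show ?thesis using assms by (simp add: crit_threshold_def crit_point_def ln_div)
qed

lemma DERIV_crit_threshold:
  assumes "0 < x" "x < 1" "\<gamma> > 1"
  shows "(crit_threshold \<gamma> has_real_derivative (\<gamma> * (crit_point \<gamma> - x) / ((\<gamma> - 1) * x * (1 - x)\<^sup>2))) (at x)"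
proof -
  have 1: "(crit_threshold \<gamma> has_real_derivative (1 / x + 1 / (1 - x) - 1 / ((\<gamma> - 1) * (1 - x)\<^sup>2))) (at x)"
  proof -
    have "((\<lambda>x. inverse (1 - x)) has_real_derivative (inverse (1 - x))\<^sup>2) (at x)"
      using assms by (auto intro!: derivative_eq_intros simp: power2_eq_square)
    from DERIV_cmult[OF this, of "inverse (\<gamma> - 1)"]
    have d: "((\<lambda>x. 1 / ((\<gamma> - 1) * (1 - x))) has_real_derivative 1 / ((\<gamma> - 1) * (1 - x)\<^sup>2)) (at x)"
      by (simp add: divide_inverse power_inverse)
    have "((\<lambda>x. ln x - ln (1 - x)) has_real_derivative (1 / x + 1 / (1 - x))) (at x)"
      using assms by (auto intro!: derivative_eq_intros)
    from DERIV_diff[OF this d] show ?thesis by (simp add: crit_threshold_def[abs_def])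
  qed
  have "\<gamma> * (crit_point \<gamma> - x) = (\<gamma> - 1) * (1 - x) - x" using assms by (simp add: crit_point_def field_simps)
  moreover have "1 / x + 1 / (1 - x) - 1 / ((\<gamma> - 1) * (1 - x)\<^sup>2) = ((\<gamma> - 1) * (1 - x) - x) / ((\<gamma> - 1) * x * (1 - x)\<^sup>2)"
  proof -
    have "1 / x + 1 / (1 - x) = ((\<gamma> - 1) * (1 - x)) / ((\<gamma> - 1) * x * (1 - x)\<^sup>2)"
      using assms by (simp add: divide_simps power2_eq_square)
    moreover have "1 / ((\<gamma> - 1) * (1 - x)\<^sup>2) = x / ((\<gamma> - 1) * x * (1 - x)\<^sup>2)" using assms by simp
    ultimately show ?thesis by (simp add: diff_divide_distrib)
  qed
  ultimately show ?thesis using 1 by simp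
qed

lemma crit_threshold_less:
  assumes "0 < x" "x < 1" "\<gamma> > 1" "x \<noteq> crit_point \<gamma>"
  shows "crit_threshold \<gamma> x < crit_threshold \<gamma> (crit_point \<gamma>)"
proof -
  note cp = crit_point_bounds[OF assms(3)]
  have den: "0 < (\<gamma> - 1) * y * (1 - y)\<^sup>2" if "0 < y" "y < 1" for y using that assms by simp
  show ?thesis
  proof (cases "x < crit_point \<gamma>")
    case True
    show ?thesis
    proof (rule DERIV_pos_imp_increasing_open[OF True])
      fix y assume y: "x < y" "y < crit_point \<gamma>"
      then have "0 < \<gamma> * (crit_point \<gamma> - y) / ((\<gamma> - 1) * y * (1 - y)\<^sup>2)"
        using den[of y] assms cp by simp
      then show "\<exists>z. (crit_threshold \<gamma> has_real_derivative z) (at y) \<and> 0 < z"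
        using DERIV_crit_threshold[of y \<gamma>] y assms cp by (meson less_trans)
    next
      show "continuous_on {x..crit_point \<gamma>} (crit_threshold \<gamma>)"
        using assms cp by (intro continuous_at_imp_continuous_on ballI DERIV_isCont[OF DERIV_crit_threshold]) auto
    qed
  next
    case False
    then have "crit_point \<gamma> < x" using assms by simp
    then show ?thesis
    proof (rule DERIV_neg_imp_decreasing_open)
      fix y assume y: "crit_point \<gamma> < y" "y < x"
      then have "\<gamma> * (crit_point \<gamma> - y) / ((\<gamma> - 1) * y * (1 - y)\<^sup>2) < 0"
        using den[of y] assms cp by (intro divide_neg_pos mult_pos_neg) auto
      then show "\<exists>z. (crit_threshold \<gamma> has_real_derivative z) (at y) \<and> z < 0"
        using DERIV_crit_threshold[of y \<gamma>] y assms cp by (meson less_trans)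
    next
      show "continuous_on {crit_point \<gamma>..x} (crit_threshold \<gamma>)"
        using assms cp by (intro continuous_at_imp_continuous_on ballI DERIV_isCont[OF DERIV_crit_threshold]) auto
    qed
  qed
qed

section \<open>Number and position of the maximizers\<close>

text \<open>Critical points for the same \<kappa> lie in one level set of \<open>crit_coeff\<close>,
  so Rolle's theorem eliminates \<kappa>.\<close>

lemma critical_points_Rolle:
  assumes "0 < x" "x < y" "y < 1" "\<gamma> > 1" "ell' \<beta>1 \<kappa> \<gamma> x = 0" "ell' \<beta>1 \<kappa> \<gamma> y = 0"
  shows "\<exists>z. x < z \<and> z < y \<and> crit_threshold \<gamma> z = \<beta>1"
proof -
  have der: "(crit_coeff \<beta>1 \<gamma> has_real_derivative ((\<gamma> - 1) * z powr (- \<gamma>) * (\<beta>1 - crit_threshold \<gamma> z))) (at z)"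
    if "x \<le> z" "z \<le> y" for z using DERIV_crit_coeff[of z \<gamma> \<beta>1] that assms by simp
  have "\<exists>z. x < z \<and> z < y \<and> (\<gamma> - 1) * z powr (- \<gamma>) * (\<beta>1 - crit_threshold \<gamma> z) = 0"
  proof -
    have "crit_coeff \<beta>1 \<gamma> y - crit_coeff \<beta>1 \<gamma> x = 0"
      using assms critical_iff[of x \<beta>1 \<kappa> \<gamma>] critical_iff[of y \<beta>1 \<kappa> \<gamma>] by simp
    moreover obtain z where "x < z" "z < y" "crit_coeff \<beta>1 \<gamma> y - crit_coeff \<beta>1 \<gamma> x
       = (y - x) * ((\<gamma> - 1) * z powr (- \<gamma>) * (\<beta>1 - crit_threshold \<gamma> z))"
      using MVT2[OF assms(2) der] by blast
    ultimately show ?thesis using assms(2) by (intro exI[of _ z]) simp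
  qed
  then show ?thesis using assms by auto
qed

text \<open>In this range \<open>crit_coeff\<close> is nondecreasing, so equal values at x and y
  make the midpoint critical too. Rolle on both halves gives two points where
  \<open>crit_threshold\<close> equals \<beta>1; as \<beta>1 is at least its maximum, both would be
  \<open>crit_point\<close>. The midpoint serves the borderline case, where the derivative of
  \<open>crit_coeff\<close> does vanish once.\<close>

lemma critical_point_unique:
  assumes "0 < x" "x < y" "y < 1" "\<gamma> > 1" "ell' \<beta>1 \<kappa> \<gamma> x = 0" "ell' \<beta>1 \<kappa> \<gamma> y = 0"
    and \<beta>1: "\<beta>1 \<ge> ln (\<gamma> - 1) - \<gamma> / (\<gamma> - 1)"
  shows False
proof -
  have le: "crit_threshold \<gamma> z \<le> \<beta>1" if "0 < z" "z < 1" for z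
    using crit_threshold_less[of z \<gamma>] that assms(4) \<beta>1 crit_threshold_crit_point[OF assms(4)]
    by (cases "z = crit_point \<gamma>") auto
  have nonneg: "0 \<le> (\<gamma> - 1) * z powr (- \<gamma>) * (\<beta>1 - crit_threshold \<gamma> z)" if "0 < z" "z < 1" for z
    using le[OF that] assms(4) by simp
  have mono: "crit_coeff \<beta>1 \<gamma> a \<le> crit_coeff \<beta>1 \<gamma> b" if "x \<le> a" "a \<le> b" "b \<le> y" for a b
  proof (rule DERIV_nonneg_imp_nondecreasing[OF that(2)])
    fix z assume "a \<le> z" "z \<le> b"
    then have z: "0 < z" "z < 1" using that assms by auto
    show "\<exists>w. (crit_coeff \<beta>1 \<gamma> has_real_derivative w) (at z) \<and> 0 \<le> w"
      using DERIV_crit_coeff[OF z assms(4)] nonneg[OF z] by blast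
  qed
  define m where "m = (x + y) / 2"
  have m: "x < m" "m < y" using assms by (auto simp: m_def)
  have "crit_coeff \<beta>1 \<gamma> x = crit_coeff \<beta>1 \<gamma> y"
    using assms critical_iff[of x \<beta>1 \<kappa> \<gamma>] critical_iff[of y \<beta>1 \<kappa> \<gamma>] by simp
  then have "crit_coeff \<beta>1 \<gamma> m = crit_coeff \<beta>1 \<gamma> x" using mono[of x m] mono[of m y] m by simp
  then have "ell' \<beta>1 \<kappa> \<gamma> m = 0"
    using critical_iff[of m \<beta>1 \<kappa> \<gamma>] critical_iff[of x \<beta>1 \<kappa> \<gamma>] assms m by simp
  then obtain z1 z2 where z: "x < z1" "z1 < m" "crit_threshold \<gamma> z1 = \<beta>1" "m < z2" "z2 < y" "crit_threshold \<gamma> z2 = \<beta>1"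
    using critical_points_Rolle[of x m \<gamma> \<beta>1 \<kappa>] critical_points_Rolle[of m y \<gamma> \<beta>1 \<kappa>] assms m by auto
  then have "z1 < z2" by simp
  then consider "z1 \<noteq> crit_point \<gamma>" | "z2 \<noteq> crit_point \<gamma>" by force
  then show False
  proof cases
    case 1
    then show False using crit_threshold_less[of z1 \<gamma>] z assms m \<beta>1
      crit_threshold_crit_point[OF assms(4)] by simp
  next
    case 2
    then show False using crit_threshold_less[of z2 \<gamma>] z assms m \<beta>1
      crit_threshold_crit_point[OF assms(4)] by simp
  qed
qed

text \<open>Rolle for three functions: for \<open>ell\<close> between the maximizers, giving a third
  critical point; for \<open>crit_coeff\<close> on both sides of it, giving two points with equal
  \<open>crit_threshold\<close>; for \<open>crit_threshold\<close> between these, whose derivative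
  vanishes only at \<open>crit_point\<close>.\<close>

lemma two_maximizers_straddle:
  assumes "is_maximizer (ell \<beta>1 \<kappa> \<gamma>) x" "is_maximizer (ell \<beta>1 \<kappa> \<gamma>) y" "x < y" "\<gamma> > 1"
  shows "x < crit_point \<gamma>" "crit_point \<gamma> < y"
proof -
  have xy: "0 < x" "x < 1" "0 < y" "y < 1" "ell \<beta>1 \<kappa> \<gamma> x = ell \<beta>1 \<kappa> \<gamma> y"
    using assms(1,2) by (auto simp: is_maximizer_def intro!: antisym)
  have der: "(ell \<beta>1 \<kappa> \<gamma> has_real_derivative ell' \<beta>1 \<kappa> \<gamma> z) (at z)" if "x \<le> z" "z \<le> y" for z
    using DERIV_ell[of z] that xy by simp
  obtain w where w: "x < w" "w < y" "ell \<beta>1 \<kappa> \<gamma> y - ell \<beta>1 \<kappa> \<gamma> x = (y - x) * ell' \<beta>1 \<kappa> \<gamma> w"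
    using MVT2[OF assms(3) der] by blast
  then have w0: "ell' \<beta>1 \<kappa> \<gamma> w = 0" using xy assms(3) by simp
  obtain z1 z2 where z: "x < z1" "z1 < w" "crit_threshold \<gamma> z1 = \<beta>1" "w < z2" "z2 < y" "crit_threshold \<gamma> z2 = \<beta>1"
    using critical_points_Rolle[of x w \<gamma> \<beta>1 \<kappa>] critical_points_Rolle[of w y \<gamma> \<beta>1 \<kappa>]
      maximizer_critical[OF assms(1)] maximizer_critical[OF assms(2)] w w0 xy assms(4) by auto
  have z12: "z1 < z2" using z by simp
  have derT: "(crit_threshold \<gamma> has_real_derivative (\<gamma> * (crit_point \<gamma> - t) / ((\<gamma> - 1) * t * (1 - t)\<^sup>2))) (at t)"
    if "z1 \<le> t" "t \<le> z2" for t using that z w xy assms(4) by (intro DERIV_crit_threshold) auto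
  obtain t where t: "z1 < t" "t < z2" "crit_threshold \<gamma> z2 - crit_threshold \<gamma> z1
      = (z2 - z1) * (\<gamma> * (crit_point \<gamma> - t) / ((\<gamma> - 1) * t * (1 - t)\<^sup>2))"
    using MVT2[OF z12 derT] by blast
  then have "t = crit_point \<gamma>" using z z12 xy w assms(4) by auto
  then show "x < crit_point \<gamma>" "crit_point \<gamma> < y" using t z by auto
qed

lemma maximizer_unique:
  assumes "is_maximizer (ell \<beta>1 \<kappa> \<gamma>) x" "is_maximizer (ell \<beta>1 \<kappa> \<gamma>) y" "\<gamma> > 1"
    and "\<beta>1 \<ge> ln (\<gamma> - 1) - \<gamma> / (\<gamma> - 1)"
  shows "x = y"
proof (rule ccontr)
  have b: "0 < x" "x < 1" "0 < y" "y < 1" using assms(1,2) by (auto simp: is_maximizer_def)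
  assume "x \<noteq> y"
  then consider "x < y" | "y < x" by linarith
  then show False
    using critical_point_unique[of x y \<gamma> \<beta>1 \<kappa>] critical_point_unique[of y x \<gamma> \<beta>1 \<kappa>] b
      maximizer_critical[OF assms(1)] maximizer_critical[OF assms(2)] assms(3,4) by cases auto
qed

text \<open>Monotone comparative statics: when the two optimality inequalities are added, only the
  product of \<open>\<kappa>' - \<kappa>\<close> and
  \<open>x powr \<gamma> - y powr \<gamma>\<close> survives.\<close>

lemma maximizer_mono:
  assumes "is_maximizer (ell \<beta>1 \<kappa> \<gamma>) x" "is_maximizer (ell \<beta>1 \<kappa>' \<gamma>) y" "\<kappa> < \<kappa>'" "\<gamma> > 0"
  shows "x \<le> y"
proof (rule ccontr)
  assume "\<not> x \<le> y"
  have b: "0 < x" "x < 1" "0 < y" "y < 1" using assms(1,2) by (auto simp: is_maximizer_def)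
  then have "ell \<beta>1 \<kappa> \<gamma> y \<le> ell \<beta>1 \<kappa> \<gamma> x" "ell \<beta>1 \<kappa>' \<gamma> x \<le> ell \<beta>1 \<kappa>' \<gamma> y"
    using assms(1,2) by (auto simp: is_maximizer_def)
  then have "(\<kappa>' - \<kappa>) * (x powr \<gamma> - y powr \<gamma>) \<le> 0" by (simp add: ell_def algebra_simps)
  moreover have "y powr \<gamma> < x powr \<gamma>" using \<open>\<not> x \<le> y\<close> b assms(4) by (intro powr_less_mono2) auto
  ultimately show False using assms(3) by (simp add: mult_le_0_iff)
qed

definition two_phase :: "real \<Rightarrow> real \<Rightarrow> real \<Rightarrow> bool" where
  "two_phase \<beta>1 \<gamma> \<kappa> \<longleftrightarrow> \<kappa> > 0 \<and> (\<exists>x y. x < y \<and> is_maximizer (ell \<beta>1 \<kappa> \<gamma>) x \<and> is_maximizer (ell \<beta>1 \<kappa> \<gamma>) y)"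

text \<open>By monotonicity, the maximizers at the smaller coefficient do not exceed those at the
  larger one, yet both pairs straddle the same \<open>crit_point\<close>. This is why coexistence
  happens on a graph over \<beta>1.\<close>

lemma two_phase_unique:
  assumes "two_phase \<beta>1 \<gamma> \<kappa>" "two_phase \<beta>1 \<gamma> \<kappa>'" "\<gamma> > 1"
  shows "\<kappa> = \<kappa>'"
proof -
  have False if tp: "two_phase \<beta>1 \<gamma> \<kappa>" "two_phase \<beta>1 \<gamma> \<kappa>'" "\<kappa> < \<kappa>'" for \<kappa> \<kappa>'
  proof -
    obtain x y where xy: "x < y" "is_maximizer (ell \<beta>1 \<kappa> \<gamma>) x" "is_maximizer (ell \<beta>1 \<kappa> \<gamma>) y"
      using tp(1) by (auto simp: two_phase_def)
    obtain x' y' where xy': "x' < y'" "is_maximizer (ell \<beta>1 \<kappa>' \<gamma>) x'" "is_maximizer (ell \<beta>1 \<kappa>' \<gamma>) y'"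
      using tp(2) by (auto simp: two_phase_def)
    have "y \<le> x'" using maximizer_mono[OF xy(3) xy'(2) tp(3)] assms(3) by simp
    then show False
      using two_maximizers_straddle(2)[OF xy(2,3,1) assms(3)] two_maximizers_straddle(1)[OF xy'(2,3,1) assms(3)] by simp
  qed
  then show ?thesis using assms by (metis linorder_neqE_linordered_idom)
qed

text \<open>Of three maximizers, the middle one would lie on both sides of
  \<open>crit_point\<close>.\<close>

lemma maximizers_at_most_two:
  assumes "is_maximizer (ell \<beta>1 \<kappa> \<gamma>) x" "is_maximizer (ell \<beta>1 \<kappa> \<gamma>) y" "x < y" "\<gamma> > 1"
    and "is_maximizer (ell \<beta>1 \<kappa> \<gamma>) z"
  shows "z = x \<or> z = y"
proof (rule ccontr)
  assume "\<not> ?thesis"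
  then consider "z < x" | "x < z \<and> z < y" | "y < z" by linarith
  then show False
    using two_maximizers_straddle[OF assms(1,2,3,4)] two_maximizers_straddle[OF assms(5,1) _ assms(4)]
      two_maximizers_straddle[OF assms(1,5) _ assms(4)] two_maximizers_straddle[OF assms(2,5) _ assms(4)]
      two_maximizers_straddle[OF assms(5,2) _ assms(4)] by cases auto
qed

section \<open>Passing to another exponent\<close>

text \<open>This \<kappa> gives \<open>\<kappa> * x powr \<gamma>'\<close> and
  \<open>\<beta>2 * x powr \<gamma>\<close> the same derivative at u. Equivalently, it is the slope
  at \<open>u powr \<gamma>'\<close> of \<beta>2 times the power with exponent \<gamma> /
  \<gamma>'.\<close>

lemma rescaled_critical:
  assumes u: "0 < u" and "\<gamma>' > 0"
    and "\<kappa> = \<beta>2 * (\<gamma> / \<gamma>') * u powr (\<gamma> - \<gamma>')"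
  shows "ell' \<beta>1 \<kappa> \<gamma>' u = ell' \<beta>1 \<beta>2 \<gamma> u"
proof -
  have "u powr (\<gamma> - \<gamma>') * u powr (\<gamma>' - 1) = u powr (\<gamma> - 1)" by (simp add: powr_add[symmetric])
  then have "\<kappa> * \<gamma>' * u powr (\<gamma>' - 1) = \<beta>2 * \<gamma> * u powr (\<gamma> - 1)"
    using assms by (simp add: mult.assoc)
  then show ?thesis by (simp add: ell'_def)
qed

text \<open>u is critical for the new problem, and in this range of \<beta>1 critical points are
  unique, so the maximizer, which is critical too, must be u.\<close>

lemma rescaled_maximizer:
  assumes u: "is_maximizer (ell \<beta>1 \<beta>2 \<gamma>) u" and "\<gamma> > 0" "\<gamma>' > 1" "\<beta>2 > 0"
    and \<kappa>: "\<kappa> = \<beta>2 * (\<gamma> / \<gamma>') * u powr (\<gamma> - \<gamma>')"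
    and \<beta>1: "\<beta>1 \<ge> ln (\<gamma>' - 1) - \<gamma>' / (\<gamma>' - 1)"
  shows "is_maximizer (ell \<beta>1 \<kappa> \<gamma>') u"
proof -
  have u01: "0 < u" "u < 1" using u by (auto simp: is_maximizer_def)
  have "\<kappa> > 0" using assms u01 by simp
  then obtain v where v: "is_maximizer (ell \<beta>1 \<kappa> \<gamma>') v"
    using ell_maximizer_exists[of \<gamma>' \<kappa> \<beta>1] assms(3) by auto
  have v01: "0 < v" "v < 1" using v by (auto simp: is_maximizer_def)
  have cu: "ell' \<beta>1 \<kappa> \<gamma>' u = 0"
    using rescaled_critical[of u \<gamma>' \<kappa> \<beta>2 \<gamma> \<beta>1] maximizer_critical[OF u] assms u01 by simp
  have "u = v"
  proof (rule ccontr)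
    assume "u \<noteq> v"
    then consider "u < v" | "v < u" by linarith
    then show False
      using critical_point_unique[of u v \<gamma>' \<beta>1 \<kappa>] critical_point_unique[of v u \<gamma>' \<beta>1 \<kappa>]
        maximizer_critical[OF v] cu u01 v01 assms(3) \<beta>1 by cases auto
  qed
  then show ?thesis using v by simp
qed

text \<open>Around \<open>crit_point\<close> the function \<open>crit_coeff\<close> is now strictly
  decreasing, so a critical point there is a local minimum of \<open>ell\<close>. The width \<delta>
  does not depend on \<kappa>; this uniform gap is what opens the interval of \<beta>2 in
  (c).\<close>

lemma maximizers_avoid_crit_point:
  assumes \<gamma>: "\<gamma> > 1" and \<beta>1: "\<beta>1 < ln (\<gamma> - 1) - \<gamma> / (\<gamma> - 1)"
  obtains \<delta> where "0 < \<delta>" "\<delta> < crit_point \<gamma>" "\<delta> < 1 - crit_point \<gamma>"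
    "\<And>\<kappa> u. is_maximizer (ell \<beta>1 \<kappa> \<gamma>) u \<Longrightarrow> u \<le> crit_point \<gamma> - \<delta> \<or> crit_point \<gamma> + \<delta> \<le> u"
proof -
  let ?c = "crit_point \<gamma>"
  note cp = crit_point_bounds[OF \<gamma>]
  have "isCont (crit_threshold \<gamma>) ?c"
    using cp \<gamma> by (intro DERIV_isCont[OF DERIV_crit_threshold]) auto
  then have "(crit_threshold \<gamma> \<longlongrightarrow> crit_threshold \<gamma> ?c) (at ?c)" by (simp add: isCont_def)
  then have "\<forall>\<^sub>F x in at ?c. \<beta>1 < crit_threshold \<gamma> x"
    by (rule order_tendstoD(1)) (use \<beta>1 crit_threshold_crit_point[OF \<gamma>] in simp)
  then obtain \<epsilon> where \<epsilon>: "\<epsilon> > 0" "\<And>x. x \<noteq> ?c \<Longrightarrow> dist x ?c < \<epsilon> \<Longrightarrow> \<beta>1 < crit_threshold \<gamma> x"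
    unfolding eventually_at by blast
  have thr: "\<beta>1 < crit_threshold \<gamma> x" if "\<bar>x - ?c\<bar> < \<epsilon>" for x
    using \<epsilon>(2)[of x] that \<beta>1 crit_threshold_crit_point[OF \<gamma>] by (cases "x = ?c") (auto simp: dist_real_def)
  define \<delta> where "\<delta> = min (\<epsilon> / 2) (min (?c / 2) ((1 - ?c) / 2))"
  have \<delta>: "0 < \<delta>" "\<delta> < \<epsilon>" "\<delta> < ?c" "\<delta> < 1 - ?c"
    using \<epsilon>(1) cp unfolding \<delta>_def by (simp_all add: min_less_iff_disj)
  show ?thesis
  proof (rule that[OF \<delta>(1,3,4)])
    fix \<kappa> u assume u: "is_maximizer (ell \<beta>1 \<kappa> \<gamma>) u"
    show "u \<le> ?c - \<delta> \<or> ?c + \<delta> \<le> u"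
    proof (rule ccontr)
      assume "\<not> ?thesis"
      then have near: "?c - \<delta> < u" "u < ?c + \<delta>" by auto
      let ?b = "?c + \<delta>"
      have cu: "crit_coeff \<beta>1 \<gamma> u = \<kappa> * \<gamma>"
        using maximizer_critical[OF u] critical_iff[of u \<beta>1 \<kappa> \<gamma>] u by (simp add: is_maximizer_def)
      have inc: "ell \<beta>1 \<kappa> \<gamma> u < ell \<beta>1 \<kappa> \<gamma> ?b"
      proof (rule DERIV_pos_imp_increasing_open[OF near(2)])
        fix x assume x: "u < x" "x < ?b"
        have x01: "0 < x" "x < 1" using x near \<delta> by auto
        have "crit_coeff \<beta>1 \<gamma> x < crit_coeff \<beta>1 \<gamma> u"
        proof (rule DERIV_neg_imp_decreasing[OF x(1)])
          fix z assume z: "u \<le> z" "z \<le> x"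
          have z01: "0 < z" "z < 1" using z x near \<delta> by auto
          have "\<bar>z - ?c\<bar> < \<epsilon>" using z x near \<delta> by auto
          then have "(\<gamma> - 1) * z powr (- \<gamma>) * (\<beta>1 - crit_threshold \<gamma> z) < 0"
            using thr[of z] \<gamma> z01 by (intro mult_pos_neg) auto
          then show "\<exists>w. (crit_coeff \<beta>1 \<gamma> has_real_derivative w) (at z) \<and> w < 0"
            using DERIV_crit_coeff[OF z01 \<gamma>] by blast
        qed
        then have "0 < ell' \<beta>1 \<kappa> \<gamma> x" using x01 cu by (simp add: ell'_eq)
        then show "\<exists>y. (ell \<beta>1 \<kappa> \<gamma> has_real_derivative y) (at x) \<and> 0 < y" using DERIV_ell[OF x01] by blast
      next
        show "continuous_on {u..?b} (ell \<beta>1 \<kappa> \<gamma>)"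
          using near \<delta> by (intro continuous_at_imp_continuous_on ballI DERIV_isCont[OF DERIV_ell]) auto
      qed
      moreover have "?b \<in> {0..1}" using \<delta> cp by auto
      ultimately show False using u by (auto simp: is_maximizer_def not_less[symmetric])
    qed
  qed
qed

text \<open>For \<kappa> = 0 the derivative is \<beta>1 minus the log-odds of x, and \<beta>1 lies
  below ln (\<gamma> - 1), the log-odds of \<open>crit_point\<close>.\<close>

lemma ell_0_decreasing_above_crit_point:
  assumes \<gamma>: "\<gamma> > 1" and \<beta>1: "\<beta>1 < ln (\<gamma> - 1) - \<gamma> / (\<gamma> - 1)" and x: "crit_point \<gamma> \<le> x" "x < 1"
  shows "ell' \<beta>1 0 1 x < 0"
proof -
  note cp = crit_point_bounds[OF \<gamma>]
  have "ln (\<gamma> - 1) = ln (crit_point \<gamma>) - ln (1 - crit_point \<gamma>)"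
  proof -
    have "1 - crit_point \<gamma> = 1 / \<gamma>" using \<gamma> by (simp add: crit_point_def field_simps)
    then show ?thesis using \<gamma> by (simp add: crit_point_def ln_div)
  qed
  also have "\<dots> \<le> ln x - ln (1 - x)"
  proof -
    have "ln (crit_point \<gamma>) \<le> ln x" "ln (1 - x) \<le> ln (1 - crit_point \<gamma>)" using x cp by (auto intro!: ln_mono)
    then show ?thesis by linarith
  qed
  moreover have "\<gamma> / (\<gamma> - 1) > 0" using \<gamma> by simp
  ultimately show ?thesis using \<beta>1 by (simp add: ell'_def)
qed

text \<open>For \<open>\<beta>2\<close> in the interval produced here, the maximizer \<open>u\<close> of \<open>ell \<beta>1 \<beta>2 \<gamma>\<close> is a critical
  point but not a maximizer of \<open>ell \<beta>1 \<kappa> \<gamma>'\<close>: the maximizers of the latter family jump across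
  \<open>crit_point \<gamma>'\<close> as \<open>\<kappa>\<close> grows, and \<open>\<beta>2\<close> is a strictly increasing function of \<open>\<kappa>\<close> and \<open>u\<close>.\<close>
lemma symmetry_breaking_interval:
  assumes \<gamma>: "0 < \<gamma>" "\<gamma> < \<gamma>'" "\<gamma>' > 1" and \<beta>1: "\<beta>1 < ln (\<gamma>' - 1) - \<gamma>' / (\<gamma>' - 1)"
  obtains a b where "0 \<le> a" "a < b"
    "\<And>\<beta>2. a < \<beta>2 \<Longrightarrow> \<beta>2 < b \<Longrightarrow> \<exists>u r. is_maximizer (ell \<beta>1 \<beta>2 \<gamma>) u \<and> 0 < r \<and> r < 1 \<and>
       ell \<beta>1 (\<beta>2 * (\<gamma> / \<gamma>') * u powr (\<gamma> - \<gamma>')) \<gamma>' u < ell \<beta>1 (\<beta>2 * (\<gamma> / \<gamma>') * u powr (\<gamma> - \<gamma>')) \<gamma>' r"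
proof -
  let ?c = "crit_point \<gamma>'"
  note cp = crit_point_bounds[OF \<gamma>(3)]
  have \<gamma>'0: "\<gamma>' > 0" using \<gamma> by simp
  obtain \<delta> where \<delta>: "0 < \<delta>" "\<delta> < ?c" "\<delta> < 1 - ?c"
    "\<And>\<kappa> u. is_maximizer (ell \<beta>1 \<kappa> \<gamma>') u \<Longrightarrow> u \<le> ?c - \<delta> \<or> ?c + \<delta> \<le> u"
    using maximizers_avoid_crit_point[OF \<gamma>(3) \<beta>1] by blast
  \<comment> \<open>The coefficients that admit a maximizer in the left phase. The supremum of S is
    where the maximizers jump; whether it belongs to S does not have to be decided.\<close>
  define S where "S = {\<kappa>. \<kappa> > 0 \<and> (\<exists>u. is_maximizer (ell \<beta>1 \<kappa> \<gamma>') u \<and> u < ?c)}"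
  let ?\<psi> = "ell \<beta>1 0 1"
  have ell_\<psi>: "ell \<beta>1 \<kappa> \<gamma>' x = ?\<psi> x + \<kappa> * x powr \<gamma>'" for \<kappa> x by (simp add: ell_def)
  have "S \<noteq> {}"
  proof -
    have dc: "(?\<psi> has_real_derivative ell' \<beta>1 0 1 ?c) (at ?c)" using cp by (intro DERIV_ell) auto
    have "ell' \<beta>1 0 1 ?c < 0" using cp by (intro ell_0_decreasing_above_crit_point[OF \<gamma>(3) \<beta>1]) auto
    from DERIV_neg_dec_left[OF dc this] obtain \<epsilon> where
      \<epsilon>: "\<epsilon> > 0" "\<forall>h>0. h < \<epsilon> \<longrightarrow> ?\<psi> ?c < ?\<psi> (?c - h)" by (elim exE conjE) (rule that)
    define v where "v = ?c - min (\<epsilon> / 2) (?c / 2)"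
    have v: "0 < v" "v < ?c" "?\<psi> ?c < ?\<psi> v"
    proof -
      have h: "0 < min (\<epsilon> / 2) (?c / 2)" "min (\<epsilon> / 2) (?c / 2) < \<epsilon>" "min (\<epsilon> / 2) (?c / 2) < ?c"
        using \<epsilon>(1) cp by (simp_all add: min_less_iff_disj)
      then show "0 < v" "v < ?c" "?\<psi> ?c < ?\<psi> v" using \<epsilon>(2) unfolding v_def by simp_all
    qed
    \<comment> \<open>Half the advantage of v over \<open>crit_point\<close>: as
      \<open>u powr \<gamma>' \<le> 1\<close>, the power term cannot make up for it at any u on the
      right.\<close>
    define \<kappa> where "\<kappa> = (?\<psi> v - ?\<psi> ?c) / 2"
    have \<kappa>: "\<kappa> > 0" using v by (simp add: \<kappa>_def)
    obtain u where u: "is_maximizer (ell \<beta>1 \<kappa> \<gamma>') u" using ell_maximizer_exists[OF \<gamma>'0 \<kappa>] by blast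
    have "u < ?c"
    proof (rule ccontr)
      assume "\<not> u < ?c"
      then have uc: "?c \<le> u" "u < 1" using u by (auto simp: is_maximizer_def)
      have "?\<psi> u \<le> ?\<psi> ?c"
      proof (rule DERIV_nonpos_imp_nonincreasing[OF uc(1)])
        fix x assume x: "?c \<le> x" "x \<le> u"
        then have "0 < x" "x < 1" using uc cp by auto
        then show "\<exists>y. (?\<psi> has_real_derivative y) (at x) \<and> y \<le> 0"
          using DERIV_ell[of x \<beta>1 0 1] ell_0_decreasing_above_crit_point[OF \<gamma>(3) \<beta>1 x(1)] less_imp_le by blast
      qed
      moreover have "u powr \<gamma>' \<le> 1" using powr_mono2[of \<gamma>' u 1] uc cp \<gamma>'0 by simp
      then have "\<kappa> * u powr \<gamma>' \<le> \<kappa>" using \<kappa> by (simp add: mult_left_le)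
      moreover have "?\<psi> v + \<kappa> * v powr \<gamma>' \<le> ?\<psi> u + \<kappa> * u powr \<gamma>'"
        using u v cp unfolding is_maximizer_def ell_\<psi> by simp
      moreover have "0 \<le> \<kappa> * v powr \<gamma>'" using \<kappa> by simp
      ultimately show False using \<kappa> by (simp add: \<kappa>_def)
    qed
    then show ?thesis using u \<kappa> by (auto simp: S_def)
  qed
  \<comment> \<open>Comparison with the point 1: there the power term is worth \<kappa>, but to the
    left of \<open>crit_point\<close> only a fixed fraction of it, so a large \<kappa> leaves no
    maximizer on the left.\<close>
  moreover have "bdd_above S"
  proof (rule bdd_aboveI)
    fix \<kappa> assume "\<kappa> \<in> S"
    then obtain u where u: "\<kappa> > 0" "is_maximizer (ell \<beta>1 \<kappa> \<gamma>') u" "u < ?c" by (auto simp: S_def)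
    have u0: "0 < u" using u by (simp add: is_maximizer_def)
    have "\<beta>1 * 1 + ent 1 + \<kappa> * 1 powr \<gamma>' \<le> \<beta>1 * u + ent u + \<kappa> * u powr \<gamma>'"
    proof -
      show ?thesis using is_maximizerD[OF u(2), of 1] by (simp add: ell_def)
    qed
    moreover have "ent u \<le> 1" "ent 1 = 0" using ent_bounds[of u] u0 u cp by (auto simp: ent_def)
    moreover have "\<beta>1 * u \<le> \<bar>\<beta>1\<bar>"
    proof -
      have "\<bar>\<beta>1 * u\<bar> \<le> \<bar>\<beta>1\<bar> * 1" unfolding abs_mult using u0 u cp by (intro mult_left_mono) auto
      then show ?thesis by linarith
    qed
    moreover have "\<kappa> * u powr \<gamma>' \<le> \<kappa> * ?c powr \<gamma>'"
      using u u0 \<gamma>'0 by (intro mult_left_mono powr_mono2) auto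
    ultimately have "\<kappa> * (1 - ?c powr \<gamma>') \<le> 2 * \<bar>\<beta>1\<bar> + 1" by (simp add: right_diff_distrib)
    moreover have "?c powr \<gamma>' < 1" using powr_less_mono2[of \<gamma>' ?c 1] cp \<gamma>'0 by simp
    ultimately show "\<kappa> \<le> (2 * \<bar>\<beta>1\<bar> + 1) / (1 - ?c powr \<gamma>')" by (simp add: pos_le_divide_eq)
  qed
  ultimately have upper: "\<And>\<kappa>. \<kappa> \<in> S \<Longrightarrow> \<kappa> \<le> Sup S" and lower: "\<And>y. y < Sup S \<Longrightarrow> \<exists>\<kappa>\<in>S. y < \<kappa>"
    by (auto intro: cSup_upper simp: less_cSup_iff)
  define kc where "kc = Sup S"
  have kc: "kc > 0" using \<open>S \<noteq> {}\<close> upper unfolding kc_def S_def by fastforce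
  \<comment> \<open>\<beta>2 as a function of \<kappa> and u, evaluated at the jump
    \<open>kc\<close> and at the two edges of the window that maximizers avoid.\<close>
  define a where "a = kc * (\<gamma>' / \<gamma>) * (?c - \<delta>) powr (\<gamma>' - \<gamma>)"
  define b where "b = kc * (\<gamma>' / \<gamma>) * (?c + \<delta>) powr (\<gamma>' - \<gamma>)"
  have pos: "kc * (\<gamma>' / \<gamma>) > 0" using kc \<gamma> by simp
  show ?thesis
  proof (rule that[of a b])
    show a0: "0 \<le> a" unfolding a_def using pos by (intro mult_nonneg_nonneg[of "kc * (\<gamma>' / \<gamma>)"]) simp_all
    show "a < b" unfolding a_def b_def
      using pos \<delta>(1-3) \<gamma> by (intro mult_strict_left_mono[of _ _ "kc * (\<gamma>' / \<gamma>)"] powr_less_mono2) auto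
    fix \<beta>2 assume \<beta>2: "a < \<beta>2" "\<beta>2 < b"
    have \<beta>20: "\<beta>2 > 0" using \<beta>2 a0 by simp
    obtain u where u: "is_maximizer (ell \<beta>1 \<beta>2 \<gamma>) u" using ell_maximizer_exists[OF \<gamma>(1) \<beta>20] by blast
    have u01: "0 < u" "u < 1" using u by (auto simp: is_maximizer_def)
    define \<kappa> where "\<kappa> = \<beta>2 * (\<gamma> / \<gamma>') * u powr (\<gamma> - \<gamma>')"
    have \<kappa>: "\<kappa> > 0" using \<beta>20 \<gamma> u01 by (simp add: \<kappa>_def)
    have \<beta>2_eq: "\<beta>2 = \<kappa> * (\<gamma>' / \<gamma>) * u powr (\<gamma>' - \<gamma>)"
    proof -
      have "u powr (\<gamma> - \<gamma>') * u powr (\<gamma>' - \<gamma>) = 1" using u01 by (simp add: powr_add[symmetric])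
      then show ?thesis unfolding \<kappa>_def using \<gamma> by (simp add: field_simps)
    qed
    have not_max: "\<not> is_maximizer (ell \<beta>1 \<kappa> \<gamma>') u"
    proof
      assume m: "is_maximizer (ell \<beta>1 \<kappa> \<gamma>') u"
      have low: "\<not> (\<kappa> \<le> kc \<and> u \<le> ?c - \<delta>)"
      proof
        assume *: "\<kappa> \<le> kc \<and> u \<le> ?c - \<delta>"
        then have "\<beta>2 \<le> a" unfolding \<beta>2_eq a_def
          using \<kappa> \<gamma> u01 kc by (intro mult_mono mult_right_mono powr_mono2) auto
        then show False using \<beta>2 by simp
      qed
      have high: "\<not> (kc \<le> \<kappa> \<and> ?c + \<delta> \<le> u)"
      proof
        assume *: "kc \<le> \<kappa> \<and> ?c + \<delta> \<le> u"
        then have "b \<le> \<beta>2" unfolding \<beta>2_eq b_def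
          using \<kappa> \<gamma> u01 kc cp \<delta>(1-3) by (intro mult_mono mult_right_mono powr_mono2) auto
        then show False using \<beta>2 by simp
      qed
      \<comment> \<open>Before the jump, monotonicity puts u into the left phase and so \<beta>2
        \<le> a; after it, u is in the right phase because \<kappa> is not in S, and so \<beta>2
        \<ge> b. At the jump itself one of the two happens.\<close>
      consider "\<kappa> < kc" | "\<kappa> = kc" | "kc < \<kappa>" by linarith
      then show False
      proof cases
        case 1
        then obtain \<kappa>' where \<kappa>': "\<kappa>' \<in> S" "\<kappa> < \<kappa>'" using lower unfolding kc_def by blast
        then obtain v where "is_maximizer (ell \<beta>1 \<kappa>' \<gamma>') v" "v < ?c" by (auto simp: S_def)
        then have "u < ?c" using maximizer_mono[OF m _ \<kappa>'(2) \<gamma>'0] by fastforce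
        then show False using \<delta>(4)[OF m] \<delta>(1) low 1 by auto
      next
        case 2
        then show False using \<delta>(4)[OF m] low high by auto
      next
        case 3
        then have "\<kappa> \<notin> S" using upper unfolding kc_def by force
        have "\<not> u < ?c"
        proof
          assume "u < ?c"
          then have "\<kappa> \<in> S" unfolding S_def by (intro CollectI conjI \<kappa> exI[of _ u] m)
          then show False using \<open>\<kappa> \<notin> S\<close> by simp
        qed
        then show False using \<delta>(4)[OF m] \<delta>(1) high 3 by auto
      qed
    qed
    obtain r where r: "is_maximizer (ell \<beta>1 \<kappa> \<gamma>') r" using ell_maximizer_exists[OF \<gamma>'0 \<kappa>] by blast
    have "ell \<beta>1 \<kappa> \<gamma>' u < ell \<beta>1 \<kappa> \<gamma>' r"
    proof (rule ccontr)
      assume "\<not> ?thesis"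
      then have "is_maximizer (ell \<beta>1 \<kappa> \<gamma>') u"
        using r u01 unfolding is_maximizer_def not_less by (intro conjI ballI) (auto intro: order_trans)
      then show False using not_max by simp
    qed
    then show "\<exists>u r. is_maximizer (ell \<beta>1 \<beta>2 \<gamma>) u \<and> 0 < r \<and> r < 1 \<and>
       ell \<beta>1 (\<beta>2 * (\<gamma> / \<gamma>') * u powr (\<gamma> - \<gamma>')) \<gamma>' u < ell \<beta>1 (\<beta>2 * (\<gamma> / \<gamma>') * u powr (\<gamma> - \<gamma>')) \<gamma>' r"
      using u r unfolding \<kappa>_def is_maximizer_def by blast
  qed
qed

subsection \<open>Stability of Finner's inequality on two-valued weights\<close>

lemma avg_square_le:
  assumes "finite A" "A \<noteq> {}"
  shows "(avg A f)\<^sup>2 \<le> avg A (\<lambda>x. (f x)\<^sup>2)"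
proof -
  have c: "real (card A) > 0" using assms by (simp add: card_gt_0_iff)
  have "(\<Sum>x\<in>A. f x)\<^sup>2 \<le> (\<Sum>x\<in>A. (f x)\<^sup>2) * real (card A)" by (rule sum_squared_le_sum_of_squares)
  then have "(\<Sum>x\<in>A. f x)\<^sup>2 / (real (card A))\<^sup>2 \<le> (\<Sum>x\<in>A. (f x)\<^sup>2) * real (card A) / (real (card A))\<^sup>2"
    by (intro divide_right_mono) auto
  also have "\<dots> = (\<Sum>x\<in>A. (f x)\<^sup>2) / real (card A)" using c by (simp add: power2_eq_square)
  finally show ?thesis by (simp add: avg_def power_divide)
qed

text \<open>If most \<open>2 \<times> 2\<close> minors of a symmetric 0-1 matrix \<open>b\<close> vanish additively, then
  \<open>b x y \<approx> z x y = a x + a y - m\<close> in mean. Since \<open>b\<^sup>2 = b\<close>, the mixed second difference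
  \<open>2 (a x - a x') (a y - a y')\<close> of \<open>z\<^sup>2 - z\<close> is small, so \<open>a\<close> and hence \<open>b\<close> is almost constant.\<close>
lemma additive_bits_almost_constant:
  fixes b :: "'w \<Rightarrow> 'w \<Rightarrow> real"
  assumes V: "finite V" "V \<noteq> {}"
    and b: "\<And>x y. b x y = 0 \<or> b x y = 1" and sym: "\<And>x y. b x y = b y x"
    and minors: "avg V (\<lambda>x. avg V (\<lambda>y. avg V (\<lambda>x'. avg V (\<lambda>y'. (b x y + b x' y' - b x' y - b x y')\<^sup>2)))) \<le> \<zeta>"
    and m: "m = avg V (\<lambda>x. avg V (b x))"
  shows "m * (1 - m) \<le> sqrt \<zeta> / 2 + 2 * sqrt (sqrt \<zeta>)"
proof -
  let ?E = "\<lambda>f. avg V (\<lambda>x. avg V (\<lambda>y. f x y)) :: real"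
  note const = avg_const[OF V]
  have E_sq: "(?E f)\<^sup>2 \<le> ?E (\<lambda>x y. (f x y)\<^sup>2)" for f :: "'w \<Rightarrow> 'w \<Rightarrow> real"
    by (rule order_trans[OF avg_square_le[OF V]]) (intro avg_mono avg_square_le[OF V])
  define a where "a x = avg V (b x)" for x
  have a': "avg V (\<lambda>x. b x y) = a y" for y by (simp add: a_def sym[of _ y])
  have bb: "0 \<le> b x y" "b x y \<le> 1" for x y using b[of x y] by auto
  have a01: "0 \<le> a x" "a x \<le> 1" for x using bb by (auto simp: a_def intro!: avg_nonneg avg_le_1)
  have m_a: "m = avg V a" by (simp add: m a_def[abs_def])
  have m01: "0 \<le> m" "m \<le> 1" using a01 by (auto simp: m_a intro!: avg_nonneg avg_le_1)
  define z where "z x y = a x + a y - m" for x y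
  have zb: "(b x y - z x y)\<^sup>2 \<le> ?E (\<lambda>x' y'. (b x y + b x' y' - b x' y - b x y')\<^sup>2)" for x y
  proof -
    have "?E (\<lambda>x' y'. b x y + b x' y' - b x' y - b x y') = b x y - z x y"
      by (simp add: avg_add avg_diff const a' m[symmetric] z_def a_def[of x])
    then show ?thesis using E_sq[of "\<lambda>x' y'. b x y + b x' y' - b x' y - b x y'"] by simp
  qed
  have "?E (\<lambda>x y. (b x y - z x y)\<^sup>2) \<le> \<zeta>"
    by (rule order_trans[OF _ minors]) (intro avg_mono zb)
  moreover have "(?E (\<lambda>x y. \<bar>b x y - z x y\<bar>))\<^sup>2 \<le> ?E (\<lambda>x y. (b x y - z x y)\<^sup>2)"
    using E_sq[of "\<lambda>x y. \<bar>b x y - z x y\<bar>"] by simp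
  ultimately have L1: "?E (\<lambda>x y. \<bar>b x y - z x y\<bar>) \<le> sqrt \<zeta>" by (intro real_le_rsqrt) linarith
  define P where "P t = t\<^sup>2 - t" for t :: real
  have Pz: "\<bar>P (z x y)\<bar> \<le> 2 * \<bar>b x y - z x y\<bar>" for x y
  proof -
    have "P (z x y) = - ((b x y - z x y) * (z x y + b x y - 1))"
      using b[of x y] by (auto simp: P_def power2_eq_square algebra_simps)
    then have "\<bar>P (z x y)\<bar> = \<bar>b x y - z x y\<bar> * \<bar>z x y + b x y - 1\<bar>" by (simp add: abs_mult)
    also have "\<dots> \<le> \<bar>b x y - z x y\<bar> * 2"
    proof (rule mult_left_mono)
      show "\<bar>z x y + b x y - 1\<bar> \<le> 2" unfolding z_def using a01[of x] a01[of y] m01 bb[of x y] by linarith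
    qed simp
    finally show ?thesis by simp
  qed
  have EP: "?E (\<lambda>x y. \<bar>P (z x y)\<bar>) \<le> 2 * sqrt \<zeta>"
  proof -
    have "?E (\<lambda>x y. \<bar>P (z x y)\<bar>) \<le> ?E (\<lambda>x y. 2 * \<bar>b x y - z x y\<bar>)" by (intro avg_mono Pz)
    also have "\<dots> = 2 * ?E (\<lambda>x y. \<bar>b x y - z x y\<bar>)" by (simp only: avg_cmult)
    finally show ?thesis using L1 by simp
  qed
  define s where "s = ?E (\<lambda>x x'. \<bar>a x - a x'\<bar>)"
  have "2 * s\<^sup>2 \<le> 8 * sqrt \<zeta>"
  proof -
    have diff2: "2 * (\<bar>a x - a x'\<bar> * \<bar>a y - a y'\<bar>)
        \<le> \<bar>P (z x y)\<bar> + \<bar>P (z x y')\<bar> + (\<bar>P (z x' y)\<bar> + \<bar>P (z x' y')\<bar>)" for x x' y y'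
    proof -
      have "2 * ((a x - a x') * (a y - a y')) = P (z x y) - P (z x y') - (P (z x' y) - P (z x' y'))"
        by (simp add: P_def z_def power2_eq_square algebra_simps)
      then have "2 * \<bar>(a x - a x') * (a y - a y')\<bar> = \<bar>P (z x y) - P (z x y') - (P (z x' y) - P (z x' y'))\<bar>" by simp
      then show ?thesis unfolding abs_mult by linarith
    qed
    have "2 * s\<^sup>2 = ?E (\<lambda>x x'. ?E (\<lambda>y y'. 2 * (\<bar>a x - a x'\<bar> * \<bar>a y - a y'\<bar>)))"
      unfolding avg_cmult s_def[symmetric] avg_cmult_right by (simp add: power2_eq_square s_def[symmetric])
    also have "\<dots> \<le> ?E (\<lambda>x x'. ?E (\<lambda>y y'. \<bar>P (z x y)\<bar> + \<bar>P (z x y')\<bar> + (\<bar>P (z x' y)\<bar> + \<bar>P (z x' y')\<bar>)))"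
      by (intro avg_mono diff2)
    also have "\<dots> = 4 * ?E (\<lambda>x y. \<bar>P (z x y)\<bar>)"
      by (simp add: avg_add const avg_cmult)
    finally show ?thesis using EP by simp
  qed
  then have "s\<^sup>2 \<le> 4 * sqrt \<zeta>" by simp
  then have "s \<le> sqrt (4 * sqrt \<zeta>)" by (rule real_le_rsqrt)
  then have s: "s \<le> 2 * sqrt (sqrt \<zeta>)" by (simp add: real_sqrt_mult)
  have am: "avg V (\<lambda>x. \<bar>a x - m\<bar>) \<le> s"
    unfolding s_def
  proof (rule avg_mono)
    fix x
    have "a x - m = avg V (\<lambda>x'. a x - a x')" by (simp add: avg_diff const m_a)
    then show "\<bar>a x - m\<bar> \<le> avg V (\<lambda>x'. \<bar>a x - a x'\<bar>)" by (simp only: avg_abs)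
  qed
  have "?E (\<lambda>x y. \<bar>b x y - m\<bar>) \<le> ?E (\<lambda>x y. \<bar>b x y - z x y\<bar> + (\<bar>a x - m\<bar> + \<bar>a y - m\<bar>))"
    by (intro avg_mono) (simp add: z_def)
  also have "\<dots> = ?E (\<lambda>x y. \<bar>b x y - z x y\<bar>) + 2 * avg V (\<lambda>x. \<bar>a x - m\<bar>)"
    by (simp add: avg_add const)
  finally have "?E (\<lambda>x y. \<bar>b x y - m\<bar>) \<le> sqrt \<zeta> + 2 * s" using L1 am by simp
  moreover have "?E (\<lambda>x y. \<bar>b x y - m\<bar>) = 2 * (m * (1 - m))"
  proof -
    have "\<bar>b x y - m\<bar> = m + (1 - 2 * m) * b x y" for x y using b[of x y] m01 by auto
    then have "?E (\<lambda>x y. \<bar>b x y - m\<bar>) = m + (1 - 2 * m) * m"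
      by (simp add: avg_add avg_cmult const m[symmetric])
    then show ?thesis by (simp add: algebra_simps)
  qed
  ultimately show ?thesis using s by simp
qed

section \<open>Deficits in Hoelder's and Finner's inequalities\<close>

text \<open>Lagrange's identity: the deficit in Cauchy-Schwarz is half the mean square of the 2 by 2
  minors.\<close>

lemma avg_mult_deficit:
  assumes V: "finite V" "V \<noteq> {}"
  shows "avg V (\<lambda>x. (f x)\<^sup>2) * avg V (\<lambda>x. (h x)\<^sup>2) - (avg V (\<lambda>x. f x * h x))\<^sup>2
    = avg V (\<lambda>x. avg V (\<lambda>x'. (f x * h x' - f x' * h x)\<^sup>2)) / 2"
proof -
  have "avg V (\<lambda>x. avg V (\<lambda>x'. (f x * h x' - f x' * h x)\<^sup>2))
    = avg V (\<lambda>x. avg V (\<lambda>x'. (f x)\<^sup>2 * (h x')\<^sup>2 + (h x)\<^sup>2 * (f x')\<^sup>2 - 2 * ((f x * h x) * (f x' * h x'))))"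
    by (intro avg_cong) (simp add: power2_eq_square algebra_simps)
  also have "\<dots> = 2 * (avg V (\<lambda>x. (f x)\<^sup>2) * avg V (\<lambda>x. (h x)\<^sup>2)) - 2 * (avg V (\<lambda>x. f x * h x))\<^sup>2"
    by (simp add: avg_add avg_diff avg_cmult avg_cmult_right power2_eq_square)
  finally show ?thesis by simp
qed

lemma power_diff_le:
  fixes x y :: real
  assumes "0 \<le> y" "y \<le> x" "x \<le> 1"
  shows "x ^ d - y ^ d \<le> d * (x - y)"
proof (induction d)
  case (Suc d)
  have "x ^ Suc d - y ^ Suc d = x * (x ^ d - y ^ d) + y ^ d * (x - y)" by (simp add: algebra_simps)
  also have "\<dots> \<le> 1 * (x ^ d - y ^ d) + 1 * (x - y)"
    using assms by (intro add_mono mult_right_mono power_le_one) (auto simp: power_mono)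
  finally show ?case using Suc by (simp add: algebra_simps)
qed simp

definition col_norm :: "nat \<Rightarrow> 'w set \<Rightarrow> ('w set \<Rightarrow> real) \<Rightarrow> 'w \<Rightarrow> real" where
  "col_norm d V R y = root d (avg V (\<lambda>x. R {x, y} ^ d))"

text \<open>What Hoelder's inequality yields for two columns when both are first replaced by their
  geometric mean: two equal norms, hence the square. It competes with the product of the two values
  of \<open>col_norm\<close>.\<close>

definition col_corr :: "nat \<Rightarrow> 'w set \<Rightarrow> ('w set \<Rightarrow> real) \<Rightarrow> 'w \<Rightarrow> 'w \<Rightarrow> real" where
  "col_corr d V R y y' = (root d (avg V (\<lambda>x. sqrt (R {x, y} * R {x, y'}) ^ d)))\<^sup>2"

text \<open>For the vectors of square roots of d-th powers, the d-th powers of both quantities are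
  the two sides of Cauchy-Schwarz, whose difference is given by Lagrange's identity. Since the
  quantities are at most 1, \<open>power_diff_le\<close> removes the d-th powers at the cost of a
  factor d.\<close>

lemma col_deficit:
  assumes V: "finite V" "V \<noteq> {}" and d: "d > 0" and R: "\<And>s. 0 \<le> R s \<and> R s \<le> 1"
  shows "col_corr d V R y y' \<le> col_norm d V R y * col_norm d V R y'"
    and "avg V (\<lambda>x. avg V (\<lambda>x'. (sqrt (R {x, y} ^ d) * sqrt (R {x', y'} ^ d) - sqrt (R {x', y} ^ d) * sqrt (R {x, y'} ^ d))\<^sup>2))
      \<le> 2 * real d * (col_norm d V R y * col_norm d V R y' - col_corr d V R y y')"
proof -
  let ?f = "\<lambda>x. sqrt (R {x, y} ^ d)" and ?h = "\<lambda>x. sqrt (R {x, y'} ^ d)"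
  let ?M = "col_norm d V R y * col_norm d V R y'" and ?K = "col_corr d V R y y'"
  let ?Q = "avg V (\<lambda>x. avg V (\<lambda>x'. (?f x * ?h x' - ?f x' * ?h x)\<^sup>2))"
  have nn: "0 \<le> avg V (\<lambda>x. R {x, y} ^ d)" for y using R by (intro avg_nonneg zero_le_power) auto
  have fh: "sqrt (R {x, y} * R {x, y'}) ^ d = ?f x * ?h x" for x
    by (simp add: real_sqrt_mult real_sqrt_power power_mult_distrib)
  have Md: "?M ^ d = avg V (\<lambda>x. (?f x)\<^sup>2) * avg V (\<lambda>x. (?h x)\<^sup>2)"
    unfolding col_norm_def power_mult_distrib using d nn R by simp
  have nK: "0 \<le> avg V (\<lambda>x. ?f x * ?h x)" using R by (intro avg_nonneg) auto
  have Kd: "?K ^ d = (avg V (\<lambda>x. ?f x * ?h x))\<^sup>2"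
    unfolding col_corr_def fh using d nK by (simp add: power_mult[symmetric] mult.commute[of 2]) (simp add: power_mult)
  have eq: "?M ^ d - ?K ^ d = ?Q / 2" unfolding Md Kd by (rule avg_mult_deficit[OF V])
  have Q0: "0 \<le> ?Q" by (intro avg_nonneg) auto
  have M0: "0 \<le> col_norm d V R y" for y unfolding col_norm_def using d nn by (intro real_root_ge_zero) auto
  have M1: "col_norm d V R y \<le> 1" for y
  proof -
    have "avg V (\<lambda>x. R {x, y} ^ d) \<le> 1" using R by (intro avg_le_1 power_le_one) auto
    then show ?thesis unfolding col_norm_def using d by simp
  qed
  have M01: "0 \<le> ?M" "?M \<le> 1" using M0 M1 by (auto intro: mult_le_one)
  have K0: "0 \<le> ?K" by (simp add: col_corr_def)
  show KM: "?K \<le> ?M"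
  proof (rule power_le_imp_le_base[of _ "d - 1"])
    show "?K ^ Suc (d - 1) \<le> ?M ^ Suc (d - 1)" using eq Q0 d by simp
  qed (rule M01)
  have "?M ^ d - ?K ^ d \<le> d * (?M - ?K)" by (rule power_diff_le[OF K0 KM M01(2)])
  then show "?Q \<le> 2 * real d * (?M - ?K)" using eq by simp
qed

text \<open>Integrate out one vertex v first. As d \<ge> 2, it has two edges, to distinct z1 and z2;
  replacing both factors by their geometric mean preserves the product and improves Hoelder's bound
  from \<open>col_norm\<close> to \<open>col_corr\<close>. The other factors are at least a, so the
  gain survives, and the remaining vertices are left to Finner's inequality.\<close>

lemma wdens_Finner_deficit:
  fixes H :: "'v graph" and R :: "'w set \<Rightarrow> real"
  assumes H: "simple_graph H" "regular_graph d H" "verts H \<noteq> {}" and d: "d \<ge> 2"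
    and V: "finite V" "V \<noteq> {}" and R: "\<And>s. a \<le> R s \<and> R s \<le> 1" and a: "0 < a"
  shows "a ^ card (edges H) * avg V (\<lambda>y. avg V (\<lambda>y'. col_norm d V R y * col_norm d V R y' - col_corr d V R y y'))
    \<le> root d (avg2 V (\<lambda>e. R e ^ d)) ^ card (edges H) - wdens H V R"
proof -
  let ?E = "edges H"
  let ?M = "col_norm d V R" and ?K = "col_corr d V R"
  have d0: "d > 0" using d by simp
  have R0: "0 \<le> R s" "R s \<le> 1" for s using R[of s] a by auto
  have finE: "finite ?E" using simple_graph_finite[OF H(1)] by simp
  obtain v where v: "v \<in> verts H" using H(3) by auto
  define J where "J = verts H - {v}"
  have J: "verts H = insert v J" "v \<notin> J" "finite J" using v simple_graph_finite[OF H(1)] by (auto simp: J_def)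
  define T where "T = {e \<in> ?E. v \<in> e}"
  have T: "finite T" "card T = d" "T \<subseteq> ?E" using H(2) v finE by (auto simp: T_def regular_graph_def)
  obtain e1 where e1: "e1 \<in> T" using T d by fastforce
  have "card (T - {e1}) > 0" using T e1 d by simp
  then obtain e2 where e2: "e2 \<in> T" "e2 \<noteq> e1" by (metis Diff_iff card_gt_0_iff ex_in_conv singletonI)
  have nb: "\<exists>z\<in>J. e = {v, z}" if "e \<in> T" for e
  proof -
    have e: "e \<in> ?E" "v \<in> e" using that by (auto simp: T_def)
    obtain p q where "e = {p, q}" "p \<noteq> q" "p \<in> verts H" "q \<in> verts H" using simple_graph_edgeE[OF H(1) e(1)] .
    then show ?thesis using e(2) by (auto simp: J_def doubleton_eq_iff)
  qed
  obtain z1 where z1: "z1 \<in> J" "e1 = {v, z1}" using nb[OF e1] by auto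
  obtain z2 where z2: "z2 \<in> J" "e2 = {v, z2}" using nb[OF e2(1)] by auto
  have z12: "z1 \<noteq> z2" "z1 \<noteq> v" "z2 \<noteq> v" using z1 z2 e2(2) J(2) by auto
  define F' where "F' e g = root d (avg V (\<lambda>x. R ((g(v := x)) ` e) ^ d))" for e and g :: "'v \<Rightarrow> 'w"
  have F'M: "F' {v, z} g = ?M (g z)" if "z \<noteq> v" for z g
    using that by (simp add: F'_def col_norm_def insert_commute)
  have F'_ge: "a \<le> F' e g" for e g
  proof -
    have "a ^ d = avg V (\<lambda>x. a ^ d)" by (simp add: avg_const[OF V])
    also have "\<dots> \<le> avg V (\<lambda>x. R ((g(v := x)) ` e) ^ d)"
      using R a by (intro avg_mono power_mono) auto
    finally have "root d (a ^ d) \<le> F' e g" unfolding F'_def using d0 by simp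
    then show ?thesis using d0 a by (simp add: real_root_power_cancel)
  qed
  have F'0: "0 \<le> F' e g" for e g using F'_ge[of e g] a by simp
  have a1: "a \<le> 1" using R[of "{}"] by linarith
  have notT: "F' e g = R ((g(v := x)) ` e)" if "e \<in> ?E - T" for e g x
  proof -
    have im: "(g(v := x')) ` e = g ` e" for x' using that by (intro image_cong) (auto simp: T_def)
    show ?thesis unfolding F'_def im using d0 R0 by (simp add: avg_const[OF V] real_root_power_cancel)
  qed
  have split: "(\<Prod>e\<in>?E. h e) = (\<Prod>e\<in>?E - T. h e) * (\<Prod>e\<in>T. h e)" for h :: "'v set \<Rightarrow> real"
    using prod.subset_diff[OF T(3) finE, of h] .
  have split2: "(\<Prod>e\<in>T. h e) = h e1 * (h e2 * (\<Prod>e\<in>T - {e1} - {e2}. h e))" for h :: "'v set \<Rightarrow> real"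
    using prod.remove[OF T(1) e1, of h] prod.remove[of "T - {e1}" e2 h] T(1) e2 by simp
  have inner: "avg V (\<lambda>x. \<Prod>e\<in>?E. R ((g(v := x)) ` e)) \<le> (\<Prod>e\<in>?E. F' e g)
      - a ^ card ?E * (?M (g z1) * ?M (g z2) - ?K (g z1) (g z2))" for g
  proof -
    define f where "f e x = (if e = e1 \<or> e = e2 then sqrt (R {x, g z1} * R {x, g z2}) else R ((g(v := x)) ` e))" for e x
    let ?P = "\<Prod>e\<in>?E - T. F' e g" and ?P2 = "\<Prod>e\<in>T - {e1} - {e2}. F' e g"
    have P_eq: "(\<Prod>e\<in>?E - T. R ((g(v := x)) ` e)) = ?P" for x
      by (intro prod.cong refl notT[symmetric])
    have T_eq: "(\<Prod>e\<in>T. R ((g(v := x)) ` e)) = (\<Prod>e\<in>T. f e x)" for x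
    proof -
      have "(\<Prod>e\<in>T - {e1} - {e2}. R ((g(v := x)) ` e)) = (\<Prod>e\<in>T - {e1} - {e2}. f e x)"
        by (intro prod.cong refl) (auto simp: f_def)
      moreover have "R ((g(v := x)) ` e1) * R ((g(v := x)) ` e2) = f e1 x * f e2 x"
        using z1 z2 z12 R0 by (simp add: f_def insert_commute)
      ultimately show ?thesis unfolding split2 by (simp only: mult.assoc[symmetric])
    qed
    have "avg V (\<lambda>x. \<Prod>e\<in>?E. R ((g(v := x)) ` e)) = avg V (\<lambda>x. ?P * (\<Prod>e\<in>T. f e x))"
      by (simp only: split P_eq T_eq)
    also have "\<dots> \<le> ?P * (\<Prod>e\<in>T. root d (avg V (\<lambda>x. f e x ^ d)))"
      unfolding avg_cmult using R0
      by (intro mult_left_mono generalized_Hoelder[OF V T(1,2) d0] prod_nonneg F'0 ballI) (auto simp: f_def)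
    also have "(\<Prod>e\<in>T. root d (avg V (\<lambda>x. f e x ^ d))) = ?K (g z1) (g z2) * ?P2"
    proof -
      have "(\<Prod>e\<in>T - {e1} - {e2}. root d (avg V (\<lambda>x. f e x ^ d))) = ?P2"
        by (intro prod.cong refl) (auto simp: f_def F'_def)
      moreover have "root d (avg V (\<lambda>x. f e1 x ^ d)) * root d (avg V (\<lambda>x. f e2 x ^ d)) = ?K (g z1) (g z2)"
        by (simp add: f_def col_corr_def power2_eq_square)
      ultimately show ?thesis unfolding split2 by (simp only: mult.assoc[symmetric])
    qed
    also have "?P * (?K (g z1) (g z2) * ?P2) = (\<Prod>e\<in>?E. F' e g) - ?P * ?P2 * (?M (g z1) * ?M (g z2) - ?K (g z1) (g z2))"
    proof -
      have "(\<Prod>e\<in>?E. F' e g) = ?P * (?M (g z1) * (?M (g z2) * ?P2))"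
        unfolding split split2 using z1 z2 z12 by (simp add: F'M)
      then show ?thesis by (simp add: algebra_simps)
    qed
    also have "\<dots> \<le> (\<Prod>e\<in>?E. F' e g) - a ^ card ?E * (?M (g z1) * ?M (g z2) - ?K (g z1) (g z2))"
    proof -
      have "?P * ?P2 = (\<Prod>e\<in>(?E - T) \<union> (T - {e1} - {e2}). F' e g)"
        using finE T(1) by (intro prod.union_disjoint[symmetric]) auto
      moreover have "a ^ card ?E \<le> a ^ card ((?E - T) \<union> (T - {e1} - {e2}))"
        using T finE a a1 by (intro power_decreasing card_mono) auto
      moreover have "(\<Prod>e\<in>(?E - T) \<union> (T - {e1} - {e2}). a) \<le> (\<Prod>e\<in>(?E - T) \<union> (T - {e1} - {e2}). F' e g)"
        using F'_ge a by (intro prod_mono) auto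
      ultimately have "a ^ card ?E \<le> ?P * ?P2" by simp
      moreover have "0 \<le> ?M (g z1) * ?M (g z2) - ?K (g z1) (g z2)"
        using col_deficit(1)[OF V d0, of R] R0 by simp
      ultimately show ?thesis by (simp add: mult_right_mono)
    qed
    finally show ?thesis .
  qed
  have "wdens H V R = avg (J \<rightarrow>\<^sub>E V) (\<lambda>g. avg V (\<lambda>x. \<Prod>e\<in>?E. R ((g(v := x)) ` e)))"
    unfolding wdens_def J(1) by (rule avg_PiE_insert[OF J(3,2) V(1)])
  also have "\<dots> \<le> avg (J \<rightarrow>\<^sub>E V) (\<lambda>g. (\<Prod>e\<in>?E. F' e g)
      - a ^ card ?E * (?M (g z1) * ?M (g z2) - ?K (g z1) (g z2)))"
    by (intro avg_mono inner)
  also have "\<dots> = avg (J \<rightarrow>\<^sub>E V) (\<lambda>g. \<Prod>e\<in>?E. F' e g)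
      - a ^ card ?E * avg V (\<lambda>y. avg V (\<lambda>y'. ?M y * ?M y' - ?K y y'))"
    unfolding avg_diff[of _ "\<lambda>g. \<Prod>e\<in>?E. F' e g"] avg_cmult
    by (subst avg_PiE_pair[OF J(3) V z1(1) z2(1) z12(1), of "\<lambda>y y'. ?M y * ?M y' - ?K y y'"]) simp
  finally have 1: "wdens H V R \<le> avg (J \<rightarrow>\<^sub>E V) (\<lambda>g. \<Prod>e\<in>?E. F' e g)
      - a ^ card ?E * avg V (\<lambda>y. avg V (\<lambda>y'. ?M y * ?M y' - ?K y y'))" .
  have "avg (J \<rightarrow>\<^sub>E V) (\<lambda>g. \<Prod>e\<in>?E. F' e g) \<le> (\<Prod>e\<in>?E. root d (avg (J \<rightarrow>\<^sub>E V) (\<lambda>g. F' e g ^ d)))"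
  proof (rule finner_inequality[OF J(3) V finE d0, where S = "\<lambda>e. e"])
    show "0 \<le> F' e f" for e f by (rule F'0)
    show "F' e f = F' e g" if "\<And>i. i \<in> e \<Longrightarrow> f i = g i" for e f g
    proof -
      have "(f(v := x)) ` e = (g(v := x)) ` e" for x using that by (intro image_cong) auto
      then show ?thesis by (simp add: F'_def)
    qed
    show "card {e \<in> ?E. i \<in> e} = d" if "i \<in> J" for i
      using H(2) that by (auto simp: regular_graph_def J_def)
  qed
  also have "\<dots> = (\<Prod>e\<in>?E. root d (avg2 V (\<lambda>e. R e ^ d)))"
  proof (intro prod.cong refl)
    fix e assume e: "e \<in> ?E"
    have "0 \<le> avg V (\<lambda>x. R ((g(v := x)) ` e) ^ d)" for g using R0 by (intro avg_nonneg) auto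
    then have "F' e g ^ d = avg V (\<lambda>x. R ((g(v := x)) ` e) ^ d)" for g
      unfolding F'_def using d0 by simp
    then have "avg (J \<rightarrow>\<^sub>E V) (\<lambda>g. F' e g ^ d) = avg (verts H \<rightarrow>\<^sub>E V) (\<lambda>f. R (f ` e) ^ d)"
      unfolding J(1) by (simp add: avg_PiE_insert[OF J(3,2) V(1)])
    also have "\<dots> = avg2 V (\<lambda>e. R e ^ d)" using avg_edge[OF H(1) e V, of "\<lambda>e. R e ^ d"] by simp
    finally show "root d (avg (J \<rightarrow>\<^sub>E V) (\<lambda>g. F' e g ^ d)) = root d (avg2 V (\<lambda>e. R e ^ d))" by simp
  qed
  finally show ?thesis using 1 by simp
qed

text \<open>A product of two entries depends only on the number of ones among their bits, and its
  values p1 p1, p1 p2, p2 p2 have gaps of at least p1 (p2 - p1). So multiplicative minors control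
  the additive minors of the bits.\<close>

lemma bit_minor_bound:
  fixes p1 p2 :: real
  assumes p: "0 \<le> p1" "p1 \<le> p2" and b: "b1 = 0 \<or> b1 = 1" "b2 = 0 \<or> b2 = 1" "b3 = 0 \<or> b3 = 1" "b4 = 0 \<or> b4 = 1"
  shows "p1 * (p2 - p1) * \<bar>b1 + b2 - b3 - b4\<bar>
    \<le> 2 * \<bar>(p1 + (p2 - p1) * b1) * (p1 + (p2 - p1) * b2) - (p1 + (p2 - p1) * b3) * (p1 + (p2 - p1) * b4)\<bar>"
proof -
  have f: "p1 * p1 \<le> p1 * p2" "p1 * p2 \<le> p2 * p2" "2 * (p1 * p2) \<le> p1 * p1 + p2 * p2"
    using p zero_le_square[of "p2 - p1"] by (auto intro: mult_left_mono mult_right_mono simp: algebra_simps)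
  have e: "p1 * (p2 - p1) = p1 * p2 - p1 * p1" by (simp add: algebra_simps)
  have v: "(b + b' = 0 \<and> (p1 + (p2 - p1) * b) * (p1 + (p2 - p1) * b') = p1 * p1)
      \<or> (b + b' = 1 \<and> (p1 + (p2 - p1) * b) * (p1 + (p2 - p1) * b') = p1 * p2)
      \<or> (b + b' = 2 \<and> (p1 + (p2 - p1) * b) * (p1 + (p2 - p1) * b') = p2 * p2)"
    if "b = 0 \<or> b = 1" "b' = 0 \<or> b' = 1" for b b' :: real
    using that by auto
  have lin: "(X - P) * \<bar>s - t\<bar> \<le> 2 * \<bar>A - B\<bar>"
    if "s = 0 \<and> A = P \<or> s = 1 \<and> A = X \<or> s = 2 \<and> A = Z" "t = 0 \<and> B = P \<or> t = 1 \<and> B = X \<or> t = 2 \<and> B = Z"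
      "P \<le> X" "X \<le> Z" "2 * X \<le> P + Z" for s t A B X P Z :: real
    using that by auto
  have s: "b1 + b2 - b3 - b4 = (b1 + b2) - (b3 + b4)" by simp
  show ?thesis unfolding e s by (rule lin[OF v[OF b(1,2)] v[OF b(3,4)] f])
qed

text \<open>A small Finner deficit makes the multiplicative minors of the matrix with entries
  \<open>R {x, y} ^ d\<close> small in mean, hence also the additive minors of the bits that mark R
  = u2; these bits are then almost constant by \<open>additive_bits_almost_constant\<close>.\<close>

lemma two_valued_stability:
  fixes H :: "'v graph"
  assumes H: "simple_graph H" "regular_graph d H" "verts H \<noteq> {}" and d: "d \<ge> 2"
    and u: "0 < u1" "u1 < u2" "u2 \<le> 1" and \<epsilon>: "\<epsilon> > 0"
  obtains \<xi> where "\<xi> > 0"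
    "\<And>(V :: 'w set) R. \<lbrakk>finite V; V \<noteq> {}; \<And>s. R s = u1 \<or> R s = u2;
        root d (avg2 V (\<lambda>e. R e ^ d)) ^ card (edges H) - wdens H V R \<le> \<xi>\<rbrakk>
      \<Longrightarrow> avg2 V (\<lambda>e. \<bar>R e - u1\<bar>) \<le> \<epsilon> \<or> avg2 V (\<lambda>e. \<bar>R e - u2\<bar>) \<le> \<epsilon>"
proof -
  define p1 where "p1 = sqrt (u1 ^ d)"
  define p2 where "p2 = sqrt (u2 ^ d)"
  have p: "0 < p1" "p1 < p2"
    using u d by (auto simp: p1_def p2_def intro!: power_strict_mono)
  define c0 where "c0 = p1 * (p2 - p1)"
  have c0: "c0 > 0" using p by (simp add: c0_def)
  \<comment> \<open>The accumulated losses: \<open>4 / c0\<^sup>2\<close> from squaring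
    \<open>bit_minor_bound\<close>, 2 d from \<open>col_deficit\<close>, and the power of u1 from
    \<open>wdens_Finner_deficit\<close>.\<close>
  define C where "C = 8 * d / (c0\<^sup>2 * u1 ^ card (edges H))"
  have C: "C > 0" using c0 u d by (simp add: C_def)
  have "((\<lambda>\<zeta>. sqrt \<zeta> / 2 + 2 * sqrt (sqrt \<zeta>)) \<longlongrightarrow> sqrt 0 / 2 + 2 * sqrt (sqrt 0)) (at_right 0)"
    by (intro tendsto_intros) auto
  then have "((\<lambda>\<zeta>. sqrt \<zeta> / 2 + 2 * sqrt (sqrt \<zeta>)) \<longlongrightarrow> 0) (at_right 0)" by simp
  then have "\<forall>\<^sub>F \<zeta> in at_right 0. sqrt \<zeta> / 2 + 2 * sqrt (sqrt \<zeta>) < \<epsilon> / 2"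
    by (rule order_tendstoD) (use \<epsilon> in simp)
  then obtain b where b: "b > 0" "\<And>\<zeta>. 0 < \<zeta> \<Longrightarrow> \<zeta> < b \<Longrightarrow> sqrt \<zeta> / 2 + 2 * sqrt (sqrt \<zeta>) < \<epsilon> / 2"
    unfolding eventually_at_right_field by blast
  define \<zeta> where "\<zeta> = b / 2"
  have \<zeta>: "\<zeta> > 0" "sqrt \<zeta> / 2 + 2 * sqrt (sqrt \<zeta>) < \<epsilon> / 2" using b by (auto simp: \<zeta>_def)
  show ?thesis
  proof (rule that[of "\<zeta> / C"])
    show "0 < \<zeta> / C" using \<zeta> C by simp
    fix V :: "'w set" and R
    assume V: "finite V" "V \<noteq> {}" and R: "\<And>s. R s = u1 \<or> R s = u2"
      and def: "root d (avg2 V (\<lambda>e. R e ^ d)) ^ card (edges H) - wdens H V R \<le> \<zeta> / C"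
    let ?M = "col_norm d V R" and ?K = "col_corr d V R"
    have R': "u1 \<le> R s \<and> R s \<le> 1" "0 \<le> R s \<and> R s \<le> 1" for s using R[of s] u by auto
    define bt where "bt x y = (if R {x, y} = u2 then 1 else 0 :: real)" for x y
    have bt: "bt x y = 0 \<or> bt x y = 1" "bt x y = bt y x" for x y by (auto simp: bt_def insert_commute)
    let ?D = "\<lambda>x y x' y'. (bt x y + bt x' y' - bt x' y - bt x y')\<^sup>2"
    let ?Q = "\<lambda>x y x' y'. (sqrt (R {x, y} ^ d) * sqrt (R {x', y'} ^ d) - sqrt (R {x', y} ^ d) * sqrt (R {x, y'} ^ d))\<^sup>2"
    have DQ: "?D x y x' y' \<le> 4 / c0\<^sup>2 * ?Q x y x' y'" for x y x' y'
    proof -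
      have val: "sqrt (R s ^ d) = p1 + (p2 - p1) * (if R s = u2 then 1 else 0)" for s
        using R[of s] u by (auto simp: p1_def p2_def)
      have q: "sqrt (R {x, y} ^ d) = p1 + (p2 - p1) * bt x y" for x y unfolding val bt_def by simp
      have key: "c0\<^sup>2 * ?D x y x' y' \<le> 4 * ?Q x y x' y'"
      proof -
        have "c0 * \<bar>bt x y + bt x' y' - bt x' y - bt x y'\<bar>
          \<le> 2 * \<bar>sqrt (R {x, y} ^ d) * sqrt (R {x', y'} ^ d) - sqrt (R {x', y} ^ d) * sqrt (R {x, y'} ^ d)\<bar>"
          unfolding q c0_def by (rule bit_minor_bound[OF less_imp_le[OF p(1)] less_imp_le[OF p(2)] bt(1) bt(1) bt(1) bt(1)])
        from power_mono[OF this, of 2] c0 show ?thesis by (simp add: power_mult_distrib)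
      qed
      have "?D x y x' y' = (c0\<^sup>2 * ?D x y x' y') / c0\<^sup>2" using c0 by simp
      also have "\<dots> \<le> (4 * ?Q x y x' y') / c0\<^sup>2" by (intro divide_right_mono key) simp
      finally show ?thesis by simp
    qed
    have "avg V (\<lambda>x. avg V (\<lambda>y. avg V (\<lambda>x'. avg V (\<lambda>y'. ?D x y x' y'))))
        \<le> avg V (\<lambda>x. avg V (\<lambda>y. avg V (\<lambda>x'. avg V (\<lambda>y'. 4 / c0\<^sup>2 * ?Q x y x' y'))))"
      by (intro avg_mono DQ)
    also have "\<dots> = 4 / c0\<^sup>2 * avg V (\<lambda>x. avg V (\<lambda>y. avg V (\<lambda>x'. avg V (\<lambda>y'. ?Q x y x' y'))))"
      by (simp only: avg_cmult)
    also have "avg V (\<lambda>x. avg V (\<lambda>y. avg V (\<lambda>x'. avg V (\<lambda>y'. ?Q x y x' y'))))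
      = avg V (\<lambda>y. avg V (\<lambda>y'. avg V (\<lambda>x. avg V (\<lambda>x'. ?Q x y x' y'))))"
    proof -
      have "avg V (\<lambda>x. avg V (\<lambda>y. avg V (\<lambda>x'. avg V (\<lambda>y'. ?Q x y x' y'))))
        = avg V (\<lambda>y. avg V (\<lambda>x. avg V (\<lambda>x'. avg V (\<lambda>y'. ?Q x y x' y'))))" by (rule avg_swap)
      also have "\<dots> = avg V (\<lambda>y. avg V (\<lambda>x. avg V (\<lambda>y'. avg V (\<lambda>x'. ?Q x y x' y'))))"
        by (intro avg_cong avg_swap)
      also have "\<dots> = avg V (\<lambda>y. avg V (\<lambda>y'. avg V (\<lambda>x. avg V (\<lambda>x'. ?Q x y x' y'))))"
        by (intro avg_cong avg_swap)
      finally show ?thesis .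
    qed
    also have "4 / c0\<^sup>2 * \<dots> \<le> 4 / c0\<^sup>2 * avg V (\<lambda>y. avg V (\<lambda>y'. 2 * real d * (?M y * ?M y' - ?K y y')))"
      using R' d by (intro mult_left_mono avg_mono col_deficit(2)[OF V]) auto
    also have "\<dots> = 8 * d / c0\<^sup>2 * avg V (\<lambda>y. avg V (\<lambda>y'. ?M y * ?M y' - ?K y y'))"
      by (simp only: avg_cmult) simp
    also have "\<dots> \<le> \<zeta>"
    proof -
      have "u1 ^ card (edges H) * avg V (\<lambda>y. avg V (\<lambda>y'. ?M y * ?M y' - ?K y y')) \<le> \<zeta> / C"
        using wdens_Finner_deficit[OF H d V, of u1 R] R' u def by simp
      then have "C * (u1 ^ card (edges H) * avg V (\<lambda>y. avg V (\<lambda>y'. ?M y * ?M y' - ?K y y'))) \<le> C * (\<zeta> / C)"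
        using C by (intro mult_left_mono) auto
      moreover have "C * u1 ^ card (edges H) = 8 * d / c0\<^sup>2" using u by (simp add: C_def)
      ultimately show ?thesis using C by (simp add: mult.assoc[symmetric])
    qed
    finally have minors: "avg V (\<lambda>x. avg V (\<lambda>y. avg V (\<lambda>x'. avg V (\<lambda>y'. ?D x y x' y')))) \<le> \<zeta>" .
    define m where "m = avg V (\<lambda>x. avg V (bt x))"
    have "m * (1 - m) \<le> sqrt \<zeta> / 2 + 2 * sqrt (sqrt \<zeta>)"
      by (rule additive_bits_almost_constant[OF V bt minors m_def])
    then have mm: "m * (1 - m) < \<epsilon> / 2" using \<zeta> by simp
    have m01: "0 \<le> m" "m \<le> 1" unfolding m_def by (auto simp: bt_def intro!: avg_nonneg avg_le_1)
    have m2: "m = avg2 V (\<lambda>e. if R e = u2 then 1 else 0)" by (simp add: m_def bt_def[abs_def] avg2_def)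
    have "avg2 V (\<lambda>e. \<bar>R e - u1\<bar>) \<le> m"
      unfolding m2
    proof (intro avg2_mono)
      fix x y show "\<bar>R {x, y} - u1\<bar> \<le> (if R {x, y} = u2 then 1 else 0)" using R[of "{x, y}"] u by auto
    qed
    moreover have "avg2 V (\<lambda>e. \<bar>R e - u2\<bar>) \<le> 1 - m"
    proof -
      have "avg2 V (\<lambda>e. \<bar>R e - u2\<bar>) \<le> avg2 V (\<lambda>e. 1 - (if R e = u2 then 1 else 0))"
      proof (intro avg2_mono)
        fix x y show "\<bar>R {x, y} - u2\<bar> \<le> 1 - (if R {x, y} = u2 then 1 else 0)" using R[of "{x, y}"] u by auto
      qed
      then show ?thesis unfolding avg2_diff avg2_const[OF V] m2 .
    qed
    \<comment> \<open>One of the factors m and 1 - m is at least 1 / 2, so the other is at most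
      \<epsilon>.\<close>
    moreover have "m \<le> \<epsilon> \<or> 1 - m \<le> \<epsilon>"
    proof (cases "m \<le> 1 / 2")
      case True
      have "m * (1 / 2) \<le> m * (1 - m)" using True m01 by (intro mult_left_mono) auto
      then show ?thesis using mm by simp
    next
      case False
      have "1 / 2 * (1 - m) \<le> m * (1 - m)" using False m01 by (intro mult_right_mono) auto
      then show ?thesis using mm by simp
    qed
    ultimately show "avg2 V (\<lambda>e. \<bar>R e - u1\<bar>) \<le> \<epsilon> \<or> avg2 V (\<lambda>e. \<bar>R e - u2\<bar>) \<le> \<epsilon>" by linarith
  qed
qed

section \<open>Tangent inequalities and the bound of the free energy by \<open>ell\<close>\<close>

text \<open>Young's inequality with second factor 1 is the tangent at 1; scaling by \<tau> moves the
  point of contact.\<close>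

lemma powr_tangent_concave:
  fixes p z \<tau> :: real
  assumes "0 < p" "p \<le> 1" "0 \<le> z" "0 < \<tau>"
  shows "z powr p \<le> \<tau> powr p + p * \<tau> powr (p - 1) * (z - \<tau>)"
proof -
  have t: "t powr p \<le> 1 + p * (t - 1)" if "0 \<le> t" for t :: real
  proof (cases "t = 0")
    case False
    then show ?thesis using Youngs_inequality_0[of p "1 - p" t 1] assms that by (simp add: algebra_simps)
  qed (use assms in simp)
  have "z powr p = \<tau> powr p * (z / \<tau>) powr p" using assms by (simp add: powr_mult[symmetric])
  also have "\<dots> \<le> \<tau> powr p * (1 + p * (z / \<tau> - 1))" using assms by (intro mult_left_mono t) auto
  also have "\<dots> = \<tau> powr p + p * (\<tau> powr p / \<tau>) * (z - \<tau>)" using assms by (simp add: field_simps)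
  also have "\<tau> powr p / \<tau> = \<tau> powr (p - 1)" using assms by (simp add: powr_diff)
  finally show ?thesis .
qed

text \<open>The concave case for the inverse power: Young's inequality with weight 1 / p, applied to
  \<open>t powr p\<close>.\<close>

lemma powr_tangent_convex:
  fixes p z \<tau> :: real
  assumes "1 \<le> p" "0 \<le> z" "0 < \<tau>"
  shows "\<tau> powr p + p * \<tau> powr (p - 1) * (z - \<tau>) \<le> z powr p"
proof -
  have t: "1 + p * (t - 1) \<le> t powr p" if "0 \<le> t" for t :: real
  proof (cases "t = 0")
    case False
    then have "t \<le> t powr p / p + (1 - 1 / p)"
      using Youngs_inequality_0[of "1 / p" "1 - 1 / p" "t powr p" 1] assms that by (simp add: powr_powr)
    then have "p * t \<le> p * (t powr p / p + (1 - 1 / p))" using assms by (intro mult_left_mono) auto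
    then show ?thesis using assms by (simp add: algebra_simps)
  qed (use assms in simp)
  have "\<tau> powr p + p * \<tau> powr (p - 1) * (z - \<tau>) = \<tau> powr p + p * (\<tau> powr p / \<tau>) * (z - \<tau>)"
    using assms by (simp add: powr_diff)
  also have "\<dots> = \<tau> powr p * (1 + p * (z / \<tau> - 1))" using assms by (simp add: field_simps)
  also have "\<dots> \<le> \<tau> powr p * (z / \<tau>) powr p" using assms by (intro mult_left_mono t) auto
  also have "\<dots> = z powr p" using assms by (simp add: powr_mult[symmetric])
  finally show ?thesis .
qed

lemma avg2_powr_ge:
  assumes "1 \<le> p" "finite V" "V \<noteq> {}" "\<And>x y. x \<in> V \<Longrightarrow> y \<in> V \<Longrightarrow> 0 \<le> f {x, y}"
  shows "avg2 V f powr p \<le> avg2 V (\<lambda>e. f e powr p)"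
proof (cases "avg2 V f = 0")
  case True
  then show ?thesis by (simp add: avg2_nonneg)
next
  case False
  define \<tau> where "\<tau> = avg2 V f"
  have "\<tau> > 0" using False avg2_nonneg[of V f] assms(4) by (simp add: \<tau>_def less_le)
  have "\<tau> powr p = avg2 V (\<lambda>e. \<tau> powr p + p * \<tau> powr (p - 1) * (f e - \<tau>))"
    by (simp add: avg2_add avg2_cmult avg2_diff avg2_const[OF assms(2,3)] \<tau>_def[symmetric])
  also have "\<dots> \<le> avg2 V (\<lambda>e. f e powr p)"
    using assms \<open>\<tau> > 0\<close> by (intro avg2_mono powr_tangent_convex) auto
  finally show ?thesis by (simp add: \<tau>_def)
qed

lemma card_edges_pos:
  assumes "simple_graph H" "regular_graph d H" "verts H \<noteq> {}" "d > 0"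
  shows "card (edges H) > 0"
proof -
  obtain v where "v \<in> verts H" using assms(3) by auto
  then have "card {e \<in> edges H. v \<in> e} > 0" using assms by (auto simp: regular_graph_def)
  then show ?thesis using simple_graph_finite[OF assms(1)] by (auto simp: card_gt_0_iff)
qed

lemma wdens_powr_le:
  fixes H :: "'v graph" and w :: "'w set \<Rightarrow> real"
  assumes H: "simple_graph H" "regular_graph d H" "verts H \<noteq> {}" and d: "d > 0" and \<alpha>: "\<alpha> > 0"
    and V: "finite V" "V \<noteq> {}" and w: "\<And>s. 0 \<le> w s \<and> w s \<le> 1"
  shows "wdens H V w powr \<alpha> \<le> avg2 V (\<lambda>e. w e ^ d) powr (real (card (edges H)) * \<alpha> / d)"
proof -
  let ?Y = "avg2 V (\<lambda>e. w e ^ d)"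
  have Y: "0 \<le> ?Y" using w by (intro avg2_nonneg) auto
  have E: "card (edges H) > 0" by (rule card_edges_pos[OF H d])
  have "wdens H V w powr \<alpha> \<le> (root d ?Y ^ card (edges H)) powr \<alpha>"
    using wdens_bounds[OF H(1), of V w] wdens_le_norm[OF H(1,2) d V, of w] w \<alpha> by (intro powr_mono2) auto
  also have "\<dots> = ?Y powr (real (card (edges H)) * \<alpha> / d)"
  proof (cases "?Y = 0")
    case True
    then show ?thesis using E d by simp
  next
    case False
    then have "root d ?Y ^ card (edges H) = (?Y powr (1 / d)) powr (card (edges H))"
      using Y d by (simp add: root_powr_inverse powr_realpow)
    then show ?thesis using False by (simp add: powr_powr field_simps)
  qed
  finally show ?thesis .
qed

lemma free_energy_const:
  fixes H :: "'v graph"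
  assumes H: "simple_graph H" and V: "finite V" "V \<noteq> {}" and u: "0 < u"
  shows "free_energy H \<alpha> \<beta>1 \<beta>2 V (\<lambda>e. u) = ell \<beta>1 \<beta>2 (real (card (edges H)) * \<alpha>) u"
proof -
  have "finite (verts H \<rightarrow>\<^sub>E V)" "verts H \<rightarrow>\<^sub>E V \<noteq> {}"
    using simple_graph_finite[OF H] V by (auto simp: PiE_eq_empty_iff intro!: finite_PiE)
  then have "wdens H V (\<lambda>e. u) = u ^ card (edges H)" by (simp add: wdens_def avg_const)
  also have "\<dots> = u powr (card (edges H))" using u by (simp add: powr_realpow)
  finally have "wdens H V (\<lambda>e. u) powr \<alpha> = u powr (real (card (edges H)) * \<alpha>)" by (simp add: powr_powr)
  then show ?thesis by (simp add: free_energy_def ell_def avg2_const[OF V])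
qed

lemma avg2_ell:
  "avg2 V (\<lambda>e. ell \<beta>1 \<kappa> \<gamma> (w e)) = \<beta>1 * avg2 V w + avg2 V (\<lambda>e. ent (w e)) + \<kappa> * avg2 V (\<lambda>e. w e powr \<gamma>)"
  by (simp add: ell_def avg2_add avg2_cmult)

lemma power_powr_divide:
  fixes x :: real
  assumes "0 \<le> x" "d > 0" "p \<noteq> 0"
  shows "(x ^ d) powr (p / d) = x powr p"
  using assms by (cases "x = 0") (auto simp: powr_realpow[symmetric] powr_powr)

text \<open>Jensen's inequality for the exponent \<gamma> / d, which is at least 1.\<close>

lemma norm_powr_le_avg2:
  assumes d: "d > 0" "\<gamma> \<ge> real d" and V: "finite V" "V \<noteq> {}" and w: "\<And>s. 0 \<le> w s \<and> w s \<le> 1"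
  shows "avg2 V (\<lambda>e. w e ^ d) powr (\<gamma> / d) \<le> avg2 V (\<lambda>e. w e powr \<gamma>)"
proof -
  have "avg2 V (\<lambda>e. w e ^ d) powr (\<gamma> / d) \<le> avg2 V (\<lambda>e. (w e ^ d) powr (\<gamma> / d))"
    using d w by (intro avg2_powr_ge V) auto
  also have "\<dots> = avg2 V (\<lambda>e. w e powr \<gamma>)"
    using d w by (intro avg2_cong power_powr_divide) auto
  finally show ?thesis .
qed

text \<open>The loss in Finner's inequality is kept as a subtracted term; with two maximizers it is
  what rules out mixtures of the two values.\<close>

lemma free_energy_le_ell_large:
  fixes H :: "'v graph" and w :: "'w set \<Rightarrow> real"
  assumes H: "simple_graph H" "regular_graph d H" "verts H \<noteq> {}" and d: "d > 0" and \<alpha>: "\<alpha> > 0"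
    and V: "finite V" "V \<noteq> {}" and w: "\<And>s. 0 \<le> w s \<and> w s \<le> 1" and \<beta>2: "\<beta>2 \<ge> 0"
    and \<gamma>: "\<gamma> = real (card (edges H)) * \<alpha>" "\<gamma> \<ge> d"
  shows "free_energy H \<alpha> \<beta>1 \<beta>2 V w \<le> avg2 V (\<lambda>e. ell \<beta>1 \<beta>2 \<gamma> (w e)) - \<beta>2 * (avg2 V (\<lambda>e. w e ^ d) powr (\<gamma> / d) - wdens H V w powr \<alpha>)"
  unfolding free_energy_def avg2_ell
  using mult_left_mono[OF norm_powr_le_avg2[OF d \<gamma>(2) V, of w] \<beta>2] w by (simp add: algebra_simps)

text \<open>Below the threshold \<open>\<gamma> < d\<close>, the concave function \<open>t powr (\<gamma> / d)\<close> is replaced by its tangent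
  at \<open>u ^ d\<close>.\<close>
lemma free_energy_le_ell_small:
  fixes H :: "'v graph" and w :: "'w set \<Rightarrow> real"
  assumes H: "simple_graph H" "regular_graph d H" "verts H \<noteq> {}" and d: "d > 0" and \<alpha>: "\<alpha> > 0"
    and V: "finite V" "V \<noteq> {}" and w: "\<And>s. 0 \<le> w s \<and> w s \<le> 1" and \<beta>2: "\<beta>2 \<ge> 0" and u: "0 < u"
    and \<gamma>: "\<gamma> = real (card (edges H)) * \<alpha>" "\<gamma> < d" and \<kappa>: "\<kappa> = \<beta>2 * (\<gamma> / d) * u powr (\<gamma> - d)"
  shows "free_energy H \<alpha> \<beta>1 \<beta>2 V w \<le> avg2 V (\<lambda>e. ell \<beta>1 \<kappa> d (w e)) + (ell \<beta>1 \<beta>2 \<gamma> u - ell \<beta>1 \<kappa> d u)"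
proof -
  let ?Y = "avg2 V (\<lambda>e. w e ^ d)"
  have \<gamma>0: "\<gamma> > 0" using card_edges_pos[OF H d] \<alpha> \<gamma> by simp
  have Y: "0 \<le> ?Y" using w by (intro avg2_nonneg) auto
  have "wdens H V w powr \<alpha> \<le> ?Y powr (\<gamma> / d)"
    using wdens_powr_le[OF H d \<alpha> V, of w] w \<gamma> by simp
  also have "\<dots> \<le> (u ^ d) powr (\<gamma> / d) + \<gamma> / d * (u ^ d) powr (\<gamma> / d - 1) * (?Y - u ^ d)"
    using \<gamma>0 \<gamma> d u Y by (intro powr_tangent_concave) auto
  also have "(u ^ d) powr (\<gamma> / d) = u powr \<gamma>" using power_powr_divide[of u d \<gamma>] u d \<gamma>0 by simp
  also have "(u ^ d) powr (\<gamma> / d - 1) = u powr (\<gamma> - d)"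
    using power_powr_divide[of u d "\<gamma> - d"] u d \<gamma> by (simp add: diff_divide_distrib)
  finally have "\<beta>2 * wdens H V w powr \<alpha> \<le> \<beta>2 * (u powr \<gamma> + \<gamma> / d * u powr (\<gamma> - d) * (?Y - u ^ d))"
    using \<beta>2 by (intro mult_left_mono) auto
  then have "\<beta>2 * wdens H V w powr \<alpha> \<le> \<beta>2 * u powr \<gamma> + \<kappa> * ?Y - \<kappa> * u ^ d"
  proof -
    have "b * (a + g * p * (Y - t)) = b * a + b * g * p * Y - b * g * p * t" for a b g p Y t :: real by algebra
    from this[of \<beta>2 "u powr \<gamma>" "\<gamma> / d" "u powr (\<gamma> - d)" ?Y "u ^ d"]
    show "\<beta>2 * wdens H V w powr \<alpha> \<le> \<beta>2 * (u powr \<gamma> + \<gamma> / d * u powr (\<gamma> - d) * (?Y - u ^ d)) \<Longrightarrow> ?thesis"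
      unfolding \<kappa> by simp
  qed
  moreover have "?Y = avg2 V (\<lambda>e. w e powr d)"
  proof (intro avg2_cong)
    fix x y show "w {x, y} ^ d = w {x, y} powr d"
      using w[of "{x, y}"] d by (cases "w {x, y} = 0") (auto simp: powr_realpow)
  qed
  ultimately show ?thesis
    unfolding free_energy_def avg2_ell using u by (simp add: ell_def powr_realpow)
qed

text \<open>By compactness \<Lambda> - L has a positive lower bound \<rho> away from u1 and u2, and
  distances in [0, 1] are at most 1. The affine form of the result can be averaged over all pairs
  without isolating exceptional ones.\<close>

lemma maximizer_gap:
  fixes L :: "real \<Rightarrow> real"
  assumes cont: "continuous_on {0..1} L" and max: "\<And>x. 0 \<le> x \<Longrightarrow> x \<le> 1 \<Longrightarrow> L x \<le> \<Lambda>"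
    and only: "\<And>x. 0 \<le> x \<Longrightarrow> x \<le> 1 \<Longrightarrow> L x = \<Lambda> \<Longrightarrow> x = u1 \<or> x = u2"
    and u: "0 \<le> u1" "u1 \<le> 1" "0 \<le> u2" "u2 \<le> 1" and \<epsilon>: "\<epsilon> > 0"
  shows "\<exists>\<rho>>0. \<forall>x\<in>{0..1}. min \<bar>x - u1\<bar> \<bar>x - u2\<bar> \<le> \<epsilon> + (\<Lambda> - L x) / \<rho>"
proof -
  define C where "C = {x \<in> {0..1}. \<epsilon> \<le> min \<bar>x - u1\<bar> \<bar>x - u2\<bar>}"
  have "compact C"
  proof -
    have "closed {x. \<epsilon> \<le> min \<bar>x - u1\<bar> \<bar>x - u2\<bar>}" by (intro closed_Collect_le continuous_intros)
    moreover have "C = {0..1} \<inter> {x. \<epsilon> \<le> min \<bar>x - u1\<bar> \<bar>x - u2\<bar>}" by (auto simp: C_def)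
    ultimately show ?thesis by (simp add: compact_Int_closed)
  qed
  have "\<exists>\<rho>>0. \<forall>x\<in>C. \<rho> \<le> \<Lambda> - L x"
  proof (cases "C = {}")
    case True
    then show ?thesis by (intro exI[of _ 1]) auto
  next
    case False
    have "continuous_on C L" using cont by (rule continuous_on_subset) (auto simp: C_def)
    then obtain c where c: "c \<in> C" "\<forall>x\<in>C. L x \<le> L c"
      using continuous_attains_sup[OF \<open>compact C\<close> False] by blast
    have "L c \<noteq> \<Lambda>" using c(1) only[of c] \<epsilon> by (auto simp: C_def)
    then have "L c < \<Lambda>" using max[of c] c(1) by (auto simp: C_def less_le)
    then show ?thesis using c(2) by (intro exI[of _ "\<Lambda> - L c"]) auto
  qed
  then obtain \<rho> where \<rho>: "\<rho> > 0" "\<forall>x\<in>C. \<rho> \<le> \<Lambda> - L x" by blast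
  show ?thesis
  proof (intro exI[of _ \<rho>] conjI ballI \<rho>(1))
    fix x :: real assume "x \<in> {0..1}"
    then have x: "0 \<le> x" "x \<le> 1" by auto
    have nn: "0 \<le> (\<Lambda> - L x) / \<rho>" using max[OF x] \<rho>(1) by simp
    show "min \<bar>x - u1\<bar> \<bar>x - u2\<bar> \<le> \<epsilon> + (\<Lambda> - L x) / \<rho>"
    proof (cases "x \<in> C")
      case True
      then have "1 \<le> (\<Lambda> - L x) / \<rho>" using \<rho> by (simp add: le_divide_eq)
      moreover have "min \<bar>x - u1\<bar> \<bar>x - u2\<bar> \<le> 1" using x u by (auto simp: min_def abs_if)
      ultimately show ?thesis using \<epsilon> by linarith
    next
      case False
      then have "min \<bar>x - u1\<bar> \<bar>x - u2\<bar> < \<epsilon>" using x by (auto simp: C_def not_le)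
      then show ?thesis using nn by linarith
    qed
  qed
qed

subsection \<open>Concentration near the phases\<close>

text \<open>Stability in mean distance, with \<xi> independent of n. A single phase is expressed by
  u1 = u2.\<close>

definition phase_stable :: "'v graph \<Rightarrow> real \<Rightarrow> real \<Rightarrow> real \<Rightarrow> real \<Rightarrow> real \<Rightarrow> real \<Rightarrow> bool" where
  "phase_stable H \<alpha> \<beta>1 \<beta>2 \<Lambda> u1 u2 \<longleftrightarrow> (\<forall>\<epsilon>>0. \<exists>\<xi>>0. \<forall>n\<ge>1. \<forall>w :: nat set \<Rightarrow> real.
     (\<forall>s. 0 \<le> w s \<and> w s \<le> 1) \<longrightarrow> \<Lambda> - \<xi> \<le> free_energy H \<alpha> \<beta>1 \<beta>2 {1..n} w
     \<longrightarrow> avg2 {1..n} (\<lambda>e. \<bar>w e - u1\<bar>) \<le> \<epsilon> \<or> avg2 {1..n} (\<lambda>e. \<bar>w e - u2\<bar>) \<le> \<epsilon>)"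

lemma phase_stable_single:
  fixes L :: "real \<Rightarrow> real"
  assumes cont: "continuous_on {0..1} L" and max: "\<And>x. 0 \<le> x \<Longrightarrow> x \<le> 1 \<Longrightarrow> L x \<le> \<Lambda>"
    and only: "\<And>x. 0 \<le> x \<Longrightarrow> x \<le> 1 \<Longrightarrow> L x = \<Lambda> \<Longrightarrow> x = u" and u: "0 \<le> u" "u \<le> 1"
    and le: "\<And>n w. n \<ge> 1 \<Longrightarrow> (\<And>s. 0 \<le> w s \<and> w s \<le> 1) \<Longrightarrow> free_energy H \<alpha> \<beta>1 \<beta>2 {1..n::nat} w \<le> avg2 {1..n} (\<lambda>e. L (w e))"
  shows "phase_stable H \<alpha> \<beta>1 \<beta>2 \<Lambda> u u"
  unfolding phase_stable_def
proof (intro allI impI)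
  fix \<epsilon> :: real assume \<epsilon>: "\<epsilon> > 0"
  have "\<exists>\<rho>>0. \<forall>x\<in>{0..1}. min \<bar>x - u\<bar> \<bar>x - u\<bar> \<le> \<epsilon> / 2 + (\<Lambda> - L x) / \<rho>"
  proof (rule maximizer_gap[OF cont])
    show "L x \<le> \<Lambda>" if "0 \<le> x" "x \<le> 1" for x by (rule max[OF that])
    show "x = u \<or> x = u" if "0 \<le> x" "x \<le> 1" "L x = \<Lambda>" for x using only[OF that] by simp
  qed (use u \<epsilon> in auto)
  then obtain \<rho> where \<rho>: "\<rho> > 0"
    "\<forall>x\<in>{0..1}. min \<bar>x - u\<bar> \<bar>x - u\<bar> \<le> \<epsilon> / 2 + (\<Lambda> - L x) / \<rho>" by blast
  show "\<exists>\<xi>>0. \<forall>n\<ge>1. \<forall>w :: nat set \<Rightarrow> real.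
     (\<forall>s. 0 \<le> w s \<and> w s \<le> 1) \<longrightarrow> \<Lambda> - \<xi> \<le> free_energy H \<alpha> \<beta>1 \<beta>2 {1..n} w
     \<longrightarrow> avg2 {1..n} (\<lambda>e. \<bar>w e - u\<bar>) \<le> \<epsilon> \<or> avg2 {1..n} (\<lambda>e. \<bar>w e - u\<bar>) \<le> \<epsilon>"
  proof (rule exI[of _ "\<rho> * \<epsilon> / 2"], intro conjI allI impI)
    show "0 < \<rho> * \<epsilon> / 2" using \<rho> \<epsilon> by simp
    fix n :: nat and w :: "nat set \<Rightarrow> real"
    assume n: "1 \<le> n" and w: "\<forall>s. 0 \<le> w s \<and> w s \<le> 1" and fe: "\<Lambda> - \<rho> * \<epsilon> / 2 \<le> free_energy H \<alpha> \<beta>1 \<beta>2 {1..n} w"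
    have V: "finite {1..n}" "{1..n} \<noteq> {}" using n by auto
    have "avg2 {1..n} (\<lambda>e. \<bar>w e - u\<bar>) \<le> avg2 {1..n} (\<lambda>e. \<epsilon> / 2 + (1 / \<rho>) * (\<Lambda> - L (w e)))"
      using \<rho>(2) w by (intro avg2_mono) (simp add: mult.commute)
    also have "\<dots> = \<epsilon> / 2 + (1 / \<rho>) * (\<Lambda> - avg2 {1..n} (\<lambda>e. L (w e)))"
      by (simp only: avg2_add avg2_cmult avg2_diff avg2_const[OF V])
    also have "\<dots> \<le> \<epsilon> / 2 + (1 / \<rho>) * (\<rho> * \<epsilon> / 2)"
      using le[OF n, of w] w fe \<rho>(1) by (intro add_left_mono mult_left_mono) auto
    also have "\<dots> = \<epsilon>" using \<rho>(1) by simp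
    finally show "avg2 {1..n} (\<lambda>e. \<bar>w e - u\<bar>) \<le> \<epsilon> \<or> avg2 {1..n} (\<lambda>e. \<bar>w e - u\<bar>) \<le> \<epsilon>" by simp
  qed
qed

lemma maximizer_only:
  assumes "is_maximizer (ell \<beta>1 \<kappa> \<gamma>) u" "0 \<le> x" "x \<le> 1" "ell \<beta>1 \<kappa> \<gamma> x = ell \<beta>1 \<kappa> \<gamma> u"
    and "0 < \<gamma>" "0 < \<kappa>"
  shows "is_maximizer (ell \<beta>1 \<kappa> \<gamma>) x"
  using assms by (intro ell_max_interior ballI) (auto simp: is_maximizer_def)

text \<open>The slack \<xi> bounds the loss in \<open>ell\<close> and the loss in Finner's
  inequality separately, as both are nonnegative. The first makes w close to its rounding R to the
  nearer maximizer; R then inherits a small Finner deficit by continuity, and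
  \<open>two_valued_stability\<close> applies to R.\<close>

lemma phase_stable_double:
  fixes H :: "'v graph"
  assumes H: "simple_graph H" "regular_graph d H" "verts H \<noteq> {}" and d: "d \<ge> 2" and \<alpha>: "\<alpha> > 0" and \<beta>2: "\<beta>2 > 0"
    and \<gamma>: "\<gamma> = real (card (edges H)) * \<alpha>" "\<gamma> \<ge> d"
    and u: "0 < u1" "u1 < u2" "u2 < 1" 
    and max: "\<And>x. 0 \<le> x \<Longrightarrow> x \<le> 1 \<Longrightarrow> ell \<beta>1 \<beta>2 \<gamma> x \<le> \<Lambda>"
    and only: "\<And>x. 0 \<le> x \<Longrightarrow> x \<le> 1 \<Longrightarrow> ell \<beta>1 \<beta>2 \<gamma> x = \<Lambda> \<Longrightarrow> x = u1 \<or> x = u2"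
  shows "phase_stable H \<alpha> \<beta>1 \<beta>2 \<Lambda> u1 u2"
  unfolding phase_stable_def
proof (intro allI impI)
  fix \<epsilon> :: real assume \<epsilon>: "\<epsilon> > 0"
  let ?e = "card (edges H)" and ?L = "ell \<beta>1 \<beta>2 \<gamma>"
  have d0: "d > 0" using d by simp
  have e0: "?e > 0" by (rule card_edges_pos[OF H d0])
  have \<gamma>0: "\<gamma> > 0" using e0 \<alpha> \<gamma> by simp
  obtain \<xi>1 where \<xi>1: "\<xi>1 > 0"
    "\<And>(V :: nat set) R. \<lbrakk>finite V; V \<noteq> {}; \<And>s. R s = u1 \<or> R s = u2;
        root d (avg2 V (\<lambda>e. R e ^ d)) ^ ?e - wdens H V R \<le> \<xi>1\<rbrakk>
      \<Longrightarrow> avg2 V (\<lambda>e. \<bar>R e - u1\<bar>) \<le> \<epsilon> / 2 \<or> avg2 V (\<lambda>e. \<bar>R e - u2\<bar>) \<le> \<epsilon> / 2"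
    using two_valued_stability[OF H d u(1,2) less_imp_le[OF u(3)] half_gt_zero[OF \<epsilon>], where ?'w = nat] by blast
  \<comment> \<open>The Finner deficit allowed for R, measured in \<alpha>-th powers. One third is
    spent on the slack of w, and one third each on the change of the density and of the norm when w
    is replaced by R.\<close>
  obtain \<kappa>1 where \<kappa>1: "\<kappa>1 > 0"
    "\<And>s t. \<lbrakk>0 \<le> s; s \<le> 1; 0 \<le> t; t \<le> 1; \<bar>s - t\<bar> \<le> \<kappa>1\<rbrakk> \<Longrightarrow> \<bar>s powr (1 / \<alpha>) - t powr (1 / \<alpha>)\<bar> \<le> \<xi>1"
    using powr_modulus[of "1 / \<alpha>" \<xi>1] \<alpha> \<xi>1(1) by (metis zero_less_divide_1_iff)
  obtain \<kappa>2 where \<kappa>2: "\<kappa>2 > 0"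
    "\<And>s t. \<lbrakk>0 \<le> s; s \<le> 1; 0 \<le> t; t \<le> 1; \<bar>s - t\<bar> \<le> \<kappa>2\<rbrakk> \<Longrightarrow> \<bar>s powr \<alpha> - t powr \<alpha>\<bar> \<le> \<kappa>1 / 3"
    using powr_modulus[of \<alpha> "\<kappa>1 / 3"] \<alpha> \<kappa>1(1) by (metis zero_less_divide_iff zero_less_numeral)
  obtain \<kappa>3 where \<kappa>3: "\<kappa>3 > 0"
    "\<And>s t. \<lbrakk>0 \<le> s; s \<le> 1; 0 \<le> t; t \<le> 1; \<bar>s - t\<bar> \<le> \<kappa>3\<rbrakk> \<Longrightarrow> \<bar>s powr (\<gamma> / d) - t powr (\<gamma> / d)\<bar> \<le> \<kappa>1 / 3"
    using powr_modulus[of "\<gamma> / d" "\<kappa>1 / 3"] \<gamma>0 d0 \<kappa>1(1) by (metis of_nat_0_less_iff zero_less_divide_iff zero_less_numeral)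
  define \<eta> where "\<eta> = min (\<epsilon> / 2) (min (\<kappa>2 / ?e) (\<kappa>3 / d))"
  have \<eta>: "\<eta> > 0" "\<eta> \<le> \<epsilon> / 2" "?e * \<eta> \<le> \<kappa>2" "d * \<eta> \<le> \<kappa>3"
  proof -
    show "\<eta> > 0" using \<epsilon> \<kappa>2(1) \<kappa>3(1) e0 d0 by (simp add: \<eta>_def)
    show "\<eta> \<le> \<epsilon> / 2" unfolding \<eta>_def by (rule min.cobounded1)
    have "\<eta> \<le> \<kappa>2 / ?e" "\<eta> \<le> \<kappa>3 / d" by (auto simp: \<eta>_def)
    then show "?e * \<eta> \<le> \<kappa>2" "d * \<eta> \<le> \<kappa>3" using e0 d0 by (auto simp: field_simps)
  qed
  have "\<exists>\<rho>>0. \<forall>x\<in>{0..1}. min \<bar>x - u1\<bar> \<bar>x - u2\<bar> \<le> \<eta> / 2 + (\<Lambda> - ?L x) / \<rho>"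
  proof (rule maximizer_gap[OF continuous_on_ell[OF \<gamma>0]])
    show "?L x \<le> \<Lambda>" if "0 \<le> x" "x \<le> 1" for x by (rule max[OF that])
    show "x = u1 \<or> x = u2" if "0 \<le> x" "x \<le> 1" "?L x = \<Lambda>" for x by (rule only[OF that])
  qed (use u \<eta>(1) in auto)
  then obtain \<rho> where \<rho>: "\<rho> > 0"
    "\<forall>x\<in>{0..1}. min \<bar>x - u1\<bar> \<bar>x - u2\<bar> \<le> \<eta> / 2 + (\<Lambda> - ?L x) / \<rho>" by blast
  define \<xi> where "\<xi> = min (\<rho> * \<eta> / 2) (\<beta>2 * \<kappa>1 / 3)"
  have \<xi>: "\<xi> > 0" "\<xi> \<le> \<rho> * \<eta> / 2" "\<xi> \<le> \<beta>2 * \<kappa>1 / 3"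
  proof -
    show "\<xi> > 0" using \<rho>(1) \<eta>(1) \<beta>2 \<kappa>1(1) by (simp add: \<xi>_def)
    show "\<xi> \<le> \<rho> * \<eta> / 2" "\<xi> \<le> \<beta>2 * \<kappa>1 / 3" unfolding \<xi>_def by (rule min.cobounded1, rule min.cobounded2)
  qed
  show "\<exists>\<xi>>0. \<forall>n\<ge>1. \<forall>w :: nat set \<Rightarrow> real.
     (\<forall>s. 0 \<le> w s \<and> w s \<le> 1) \<longrightarrow> \<Lambda> - \<xi> \<le> free_energy H \<alpha> \<beta>1 \<beta>2 {1..n} w
     \<longrightarrow> avg2 {1..n} (\<lambda>e. \<bar>w e - u1\<bar>) \<le> \<epsilon> \<or> avg2 {1..n} (\<lambda>e. \<bar>w e - u2\<bar>) \<le> \<epsilon>"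
  proof (rule exI[of _ \<xi>], intro conjI allI impI)
    show "0 < \<xi>" by (rule \<xi>(1))
    fix n :: nat and w :: "nat set \<Rightarrow> real"
    let ?V = "{1..n}"
    assume n: "1 \<le> n" and w': "\<forall>s. 0 \<le> w s \<and> w s \<le> 1" and fe: "\<Lambda> - \<xi> \<le> free_energy H \<alpha> \<beta>1 \<beta>2 ?V w"
    have V: "finite ?V" "?V \<noteq> {}" using n by auto
    have w: "0 \<le> w s \<and> w s \<le> 1" for s using w' by blast
    let ?Yw = "avg2 ?V (\<lambda>e. w e ^ d)"
    have le: "free_energy H \<alpha> \<beta>1 \<beta>2 ?V w \<le> avg2 ?V (\<lambda>e. ?L (w e)) - \<beta>2 * (?Yw powr (\<gamma> / d) - wdens H ?V w powr \<alpha>)"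
      by (rule free_energy_le_ell_large[OF H d0 \<alpha> V w less_imp_le[OF \<beta>2] \<gamma>])
    have def: "wdens H ?V w powr \<alpha> \<le> ?Yw powr (\<gamma> / d)"
      using wdens_powr_le[OF H d0 \<alpha> V w] \<gamma>(1) by simp
    have Lle: "avg2 ?V (\<lambda>e. ?L (w e)) \<le> \<Lambda>"
    proof -
      have "avg2 ?V (\<lambda>e. ?L (w e)) \<le> avg2 ?V (\<lambda>e. \<Lambda>)" using w by (intro avg2_mono max) auto
      then show ?thesis unfolding avg2_const[OF V] .
    qed
    have "\<beta>2 * (?Yw powr (\<gamma> / d) - wdens H ?V w powr \<alpha>) \<le> \<beta>2 * (\<kappa>1 / 3)" using le Lle fe \<xi>(3) by simp
    then have d1: "?Yw powr (\<gamma> / d) - wdens H ?V w powr \<alpha> \<le> \<kappa>1 / 3" using \<beta>2 by simp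
    have "0 \<le> \<beta>2 * (?Yw powr (\<gamma> / d) - wdens H ?V w powr \<alpha>)" using def \<beta>2 by simp
    then have Lge: "\<Lambda> - \<xi> \<le> avg2 ?V (\<lambda>e. ?L (w e))" using le fe by simp
    define R where "R s = (if \<bar>w s - u1\<bar> \<le> \<bar>w s - u2\<bar> then u1 else u2)" for s
    have R: "R s = u1 \<or> R s = u2" for s by (simp add: R_def)
    have R01: "0 \<le> R s \<and> R s \<le> 1" for s using R[of s] u by auto
    have wR: "\<bar>w s - R s\<bar> = min \<bar>w s - u1\<bar> \<bar>w s - u2\<bar>" for s by (simp add: R_def)
    have close: "avg2 ?V (\<lambda>e. \<bar>w e - R e\<bar>) \<le> \<eta>"
    proof -
      have "avg2 ?V (\<lambda>e. \<bar>w e - R e\<bar>) \<le> avg2 ?V (\<lambda>e. \<eta> / 2 + (1 / \<rho>) * (\<Lambda> - ?L (w e)))"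
        unfolding wR using \<rho>(2) w by (intro avg2_mono) simp
      also have "\<dots> = \<eta> / 2 + (1 / \<rho>) * (\<Lambda> - avg2 ?V (\<lambda>e. ?L (w e)))"
        by (simp only: avg2_add avg2_cmult avg2_diff avg2_const[OF V])
      also have "\<dots> \<le> \<eta> / 2 + (1 / \<rho>) * (\<rho> * \<eta> / 2)"
        using Lge \<xi>(2) \<rho>(1) by (intro add_left_mono mult_left_mono) auto
      also have "\<dots> = \<eta>" using \<rho>(1) by simp
      finally show ?thesis .
    qed
    let ?YR = "avg2 ?V (\<lambda>e. R e ^ d)"
    have Y01: "0 \<le> ?Yw" "?Yw \<le> 1" "0 \<le> ?YR" "?YR \<le> 1"
      using w R01 by (auto intro!: avg2_nonneg avg2_le_1 power_le_one)
    have t01: "0 \<le> wdens H ?V w" "wdens H ?V w \<le> 1" "0 \<le> wdens H ?V R" "wdens H ?V R \<le> 1"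
      using wdens_bounds[OF H(1), of ?V w] wdens_bounds[OF H(1), of ?V R] w R01 by auto
    have "\<bar>wdens H ?V w - wdens H ?V R\<bar> \<le> ?e * avg2 ?V (\<lambda>e. \<bar>w e - R e\<bar>)"
      using w R01 by (intro counting_lemma[OF H(1) V cut_le_L1[OF V]]) auto
    also have "\<dots> \<le> ?e * \<eta>" using close by (intro mult_left_mono) auto
    finally have tt: "\<bar>wdens H ?V w powr \<alpha> - wdens H ?V R powr \<alpha>\<bar> \<le> \<kappa>1 / 3"
      using \<eta>(3) t01 by (intro \<kappa>2(2)) auto
    have pw: "\<bar>w s ^ d - R s ^ d\<bar> \<le> d * \<bar>w s - R s\<bar>" for s
      using power_diff_le[of "R s" "w s" d] power_diff_le[of "w s" "R s" d] w[of s] R01[of s] power_mono[of "R s" "w s" d] power_mono[of "w s" "R s" d]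
      by (cases "R s \<le> w s") auto
    have "\<bar>?Yw - ?YR\<bar> \<le> avg2 ?V (\<lambda>e. \<bar>w e ^ d - R e ^ d\<bar>)" unfolding avg2_diff[symmetric] by (rule avg2_abs)
    also have "\<dots> \<le> avg2 ?V (\<lambda>e. d * \<bar>w e - R e\<bar>)" by (intro avg2_mono pw)
    also have "\<dots> \<le> d * \<eta>" unfolding avg2_cmult using close by (intro mult_left_mono) auto
    finally have YY: "\<bar>?Yw powr (\<gamma> / d) - ?YR powr (\<gamma> / d)\<bar> \<le> \<kappa>1 / 3"
      using \<eta>(4) Y01 by (intro \<kappa>3(2)) auto
    let ?y = "root d ?YR ^ ?e"
    have y01: "0 \<le> ?y" "?y \<le> 1" using Y01 d0 by (auto intro!: power_le_one)
    have YRpos: "?YR > 0"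
    proof -
      have "u1 \<le> R s" for s using R[of s] u by auto
      then have "avg2 ?V (\<lambda>e. u1 ^ d) \<le> ?YR" using u by (intro avg2_mono power_mono) auto
      moreover have "0 < u1 ^ d" using u by simp
      ultimately show ?thesis unfolding avg2_const[OF V] by linarith
    qed
    have y\<alpha>: "?y powr \<alpha> = ?YR powr (\<gamma> / d)"
    proof -
      have "?y = (?YR powr (1 / d)) powr ?e"
        using YRpos d0 by (simp add: root_powr_inverse powr_realpow)
      then show ?thesis using \<gamma>(1) by (simp add: powr_powr)
    qed
    have deficit: "?y - wdens H ?V R \<le> \<xi>1"
    proof (cases "?y \<le> wdens H ?V R")
      case True
      then show ?thesis using \<xi>1(1) by simp
    next
      case False
      then have "wdens H ?V R powr \<alpha> \<le> ?y powr \<alpha>" using t01 \<alpha> by (intro powr_mono2) auto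
      moreover have "?y powr \<alpha> - wdens H ?V R powr \<alpha> \<le> \<kappa>1" using d1 tt YY y\<alpha> by linarith
      ultimately have "\<bar>?y powr \<alpha> - wdens H ?V R powr \<alpha>\<bar> \<le> \<kappa>1" by simp
      then have "\<bar>(?y powr \<alpha>) powr (1 / \<alpha>) - (wdens H ?V R powr \<alpha>) powr (1 / \<alpha>)\<bar> \<le> \<xi>1"
        using y01 t01 \<alpha> powr_mono2[of \<alpha> ?y 1] powr_mono2[of \<alpha> "wdens H ?V R" 1] by (intro \<kappa>1(2)) auto
      then show ?thesis using y01 t01 \<alpha> by (simp add: powr_powr)
    qed
    have fin: "avg2 ?V (\<lambda>e. \<bar>w e - v\<bar>) \<le> \<epsilon>" if "avg2 ?V (\<lambda>e. \<bar>R e - v\<bar>) \<le> \<epsilon> / 2" for v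
    proof -
      have "avg2 ?V (\<lambda>e. \<bar>w e - v\<bar>) \<le> avg2 ?V (\<lambda>e. \<bar>w e - R e\<bar> + \<bar>R e - v\<bar>)" by (intro avg2_mono) simp
      then show ?thesis using that close \<eta>(2) unfolding avg2_add by linarith
    qed
    show "avg2 ?V (\<lambda>e. \<bar>w e - u1\<bar>) \<le> \<epsilon> \<or> avg2 ?V (\<lambda>e. \<bar>w e - u2\<bar>) \<le> \<epsilon>"
      using \<xi>1(2)[OF V R deficit] fin by blast
  qed
qed

lemma ergm_Z_pos: "0 < ergm_Z H \<alpha> \<beta>1 \<beta>2 n"
proof -
  have "({1..n}, {}) \<in> labeled_graphs n" by (simp add: labeled_graphs_def simple_graph_def)
  then show ?thesis unfolding ergm_Z_def
    by (intro sum_pos finite_labeled_graphs) (auto simp: ergm_weight_def)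
qed

text \<open>Regularise G. The mean distance dominates the cut norm, so if G is far from both phases,
  its block densities are far from them in mean, and by \<open>phase_stable\<close> their free
  energy is at most \<Lambda> - \<xi>. The constant u, which achieves \<Lambda>, bounds the
  partition function from below.\<close>

lemma ergm_weight_far_from_phases:
  fixes H :: "'v graph"
  assumes H: "simple_graph H" and \<alpha>: "\<alpha> > 0" and \<beta>2: "\<beta>2 > 0"
    and u: "0 < u" "u < 1" and \<Lambda>: "\<Lambda> = ell \<beta>1 \<beta>2 (real (card (edges H)) * \<alpha>) u"
    and st: "phase_stable H \<alpha> \<beta>1 \<beta>2 \<Lambda> u1 u2" and \<epsilon>: "\<epsilon> > 0"
  shows "\<exists>c>0. \<exists>n0. \<forall>n\<ge>n0. (\<Sum>G\<in>{G \<in> labeled_graphs n. min (cut_dist G u1) (cut_dist G u2) > \<epsilon>}. ergm_weight H \<alpha> \<beta>1 \<beta>2 n G)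
      \<le> exp (- c * (real n)\<^sup>2) * ergm_Z H \<alpha> \<beta>1 \<beta>2 n"
proof -
  have "\<epsilon> / 2 > 0" using \<epsilon> by simp
  then obtain \<xi> where \<xi>: "\<xi> > 0" "\<And>n w. \<lbrakk>n \<ge> 1; \<forall>s. 0 \<le> w s \<and> w s \<le> 1; \<Lambda> - \<xi> \<le> free_energy H \<alpha> \<beta>1 \<beta>2 {1..n::nat} w\<rbrakk>
      \<Longrightarrow> avg2 {1..n} (\<lambda>e. \<bar>w e - u1\<bar>) \<le> \<epsilon> / 2 \<or> avg2 {1..n} (\<lambda>e. \<bar>w e - u2\<bar>) \<le> \<epsilon> / 2"
    using st unfolding phase_stable_def by metis
  \<comment> \<open>The upper and the lower bound lose \<xi> / 4 each; the remaining \<xi> / 2,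
    times \<open>n choose 2\<close>, which is at least \<open>n\<^sup>2 / 4\<close>, gives the rate
    \<xi> / 8.\<close>
  have \<zeta>: "\<xi> / 4 > 0" using \<xi>(1) by simp
  obtain \<eta>0 where \<eta>0: "\<eta>0 > 0" and up: "\<forall>\<eta>\<ge>0. \<eta> \<le> \<eta>0 \<longrightarrow> (\<forall>K. \<exists>n0. \<forall>n\<ge>n0. \<forall>B\<subseteq>labeled_graphs n. \<forall>\<Lambda>.
      (\<forall>G\<in>B. \<exists>c \<in> {1..n} \<rightarrow>\<^sub>E {..<K}. 
        cut_le {1..n} (\<lambda>e. adj G e - block_avg {1..n} c (adj G) e) \<eta>
        \<and> free_energy H \<alpha> \<beta>1 \<beta>2 {1..n} (block_avg {1..n} c (adj G)) \<le> \<Lambda>)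
      \<longrightarrow> (\<Sum>G\<in>B. ergm_weight H \<alpha> \<beta>1 \<beta>2 n G) \<le> exp (real (n choose 2) * (\<Lambda> + \<xi> / 4)))"
    using ergm_weight_sum_upper_asymptotic[OF H less_imp_le[OF \<beta>2] \<alpha> \<zeta>, of \<beta>1] by blast
  define \<eta> where "\<eta> = min \<eta>0 (\<epsilon> / 2)"
  have \<eta>: "\<eta> > 0" "\<eta> \<le> \<eta>0" "\<eta> \<le> \<epsilon> / 2"
    unfolding \<eta>_def using \<eta>0 \<epsilon> by (simp_all only: min.cobounded1 min.cobounded2 min_less_iff_conj half_gt_zero simp_thms)
  obtain M :: nat where M: "M > 0" "1 / sqrt (real M) \<le> \<eta>"
  proof -
    obtain M :: nat where M: "1 / \<eta>\<^sup>2 < real M" using reals_Archimedean2 by blast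
    have "0 < 1 / \<eta>\<^sup>2" using \<eta> by simp
    then have M0: "0 < real M" using M by linarith
    have "(1 / \<eta>)\<^sup>2 \<le> real M" using M by (simp add: power_divide)
    then have "1 / \<eta> \<le> sqrt (real M)" by (rule real_le_rsqrt)
    then have "1 / sqrt (real M) \<le> \<eta>" using \<eta> M0 by (simp add: field_simps)
    then show ?thesis using that M0 by simp
  qed
  obtain n1 where n1: "\<forall>n\<ge>n1. \<forall>B\<subseteq>labeled_graphs n. \<forall>\<Lambda>.
      (\<forall>G\<in>B. \<exists>c \<in> {1..n} \<rightarrow>\<^sub>E {..<4 ^ M}. 
        cut_le {1..n} (\<lambda>e. adj G e - block_avg {1..n} c (adj G) e) \<eta>
        \<and> free_energy H \<alpha> \<beta>1 \<beta>2 {1..n} (block_avg {1..n} c (adj G)) \<le> \<Lambda>)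
      \<longrightarrow> (\<Sum>G\<in>B. ergm_weight H \<alpha> \<beta>1 \<beta>2 n G) \<le> exp (real (n choose 2) * (\<Lambda> + \<xi> / 4))"
    using up \<eta> by (meson less_imp_le)
  define \<rho> where "\<rho> = min u (1 - u)"
  have \<rho>: "\<rho> > 0" "\<rho> \<le> u" "u \<le> 1 - \<rho>" using u unfolding \<rho>_def by linarith+
  obtain n2 where n2: "\<forall>n\<ge>n2. \<forall>(c :: nat \<Rightarrow> nat) P. (\<forall>x\<in>{1..n}. c x < 1) \<longrightarrow> (\<forall>L. \<rho> \<le> P L \<and> P L \<le> 1 - \<rho>)
     \<longrightarrow> exp (real (n choose 2) * (free_energy H \<alpha> \<beta>1 \<beta>2 {1..n} (\<lambda>e. P (c ` e)) - \<xi> / 4)) \<le> ergm_Z H \<alpha> \<beta>1 \<beta>2 n"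
    using ergm_Z_lower_asymptotic[OF H less_imp_le[OF \<beta>2] \<alpha> \<zeta> \<rho>(1), of 1 \<beta>1] by blast
  show ?thesis
  proof (rule exI[of _ "\<xi> / 8"], intro conjI exI[of _ "max (max n1 n2) 2"] allI impI)
    show "0 < \<xi> / 8" using \<xi>(1) by simp
    fix n assume n: "max (max n1 n2) 2 \<le> n"
    let ?V = "{1..n}" and ?N = "real (n choose 2)"
    have V: "finite ?V" "?V \<noteq> {}" using n by auto
    let ?B = "{G \<in> labeled_graphs n. min (cut_dist G u1) (cut_dist G u2) > \<epsilon>}"
    have Bsub: "?B \<subseteq> labeled_graphs n" by auto
    have "(\<Sum>G\<in>?B. ergm_weight H \<alpha> \<beta>1 \<beta>2 n G) \<le> exp (?N * (\<Lambda> - \<xi> + \<xi> / 4))"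
    proof (rule n1[rule_format, OF _ Bsub])
      show "n1 \<le> n" using n by simp
      fix G assume G: "G \<in> ?B"
      have Gl: "G \<in> labeled_graphs n" and far: "cut_dist G u1 > \<epsilon>" "cut_dist G u2 > \<epsilon>" using G by auto
      have vG: "verts G = ?V" using labeled_graphsD[OF Gl] by simp
      obtain c where c: "c \<in> ?V \<rightarrow>\<^sub>E {..<4 ^ M}" "cut_le ?V (\<lambda>e. adj G e - block_avg ?V c (adj G) e) (1 / sqrt (real M))"
        using weak_regularity[OF V M(1), of "adj G"] adj_bounds[of G] by blast
      define w where "w = block_avg ?V c (adj G)"
      have cut: "cut_le ?V (\<lambda>e. adj G e - w e) \<eta>" using cut_le_mono[OF c(2) M(2)] by (simp add: w_def)
      have w01: "\<forall>s. 0 \<le> w s \<and> w s \<le> 1"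
        unfolding w_def using block_avg_bounds[of ?V "adj G" c] adj_bounds[of G] by blast
      have nofar: "cut_dist G v \<le> \<epsilon>" if "avg2 ?V (\<lambda>e. \<bar>w e - v\<bar>) \<le> \<epsilon> / 2" for v
      proof -
        have "cut_le ?V (\<lambda>e. w e - v) (\<epsilon> / 2)" by (rule cut_le_mono[OF cut_le_L1[OF V] that])
        from cut_le_add[OF cut this] have "cut_le ?V (\<lambda>e. adj G e - v) (\<eta> + \<epsilon> / 2)" by simp
        then have "cut_le ?V (\<lambda>e. adj G e - v) \<epsilon>" by (rule cut_le_mono) (use \<eta>(3) in simp)
        then show ?thesis using cut_dist_le_iff[of G v \<epsilon>] V vG by simp
      qed
      have "free_energy H \<alpha> \<beta>1 \<beta>2 ?V w \<le> \<Lambda> - \<xi>"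
      proof (rule ccontr)
        assume "\<not> ?thesis"
        then have "avg2 ?V (\<lambda>e. \<bar>w e - u1\<bar>) \<le> \<epsilon> / 2 \<or> avg2 ?V (\<lambda>e. \<bar>w e - u2\<bar>) \<le> \<epsilon> / 2"
          using n w01 by (intro \<xi>(2)) auto
        then show False using nofar far by fastforce
      qed
      then show "\<exists>c \<in> ?V \<rightarrow>\<^sub>E {..<4 ^ M}. cut_le ?V (\<lambda>e. adj G e - block_avg ?V c (adj G) e) \<eta>
        \<and> free_energy H \<alpha> \<beta>1 \<beta>2 ?V (block_avg ?V c (adj G)) \<le> \<Lambda> - \<xi>"
        using c(1) cut unfolding w_def by blast
    qed
    also have "\<dots> = exp (- ?N * (\<xi> / 2)) * exp (?N * (\<Lambda> - \<xi> / 4))"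
      by (simp add: exp_add[symmetric] algebra_simps)
    also have "\<dots> \<le> exp (- (\<xi> / 8) * (real n)\<^sup>2) * ergm_Z H \<alpha> \<beta>1 \<beta>2 n"
    proof (rule mult_mono)
      have "(real n)\<^sup>2 / 4 \<le> ?N"
      proof -
        have "2 * real n \<le> real n * real n" using n by (intro mult_right_mono) auto
        then show ?thesis by (simp add: real_choose_2 power2_eq_square)
      qed
      then have "(\<xi> / 2) * ((real n)\<^sup>2 / 4) \<le> (\<xi> / 2) * ?N" using \<xi>(1) by (intro mult_left_mono) auto
      then show "exp (- ?N * (\<xi> / 2)) \<le> exp (- (\<xi> / 8) * (real n)\<^sup>2)" by (simp add: mult.commute)
      have "exp (?N * (free_energy H \<alpha> \<beta>1 \<beta>2 ?V (\<lambda>e. u) - \<xi> / 4)) \<le> ergm_Z H \<alpha> \<beta>1 \<beta>2 n"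
        using n2[rule_format, of n "\<lambda>x. 0" "\<lambda>L. u"] n \<rho> by simp
      then show "exp (?N * (\<Lambda> - \<xi> / 4)) \<le> ergm_Z H \<alpha> \<beta>1 \<beta>2 n"
        using free_energy_const[OF H V u(1), of \<alpha> \<beta>1 \<beta>2] \<Lambda> by simp
    qed (auto simp: less_imp_le[OF ergm_Z_pos])
    finally show "(\<Sum>G\<in>?B. ergm_weight H \<alpha> \<beta>1 \<beta>2 n G) \<le> exp (- (\<xi> / 8) * (real n)\<^sup>2) * ergm_Z H \<alpha> \<beta>1 \<beta>2 n" .
  qed
qed

section \<open>From Gibbs weights to almost sure convergence\<close>

lemma ergm_measure:
  assumes "is_ergm H \<alpha> \<beta>1 \<beta>2 M G" "n \<ge> 1"
  shows "{\<omega> \<in> space M. P (G n \<omega>)} \<in> sets M"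
    and "measure M {\<omega> \<in> space M. P (G n \<omega>)}
      = (\<Sum>g\<in>{g \<in> labeled_graphs n. P g}. ergm_weight H \<alpha> \<beta>1 \<beta>2 n g) / ergm_Z H \<alpha> \<beta>1 \<beta>2 n"
proof -
  let ?A = "{g \<in> labeled_graphs n. P g}" and ?pr = "ergm_prob H \<alpha> \<beta>1 \<beta>2 n"
  have D: "distributed M (count_space (labeled_graphs n)) (G n) (\<lambda>g. ennreal (?pr g))"
    using assms by (auto simp: is_ergm_def)
  have meas: "G n \<in> measurable M (count_space (labeled_graphs n))" using D by (rule distributed_measurable)
  have eq: "{\<omega> \<in> space M. P (G n \<omega>)} = G n -` ?A \<inter> space M"
    using measurable_space[OF meas] by auto
  show "{\<omega> \<in> space M. P (G n \<omega>)} \<in> sets M" unfolding eq by (rule measurable_sets[OF meas]) auto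
  have pr0: "0 \<le> ?pr g" for g using ergm_Z_pos[of H \<alpha> \<beta>1 \<beta>2 n] by (simp add: ergm_prob_def ergm_weight_def)
  have "emeasure M {\<omega> \<in> space M. P (G n \<omega>)} = (\<integral>\<^sup>+g. ennreal (?pr g) * indicator ?A g \<partial>count_space (labeled_graphs n))"
    unfolding eq by (rule distributed_emeasure[OF D]) auto
  also have "\<dots> = (\<Sum>g\<in>labeled_graphs n. ennreal (?pr g) * indicator ?A g)"
    by (rule nn_integral_count_space_finite[OF finite_labeled_graphs])
  also have "\<dots> = (\<Sum>g\<in>?A. ennreal (?pr g))"
    using finite_labeled_graphs by (intro sum.mono_neutral_cong_right) auto
  also have "\<dots> = ennreal (\<Sum>g\<in>?A. ?pr g)" by (rule sum_ennreal) (rule pr0)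
  finally have "measure M {\<omega> \<in> space M. P (G n \<omega>)} = (\<Sum>g\<in>?A. ?pr g)"
    by (simp add: measure_def sum_nonneg pr0)
  then show "measure M {\<omega> \<in> space M. P (G n \<omega>)} = (\<Sum>g\<in>?A. ergm_weight H \<alpha> \<beta>1 \<beta>2 n g) / ergm_Z H \<alpha> \<beta>1 \<beta>2 n"
    by (simp add: ergm_prob_def sum_divide_distrib)
qed

lemma ergm_graph_in:
  assumes "is_ergm H \<alpha> \<beta>1 \<beta>2 M G" "n \<ge> 1" "\<omega> \<in> space M"
  shows "G n \<omega> \<in> labeled_graphs n"
proof -
  have "distributed M (count_space (labeled_graphs n)) (G n) (\<lambda>g. ennreal (ergm_prob H \<alpha> \<beta>1 \<beta>2 n g))"
    using assms by (auto simp: is_ergm_def)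
  from measurable_space[OF distributed_measurable[OF this] assms(3)] show ?thesis by simp
qed

lemma summable_exp_square:
  assumes "c > 0"
  shows "summable (\<lambda>n. exp (- c * (real n)\<^sup>2))"
proof (rule summable_comparison_test'[where N = 0])
  show "summable (\<lambda>n. exp (- c) ^ n)" using assms by (intro summable_geometric) simp
  fix n :: nat
  have "real n \<le> (real n)\<^sup>2" by (cases n) (auto simp: power2_eq_square)
  then have "c * real n \<le> c * (real n)\<^sup>2" using assms by (intro mult_left_mono) auto
  then show "norm (exp (- c * (real n)\<^sup>2)) \<le> exp (- c) ^ n"
    by (simp add: exp_of_nat_mult[symmetric] mult.commute)
qed

lemma ergm_AE_convergence:
  fixes H :: "'v graph" and M :: "'w measure"
  assumes H: "simple_graph H" and \<alpha>: "\<alpha> > 0" and \<beta>2: "\<beta>2 > 0"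
    and u: "0 < u" "u < 1" and \<Lambda>: "\<Lambda> = ell \<beta>1 \<beta>2 (real (card (edges H)) * \<alpha>) u"
    and st: "phase_stable H \<alpha> \<beta>1 \<beta>2 \<Lambda> u1 u2"
    and M: "is_ergm H \<alpha> \<beta>1 \<beta>2 M G"
  shows "AE \<omega> in M. (\<lambda>n. min (cut_dist (G n \<omega>) u1) (cut_dist (G n \<omega>) u2)) \<longlonglongrightarrow> 0"
proof -
  interpret prob_space M using M by (simp add: is_ergm_def)
  let ?h = "\<lambda>g. min (cut_dist g u1) (cut_dist g u2)"
  have far: "AE \<omega> in M. \<forall>\<^sub>F n in sequentially. n \<ge> 1 \<longrightarrow> ?h (G n \<omega>) \<le> \<epsilon>" if \<epsilon>: "\<epsilon> > 0" for \<epsilon>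
  proof -
    obtain c n0 where c: "c > 0" and n0: "\<forall>n\<ge>n0. (\<Sum>g\<in>{g \<in> labeled_graphs n. ?h g > \<epsilon>}. ergm_weight H \<alpha> \<beta>1 \<beta>2 n g)
      \<le> exp (- c * (real n)\<^sup>2) * ergm_Z H \<alpha> \<beta>1 \<beta>2 n"
      using ergm_weight_far_from_phases[OF H \<alpha> \<beta>2 u \<Lambda> st \<epsilon>] by blast
    \<comment> \<open>The law at n = 0 is unspecified, so the event there need not be measurable and
      is replaced by the empty set.\<close>
    define A where "A n = (if n = 0 then {} else {\<omega> \<in> space M. ?h (G n \<omega>) > \<epsilon>})" for n
    have sets: "A n \<in> sets M" for n
      using ergm_measure(1)[OF M, of n "\<lambda>g. ?h g > \<epsilon>"] by (cases "n = 0") (auto simp: A_def)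
    have bound: "measure M (A n) \<le> exp (- c * (real n)\<^sup>2)" if n: "n \<ge> n0" for n
    proof (cases "n = 0")
      case False
      then have "measure M (A n) = (\<Sum>g\<in>{g \<in> labeled_graphs n. ?h g > \<epsilon>}. ergm_weight H \<alpha> \<beta>1 \<beta>2 n g) / ergm_Z H \<alpha> \<beta>1 \<beta>2 n"
        unfolding A_def using ergm_measure(2)[OF M, of n "\<lambda>g. ?h g > \<epsilon>"] by simp
      then show ?thesis using n0[rule_format, OF n] ergm_Z_pos[of H \<alpha> \<beta>1 \<beta>2 n] by (simp add: divide_le_eq)
    qed (simp add: A_def)
    have "summable (\<lambda>n. measure M (A n))"
      by (rule summable_comparison_test'[OF summable_exp_square[OF c], of n0]) (use bound in auto)
    then have "AE \<omega> in M. \<forall>\<^sub>F n in sequentially. \<omega> \<in> space M - A n"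
      using sets by (intro borel_cantelli_AE1) (auto simp: emeasure_eq_measure)
    then show ?thesis
    proof (rule AE_mp, intro AE_I2 impI)
      fix \<omega> assume "\<omega> \<in> space M" "\<forall>\<^sub>F n in sequentially. \<omega> \<in> space M - A n"
      from this(2) show "\<forall>\<^sub>F n in sequentially. n \<ge> 1 \<longrightarrow> ?h (G n \<omega>) \<le> \<epsilon>"
        by eventually_elim (auto simp: A_def not_less split: if_splits)
    qed
  qed
  have "AE \<omega> in M. \<forall>k. \<forall>\<^sub>F n in sequentially. n \<ge> 1 \<longrightarrow> ?h (G n \<omega>) \<le> 1 / real (Suc k)"
    unfolding AE_all_countable by (intro allI far) simp
  then show ?thesis
  proof (rule AE_mp, intro AE_I2 impI)
    fix \<omega> assume \<omega>: "\<omega> \<in> space M" and ev: "\<forall>k. \<forall>\<^sub>F n in sequentially. n \<ge> 1 \<longrightarrow> ?h (G n \<omega>) \<le> 1 / real (Suc k)"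
    have nonneg: "0 \<le> ?h (G n \<omega>)" if "n \<ge> 1" for n
      using labeled_graphsD(2)[OF ergm_graph_in[OF M that \<omega>]] cut_dist_nonneg[of "G n \<omega>"] that by auto
    show "(\<lambda>n. ?h (G n \<omega>)) \<longlonglongrightarrow> 0"
    proof (rule tendstoI)
      fix e :: real assume "e > 0"
      then obtain k where k: "1 / real (Suc k) < e" using nat_approx_posE by blast
      have "\<forall>\<^sub>F n in sequentially. n \<ge> 1 \<longrightarrow> ?h (G n \<omega>) \<le> 1 / real (Suc k)" using ev by blast
      moreover have "\<forall>\<^sub>F n in sequentially. n \<ge> 1" by (rule eventually_ge_at_top)
      ultimately show "\<forall>\<^sub>F n in sequentially. dist (?h (G n \<omega>)) 0 < e"
      proof eventually_elim
        case (elim n)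
        then show ?case using nonneg[of n] k by (simp add: dist_real_def)
      qed
    qed
  qed
qed

subsection \<open>Symmetry breaking\<close>

lemma handshake:
  assumes "simple_graph H" "regular_graph d H"
  shows "card (verts H) * d = 2 * card (edges H)"
proof -
  note fin = simple_graph_finite[OF assms(1)]
  have "card (verts H) * d = (\<Sum>v\<in>verts H. card {e \<in> edges H. v \<in> e})"
    using assms(2) by (simp add: regular_graph_def)
  also have "\<dots> = (\<Sum>v\<in>verts H. \<Sum>e\<in>edges H. of_bool (v \<in> e))"
    using fin by (simp add: Int_def)
  also have "\<dots> = (\<Sum>e\<in>edges H. \<Sum>v\<in>verts H. of_bool (v \<in> e))" by (rule sum.swap)
  also have "\<dots> = (\<Sum>e\<in>edges H. 2)"
  proof (rule sum.cong[OF refl])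
    fix e assume "e \<in> edges H"
    then have "e \<subseteq> verts H" "card e = 2" using assms(1) by (auto simp: simple_graph_def)
    moreover have "verts H \<inter> {v. v \<in> e} = e" using calculation by auto
    ultimately show "(\<Sum>v\<in>verts H. of_bool (v \<in> e)) = (2::nat)" using fin by simp
  qed
  finally show ?thesis by simp
qed

lemma avg_PiE_prod:
  assumes "finite I" "finite V"
  shows "avg (I \<rightarrow>\<^sub>E V) (\<lambda>f. \<Prod>i\<in>I. h i (f i)) = (\<Prod>i\<in>I. avg V (h i))"
  using prod_sum_PiE[of I "\<lambda>_. V" h] assms by (simp add: avg_def card_PiE prod_dividef)

text \<open>Keep only the maps that send no vertex of H, or exactly one, into I: they decide the
  first order in \<theta>, and all others contribute nonnegative terms. With one vertex in I, its d
  edges carry r and the rest carry u.\<close>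

lemma wdens_two_block_ge:
  fixes H :: "'v graph" and V I :: "'w set"
  assumes H: "simple_graph H" "regular_graph d H" and V: "finite V" "V \<noteq> {}" and I: "I \<subseteq> V"
    and u: "0 \<le> u" and r: "0 \<le> r" and \<theta>: "\<theta> = real (card I) / real (card V)"
    and p: "\<And>e. p e = (if e \<inter> I = {} then u else r)"
  shows "(1 - \<theta>) ^ card (verts H) * u ^ card (edges H)
      + real (card (verts H)) * \<theta> * (1 - \<theta>) ^ (card (verts H) - 1) * (u ^ (card (edges H) - d) * r ^ d) \<le> wdens H V p"
proof -
  note fin = simple_graph_finite[OF H(1)]
  let ?W = "verts H" and ?E = "edges H"
  have \<theta>avg: "avg V (\<lambda>x. of_bool (x \<in> I)) = \<theta>" "avg V (\<lambda>x. of_bool (x \<notin> I)) = 1 - \<theta>"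
  proof -
    have "V \<inter> {x. x \<in> I} = I" using I by auto
    then show 1: "avg V (\<lambda>x. of_bool (x \<in> I)) = \<theta>" using V by (simp add: avg_def \<theta>)
    have "avg V (\<lambda>x. of_bool (x \<notin> I)) = avg V (\<lambda>x. 1 - of_bool (x \<in> I))" by (intro avg_cong) auto
    then show "avg V (\<lambda>x. of_bool (x \<notin> I)) = 1 - \<theta>" unfolding avg_diff avg_const[OF V] 1 .
  qed
  \<comment> \<open>The indicators are written as products over the vertices of H, so that their
    averages factor.\<close>
  define Z where "Z f = (\<Prod>z\<in>?W. of_bool (f z \<notin> I) :: real)" for f :: "'v \<Rightarrow> 'w"
  define W1 where "W1 v f = (\<Prod>z\<in>?W. (if z = v then of_bool (f z \<in> I) else of_bool (f z \<notin> I)) :: real)" for v and f :: "'v \<Rightarrow> 'w"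
  have Zv: "Z f = of_bool (\<forall>z\<in>?W. f z \<notin> I)" for f
    using fin(1) unfolding Z_def by (induction rule: finite_induct) auto
  have W1_eq: "W1 v f = of_bool (f v \<in> I \<and> (\<forall>z\<in>?W. z \<noteq> v \<longrightarrow> f z \<notin> I))" if v: "v \<in> ?W" for v f
  proof -
    have "W1 v f = (\<Prod>z\<in>?W. of_bool (if z = v then f z \<in> I else f z \<notin> I))"
      unfolding W1_def by (intro prod.cong refl) auto
    also have "\<dots> = of_bool (\<forall>z\<in>?W. if z = v then f z \<in> I else f z \<notin> I)"
      using fin(1) by (induction rule: finite_induct) auto
    also have "\<dots> = of_bool (f v \<in> I \<and> (\<forall>z\<in>?W. z \<noteq> v \<longrightarrow> f z \<notin> I))" using v by auto
    finally show ?thesis .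
  qed
  have p0: "0 \<le> p e" for e using p u r by simp
  have pt: "Z f * u ^ card ?E + (\<Sum>v\<in>?W. W1 v f * (u ^ (card ?E - d) * r ^ d)) \<le> (\<Prod>e\<in>?E. p (f ` e))" for f
  proof (cases "\<forall>z\<in>?W. f z \<notin> I")
    case True
    then have "(\<Sum>v\<in>?W. W1 v f * (u ^ (card ?E - d) * r ^ d)) = 0" by (intro sum.neutral) (auto simp: W1_eq)
    moreover have "(\<Prod>e\<in>?E. p (f ` e)) = (\<Prod>e\<in>?E. u)"
    proof (intro prod.cong refl)
      fix e assume "e \<in> ?E"
      then have "e \<subseteq> ?W" using H(1) by (auto simp: simple_graph_def)
      then show "p (f ` e) = u" using True p by auto
    qed
    ultimately show ?thesis using True by (simp add: Zv)
  next
    case False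
    then have Z0: "Z f = 0" by (auto simp: Zv)
    show ?thesis
    proof (cases "\<exists>v\<in>?W. f v \<in> I \<and> (\<forall>z\<in>?W. z \<noteq> v \<longrightarrow> f z \<notin> I)")
      case True
      then obtain v where v: "v \<in> ?W" "f v \<in> I" "\<forall>z\<in>?W. z \<noteq> v \<longrightarrow> f z \<notin> I" by auto
      have "(\<Sum>v'\<in>?W. W1 v' f * (u ^ (card ?E - d) * r ^ d)) = (\<Sum>v'\<in>{v}. W1 v' f * (u ^ (card ?E - d) * r ^ d))"
        using v fin(1) by (intro sum.mono_neutral_right) (auto simp: W1_eq)
      also have "\<dots> = u ^ (card ?E - d) * r ^ d" using v by (simp add: W1_eq)
      also have "\<dots> = (\<Prod>e\<in>?E. if v \<in> e then r else u)"
      proof -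
        have c: "card {e \<in> ?E. v \<in> e} = d" using H(2) v by (auto simp: regular_graph_def)
        have "?E \<inter> - {e. v \<in> e} = ?E - {e \<in> ?E. v \<in> e}" by auto
        then have "card (?E \<inter> - {e. v \<in> e}) = card ?E - d" using c fin(2) by (simp add: card_Diff_subset)
        moreover have "card (?E \<inter> {e. v \<in> e}) = d" using c by (simp add: Int_def)
        ultimately show ?thesis using fin(2) by (simp add: prod.If_cases mult.commute)
      qed
      also have "\<dots> = (\<Prod>e\<in>?E. p (f ` e))"
      proof (intro prod.cong refl)
        fix e assume "e \<in> ?E"
        then have "e \<subseteq> ?W" using H(1) by (auto simp: simple_graph_def)
        then have "f ` e \<inter> I = {} \<longleftrightarrow> v \<notin> e" using v by auto
        then show "(if v \<in> e then r else u) = p (f ` e)" using p by simp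
      qed
      finally show ?thesis using Z0 by simp
    next
      case False
      then have "(\<Sum>v\<in>?W. W1 v f * (u ^ (card ?E - d) * r ^ d)) = 0" by (intro sum.neutral) (auto simp: W1_eq)
      then show ?thesis using Z0 p0 by (simp add: prod_nonneg)
    qed
  qed
  have aZ: "avg (?W \<rightarrow>\<^sub>E V) Z = (1 - \<theta>) ^ card ?W"
    unfolding Z_def using avg_PiE_prod[OF fin(1) V(1), of "\<lambda>z x. of_bool (x \<notin> I)"] by (simp add: \<theta>avg)
  have aW1: "avg (?W \<rightarrow>\<^sub>E V) (W1 v) = \<theta> * (1 - \<theta>) ^ (card ?W - 1)" if v: "v \<in> ?W" for v
  proof -
    have "avg (?W \<rightarrow>\<^sub>E V) (W1 v) = (\<Prod>z\<in>?W. avg V (\<lambda>x. if z = v then of_bool (x \<in> I) else of_bool (x \<notin> I)))"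
      unfolding W1_def by (rule avg_PiE_prod[OF fin(1) V(1)])
    also have "\<dots> = (\<Prod>z\<in>?W. if z = v then \<theta> else 1 - \<theta>)"
      by (intro prod.cong refl) (simp add: \<theta>avg)
    also have "\<dots> = \<theta> * (\<Prod>z\<in>?W - {v}. if z = v then \<theta> else 1 - \<theta>)"
      using prod.remove[OF fin(1) v, of "\<lambda>z. if z = v then \<theta> else 1 - \<theta>"] by simp
    also have "(\<Prod>z\<in>?W - {v}. if z = v then \<theta> else 1 - \<theta>) = (1 - \<theta>) ^ (card ?W - 1)"
      using fin(1) v by (simp add: prod.If_cases Diff_Int_distrib card_Diff_singleton)
    finally show ?thesis .
  qed
  have "(1 - \<theta>) ^ card ?W * u ^ card ?E + real (card ?W) * \<theta> * (1 - \<theta>) ^ (card ?W - 1) * (u ^ (card ?E - d) * r ^ d)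
    = avg (?W \<rightarrow>\<^sub>E V) Z * u ^ card ?E + (\<Sum>v\<in>?W. avg (?W \<rightarrow>\<^sub>E V) (W1 v) * (u ^ (card ?E - d) * r ^ d))"
    by (simp add: aZ aW1)
  also have "\<dots> = avg (?W \<rightarrow>\<^sub>E V) (\<lambda>f. Z f * u ^ card ?E + (\<Sum>v\<in>?W. W1 v f * (u ^ (card ?E - d) * r ^ d)))"
  proof -
    have "avg (?W \<rightarrow>\<^sub>E V) (\<lambda>f. \<Sum>v\<in>?W. W1 v f * (u ^ (card ?E - d) * r ^ d))
      = (\<Sum>v\<in>?W. avg (?W \<rightarrow>\<^sub>E V) (W1 v) * (u ^ (card ?E - d) * r ^ d))"
      unfolding avg_cmult_right[symmetric] by (simp add: avg_def sum.swap[of _ "?W"] sum_divide_distrib)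
    then show ?thesis by (simp add: avg_add avg_cmult_right)
  qed
  also have "\<dots> \<le> wdens H V p" unfolding wdens_def by (intro avg_mono pt)
  finally show ?thesis .
qed

lemma avg2_two_block:
  assumes V: "finite V" "V \<noteq> {}" and I: "I \<subseteq> V" and \<theta>: "\<theta> = real (card I) / real (card V)"
  shows "avg2 V (\<lambda>e. if e \<inter> I = {} then a else b) = b + (1 - \<theta>)\<^sup>2 * (a - b)"
proof -
  have "V \<inter> {x. x \<in> I} = I" using I by auto
  then have 1: "avg V (\<lambda>x. of_bool (x \<in> I)) = \<theta>" using V by (simp add: avg_def \<theta>)
  have "avg2 V (\<lambda>e. if e \<inter> I = {} then a else b)
    = avg V (\<lambda>x. avg V (\<lambda>y. b + (a - b) * ((1 - of_bool (x \<in> I)) * (1 - of_bool (y \<in> I)))))"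
    unfolding avg2_def by (intro avg_cong) auto
  also have "\<dots> = b + (a - b) * ((1 - \<theta>) * (1 - \<theta>))"
    by (simp only: avg_add avg_cmult avg_cmult_right avg_diff avg_const[OF V] 1)
  finally show ?thesis by (simp add: power2_eq_square algebra_simps)
qed

text \<open>Includes the constant 0, which is the edge density of the empty graph.\<close>

lemma free_energy_const':
  fixes H :: "'v graph"
  assumes H: "simple_graph H" "card (edges H) > 0" and V: "finite V" "V \<noteq> {}" and u: "0 \<le> u"
  shows "free_energy H \<alpha> \<beta>1 \<beta>2 V (\<lambda>e. u) = ell \<beta>1 \<beta>2 (real (card (edges H)) * \<alpha>) u"
proof (cases "u = 0")
  case True
  have "wdens H V (\<lambda>e. 0) = 0" using H(2) by (simp add: wdens_def avg_def power_0_left)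
  then show ?thesis using True by (simp add: free_energy_def ell_def avg2_const[OF V])
qed (use free_energy_const[OF H(1) V] u in simp)

text \<open>A vertex set of density \<open>\<theta>\<close> on which all adjacent edge probabilities are changed from \<open>u\<close>
  to \<open>r\<close> changes the free energy to first order by
  \<open>2 * \<theta> * (ell \<beta>1 \<kappa> d r - ell \<beta>1 \<kappa> d u)\<close>.\<close>
lemma two_block_free_energy_gain:
  fixes H :: "'v graph"
  assumes H: "simple_graph H" "regular_graph d H" "verts H \<noteq> {}" and d: "d > 0" and \<alpha>: "\<alpha> > 0" and \<beta>2: "\<beta>2 > 0"
    and \<gamma>: "\<gamma> = real (card (edges H)) * \<alpha>" and u: "0 < u" "u < 1" and r: "0 < r" "r < 1"
    and gain: "ell \<beta>1 (\<beta>2 * (\<gamma> / d) * u powr (\<gamma> - d)) d u < ell \<beta>1 (\<beta>2 * (\<gamma> / d) * u powr (\<gamma> - d)) d r"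
  obtains \<zeta> and n0 :: nat where "\<zeta> > 0"
    "\<And>n. n \<ge> n0 \<Longrightarrow> \<exists>I\<subseteq>{1..n}. ell \<beta>1 \<beta>2 \<gamma> u + \<zeta> \<le> free_energy H \<alpha> \<beta>1 \<beta>2 {1..n} (\<lambda>e. if e \<inter> I = {} then u else r)"
proof -
  let ?v = "card (verts H)" and ?e = "card (edges H)"
  let ?\<psi> = "\<lambda>x. \<beta>1 * x + ent x"
  have vd: "?v * d = 2 * ?e" by (rule handshake[OF H(1,2)])
  have de: "d \<le> ?e"
  proof -
    obtain v where "v \<in> verts H" using H(3) by auto
    then have "d = card {e \<in> edges H. v \<in> e}" using H(2) by (simp add: regular_graph_def)
    also have "\<dots> \<le> ?e" using simple_graph_finite[OF H(1)] by (intro card_mono) auto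
    finally show ?thesis .
  qed
  \<comment> \<open>The lower bound of \<open>wdens_two_block_ge\<close> as a function of \<theta>;
    inserted into the free energy it gives \<Phi>, which equals
    \<open>ell \<beta>1 \<beta>2 \<gamma> u\<close> at \<theta> = 0.\<close>
  define T where "T \<theta> = (1 - \<theta>) ^ ?v * u ^ ?e + real ?v * \<theta> * (1 - \<theta>) ^ (?v - 1) * (u ^ (?e - d) * r ^ d)" for \<theta> :: real
  define \<Phi> where "\<Phi> \<theta> = ?\<psi> r + (1 - \<theta>)\<^sup>2 * (?\<psi> u - ?\<psi> r) + \<beta>2 * T \<theta> powr \<alpha>" for \<theta>
  have T0: "T 0 = u ^ ?e" by (simp add: T_def)
  have T0pos: "T 0 > 0" using u by (simp add: T0)
  have \<Phi>0: "\<Phi> 0 = ell \<beta>1 \<beta>2 \<gamma> u"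
    using u by (simp add: \<Phi>_def T0 ell_def \<gamma> powr_realpow[symmetric] powr_powr)
  define T' where "T' = - real ?v * u ^ ?e + real ?v * (u ^ (?e - d) * r ^ d)"
  have dT: "(T has_real_derivative T') (at 0)"
  proof -
    have "(T has_real_derivative (real ?v * (1 - 0) ^ (?v - 1) * (- 1) * u ^ ?e
      + (real ?v * (1 * (1 - 0) ^ (?v - 1) + 0 * (real (?v - 1) * (1 - 0) ^ (?v - 1 - 1) * (- 1)))) * (u ^ (?e - d) * r ^ d))) (at 0)"
      unfolding T_def[abs_def] by (auto intro!: derivative_eq_intros simp: algebra_simps)
    then show ?thesis by (simp add: T'_def)
  qed
  have contT: "isCont T \<theta>" for \<theta> unfolding T_def[abs_def] by (intro continuous_intros)
  define D where "D = 2 * (?\<psi> r - ?\<psi> u) + \<beta>2 * (\<alpha> * T 0 powr (\<alpha> - 1) * T')"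
  have d\<Phi>: "(\<Phi> has_real_derivative D) (at 0)"
  proof -
    have 1: "((\<lambda>\<theta>. T \<theta> powr \<alpha>) has_real_derivative (\<alpha> * T 0 powr (\<alpha> - 1) * T')) (at 0)"
      using DERIV_powr[OF dT T0pos DERIV_const[of \<alpha>]] T0pos by (simp add: powr_diff field_simps)
    have 2: "((\<lambda>\<theta>. ?\<psi> r + (1 - \<theta>)\<^sup>2 * (?\<psi> u - ?\<psi> r)) has_real_derivative (2 * (?\<psi> r - ?\<psi> u))) (at 0)"
      by (auto intro!: derivative_eq_intros simp: algebra_simps)
    show ?thesis unfolding \<Phi>_def[abs_def] D_def by (rule DERIV_add[OF 2 DERIV_cmult[OF 1]])
  qed
  have Dpos: "D > 0"
  proof -
    have a: "u ^ ?e = u ^ (?e - d) * u ^ d" using de by (simp add: power_add[symmetric])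
    have t1: "T' = real ?v * u ^ (?e - d) * (r ^ d - u ^ d)" unfolding T'_def a by (simp add: algebra_simps)
    have t2: "T 0 powr (\<alpha> - 1) * u ^ (?e - d) = u powr (\<gamma> - d)"
    proof -
      have "T 0 powr (\<alpha> - 1) = u powr (\<gamma> - ?e)" using u by (simp add: T0 powr_realpow[symmetric] powr_powr \<gamma> algebra_simps)
      moreover have "u ^ (?e - d) = u powr (real ?e - d)" using u de by (simp add: powr_realpow[symmetric] of_nat_diff)
      ultimately show ?thesis by (simp add: powr_add[symmetric])
    qed
    \<comment> \<open>By handshaking. This 2 matches the one from differentiating
      \<open>(1 - \<theta>)\<^sup>2\<close>, so that D is twice a difference of values of
      \<open>ell\<close>.\<close>
    have t3: "\<alpha> * real ?v = 2 * (\<gamma> / d)"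
    proof -
      have "real ?v * d = 2 * ?e" using vd by (metis of_nat_mult of_nat_numeral)
      then show ?thesis using d by (simp add: \<gamma> field_simps)
    qed
    have "\<alpha> * T 0 powr (\<alpha> - 1) * T' = (\<alpha> * real ?v) * (T 0 powr (\<alpha> - 1) * u ^ (?e - d)) * (r ^ d - u ^ d)"
      unfolding t1 by (simp only: mult_ac)
    then have "\<alpha> * T 0 powr (\<alpha> - 1) * T' = 2 * (\<gamma> / d) * u powr (\<gamma> - d) * (r ^ d - u ^ d)"
      unfolding t2 t3 .
    moreover have "2 * ((a + e) - (a' + e')) + b * (2 * g * W * (R - U))
      = 2 * (a + e + b * g * W * R - (a' + e' + b * g * W * U))" for a e a' e' b g W R U :: real
      by algebra
    ultimately have "D = 2 * (ell \<beta>1 (\<beta>2 * (\<gamma> / d) * u powr (\<gamma> - d)) d r - ell \<beta>1 (\<beta>2 * (\<gamma> / d) * u powr (\<gamma> - d)) d u)"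
      unfolding D_def ell_def powr_realpow[OF u(1)] powr_realpow[OF r(1)] by presburger
    then show ?thesis using gain by simp
  qed
  from DERIV_pos_inc_right[OF d\<Phi> Dpos] obtain h0 where h0: "h0 > 0" "\<forall>h>0. h < h0 \<longrightarrow> \<Phi> 0 < \<Phi> (0 + h)" by blast
  \<comment> \<open>The planted density h is fixed, so the gain does not shrink with n; for each n
    it is approximated by a set of integer size, the integer part of h n.\<close>
  define h where "h = min (h0 / 2) (1 / 2)"
  have h: "0 < h" "h < h0" "h < 1"
    unfolding h_def using h0(1) by (simp_all add: min_less_iff_disj)
  have \<Phi>h: "\<Phi> 0 < \<Phi> h" using h0(2) h by simp
  have Tnn: "0 < T \<theta>" if "0 \<le> \<theta>" "\<theta> < 1" for \<theta>
    unfolding T_def using that u r by (intro add_pos_nonneg mult_pos_pos mult_nonneg_nonneg) auto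
  have cont\<Phi>: "isCont \<Phi> h"
    unfolding \<Phi>_def[abs_def] using Tnn[of h] h contT by (intro continuous_intros) auto
  define \<theta> where "\<theta> n = real (nat \<lfloor>h * real n\<rfloor>) / real n" for n
  have "(\<lambda>n. \<theta> n) \<longlonglongrightarrow> h"
  proof (rule tendsto_sandwich)
    have fl: "real (nat \<lfloor>h * real n\<rfloor>) = of_int \<lfloor>h * real n\<rfloor>" for n using h by simp
    show "\<forall>\<^sub>F n in sequentially. h - 1 / real n \<le> \<theta> n"
      using eventually_gt_at_top[of 0]
    proof eventually_elim
      case (elim n)
      have "h * real n - 1 \<le> of_int \<lfloor>h * real n\<rfloor>" by linarith
      then have "(h * real n - 1) / real n \<le> \<theta> n" unfolding \<theta>_def fl by (intro divide_right_mono) auto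
      then show ?case using elim by (simp add: diff_divide_distrib)
    qed
    show "\<forall>\<^sub>F n in sequentially. \<theta> n \<le> h"
      using eventually_gt_at_top[of 0]
    proof eventually_elim
      case (elim n)
      have "of_int \<lfloor>h * real n\<rfloor> \<le> h * real n" by linarith
      then show ?case unfolding \<theta>_def fl using elim by (simp add: divide_le_eq)
    qed
    show "(\<lambda>n. h - 1 / real n) \<longlonglongrightarrow> h" by real_asymp
  qed simp
  then have "(\<lambda>n. \<Phi> (\<theta> n)) \<longlonglongrightarrow> \<Phi> h" by (rule isCont_tendsto_compose[OF cont\<Phi>])
  then have "\<forall>\<^sub>F n in sequentially. (\<Phi> 0 + \<Phi> h) / 2 < \<Phi> (\<theta> n)" by (rule order_tendstoD) (use \<Phi>h in simp)
  then obtain n1 where n1: "\<And>n. n \<ge> n1 \<Longrightarrow> (\<Phi> 0 + \<Phi> h) / 2 < \<Phi> (\<theta> n)" unfolding eventually_sequentially by blast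
  show ?thesis
  proof (rule that[of "(\<Phi> h - \<Phi> 0) / 2" "max n1 1"])
    show "0 < (\<Phi> h - \<Phi> 0) / 2" using \<Phi>h by simp
    fix n assume n: "max n1 1 \<le> n"
    let ?V = "{1..n}"
    have V: "finite ?V" "?V \<noteq> {}" using n by auto
    define I where "I = {1..nat \<lfloor>h * real n\<rfloor>}"
    have le: "nat \<lfloor>h * real n\<rfloor> \<le> n"
    proof -
      have "h * real n \<le> real n" using h by (simp add: mult_left_le_one_le)
      then have "\<lfloor>h * real n\<rfloor> \<le> int n" by linarith
      then show ?thesis by simp
    qed
    have I: "I \<subseteq> ?V" using le by (auto simp: I_def)
    have \<theta>I: "\<theta> n = real (card I) / real (card ?V)" by (simp add: \<theta>_def I_def)
    let ?p = "\<lambda>e. if e \<inter> I = {} then u else r"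
    have "T (\<theta> n) \<le> wdens H ?V ?p"
      unfolding T_def using u r by (intro wdens_two_block_ge[OF H(1,2) V I _ _ \<theta>I]) auto
    moreover have "0 \<le> T (\<theta> n)"
    proof -
      have "0 \<le> \<theta> n" "\<theta> n \<le> 1" using le n by (auto simp: \<theta>_def divide_le_eq)
      then show ?thesis unfolding T_def using u r by (intro add_nonneg_nonneg mult_nonneg_nonneg) auto
    qed
    ultimately have "\<beta>2 * T (\<theta> n) powr \<alpha> \<le> \<beta>2 * wdens H ?V ?p powr \<alpha>"
      using \<alpha> \<beta>2 by (intro mult_left_mono powr_mono2) auto
    moreover have "\<beta>1 * avg2 ?V ?p + avg2 ?V (\<lambda>e. ent (?p e)) = ?\<psi> r + (1 - \<theta> n)\<^sup>2 * (?\<psi> u - ?\<psi> r)"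
    proof -
      have "avg2 ?V (\<lambda>e. ent (?p e)) = avg2 ?V (\<lambda>e. if e \<inter> I = {} then ent u else ent r)"
        by (intro avg2_cong) simp
      then show ?thesis
        unfolding avg2_two_block[OF V I \<theta>I] by (simp only: avg2_two_block[OF V I \<theta>I]) (simp add: algebra_simps)
    qed
    ultimately have "\<Phi> (\<theta> n) \<le> free_energy H \<alpha> \<beta>1 \<beta>2 ?V ?p" unfolding \<Phi>_def free_energy_def by linarith
    moreover have "ell \<beta>1 \<beta>2 \<gamma> u + (\<Phi> h - \<Phi> 0) / 2 \<le> \<Phi> (\<theta> n)" using n1[of n] n \<Phi>0 by (simp add: field_simps)
    ultimately show "\<exists>I\<subseteq>?V. ell \<beta>1 \<beta>2 \<gamma> u + (\<Phi> h - \<Phi> 0) / 2 \<le> free_energy H \<alpha> \<beta>1 \<beta>2 ?V (\<lambda>e. if e \<inter> I = {} then u else r)"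
      using I by (intro exI[of _ I]) simp
  qed
qed

section \<open>Exponential rarity of nearly constant graphs\<close>

definition near_const :: "nat graph \<Rightarrow> real" where
  "near_const G = (INF s\<in>{0..1}. cut_dist G s)"

lemma near_const_less:
  assumes G: "finite (verts G)" "verts G \<noteq> {}" and "near_const G < \<epsilon>"
  shows "\<exists>s\<in>{0..1}. cut_dist G s < \<epsilon>"
proof -
  have "bdd_below (cut_dist G ` {0..1})" using cut_dist_nonneg[OF G] by (intro bdd_belowI[of _ 0]) auto
  then show ?thesis using assms(3) unfolding near_const_def by (subst (asm) cINF_less_iff) auto
qed

lemma block_avg_trivial:
  assumes "x \<in> V" "y \<in> V"
  shows "block_avg V (\<lambda>x. 0) g {x, y} = avg2 V g"
proof -
  have "{p \<in> V \<times> V. (\<lambda>x. 0::nat) ` {fst p, snd p} = (\<lambda>x. 0) ` {x, y}} = V \<times> V" by auto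
  then show ?thesis by (simp add: block_avg_def avg_prod avg2_def)
qed

text \<open>Singletons A and B suffice: the missing loop at 1 and the edge {1, 2} bound both s and 1
  - s by \<open>n\<^sup>2\<close> times the cut distance, and one of them is at least 1 / 2.\<close>

lemma near_const_complete:
  assumes n: "n \<ge> 2"
  shows "1 / (2 * (real n)\<^sup>2) \<le> near_const ({1..n}, pairs n)"
proof -
  let ?G = "({1..n}, pairs n)"
  have V: "finite (verts ?G)" "verts ?G \<noteq> {}" using n by auto
  have n0: "(real n)\<^sup>2 > 0" using n by simp
  have "1 / (2 * (real n)\<^sup>2) \<le> cut_dist ?G s" for s
  proof -
    have c: "cut_le (verts ?G) (\<lambda>e. adj ?G e - s) (cut_dist ?G s)" using cut_dist_le_iff[OF V] by blast
    have "\<bar>adj ?G {1} - s\<bar> \<le> cut_dist ?G s * (real n)\<^sup>2"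
      using cut_leD[OF c, of "{1}" "{1}"] n by simp
    moreover have "\<bar>adj ?G {1, 2} - s\<bar> \<le> cut_dist ?G s * (real n)\<^sup>2"
      using cut_leD[OF c, of "{1}" "{2}"] n by simp
    moreover have "adj ?G {1} = 0" using singleton_notin_pairs[of 1 n] by (simp add: adj_def)
    moreover have "adj ?G {1, 2} = 1" using n by (simp add: adj_def pairs_def)
    ultimately have "1 / 2 \<le> cut_dist ?G s * (real n)\<^sup>2" by linarith
    then show ?thesis using n0 by (simp add: field_simps)
  qed
  then show ?thesis unfolding near_const_def by (intro cINF_greatest) auto
qed

text \<open>A graph near some constant s is near its own edge density, so the partition with one
  class is already regular for it and K = 1 suffices. The free energy is then at most
  \<open>ell \<beta>1 \<beta>2 \<gamma> u\<close>, whereas the planted two-block weight lifts the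
  partition function above that by \<zeta>.\<close>

lemma ergm_symmetry_breaking:
  fixes H :: "'v graph"
  assumes H: "simple_graph H" "regular_graph d H" "verts H \<noteq> {}" and d: "d > 0" and \<alpha>: "\<alpha> > 0" and \<beta>2: "\<beta>2 > 0"
    and \<gamma>: "\<gamma> = real (card (edges H)) * \<alpha>" and u: "is_maximizer (ell \<beta>1 \<beta>2 \<gamma>) u" and r: "0 < r" "r < 1"
    and gain: "ell \<beta>1 (\<beta>2 * (\<gamma> / d) * u powr (\<gamma> - d)) d u < ell \<beta>1 (\<beta>2 * (\<gamma> / d) * u powr (\<gamma> - d)) d r"
  shows "\<exists>\<epsilon>>0. \<exists>c>0. \<exists>n0. \<forall>n\<ge>n0. (\<Sum>G\<in>{G \<in> labeled_graphs n. near_const G \<le> \<epsilon>}. ergm_weight H \<alpha> \<beta>1 \<beta>2 n G)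
      \<le> exp (- c * (real n)\<^sup>2) * ergm_Z H \<alpha> \<beta>1 \<beta>2 n"
proof -
  let ?\<Lambda> = "ell \<beta>1 \<beta>2 \<gamma> u"
  have u01: "0 < u" "u < 1" using u by (auto simp: is_maximizer_def)
  have e0: "card (edges H) > 0" by (rule card_edges_pos[OF H d])
  obtain \<zeta> and n1 :: nat where \<zeta>: "\<zeta> > 0" and n1:
    "\<And>n. n \<ge> n1 \<Longrightarrow> \<exists>I\<subseteq>{1..n}. ?\<Lambda> + \<zeta> \<le> free_energy H \<alpha> \<beta>1 \<beta>2 {1..n} (\<lambda>e. if e \<inter> I = {} then u else r)"
    using two_block_free_energy_gain[OF H d \<alpha> \<beta>2 \<gamma> u01 r gain] by blast
  \<comment> \<open>The upper and the lower bound lose \<zeta> / 4 each; the remaining \<zeta> / 2,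
    times \<open>n choose 2\<close>, which is at least \<open>n\<^sup>2 / 8\<close>, gives the rate
    \<zeta> / 16.\<close>
  have \<zeta>4: "\<zeta> / 4 > 0" using \<zeta> by simp
  define \<rho> where "\<rho> = min (min u (1 - u)) (min r (1 - r))"
  have \<rho>: "\<rho> > 0" "\<rho> \<le> u" "u \<le> 1 - \<rho>" "\<rho> \<le> r" "r \<le> 1 - \<rho>" using u01 r unfolding \<rho>_def by linarith+
  obtain n2 where n2: "\<forall>n\<ge>n2. \<forall>(c :: nat \<Rightarrow> nat) P. (\<forall>x\<in>{1..n}. c x < 2) \<longrightarrow> (\<forall>L. \<rho> \<le> P L \<and> P L \<le> 1 - \<rho>)
     \<longrightarrow> exp (real (n choose 2) * (free_energy H \<alpha> \<beta>1 \<beta>2 {1..n} (\<lambda>e. P (c ` e)) - \<zeta> / 4)) \<le> ergm_Z H \<alpha> \<beta>1 \<beta>2 n"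
    using ergm_Z_lower_asymptotic[OF H(1) less_imp_le[OF \<beta>2] \<alpha> \<zeta>4 \<rho>(1), of 2 \<beta>1] by blast
  obtain \<eta>0 where \<eta>0: "\<eta>0 > 0" and up: "\<forall>\<eta>\<ge>0. \<eta> \<le> \<eta>0 \<longrightarrow> (\<forall>K. \<exists>n0. \<forall>n\<ge>n0. \<forall>B\<subseteq>labeled_graphs n. \<forall>\<Lambda>.
      (\<forall>G\<in>B. \<exists>c \<in> {1..n} \<rightarrow>\<^sub>E {..<K}. 
        cut_le {1..n} (\<lambda>e. adj G e - block_avg {1..n} c (adj G) e) \<eta>
        \<and> free_energy H \<alpha> \<beta>1 \<beta>2 {1..n} (block_avg {1..n} c (adj G)) \<le> \<Lambda>)
      \<longrightarrow> (\<Sum>G\<in>B. ergm_weight H \<alpha> \<beta>1 \<beta>2 n G) \<le> exp (real (n choose 2) * (\<Lambda> + \<zeta> / 4)))"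
    using ergm_weight_sum_upper_asymptotic[OF H(1) less_imp_le[OF \<beta>2] \<alpha> \<zeta>4, of \<beta>1] by blast
  obtain n3 where n3: "\<forall>n\<ge>n3. \<forall>B\<subseteq>labeled_graphs n. \<forall>\<Lambda>.
      (\<forall>G\<in>B. \<exists>c \<in> {1..n} \<rightarrow>\<^sub>E {..<1}. 
        cut_le {1..n} (\<lambda>e. adj G e - block_avg {1..n} c (adj G) e) \<eta>0
        \<and> free_energy H \<alpha> \<beta>1 \<beta>2 {1..n} (block_avg {1..n} c (adj G)) \<le> \<Lambda>)
      \<longrightarrow> (\<Sum>G\<in>B. ergm_weight H \<alpha> \<beta>1 \<beta>2 n G) \<le> exp (real (n choose 2) * (\<Lambda> + \<zeta> / 4))"
    using up \<eta>0 by (meson less_imp_le order_refl)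
  have main: "(\<Sum>G\<in>{G \<in> labeled_graphs n. near_const G \<le> \<eta>0 / 4}. ergm_weight H \<alpha> \<beta>1 \<beta>2 n G)
      \<le> exp (- (\<zeta> / 16) * (real n)\<^sup>2) * ergm_Z H \<alpha> \<beta>1 \<beta>2 n"
    if n: "max (max n1 n2) (max n3 2) \<le> n" for n
  proof -
    let ?V = "{1..n}" and ?N = "real (n choose 2)"
    let ?B = "{G \<in> labeled_graphs n. near_const G \<le> \<eta>0 / 4}"
    have V: "finite ?V" "?V \<noteq> {}" using n by auto
    have Bsub: "?B \<subseteq> labeled_graphs n" by auto
    have n3': "n3 \<le> n" using n by simp
    have "(\<Sum>G\<in>?B. ergm_weight H \<alpha> \<beta>1 \<beta>2 n G) \<le> exp (?N * (?\<Lambda> + \<zeta> / 4))"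
    proof (rule n3[rule_format, OF n3' Bsub])
      fix G assume G: "G \<in> ?B"
      have vG: "verts G = ?V" using G labeled_graphsD[of G n] by simp
      have "near_const G < \<eta>0 / 2" using G \<eta>0 by simp
      then obtain s where s: "0 \<le> s" "s \<le> 1" "cut_dist G s < \<eta>0 / 2"
        using near_const_less[of G "\<eta>0 / 2"] V vG by auto
      have cs: "cut_le ?V (\<lambda>e. adj G e - s) (\<eta>0 / 2)"
        using cut_dist_le_iff[of G s "\<eta>0 / 2"] V vG s by simp
      define m where "m = avg2 ?V (adj G)"
      have m01: "0 \<le> m" "m \<le> 1" unfolding m_def using adj_bounds[of G] by (auto intro!: avg2_nonneg avg2_le_1)
      have ms: "\<bar>s - m\<bar> \<le> \<eta>0 / 2"
      proof -
        have "\<bar>avg2 ?V (\<lambda>e. adj G e - s)\<bar> \<le> \<eta>0 / 2"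
          using cut_leD[OF cs order_refl order_refl] n by (simp add: avg2_sum divide_le_eq)
        then show ?thesis unfolding avg2_diff avg2_const[OF V] m_def by linarith
      qed
      let ?c = "restrict (\<lambda>x. 0 :: nat) ?V"
      have ba: "block_avg ?V ?c (adj G) {x, y} = m" if "x \<in> ?V" "y \<in> ?V" for x y
        using block_avg_cong[of ?V ?c "\<lambda>x. 0" x y "adj G"] block_avg_trivial[OF that, of "adj G"] that by (simp add: m_def)
      have "cut_le ?V (\<lambda>e. s - m) (\<eta>0 / 2)"
        using ms by (intro cut_le_mono[OF cut_le_L1[OF V]]) (simp only: avg2_const[OF V])
      from cut_le_add[OF cs this] have "cut_le ?V (\<lambda>e. adj G e - m) \<eta>0" by simp
      then have "cut_le ?V (\<lambda>e. adj G e - block_avg ?V ?c (adj G) e) \<eta>0"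
        using ba by (subst cut_le_cong[where D' = "\<lambda>e. adj G e - m"]) auto
      moreover have "free_energy H \<alpha> \<beta>1 \<beta>2 ?V (block_avg ?V ?c (adj G)) \<le> ?\<Lambda>"
      proof -
        have "free_energy H \<alpha> \<beta>1 \<beta>2 ?V (block_avg ?V ?c (adj G)) = free_energy H \<alpha> \<beta>1 \<beta>2 ?V (\<lambda>e. m)"
          unfolding free_energy_def using ba
          by (intro arg_cong2[of _ _ _ _ "(+)"] arg_cong[of _ _ "(*) _"] arg_cong[of _ _ "\<lambda>z. z powr \<alpha>"] avg2_cong wdens_cong[OF H(1)]) simp_all
        also have "\<dots> = ell \<beta>1 \<beta>2 \<gamma> m" unfolding \<gamma> by (rule free_energy_const'[OF H(1) e0 V m01(1)])
        also have "\<dots> \<le> ?\<Lambda>" by (rule is_maximizerD[OF u m01])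
        finally show ?thesis .
      qed
      ultimately show "\<exists>c \<in> ?V \<rightarrow>\<^sub>E {..<1}. cut_le ?V (\<lambda>e. adj G e - block_avg ?V c (adj G) e) \<eta>0
        \<and> free_energy H \<alpha> \<beta>1 \<beta>2 ?V (block_avg ?V c (adj G)) \<le> ?\<Lambda>"
        by (intro bexI[of _ ?c] conjI) auto
    qed
    also have "\<dots> = exp (- ?N * (\<zeta> / 2)) * exp (?N * (?\<Lambda> + \<zeta> - \<zeta> / 4))"
      by (simp add: exp_add[symmetric] algebra_simps)
    also have "\<dots> \<le> exp (- (\<zeta> / 16) * (real n)\<^sup>2) * ergm_Z H \<alpha> \<beta>1 \<beta>2 n"
    proof (rule mult_mono)
      have "(real n)\<^sup>2 / 8 \<le> ?N"
      proof -
        have "2 * real n \<le> real n * real n" using n by (intro mult_right_mono) auto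
        then have "real n / 2 \<le> 3 / 8 * (real n * real n)" by linarith
        then show ?thesis by (simp add: real_choose_2 power2_eq_square)
      qed
      then have "(\<zeta> / 2) * ((real n)\<^sup>2 / 8) \<le> (\<zeta> / 2) * ?N" using \<zeta> by (intro mult_left_mono) auto
      then show "exp (- ?N * (\<zeta> / 2)) \<le> exp (- (\<zeta> / 16) * (real n)\<^sup>2)" by (simp add: mult.commute)
      obtain I where I: "I \<subseteq> ?V" "?\<Lambda> + \<zeta> \<le> free_energy H \<alpha> \<beta>1 \<beta>2 ?V (\<lambda>e. if e \<inter> I = {} then u else r)"
        using n1[of n] n by auto
      \<comment> \<open>Label 1 marks I, and P asks whether an edge carries that label; so the
        planted weight has the block form of the lower bound.\<close>
      define c where "c x = (if x \<in> I then 1 else 0 :: nat)" for x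
      define P where "P L = (if 1 \<in> L then r else u)" for L :: "nat set"
      have "P (c ` e) = (if e \<inter> I = {} then u else r)" for e by (auto simp: P_def c_def image_iff)
      then have Pc: "(\<lambda>e. P (c ` e)) = (\<lambda>e. if e \<inter> I = {} then u else r)" by (rule ext)
      have "exp (?N * (free_energy H \<alpha> \<beta>1 \<beta>2 ?V (\<lambda>e. P (c ` e)) - \<zeta> / 4)) \<le> ergm_Z H \<alpha> \<beta>1 \<beta>2 n"
        using n \<rho> by (intro n2[rule_format]) (auto simp: c_def P_def)
      moreover have "exp (?N * (?\<Lambda> + \<zeta> - \<zeta> / 4)) \<le> exp (?N * (free_energy H \<alpha> \<beta>1 \<beta>2 ?V (\<lambda>e. P (c ` e)) - \<zeta> / 4))"
        unfolding Pc using I(2) by (intro iffD2[OF exp_le_cancel_iff] mult_left_mono) auto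
      ultimately show "exp (?N * (?\<Lambda> + \<zeta> - \<zeta> / 4)) \<le> ergm_Z H \<alpha> \<beta>1 \<beta>2 n" by linarith
    qed (auto simp: less_imp_le[OF ergm_Z_pos])
    finally show ?thesis .
  qed
  have "0 < \<eta>0 / 4" "0 < \<zeta> / 16" using \<eta>0 \<zeta> by simp_all
  with main show ?thesis by blast
qed

lemma uniform_small_constant:
  assumes "finite S" "\<And>n. n \<in> S \<Longrightarrow> \<exists>c>0. \<forall>c'. 0 < c' \<and> c' \<le> c \<longrightarrow> Q n c'"
  shows "\<exists>c>(0::real). \<forall>n\<in>S. \<forall>c'. 0 < c' \<and> c' \<le> c \<longrightarrow> Q n c'"
  using assms
proof (induction S rule: finite_induct)
  case empty
  show ?case by (intro exI[of _ 1]) simp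
next
  case (insert n S)
  obtain c1 where c1: "c1 > 0" "\<forall>c'. 0 < c' \<and> c' \<le> c1 \<longrightarrow> Q n c'" using insert.prems[of n] by blast
  obtain c2 where c2: "c2 > 0" "\<forall>n\<in>S. \<forall>c'. 0 < c' \<and> c' \<le> c2 \<longrightarrow> Q n c'" using insert.IH insert.prems by blast
  show ?case using c1 c2 by (intro exI[of _ "min c1 c2"]) auto
qed

text \<open>Asymptotics cover n \<ge> n0. For each smaller n \<ge> 2 the complete graph is farther
  than \<epsilon> from every constant and has positive probability, so being near a constant has
  probability below 1, and a small C works. For n = 1 the only graph is the constant 0, so the claim
  starts at 2.\<close>

lemma ergm_far_from_constant:
  fixes H :: "'v graph"
  assumes H: "simple_graph H" "regular_graph d H" "verts H \<noteq> {}" and d: "d > 0" and \<alpha>: "\<alpha> > 0" and \<beta>2: "\<beta>2 > 0"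
    and \<gamma>: "\<gamma> = real (card (edges H)) * \<alpha>" and u: "is_maximizer (ell \<beta>1 \<beta>2 \<gamma>) u" and r: "0 < r" "r < 1"
    and gain: "ell \<beta>1 (\<beta>2 * (\<gamma> / d) * u powr (\<gamma> - d)) d u < ell \<beta>1 (\<beta>2 * (\<gamma> / d) * u powr (\<gamma> - d)) d r"
  shows "\<exists>\<epsilon> C. \<epsilon> > 0 \<and> C > 0 \<and> (\<forall>(M :: 'w measure) G. is_ergm H \<alpha> \<beta>1 \<beta>2 M G \<longrightarrow>
      (\<forall>n\<ge>2. measure M {\<omega> \<in> space M. (INF s\<in>{0..1}. cut_dist (G n \<omega>) s) > \<epsilon>} \<ge> 1 - exp (- C * (real n)\<^sup>2)))"
proof -
  obtain \<epsilon>1 c1 n0 where \<epsilon>1: "\<epsilon>1 > 0" and c1: "c1 > 0"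
    and n0: "\<forall>n\<ge>n0. (\<Sum>G\<in>{G \<in> labeled_graphs n. near_const G \<le> \<epsilon>1}. ergm_weight H \<alpha> \<beta>1 \<beta>2 n G)
      \<le> exp (- c1 * (real n)\<^sup>2) * ergm_Z H \<alpha> \<beta>1 \<beta>2 n"
    using ergm_symmetry_breaking[OF H d \<alpha> \<beta>2 \<gamma> u r gain] by blast
  \<comment> \<open>The second term stays below \<open>1 / (2 * n\<^sup>2)\<close>, the distance
    guaranteed by \<open>near_const_complete\<close>, for every positive n < n0.\<close>
  define \<epsilon> where "\<epsilon> = min \<epsilon>1 (1 / (4 * (real n0 + 1)\<^sup>2))"
  have "0 < (real n0 + 1)\<^sup>2" by (simp add: add_nonneg_pos)
  then have \<epsilon>: "\<epsilon> > 0" "\<epsilon> \<le> \<epsilon>1" "\<epsilon> \<le> 1 / (4 * (real n0 + 1)\<^sup>2)"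
    unfolding \<epsilon>_def using \<epsilon>1 by (simp_all add: min.coboundedI2)
  define S where "S n = (\<Sum>G\<in>{G \<in> labeled_graphs n. near_const G \<le> \<epsilon>}. ergm_weight H \<alpha> \<beta>1 \<beta>2 n G)" for n
  define Q where "Q n c \<longleftrightarrow> S n \<le> exp (- c * (real n)\<^sup>2) * ergm_Z H \<alpha> \<beta>1 \<beta>2 n" for n c
  have w0: "0 < ergm_weight H \<alpha> \<beta>1 \<beta>2 n G" for n G by (simp add: ergm_weight_def)
  note Z0 = ergm_Z_pos[of H \<alpha> \<beta>1 \<beta>2]
  have small: "\<exists>c>0. \<forall>c'. 0 < c' \<and> c' \<le> c \<longrightarrow> Q n c'" if n: "n \<in> {2..<n0}" for n
  proof -
    let ?K = "({1..n}, pairs n)"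
    have Kl: "?K \<in> labeled_graphs n" by (auto simp: labeled_graphs_eq)
    have "\<epsilon> < near_const ?K"
    proof -
      have "(real n)\<^sup>2 \<le> (real n0 + 1)\<^sup>2" using n by (intro power_mono) auto
      then have "1 / (4 * (real n0 + 1)\<^sup>2) \<le> 1 / (4 * (real n)\<^sup>2)" using n by (intro divide_left_mono) auto
      also have "\<dots> < 1 / (2 * (real n)\<^sup>2)" using n by (intro divide_strict_left_mono) auto
      also have "\<dots> \<le> near_const ?K" using n by (intro near_const_complete) simp
      finally show ?thesis using \<epsilon>(3) by linarith
    qed
    then have "S n < ergm_Z H \<alpha> \<beta>1 \<beta>2 n"
      unfolding S_def ergm_Z_def using Kl w0 finite_labeled_graphs
      by (intro sum_strict_mono2[where b = ?K]) (auto simp: less_imp_le)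
    define p where "p = S n / ergm_Z H \<alpha> \<beta>1 \<beta>2 n"
    have p: "p < 1" "S n = p * ergm_Z H \<alpha> \<beta>1 \<beta>2 n"
      using \<open>S n < _\<close> Z0[of n] by (simp_all add: p_def)
    have "((\<lambda>c. exp (- c * (real n)\<^sup>2)) \<longlongrightarrow> exp (- 0 * (real n)\<^sup>2)) (at_right 0)" by (intro tendsto_intros)
    then have "\<forall>\<^sub>F c in at_right 0. p < exp (- c * (real n)\<^sup>2)" by (rule order_tendstoD) (use p in simp)
    then obtain b where b: "b > 0" "\<And>c. 0 < c \<Longrightarrow> c < b \<Longrightarrow> p < exp (- c * (real n)\<^sup>2)"
      unfolding eventually_at_right_field by blast
    show ?thesis
    proof (intro exI[of _ "b / 2"] conjI allI impI)
      fix c' assume "0 < c' \<and> c' \<le> b / 2"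
      then have "p \<le> exp (- c' * (real n)\<^sup>2)" using b(1) by (intro less_imp_le b(2)) auto
      then show "Q n c'" unfolding Q_def p(2) using Z0[of n] by (intro mult_right_mono) auto
    qed (use b in simp)
  qed
  obtain c2 where c2: "c2 > 0" "\<forall>n\<in>{2..<n0}. \<forall>c'. 0 < c' \<and> c' \<le> c2 \<longrightarrow> Q n c'"
    using uniform_small_constant[of "{2..<n0}" Q] small by blast
  define C where "C = min c1 c2"
  have C: "C > 0" "C \<le> c1" "C \<le> c2" using c1 c2(1) by (auto simp: C_def)
  have all: "Q n C" if "n \<ge> 2" for n
  proof (cases "n < n0")
    case True
    then show ?thesis using c2(2) C that by auto
  next
    case False
    have "S n \<le> (\<Sum>G\<in>{G \<in> labeled_graphs n. near_const G \<le> \<epsilon>1}. ergm_weight H \<alpha> \<beta>1 \<beta>2 n G)"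
      unfolding S_def using \<epsilon>(2) w0 finite_labeled_graphs by (intro sum_mono2) (auto simp: less_imp_le)
    also have "\<dots> \<le> exp (- c1 * (real n)\<^sup>2) * ergm_Z H \<alpha> \<beta>1 \<beta>2 n" using n0 False by simp
    also have "\<dots> \<le> exp (- C * (real n)\<^sup>2) * ergm_Z H \<alpha> \<beta>1 \<beta>2 n"
      using C(2) Z0[of n] by (intro mult_right_mono) (auto intro: mult_right_mono)
    finally show ?thesis by (simp add: Q_def)
  qed
  show ?thesis
  proof (rule exI[of _ \<epsilon>], rule exI[of _ C], intro conjI allI impI \<epsilon>(1) C(1))
    fix M :: "'w measure" and G :: "nat \<Rightarrow> 'w \<Rightarrow> nat graph" and n :: nat
    assume M: "is_ergm H \<alpha> \<beta>1 \<beta>2 M G" and n: "n \<ge> 2"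
    have "measure M {\<omega> \<in> space M. near_const (G n \<omega>) > \<epsilon>}
      = (\<Sum>g\<in>{g \<in> labeled_graphs n. near_const g > \<epsilon>}. ergm_weight H \<alpha> \<beta>1 \<beta>2 n g) / ergm_Z H \<alpha> \<beta>1 \<beta>2 n"
      using ergm_measure(2)[OF M, of n "\<lambda>g. near_const g > \<epsilon>"] n by simp
    also have "(\<Sum>g\<in>{g \<in> labeled_graphs n. near_const g > \<epsilon>}. ergm_weight H \<alpha> \<beta>1 \<beta>2 n g) = ergm_Z H \<alpha> \<beta>1 \<beta>2 n - S n"
    proof -
      have "labeled_graphs n = {g \<in> labeled_graphs n. near_const g > \<epsilon>} \<union> {g \<in> labeled_graphs n. near_const g \<le> \<epsilon>}" by auto
      then have "ergm_Z H \<alpha> \<beta>1 \<beta>2 n = (\<Sum>g\<in>{g \<in> labeled_graphs n. near_const g > \<epsilon>} \<union> {g \<in> labeled_graphs n. near_const g \<le> \<epsilon>}. ergm_weight H \<alpha> \<beta>1 \<beta>2 n g)"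
        unfolding ergm_Z_def by simp
      also have "\<dots> = (\<Sum>g\<in>{g \<in> labeled_graphs n. near_const g > \<epsilon>}. ergm_weight H \<alpha> \<beta>1 \<beta>2 n g) + S n"
        unfolding S_def using finite_labeled_graphs by (intro sum.union_disjoint) auto
      finally show ?thesis by simp
    qed
    also have "(ergm_Z H \<alpha> \<beta>1 \<beta>2 n - S n) / ergm_Z H \<alpha> \<beta>1 \<beta>2 n = 1 - S n / ergm_Z H \<alpha> \<beta>1 \<beta>2 n"
      using Z0[of n] by (simp add: diff_divide_distrib)
    also have "\<dots> \<ge> 1 - exp (- C * (real n)\<^sup>2)"
      using all[OF n] Z0[of n] by (simp add: Q_def divide_le_eq)
    finally show "measure M {\<omega> \<in> space M. (INF s\<in>{0..1}. cut_dist (G n \<omega>) s) > \<epsilon>} \<ge> 1 - exp (- C * (real n)\<^sup>2)"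
      unfolding near_const_def .
  qed
qed

subsection \<open>Phases of the model\<close>

text \<open>A second value may be added at will; on the curve in (a) it plays the part of u2 where
  no two maximizers coexist.\<close>

lemma phase_stable_weaken: "phase_stable H \<alpha> \<beta>1 \<beta>2 \<Lambda> u u \<Longrightarrow> phase_stable H \<alpha> \<beta>1 \<beta>2 \<Lambda> u v"
  unfolding phase_stable_def disj_absorb by meson

lemma phase_stable_unique_large:
  fixes H :: "'v graph"
  assumes H: "simple_graph H" "regular_graph d H" "verts H \<noteq> {}" and d: "d > 0" and \<alpha>: "\<alpha> > 0" and \<beta>2: "\<beta>2 > 0"
    and \<gamma>: "\<gamma> = real (card (edges H)) * \<alpha>" "\<gamma> \<ge> d" and np: "\<not> two_phase \<beta>1 \<gamma> \<beta>2"
  obtains u where "0 < u" "u < 1" "phase_stable H \<alpha> \<beta>1 \<beta>2 (ell \<beta>1 \<beta>2 \<gamma> u) u u"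
proof -
  have \<gamma>0: "\<gamma> > 0" using d \<gamma>(2) by linarith
  obtain u where u: "is_maximizer (ell \<beta>1 \<beta>2 \<gamma>) u" using ell_maximizer_exists[OF \<gamma>0 \<beta>2] by blast
  have u01: "0 < u" "u < 1" using u by (auto simp: is_maximizer_def)
  have "phase_stable H \<alpha> \<beta>1 \<beta>2 (ell \<beta>1 \<beta>2 \<gamma> u) u u"
  proof (rule phase_stable_single[OF continuous_on_ell[OF \<gamma>0, of \<beta>1 \<beta>2]])
    show "ell \<beta>1 \<beta>2 \<gamma> x \<le> ell \<beta>1 \<beta>2 \<gamma> u" if "0 \<le> x" "x \<le> 1" for x by (rule is_maximizerD[OF u that])
    show "x = u" if x: "0 \<le> x" "x \<le> 1" "ell \<beta>1 \<beta>2 \<gamma> x = ell \<beta>1 \<beta>2 \<gamma> u" for x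
    proof (rule ccontr)
      assume "x \<noteq> u"
      moreover have "is_maximizer (ell \<beta>1 \<beta>2 \<gamma>) x" by (rule maximizer_only[OF u x \<gamma>0 \<beta>2])
      ultimately have "two_phase \<beta>1 \<gamma> \<beta>2"
        using u \<beta>2 unfolding two_phase_def by (metis linorder_neqE_linordered_idom)
      then show False using np by simp
    qed
    fix n :: nat and w :: "nat set \<Rightarrow> real" assume n: "n \<ge> 1" and w: "\<And>s. 0 \<le> w s \<and> w s \<le> 1"
    have V: "finite {1..n}" "{1..n} \<noteq> {}" using n by auto
    have fe: "free_energy H \<alpha> \<beta>1 \<beta>2 {1..n} w \<le> avg2 {1..n} (\<lambda>e. ell \<beta>1 \<beta>2 \<gamma> (w e)) -
        \<beta>2 * (avg2 {1..n} (\<lambda>e. w e ^ d) powr (\<gamma> / d) - wdens H {1..n} w powr \<alpha>)"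
      by (rule free_energy_le_ell_large[OF H d \<alpha> V w less_imp_le[OF \<beta>2] \<gamma>])
    have "0 \<le> \<beta>2 * (avg2 {1..n} (\<lambda>e. w e ^ d) powr (\<gamma> / d) - wdens H {1..n} w powr \<alpha>)"
      using wdens_powr_le[OF H d \<alpha> V w] \<beta>2 \<gamma>(1) by simp
    then show "free_energy H \<alpha> \<beta>1 \<beta>2 {1..n} w \<le> avg2 {1..n} (\<lambda>e. ell \<beta>1 \<beta>2 \<gamma> (w e))"
      using fe by linarith
  qed (use u01 in simp_all)
  then show ?thesis by (rule that[OF u01])
qed

lemma phase_stable_two_phase:
  fixes H :: "'v graph"
  assumes H: "simple_graph H" "regular_graph d H" "verts H \<noteq> {}" and d: "d \<ge> 2" and \<alpha>: "\<alpha> > 0"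
    and \<gamma>: "\<gamma> = real (card (edges H)) * \<alpha>" "\<gamma> \<ge> d" and tp: "two_phase \<beta>1 \<gamma> \<beta>2"
  obtains u1 u2 where "0 < u1" "u1 < u2" "u2 < 1" "phase_stable H \<alpha> \<beta>1 \<beta>2 (ell \<beta>1 \<beta>2 \<gamma> u1) u1 u2"
proof -
  have \<gamma>1: "\<gamma> > 1" "\<gamma> > 0" using d \<gamma>(2) by linarith+
  obtain x y where xy: "x < y" "is_maximizer (ell \<beta>1 \<beta>2 \<gamma>) x" "is_maximizer (ell \<beta>1 \<beta>2 \<gamma>) y" and \<beta>2: "\<beta>2 > 0"
    using tp by (auto simp: two_phase_def)
  have b: "0 < x" "y < 1" using xy by (auto simp: is_maximizer_def)
  have "phase_stable H \<alpha> \<beta>1 \<beta>2 (ell \<beta>1 \<beta>2 \<gamma> x) x y"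
  proof (rule phase_stable_double[OF H d \<alpha> \<beta>2 \<gamma> b(1) xy(1) b(2)])
    show "ell \<beta>1 \<beta>2 \<gamma> t \<le> ell \<beta>1 \<beta>2 \<gamma> x" if "0 \<le> t" "t \<le> 1" for t by (rule is_maximizerD[OF xy(2) that])
    show "t = x \<or> t = y" if t: "0 \<le> t" "t \<le> 1" "ell \<beta>1 \<beta>2 \<gamma> t = ell \<beta>1 \<beta>2 \<gamma> x" for t
      by (rule maximizers_at_most_two[OF xy(2,3,1) \<gamma>1(1) maximizer_only[OF xy(2) t \<gamma>1(2) \<beta>2]])
  qed
  then show ?thesis by (rule that[OF b(1) xy(1) b(2)])
qed

text \<open>Linearise at the maximizer u of \<open>ell \<beta>1 \<beta>2 \<gamma>\<close>. In this
  range of \<beta>1 the linearised function has u as its only maximizer; L is that function shifted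
  to have the value \<Lambda> at u.\<close>

lemma phase_stable_unique_small:
  fixes H :: "'v graph"
  assumes H: "simple_graph H" "regular_graph d H" "verts H \<noteq> {}" and d: "d \<ge> 2" and \<alpha>: "\<alpha> > 0" and \<beta>2: "\<beta>2 > 0"
    and \<gamma>: "\<gamma> = real (card (edges H)) * \<alpha>" "\<gamma> < d" and \<beta>1: "\<beta>1 \<ge> ln (real d - 1) - real d / (real d - 1)"
  obtains u where "0 < u" "u < 1" "phase_stable H \<alpha> \<beta>1 \<beta>2 (ell \<beta>1 \<beta>2 \<gamma> u) u u"
proof -
  have d0: "d > 0" and d1: "real d > 1" and d2: "real d > 0" using d by auto
  have \<gamma>0: "\<gamma> > 0" using card_edges_pos[OF H d0] \<alpha> \<gamma>(1) by simp
  obtain u where u: "is_maximizer (ell \<beta>1 \<beta>2 \<gamma>) u" using ell_maximizer_exists[OF \<gamma>0 \<beta>2] by blast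
  have u01: "0 < u" "u < 1" using u by (auto simp: is_maximizer_def)
  define \<kappa> where "\<kappa> = \<beta>2 * (\<gamma> / real d) * u powr (\<gamma> - real d)"
  have \<kappa>0: "\<kappa> > 0" using \<beta>2 \<gamma>0 d0 u01 by (simp add: \<kappa>_def)
  have m: "is_maximizer (ell \<beta>1 \<kappa> (real d)) u" by (rule rescaled_maximizer[OF u \<gamma>0 d1 \<beta>2 \<kappa>_def \<beta>1])
  define \<Lambda> where "\<Lambda> = ell \<beta>1 \<beta>2 \<gamma> u"
  define L where "L x = ell \<beta>1 \<kappa> (real d) x + (\<Lambda> - ell \<beta>1 \<kappa> (real d) u)" for x
  have cont: "continuous_on {0..1} L" unfolding L_def by (intro continuous_intros continuous_on_ell d2)
  have "phase_stable H \<alpha> \<beta>1 \<beta>2 \<Lambda> u u"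
  proof (rule phase_stable_single[OF cont])
    show "L x \<le> \<Lambda>" if "0 \<le> x" "x \<le> 1" for x using is_maximizerD[OF m that] by (simp add: L_def)
    show "x = u" if x: "0 \<le> x" "x \<le> 1" "L x = \<Lambda>" for x
    proof -
      have "ell \<beta>1 \<kappa> (real d) x = ell \<beta>1 \<kappa> (real d) u" using x(3) by (simp add: L_def)
      from maximizer_only[OF m x(1,2) this d2 \<kappa>0] show ?thesis by (rule maximizer_unique[OF _ m d1 \<beta>1])
    qed
    fix n :: nat and w :: "nat set \<Rightarrow> real" assume n: "n \<ge> 1" and w: "\<And>s. 0 \<le> w s \<and> w s \<le> 1"
    have V: "finite {1..n}" "{1..n} \<noteq> {}" using n by auto
    show "free_energy H \<alpha> \<beta>1 \<beta>2 {1..n} w \<le> avg2 {1..n} (\<lambda>e. L (w e))"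
      unfolding L_def avg2_add avg2_const[OF V] \<Lambda>_def
      by (rule free_energy_le_ell_small[OF H d0 \<alpha> V w less_imp_le[OF \<beta>2] u01(1) \<gamma> \<kappa>_def])
  qed (use u01 in simp_all)
  then show ?thesis unfolding \<Lambda>_def by (rule that[OF u01])
qed

theorem theorem1p3:
  fixes H :: "'v graph" and d :: nat and \<alpha> :: real
  assumes "simple_graph H" and "verts H \<noteq> {}"
    and "regular_graph d H" and "d \<ge> 2" and "\<alpha> > 0"
  shows
    "(\<alpha> \<ge> real d / real (card (edges H)) \<longrightarrow>
       (\<exists>\<phi> :: real \<Rightarrow> real.
         let \<gamma> = real (card (edges H)) * \<alpha>;
             \<Gamma> = {(\<beta>1, \<phi> \<beta>1) | \<beta>1. \<beta>1 < ln (\<gamma> - 1) - \<gamma> / (\<gamma> - 1)}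
         in (\<forall>(\<beta>1, \<beta>2) \<in> (UNIV \<times> {0<..}) - \<Gamma>.
               \<exists>u. 0 < u \<and> u < 1 \<and>
                 (\<forall>(M :: 'w measure) G. is_ergm H \<alpha> \<beta>1 \<beta>2 M G \<longrightarrow>
                   (AE \<omega> in M. (\<lambda>n. cut_dist (G n \<omega>) u) \<longlonglongrightarrow> 0))) \<and>
            (\<forall>(\<beta>1, \<beta>2) \<in> \<Gamma>.
               \<exists>u1 u2. 0 < u1 \<and> u1 < u2 \<and> u2 < 1 \<and>
                 (\<forall>(M :: 'w measure) G. is_ergm H \<alpha> \<beta>1 \<beta>2 M G \<longrightarrow>
                   (AE \<omega> in M. (\<lambda>n. min (cut_dist (G n \<omega>) u1) (cut_dist (G n \<omega>) u2))
                                  \<longlonglongrightarrow> 0)))))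
     \<and>
     (\<alpha> < real d / real (card (edges H)) \<longrightarrow>
       (\<forall>\<beta>1 \<beta>2. \<beta>1 \<ge> ln (real d - 1) - real d / (real d - 1) \<and> \<beta>2 > 0 \<longrightarrow>
         (\<exists>u. 0 < u \<and> u < 1 \<and>
           (\<forall>(M :: 'w measure) G. is_ergm H \<alpha> \<beta>1 \<beta>2 M G \<longrightarrow>
             (AE \<omega> in M. (\<lambda>n. cut_dist (G n \<omega>) u) \<longlonglongrightarrow> 0)))))
     \<and>
     (\<alpha> < real d / real (card (edges H)) \<longrightarrow>
       (\<forall>\<beta>1. \<beta>1 < ln (real d - 1) - real d / (real d - 1) \<longrightarrow>
         (\<exists>a b. 0 \<le> a \<and> a < b \<and>
           (\<forall>\<beta>2 \<in> {a<..<b}. \<exists>\<epsilon> C. \<epsilon> > 0 \<and> C > 0 \<and>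
             (\<forall>(M :: 'w measure) G. is_ergm H \<alpha> \<beta>1 \<beta>2 M G \<longrightarrow>
               (\<forall>n\<ge>2. measure M {\<omega> \<in> space M. (INF s\<in>{0..1}. cut_dist (G n \<omega>) s) > \<epsilon>}
                        \<ge> 1 - exp (- C * (real n)\<^sup>2)))))))"
proof (intro conjI impI)
  have d: "d > 0" and d1: "real d > 1" using assms(4) by auto
  note H = assms(1) assms(3) assms(2) and \<alpha> = assms(5)
  define \<gamma> where "\<gamma> = real (card (edges H)) * \<alpha>"
  have e0: "card (edges H) > 0" by (rule card_edges_pos[OF H d])
  have \<gamma>0: "\<gamma> > 0" using e0 \<alpha> by (simp add: \<gamma>_def)
  have conv1: "AE \<omega> in M. (\<lambda>n. cut_dist (G n \<omega>) u) \<longlonglongrightarrow> 0"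
    if "\<beta>2 > 0" "0 < u" "u < 1" "phase_stable H \<alpha> \<beta>1 \<beta>2 (ell \<beta>1 \<beta>2 \<gamma> u) u u" "is_ergm H \<alpha> \<beta>1 \<beta>2 M G"
    for \<beta>1 \<beta>2 u and M :: "'w measure" and G
    using ergm_AE_convergence[OF H(1) \<alpha> that(1,2,3) _ that(4,5)] by (simp add: \<gamma>_def)
  have conv2: "AE \<omega> in M. (\<lambda>n. min (cut_dist (G n \<omega>) u1) (cut_dist (G n \<omega>) u2)) \<longlonglongrightarrow> 0"
    if "\<beta>2 > 0" "0 < u" "u < 1" "phase_stable H \<alpha> \<beta>1 \<beta>2 (ell \<beta>1 \<beta>2 \<gamma> u) u1 u2" "is_ergm H \<alpha> \<beta>1 \<beta>2 M G"
    for \<beta>1 \<beta>2 u u1 u2 and M :: "'w measure" and G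
    using ergm_AE_convergence[OF H(1) \<alpha> that(1,2,3) _ that(4,5)] by (simp add: \<gamma>_def)
  {
    assume "real d / real (card (edges H)) \<le> \<alpha>"
    then have \<gamma>d: "\<gamma> \<ge> d" using e0 by (simp add: \<gamma>_def divide_le_eq mult.commute)
    have \<gamma>1: "\<gamma> > 1" using \<gamma>d d1 by linarith
    \<comment> \<open>The coefficient at which two maximizers coexist, unique by
      \<open>two_phase_unique\<close>. Where there is none, the default 1 is chosen because the
      points of the curve must have \<beta>2 > 0.\<close>
    define \<phi> where "\<phi> \<beta>1 = (if \<exists>\<kappa>. two_phase \<beta>1 \<gamma> \<kappa> then SOME \<kappa>. two_phase \<beta>1 \<gamma> \<kappa> else 1)" for \<beta>1
    have \<phi>_two: "\<phi> \<beta>1 = \<kappa>" if "two_phase \<beta>1 \<gamma> \<kappa>" for \<beta>1 \<kappa>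
      using two_phase_unique[OF someI[of "two_phase \<beta>1 \<gamma>", OF that] that \<gamma>1] that by (auto simp: \<phi>_def)
    define \<Gamma> where "\<Gamma> = {(\<beta>1, \<phi> \<beta>1) | \<beta>1. \<beta>1 < ln (\<gamma> - 1) - \<gamma> / (\<gamma> - 1)}"
    have off: "\<exists>u. 0 < u \<and> u < 1 \<and> (\<forall>(M :: 'w measure) G. is_ergm H \<alpha> \<beta>1 \<beta>2 M G \<longrightarrow>
        (AE \<omega> in M. (\<lambda>n. cut_dist (G n \<omega>) u) \<longlonglongrightarrow> 0))"
      if \<beta>: "(\<beta>1, \<beta>2) \<in> (UNIV \<times> {0<..}) - \<Gamma>" for \<beta>1 \<beta>2
    proof -
      have \<beta>2: "\<beta>2 > 0" using \<beta> by simp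
      have "\<not> two_phase \<beta>1 \<gamma> \<beta>2"
      proof
        assume tp: "two_phase \<beta>1 \<gamma> \<beta>2"
        then obtain x y where xy: "x < y" "is_maximizer (ell \<beta>1 \<beta>2 \<gamma>) x" "is_maximizer (ell \<beta>1 \<beta>2 \<gamma>) y"
          by (auto simp: two_phase_def)
        have "\<beta>1 < ln (\<gamma> - 1) - \<gamma> / (\<gamma> - 1)"
          using maximizer_unique[OF xy(2,3) \<gamma>1] xy(1) by (cases "\<beta>1 < ln (\<gamma> - 1) - \<gamma> / (\<gamma> - 1)") auto
        then have "(\<beta>1, \<beta>2) \<in> \<Gamma>" using \<phi>_two[OF tp] by (auto simp: \<Gamma>_def)
        then show False using \<beta> by simp
      qed
      then obtain u where "0 < u" "u < 1" "phase_stable H \<alpha> \<beta>1 \<beta>2 (ell \<beta>1 \<beta>2 \<gamma> u) u u"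
        using phase_stable_unique_large[OF H d \<alpha> \<beta>2 \<gamma>_def \<gamma>d] by blast
      then show ?thesis using conv1[OF \<beta>2] by blast
    qed
    have on: "\<exists>u1 u2. 0 < u1 \<and> u1 < u2 \<and> u2 < 1 \<and> (\<forall>(M :: 'w measure) G. is_ergm H \<alpha> \<beta>1 \<beta>2 M G \<longrightarrow>
        (AE \<omega> in M. (\<lambda>n. min (cut_dist (G n \<omega>) u1) (cut_dist (G n \<omega>) u2)) \<longlonglongrightarrow> 0))"
      if \<beta>: "(\<beta>1, \<beta>2) \<in> \<Gamma>" for \<beta>1 \<beta>2
    proof (cases "\<exists>\<kappa>. two_phase \<beta>1 \<gamma> \<kappa>")
      case True
      then have tp: "two_phase \<beta>1 \<gamma> \<beta>2" using \<beta> \<phi>_two by (auto simp: \<Gamma>_def)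
      then have \<beta>2: "\<beta>2 > 0" by (simp add: two_phase_def)
      obtain u1 u2 where u: "0 < u1" "u1 < u2" "u2 < 1" "phase_stable H \<alpha> \<beta>1 \<beta>2 (ell \<beta>1 \<beta>2 \<gamma> u1) u1 u2"
        using phase_stable_two_phase[OF H assms(4) \<alpha> \<gamma>_def \<gamma>d tp] by blast
      have "u1 < 1" using u by simp
      then show ?thesis using u conv2[OF \<beta>2 u(1) _ u(4)] by blast
    next
      case False
      then have \<beta>2: "\<beta>2 > 0" using \<beta> by (auto simp: \<Gamma>_def \<phi>_def)
      obtain u where u: "0 < u" "u < 1" "phase_stable H \<alpha> \<beta>1 \<beta>2 (ell \<beta>1 \<beta>2 \<gamma> u) u u"
        using phase_stable_unique_large[OF H d \<alpha> \<beta>2 \<gamma>_def \<gamma>d] False by blast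
      \<comment> \<open>Without coexistence the graphs converge to u alone, so any second value
        between u and 1 will do; the midpoint is taken.\<close>
      have "u < (1 + u) / 2" "(1 + u) / 2 < 1" using u by simp_all
      then show ?thesis using u(1) conv2[OF \<beta>2 u(1,2) phase_stable_weaken[OF u(3), of "(1 + u) / 2"]] by blast
    qed
    show "\<exists>\<phi> :: real \<Rightarrow> real.
         let \<gamma> = real (card (edges H)) * \<alpha>;
             \<Gamma> = {(\<beta>1, \<phi> \<beta>1) | \<beta>1. \<beta>1 < ln (\<gamma> - 1) - \<gamma> / (\<gamma> - 1)}
         in (\<forall>(\<beta>1, \<beta>2) \<in> (UNIV \<times> {0<..}) - \<Gamma>.
               \<exists>u. 0 < u \<and> u < 1 \<and>
                 (\<forall>(M :: 'w measure) G. is_ergm H \<alpha> \<beta>1 \<beta>2 M G \<longrightarrow>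
                   (AE \<omega> in M. (\<lambda>n. cut_dist (G n \<omega>) u) \<longlonglongrightarrow> 0))) \<and>
            (\<forall>(\<beta>1, \<beta>2) \<in> \<Gamma>.
               \<exists>u1 u2. 0 < u1 \<and> u1 < u2 \<and> u2 < 1 \<and>
                 (\<forall>(M :: 'w measure) G. is_ergm H \<alpha> \<beta>1 \<beta>2 M G \<longrightarrow>
                   (AE \<omega> in M. (\<lambda>n. min (cut_dist (G n \<omega>) u1) (cut_dist (G n \<omega>) u2))
                                  \<longlonglongrightarrow> 0)))"
      unfolding Let_def \<gamma>_def[symmetric]
    proof (rule exI[of _ \<phi>], unfold \<Gamma>_def[symmetric], rule conjI)
      show "\<forall>(\<beta>1, \<beta>2) \<in> (UNIV \<times> {0<..}) - \<Gamma>.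
               \<exists>u. 0 < u \<and> u < 1 \<and>
                 (\<forall>(M :: 'w measure) G. is_ergm H \<alpha> \<beta>1 \<beta>2 M G \<longrightarrow>
                   (AE \<omega> in M. (\<lambda>n. cut_dist (G n \<omega>) u) \<longlonglongrightarrow> 0))"
        by (intro ballI, split prod.split, intro allI impI) (rule off, simp)
      show "\<forall>(\<beta>1, \<beta>2) \<in> \<Gamma>.
               \<exists>u1 u2. 0 < u1 \<and> u1 < u2 \<and> u2 < 1 \<and>
                 (\<forall>(M :: 'w measure) G. is_ergm H \<alpha> \<beta>1 \<beta>2 M G \<longrightarrow>
                   (AE \<omega> in M. (\<lambda>n. min (cut_dist (G n \<omega>) u1) (cut_dist (G n \<omega>) u2))
                                  \<longlonglongrightarrow> 0))"
        by (intro ballI, split prod.split, intro allI impI) (rule on, simp)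
    qed
  }
  {
    assume "\<alpha> < real d / real (card (edges H))"
    then have \<gamma>d: "\<gamma> < d" using e0 by (simp add: \<gamma>_def less_divide_eq mult.commute)
    show "\<forall>\<beta>1 \<beta>2. \<beta>1 \<ge> ln (real d - 1) - real d / (real d - 1) \<and> \<beta>2 > 0 \<longrightarrow>
         (\<exists>u. 0 < u \<and> u < 1 \<and>
           (\<forall>(M :: 'w measure) G. is_ergm H \<alpha> \<beta>1 \<beta>2 M G \<longrightarrow>
             (AE \<omega> in M. (\<lambda>n. cut_dist (G n \<omega>) u) \<longlonglongrightarrow> 0)))"
    proof (intro allI impI)
      fix \<beta>1 \<beta>2 :: real assume \<beta>: "\<beta>1 \<ge> ln (real d - 1) - real d / (real d - 1) \<and> \<beta>2 > 0"
      then have \<beta>2: "\<beta>2 > 0" by simp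
      obtain u where "0 < u" "u < 1" "phase_stable H \<alpha> \<beta>1 \<beta>2 (ell \<beta>1 \<beta>2 \<gamma> u) u u"
        using phase_stable_unique_small[OF H assms(4) \<alpha> \<beta>2 \<gamma>_def \<gamma>d] \<beta> by blast
      then show "\<exists>u. 0 < u \<and> u < 1 \<and>
           (\<forall>(M :: 'w measure) G. is_ergm H \<alpha> \<beta>1 \<beta>2 M G \<longrightarrow>
             (AE \<omega> in M. (\<lambda>n. cut_dist (G n \<omega>) u) \<longlonglongrightarrow> 0))"
        using conv1[OF \<beta>2] by blast
    qed
    show "\<forall>\<beta>1. \<beta>1 < ln (real d - 1) - real d / (real d - 1) \<longrightarrow>
         (\<exists>a b. 0 \<le> a \<and> a < b \<and>
           (\<forall>\<beta>2 \<in> {a<..<b}. \<exists>\<epsilon> C. \<epsilon> > 0 \<and> C > 0 \<and>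
             (\<forall>(M :: 'w measure) G. is_ergm H \<alpha> \<beta>1 \<beta>2 M G \<longrightarrow>
               (\<forall>n\<ge>2. measure M {\<omega> \<in> space M. (INF s\<in>{0..1}. cut_dist (G n \<omega>) s) > \<epsilon>}
                        \<ge> 1 - exp (- C * (real n)\<^sup>2)))))"
    proof (intro allI impI)
      fix \<beta>1 :: real assume \<beta>1: "\<beta>1 < ln (real d - 1) - real d / (real d - 1)"
      obtain a b where ab: "0 \<le> a" "a < b"
        "\<And>\<beta>2. a < \<beta>2 \<Longrightarrow> \<beta>2 < b \<Longrightarrow> \<exists>u r. is_maximizer (ell \<beta>1 \<beta>2 \<gamma>) u \<and> 0 < r \<and> r < 1 \<and>
          ell \<beta>1 (\<beta>2 * (\<gamma> / d) * u powr (\<gamma> - d)) d u < ell \<beta>1 (\<beta>2 * (\<gamma> / d) * u powr (\<gamma> - d)) d r"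
        using symmetry_breaking_interval[OF \<gamma>0 \<gamma>d d1 \<beta>1] by blast
      show "\<exists>a b. 0 \<le> a \<and> a < b \<and>
           (\<forall>\<beta>2 \<in> {a<..<b}. \<exists>\<epsilon> C. \<epsilon> > 0 \<and> C > 0 \<and>
             (\<forall>(M :: 'w measure) G. is_ergm H \<alpha> \<beta>1 \<beta>2 M G \<longrightarrow>
               (\<forall>n\<ge>2. measure M {\<omega> \<in> space M. (INF s\<in>{0..1}. cut_dist (G n \<omega>) s) > \<epsilon>}
                        \<ge> 1 - exp (- C * (real n)\<^sup>2))))"
      proof (rule exI[of _ a], rule exI[of _ b], intro conjI ab(1,2) ballI)
        fix \<beta>2 assume "\<beta>2 \<in> {a<..<b}"
        then have \<beta>2: "a < \<beta>2" "\<beta>2 < b" by auto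
        obtain u r where u: "is_maximizer (ell \<beta>1 \<beta>2 \<gamma>) u" and r: "0 < r" "r < 1" and
          gain: "ell \<beta>1 (\<beta>2 * (\<gamma> / d) * u powr (\<gamma> - d)) d u < ell \<beta>1 (\<beta>2 * (\<gamma> / d) * u powr (\<gamma> - d)) d r"
          using ab(3)[OF \<beta>2] by blast
        have "\<beta>2 > 0" using \<beta>2 ab(1) by linarith
        then show "\<exists>\<epsilon> C. \<epsilon> > 0 \<and> C > 0 \<and>
             (\<forall>(M :: 'w measure) G. is_ergm H \<alpha> \<beta>1 \<beta>2 M G \<longrightarrow>
               (\<forall>n\<ge>2. measure M {\<omega> \<in> space M. (INF s\<in>{0..1}. cut_dist (G n \<omega>) s) > \<epsilon>}
                        \<ge> 1 - exp (- C * (real n)\<^sup>2)))"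
          by (rule ergm_far_from_constant[OF H d \<alpha> _ \<gamma>_def u r gain])
      qed
    qed
  }
qed

end
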